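(* (1) For any $\mathrm{ADE}$-configuration $\Phi_f$ of roots in $L_{10}$, with $R_f$ the sublattice of $L_{10}$ generated by $\Phi_f$ and $\overline{R}_f$ the primitive closure of $R_f$ in $L_{10}$, the lattice $\overline{R}_f$ is a root lattice. Two $\mathrm{ADE}$-configurations of roots $\Phi_f\subset L_{10}$ and $\Phi_{f'}\subset L_{10}$ are equivalent if and only if $\tau(\Phi_f)=\tau(\Phi_{f'})$ and $\tau(\overline{R}_f)=\tau(\overline{R}_{f'})$. (2) Let $(t,\bar t)$ be a pair of $\mathrm{ADE}$-types. Then there exists an $\mathrm{ADE}$-configuration of roots $\Phi_f\subset L_{10}$ such that $(\tau(\Phi_f),\tau(\overline{R}_f))=(t,\bar t)$ if and only if the following hold: (i) $R(t)$ is of rank $<10$; (ii) $R(\bar t)$ is (isomorphic to) an even overlattice of $R(t)$; and (iii) the Dynkin diagram of $\bar t$ is a sub-diagram of the Dynkin diagram of $E_{10}$.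
   Context: A lattice is a free $\mathbb{Z}$-module of finite rank with a non-degenerate symmetric bilinear form $\langle\ ,\ \rangle$ with values in $\mathbb{Z}$. A root of a lattice is a vector $r$ with $\langle r,r\rangle=-2$; a root lattice is a lattice generated by its roots. A lattice of rank $n$ is hyperbolic if its signature is $(1,n-1)$; a positive cone of a hyperbolic lattice $L$ is one of the two connected components of $\{x\in L\otimes\mathbb{R}\mid\langle x,x\rangle>0\}$, and $\mathrm{O}^+(L)$ is the group of isometries of $L$ preserving a positive cone. Isometries act from the right, $x\mapsto x^g$. An $\mathrm{ADE}$-configuration of roots of a lattice $L$ is a finite set $\Phi$ of roots of $L$, with $\langle r,r'\rangle\in\{0,1\}$ for distinct $r,r'\in\Phi$, such that each connected component of its Dynkin diagram (vertices: $\Phi$; edges: pairs with $\langle r,r'\rangle=1$) is of type $A_l$ ($l\ge1$), $D_m$ ($m\ge4$) or $E_n$ ($n=6,7,8$). Its $\mathrm{ADE}$-type $\tau(\Phi)$ is the type of this Dynkin diagram. A negative-definite root lattice $R$ has a basis that is an $\mathrm{ADE}$-configuration of roots, and $\tau(R)$ denotes the $\mathrm{ADE}$-type of such a basis. For an $\mathrm{ADE}$-type $t$, $R(t)$ is the negative-definite root lattice, unique up to isomorphism, with $\tau(R(t))=t$. $L_{10}$ is the even unimodular hyperbolic lattice of rank $10$ (unique up to isomorphism). It has a basis $E_{10}=\{e_1,\dots,e_{10}\}$ consisting of roots whose Dynkin diagram is the chain $e_2 - e_3 - e_4 - \cdots - e_{10}$ together with the vertex $e_1$ joined only to $e_4$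 (so $\langle e_i,e_j\rangle=1$ if $e_i,e_j$ are joined and $0$ for other $i\ne j$). A sub-diagram is the diagram formed by a subset of the vertices together with all edges among them. The primitive closure of a submodule $R\subset L$ is $(R\otimes\mathbb{Q})\cap L$. An even overlattice of an even lattice $L$ is a submodule of $L^\vee=\{v\in L\otimes\mathbb{Q}\mid\langle v,x\rangle\in\mathbb{Z}\ \forall x\in L\}$ containing $L$ on which the natural $\mathbb{Q}$-valued form is integral and even. Two $\mathrm{ADE}$-configurations of roots $\Phi_f,\Phi_{f'}\subset L_{10}$ are equivalent if there exists $g\in\mathrm{O}^+(L_{10})$ that maps $\Phi_f$ to $\Phi_{f'}$ bijectively. *)

theory Defs
  imports "HOL-Analysis.Analysis" "HOL-Analysis.Finite_Function_Topology" "HOL-Library.Multiset"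
begin

section \<open>Lattices in a real vector space\<close>

text \<open>
  A lattice is a subset \<open>L\<close> of a real vector space, free of finite rank over the integers on a
  real-linearly independent basis, with a bilinear form \<open>B\<close> defined on the ambient space.
  Thus \<open>span L\<close> is \<open>L \<otimes> \<real>\<close>, \<open>qspan L\<close> is \<open>L \<otimes> \<rat>\<close>, and \<open>dim L\<close> is the rank of \<open>L\<close>.
  Independence over the reals is no restriction: it follows from independence over the integers,
  as the form is integral and non-degenerate on \<open>L\<close>.
\<close>

abbreviation zscale :: "int \<Rightarrow> 'v::real_vector \<Rightarrow> 'v" where
  "zscale k v \<equiv> of_int k *\<^sub>R v"

abbreviation qscale :: "rat \<Rightarrow> 'v::real_vector \<Rightarrow> 'v" where
  "qscale q v \<equiv> of_rat q *\<^sub>R v"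

abbreviation zspan :: "'v::real_vector set \<Rightarrow> 'v set" where
  "zspan \<equiv> module.span zscale"

abbreviation qspan :: "'v::real_vector set \<Rightarrow> 'v set" where
  "qspan \<equiv> module.span qscale"

definition zbasis :: "'v::real_vector set \<Rightarrow> 'v set \<Rightarrow> bool" where
  "zbasis L b \<longleftrightarrow> finite b \<and> independent b \<and> zspan b = L"

definition is_lattice :: "('v::real_vector \<Rightarrow> 'v \<Rightarrow> real) \<Rightarrow> 'v set \<Rightarrow> bool" where
  "is_lattice B L \<longleftrightarrow> bilinear B \<and> (\<exists>b. zbasis L b)
     \<and> (\<forall>x\<in>L. \<forall>y\<in>L. B x y \<in> \<int> \<and> B x y = B y x)
     \<and> (\<forall>x\<in>L. (\<forall>y\<in>L. B x y = 0) \<longrightarrow> x = 0)"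

definition roots :: "('v::real_vector \<Rightarrow> 'v \<Rightarrow> real) \<Rightarrow> 'v set \<Rightarrow> 'v set" where
  "roots B L = {r \<in> L. B r r = - 2}"

definition is_root_lattice :: "('v::real_vector \<Rightarrow> 'v \<Rightarrow> real) \<Rightarrow> 'v set \<Rightarrow> bool" where
  "is_root_lattice B L \<longleftrightarrow> is_lattice B L \<and> zspan (roots B L) = L"

definition primitive_closure :: "'v::real_vector set \<Rightarrow> 'v set \<Rightarrow> 'v set" where
  "primitive_closure L R = qspan R \<inter> L"

definition dual_lattice :: "('v::real_vector \<Rightarrow> 'v \<Rightarrow> real) \<Rightarrow> 'v set \<Rightarrow> 'v set" where
  "dual_lattice B L = {v \<in> qspan L. \<forall>x\<in>L. B v x \<in> \<int>}"

definition integral_on :: "('v \<Rightarrow> 'v \<Rightarrow> real) \<Rightarrow> 'v set \<Rightarrow> bool" where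
  "integral_on B M \<longleftrightarrow> (\<forall>x\<in>M. \<forall>y\<in>M. B x y \<in> \<int>)"

definition even_on :: "('v \<Rightarrow> 'v \<Rightarrow> real) \<Rightarrow> 'v set \<Rightarrow> bool" where
  "even_on B M \<longleftrightarrow> (\<forall>x\<in>M. \<exists>k::int. B x x = 2 * of_int k)"

definition even_overlattice ::
  "('v::real_vector \<Rightarrow> 'v \<Rightarrow> real) \<Rightarrow> 'v set \<Rightarrow> 'v set \<Rightarrow> bool" where
  "even_overlattice B L M \<longleftrightarrow> module.subspace zscale M \<and> L \<subseteq> M \<and> M \<subseteq> dual_lattice B L
     \<and> integral_on B M \<and> even_on B M"

definition unimodular :: "('v::real_vector \<Rightarrow> 'v \<Rightarrow> real) \<Rightarrow> 'v set \<Rightarrow> bool" where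
  "unimodular B L \<longleftrightarrow> dual_lattice B L = L"

definition has_signature ::
  "('v::real_vector \<Rightarrow> 'v \<Rightarrow> real) \<Rightarrow> 'v set \<Rightarrow> nat \<Rightarrow> nat \<Rightarrow> bool" where
  "has_signature B L p q \<longleftrightarrow> (\<exists>b. finite b \<and> independent b \<and> span b = span L
     \<and> (\<forall>x\<in>b. \<forall>y\<in>b. x \<noteq> y \<longrightarrow> B x y = 0)
     \<and> card {x \<in> b. B x x > 0} = p \<and> card {x \<in> b. B x x < 0} = q \<and> p + q = card b)"

definition hyperbolic :: "('v::real_vector \<Rightarrow> 'v \<Rightarrow> real) \<Rightarrow> 'v set \<Rightarrow> bool" where
  "hyperbolic B L \<longleftrightarrow> has_signature B L 1 (dim L - 1)"

text \<open>An additive map \<open>L \<rightarrow> L'\<close> is represented by a linear extension of it to the ambient spaces.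
  On \<open>L \<otimes> \<real>\<close> the extension is unique; its values elsewhere are irrelevant.\<close>

definition lattice_isometry ::
  "('v::real_vector \<Rightarrow> 'v \<Rightarrow> real) \<Rightarrow> 'v set \<Rightarrow> ('w::real_vector \<Rightarrow> 'w \<Rightarrow> real) \<Rightarrow> 'w set
     \<Rightarrow> ('v \<Rightarrow> 'w) \<Rightarrow> bool" where
  "lattice_isometry B L B' L' g \<longleftrightarrow>
     linear g \<and> bij_betw g L L' \<and> (\<forall>x\<in>L. \<forall>y\<in>L. B' (g x) (g y) = B x y)"

definition lattice_isomorphic ::
  "('v::real_vector \<Rightarrow> 'v \<Rightarrow> real) \<Rightarrow> 'v set \<Rightarrow> ('w::real_vector \<Rightarrow> 'w \<Rightarrow> real) \<Rightarrow> 'w set \<Rightarrow> bool"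
  where "lattice_isomorphic B L B' L' \<longleftrightarrow> (\<exists>g. lattice_isometry B L B' L' g)"

definition positive_cones :: "('v::real_normed_vector \<Rightarrow> 'v \<Rightarrow> real) \<Rightarrow> 'v set \<Rightarrow> 'v set set" where
  "positive_cones B L = components {x \<in> span L. B x x > 0}"

definition O_plus :: "('v::real_normed_vector \<Rightarrow> 'v \<Rightarrow> real) \<Rightarrow> 'v set \<Rightarrow> ('v \<Rightarrow> 'v) set" where
  "O_plus B L = {g. lattice_isometry B L B L g \<and> (\<exists>P\<in>positive_cones B L. g ` P = P)}"


section \<open>Diagrams and ADE-types\<close>

text \<open>A diagram is a simple graph: a vertex set with a symmetric irreflexive relation on it.\<close>

type_synonym 'a diagram = "'a set \<times> ('a \<times> 'a) set"

definition sub_diagram :: "'a diagram \<Rightarrow> 'a set \<Rightarrow> 'a diagram" where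
  "sub_diagram D S = (S, snd D \<inter> S \<times> S)"

definition diagram_components :: "'a diagram \<Rightarrow> 'a set set" where
  "diagram_components D = fst D // {(u, v) \<in> fst D \<times> fst D. (u, v) \<in> (snd D)\<^sup>*}"

definition diagram_iso :: "'a diagram \<Rightarrow> 'b diagram \<Rightarrow> bool" where
  "diagram_iso D D' \<longleftrightarrow> (\<exists>f. bij_betw f (fst D) (fst D')
     \<and> (\<forall>u\<in>fst D. \<forall>v\<in>fst D. (u, v) \<in> snd D \<longleftrightarrow> (f u, f v) \<in> snd D'))"

definition chain_edges :: "nat \<Rightarrow> nat \<Rightarrow> (nat \<times> nat) set" where
  "chain_edges a b = {(i, j). i \<in> {a..b} \<and> j \<in> {a..b} \<and> (j = Suc i \<or> i = Suc j)}"

definition a_diagram :: "nat \<Rightarrow> nat diagram" where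
  "a_diagram l = ({1..l}, chain_edges 1 l)"

definition d_diagram :: "nat \<Rightarrow> nat diagram" where
  "d_diagram m = ({1..m}, chain_edges 1 (m - 1) \<union> {(m - 2, m), (m, m - 2)})"

text \<open>The chain \<open>2 - 3 - \<dots> - n\<close> with \<open>1\<close> joined to \<open>4\<close>; \<open>e_diagram 10\<close> is the diagram of
  \<open>E\<^sub>1\<^sub>0\<close>.\<close>

definition e_diagram :: "nat \<Rightarrow> nat diagram" where
  "e_diagram n = ({1..n}, chain_edges 2 n \<union> {(1, 4), (4, 1)})"

datatype ade_symbol = Type_A nat | Type_D nat | Type_E nat

fun ade_symbol_ok :: "ade_symbol \<Rightarrow> bool" where
  "ade_symbol_ok (Type_A l) \<longleftrightarrow> 1 \<le> l"
| "ade_symbol_ok (Type_D m) \<longleftrightarrow> 4 \<le> m"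
| "ade_symbol_ok (Type_E n) \<longleftrightarrow> n \<in> {6, 7, 8}"

fun symbol_diagram :: "ade_symbol \<Rightarrow> nat diagram" where
  "symbol_diagram (Type_A l) = a_diagram l"
| "symbol_diagram (Type_D m) = d_diagram m"
| "symbol_diagram (Type_E n) = e_diagram n"

text \<open>An ADE-type is a formal sum of symbols; the empty sum (rank \<open>0\<close>) is allowed.\<close>

definition is_ade_type :: "ade_symbol multiset \<Rightarrow> bool" where
  "is_ade_type t \<longleftrightarrow> (\<forall>X\<in>#t. ade_symbol_ok X)"

definition component_has_type :: "'a diagram \<Rightarrow> 'a set \<Rightarrow> ade_symbol \<Rightarrow> bool" where
  "component_has_type D C X \<longleftrightarrow>
     ade_symbol_ok X \<and> diagram_iso (sub_diagram D C) (symbol_diagram X)"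

definition is_ade_diagram :: "'a diagram \<Rightarrow> bool" where
  "is_ade_diagram D \<longleftrightarrow> (\<forall>C\<in>diagram_components D. \<exists>X. component_has_type D C X)"

definition diagram_type :: "'a diagram \<Rightarrow> ade_symbol multiset" where
  "diagram_type D =
     image_mset (\<lambda>C. THE X. component_has_type D C X) (mset_set (diagram_components D))"

text \<open>The diagram of an ADE-type: the vertex \<open>(X, k, i)\<close> is the vertex \<open>i\<close> of the \<open>k\<close>-th copy
  of the diagram of \<open>X\<close>.\<close>

definition type_diagram :: "ade_symbol multiset \<Rightarrow> (ade_symbol \<times> nat \<times> nat) diagram" where
  "type_diagram t =
     ({(X, k, i). k < count t X \<and> i \<in> fst (symbol_diagram X)},
      {((X, k, i), (Y, l, j)).
         X = Y \<and> k = l \<and> k < count t X \<and> (i, j) \<in> snd (symbol_diagram X)})"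


section \<open>ADE-configurations of roots\<close>

definition dynkin_diagram :: "('v::real_vector \<Rightarrow> 'v \<Rightarrow> real) \<Rightarrow> 'v set \<Rightarrow> 'v diagram" where
  "dynkin_diagram B \<Phi> = (\<Phi>, {(r, r') \<in> \<Phi> \<times> \<Phi>. r \<noteq> r' \<and> B r r' = 1})"

definition ade_config :: "('v::real_vector \<Rightarrow> 'v \<Rightarrow> real) \<Rightarrow> 'v set \<Rightarrow> 'v set \<Rightarrow> bool" where
  "ade_config B L \<Phi> \<longleftrightarrow> finite \<Phi> \<and> \<Phi> \<subseteq> roots B L
     \<and> (\<forall>r\<in>\<Phi>. \<forall>r'\<in>\<Phi>. r \<noteq> r' \<longrightarrow> B r r' \<in> {0, 1})
     \<and> is_ade_diagram (dynkin_diagram B \<Phi>)"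

definition config_type :: "('v::real_vector \<Rightarrow> 'v \<Rightarrow> real) \<Rightarrow> 'v set \<Rightarrow> ade_symbol multiset" where
  "config_type B \<Phi> = diagram_type (dynkin_diagram B \<Phi>)"

text \<open>Meaningful for negative-definite root lattices \<open>R\<close> only.\<close>

definition lattice_type :: "('v::real_vector \<Rightarrow> 'v \<Rightarrow> real) \<Rightarrow> 'v set \<Rightarrow> ade_symbol multiset" where
  "lattice_type B R = (THE t. \<exists>\<Phi>. ade_config B R \<Phi> \<and> zbasis R \<Phi> \<and> config_type B \<Phi> = t)"

definition equivalent_configs ::
  "('v::real_normed_vector \<Rightarrow> 'v \<Rightarrow> real) \<Rightarrow> 'v set \<Rightarrow> 'v set \<Rightarrow> 'v set \<Rightarrow> bool" where
  "equivalent_configs B L \<Phi> \<Phi>' \<longleftrightarrow> (\<exists>g\<in>O_plus B L. bij_betw g \<Phi> \<Phi>')"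


section \<open>The lattice with a given Dynkin diagram\<close>

definition vertex_vector :: "'i \<Rightarrow> ('i \<Rightarrow>\<^sub>0 real)" where
  "vertex_vector i = Poly_Mapping.single i 1"

definition diagram_gram :: "'i diagram \<Rightarrow> 'i \<Rightarrow> 'i \<Rightarrow> real" where
  "diagram_gram D i j = (if i = j then - 2 else if (i, j) \<in> snd D then 1 else 0)"

definition diagram_form :: "'i diagram \<Rightarrow> ('i \<Rightarrow>\<^sub>0 real) \<Rightarrow> ('i \<Rightarrow>\<^sub>0 real) \<Rightarrow> real" where
  "diagram_form D x y = (\<Sum>i\<in>Poly_Mapping.keys x. \<Sum>j\<in>Poly_Mapping.keys y.
     Poly_Mapping.lookup x i * Poly_Mapping.lookup y j * diagram_gram D i j)"

definition diagram_lattice :: "'i diagram \<Rightarrow> ('i \<Rightarrow>\<^sub>0 real) set" where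
  "diagram_lattice D = zspan (vertex_vector ` fst D)"

abbreviation R_form ::
  "ade_symbol multiset \<Rightarrow> (ade_symbol \<times> nat \<times> nat \<Rightarrow>\<^sub>0 real)
     \<Rightarrow> (ade_symbol \<times> nat \<times> nat \<Rightarrow>\<^sub>0 real) \<Rightarrow> real" where
  "R_form t \<equiv> diagram_form (type_diagram t)"

abbreviation R_lattice :: "ade_symbol multiset \<Rightarrow> (ade_symbol \<times> nat \<times> nat \<Rightarrow>\<^sub>0 real) set" where
  "R_lattice t \<equiv> diagram_lattice (type_diagram t)"

text \<open>The lattice \<open>L\<^sub>1\<^sub>0\<close>, on its basis \<open>E\<^sub>1\<^sub>0\<close>.\<close>

definition L10_form :: "(nat \<Rightarrow>\<^sub>0 real) \<Rightarrow> (nat \<Rightarrow>\<^sub>0 real) \<Rightarrow> real" where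
  "L10_form = diagram_form (e_diagram 10)"

definition L10 :: "(nat \<Rightarrow>\<^sub>0 real) set" where
  "L10 = diagram_lattice (e_diagram 10)"


section \<open>Basic properties of these lattices\<close>

lemma module_zscale: "module (zscale :: int \<Rightarrow> 'v::real_vector \<Rightarrow> 'v)"
  by unfold_locales (simp_all add: scaleR_add_right scaleR_add_left)

lemma module_qscale: "module (qscale :: rat \<Rightarrow> 'v::real_vector \<Rightarrow> 'v)"
  by unfold_locales (simp_all add: scaleR_add_right scaleR_add_left of_rat_add of_rat_mult)

lemma lookup_scaleR [simp]:
  "Poly_Mapping.lookup (c *\<^sub>R x) i = c * Poly_Mapping.lookup (x :: 'i \<Rightarrow>\<^sub>0 real) i"
proof -
  have "finite {i. c * Poly_Mapping.lookup x i \<noteq> 0}"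
    by (rule finite_subset[OF _ finite_lookup[of x]]) auto
  then show ?thesis
    by (simp add: scaleR_poly_mapping_def Abs_poly_mapping_inverse)
qed

lemma lookup_vertex_vector:
  "Poly_Mapping.lookup (vertex_vector i) j = (if i = j then 1 else 0)"
  by (simp add: vertex_vector_def lookup_single when_def)

lemma diagram_form_superset:
  assumes "finite S" "Poly_Mapping.keys x \<subseteq> S" "finite T" "Poly_Mapping.keys y \<subseteq> T"
  shows "diagram_form D x y = (\<Sum>i\<in>S. \<Sum>j\<in>T.
     Poly_Mapping.lookup x i * Poly_Mapping.lookup y j * diagram_gram D i j)"
proof -
  have "diagram_form D x y = (\<Sum>i\<in>Poly_Mapping.keys x. \<Sum>j\<in>T.
     Poly_Mapping.lookup x i * Poly_Mapping.lookup y j * diagram_gram D i j)"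
    unfolding diagram_form_def
    by (intro sum.cong refl sum.mono_neutral_left) (use assms in \<open>auto simp: in_keys_iff\<close>)
  also have "\<dots> = (\<Sum>i\<in>S. \<Sum>j\<in>T.
     Poly_Mapping.lookup x i * Poly_Mapping.lookup y j * diagram_gram D i j)"
    by (intro sum.mono_neutral_left) (use assms in \<open>auto simp: in_keys_iff\<close>)
  finally show ?thesis .
qed

lemma bilinear_diagram_form: "bilinear (diagram_form D)"
proof -
  have add_r: "diagram_form D x (y + z) = diagram_form D x y + diagram_form D x z" for x y z
  proof -
    let ?S = "Poly_Mapping.keys x" let ?T = "Poly_Mapping.keys y \<union> Poly_Mapping.keys z"
    have "Poly_Mapping.keys (y + z) \<subseteq> ?T" by (rule keys_add)
    then show ?thesis
      by (simp add: diagram_form_superset[of ?S _ ?T] lookup_add algebra_simps sum.distrib)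
  qed
  have add_l: "diagram_form D (y + z) x = diagram_form D y x + diagram_form D z x" for x y z
  proof -
    let ?S = "Poly_Mapping.keys x" let ?T = "Poly_Mapping.keys y \<union> Poly_Mapping.keys z"
    have "Poly_Mapping.keys (y + z) \<subseteq> ?T" by (rule keys_add)
    then show ?thesis
      by (simp add: diagram_form_superset[of ?T _ ?S] lookup_add algebra_simps sum.distrib)
  qed
  have keys_scale: "Poly_Mapping.keys (c *\<^sub>R x) \<subseteq> Poly_Mapping.keys x" for c and x :: "'a \<Rightarrow>\<^sub>0 real"
    by (auto simp: in_keys_iff)
  have scale_r: "diagram_form D x (c *\<^sub>R y) = c * diagram_form D x y" for x y c
    using keys_scale[of c y]
    by (simp add: diagram_form_superset[of "Poly_Mapping.keys x" _ "Poly_Mapping.keys y"]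
        sum_distrib_left mult_ac)
  have scale_l: "diagram_form D (c *\<^sub>R y) x = c * diagram_form D y x" for x y c
    using keys_scale[of c y]
    by (simp add: diagram_form_superset[of "Poly_Mapping.keys y" _ "Poly_Mapping.keys x"]
        sum_distrib_left mult_ac)
  show ?thesis
    unfolding bilinear_def by (auto intro!: linearI simp: add_r add_l scale_r scale_l)
qed

lemma diagram_form_vertex_vector:
  "diagram_form D (vertex_vector i) (vertex_vector j) = diagram_gram D i j"
  by (simp add: diagram_form_superset[of "{i}" _ "{j}"] vertex_vector_def)

lemma independent_if_separated:
  assumes "\<And>v. v \<in> S \<Longrightarrow> \<exists>\<phi> :: 'v::real_vector \<Rightarrow> real. linear \<phi> \<and> \<phi> v \<noteq> 0 \<and> (\<forall>w\<in>S - {v}. \<phi> w = 0)"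
  shows "independent S"
proof
  assume "dependent S"
  then obtain v where v: "v \<in> S" "v \<in> span (S - {v})" by (auto simp: dependent_def)
  then obtain \<phi> :: "'v \<Rightarrow> real" where "linear \<phi>" "\<phi> v \<noteq> 0" "\<forall>w\<in>S - {v}. \<phi> w = 0"
    using assms by blast
  then show False using linear_eq_0_on_span[of \<phi> "S - {v}" v] v by auto
qed

lemma keys_subset_iff: "Poly_Mapping.keys x \<subseteq> A \<longleftrightarrow> (\<forall>i. i \<notin> A \<longrightarrow> Poly_Mapping.lookup x i = 0)"
  by (auto simp: in_keys_iff)

lemma inj_vertex_vector: "inj vertex_vector"
proof (rule injI)
  fix i j :: 'i assume "vertex_vector i = vertex_vector j"
  then have "Poly_Mapping.lookup (vertex_vector i) j = Poly_Mapping.lookup (vertex_vector j) j"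
    by simp
  then show "i = j" by (simp add: lookup_vertex_vector split: if_splits)
qed

lemma independent_vertex_vectors: "independent (vertex_vector ` (V :: 'i set))"
proof (rule independent_if_separated)
  fix v :: "'i \<Rightarrow>\<^sub>0 real" assume "v \<in> vertex_vector ` V"
  then obtain i where v: "v = vertex_vector i" by auto
  show "\<exists>\<phi> :: ('i \<Rightarrow>\<^sub>0 real) \<Rightarrow> real. linear \<phi> \<and> \<phi> v \<noteq> 0
      \<and> (\<forall>w\<in>vertex_vector ` V - {v}. \<phi> w = 0)"
    by (intro exI[of _ "\<lambda>x. Poly_Mapping.lookup x i"])
       (auto simp: v lookup_vertex_vector lookup_add split: if_splits intro!: linearI)
qed

text \<open>The basis of \<open>diagram_lattice D\<close> consists of roots with Dynkin diagram \<open>D\<close>.\<close>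

lemma zbasis_diagram_lattice:
  "finite (fst D) \<Longrightarrow> zbasis (diagram_lattice D) (vertex_vector ` fst D)"
  by (simp add: zbasis_def diagram_lattice_def independent_vertex_vectors)

lemma vertex_vectors_roots: "vertex_vector ` fst D \<subseteq> roots (diagram_form D) (diagram_lattice D)"
  using module.span_superset[OF module_zscale, of "vertex_vector ` fst D"]
  by (auto simp: roots_def diagram_lattice_def diagram_form_vertex_vector diagram_gram_def)

lemma dynkin_diagram_vertex_vectors:
  assumes "irrefl (snd D)"
  shows "diagram_iso D (dynkin_diagram (diagram_form D) (vertex_vector ` fst D))"
  unfolding diagram_iso_def
proof (intro exI[of _ vertex_vector] conjI ballI)
  show "bij_betw vertex_vector (fst D) (fst (dynkin_diagram (diagram_form D) (vertex_vector ` fst D)))"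
    by (simp add: dynkin_diagram_def bij_betw_def inj_on_subset[OF inj_vertex_vector])
  show "(u, v) \<in> snd D \<longleftrightarrow> (vertex_vector u, vertex_vector v)
      \<in> snd (dynkin_diagram (diagram_form D) (vertex_vector ` fst D))"
    if "u \<in> fst D" "v \<in> fst D" for u v
    using that assms inj_eq[OF inj_vertex_vector, of u v]
    by (auto simp: dynkin_diagram_def diagram_form_vertex_vector diagram_gram_def irrefl_def)
qed

section \<open>\<open>L10\<close> is even, unimodular and hyperbolic of rank 10\<close>

definition E10_basis :: "(nat \<Rightarrow>\<^sub>0 real) set" where
  "E10_basis = vertex_vector ` {1..10}"

lemma zbasis_L10: "zbasis L10 E10_basis"
  by (simp add: zbasis_def E10_basis_def L10_def diagram_lattice_def e_diagram_def
      independent_vertex_vectors)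

lemma card_E10_basis: "card E10_basis = 10"
  by (simp add: E10_basis_def card_image inj_on_subset[OF inj_vertex_vector])

lemma E10_basis_subset_L10: "E10_basis \<subseteq> L10"
  using zbasis_L10 module.span_superset[OF module_zscale] by (auto simp: zbasis_def)

lemma L10_subset_span: "L10 \<subseteq> span E10_basis"
  using zbasis_L10 module.span_minimal[OF module_zscale, of E10_basis "span E10_basis"]
    span_superset[of E10_basis]
  by (simp add: zbasis_def module.subspace_def[OF module_zscale] span_zero span_add span_scale)

lemma span_L10: "span L10 = span E10_basis"
  using E10_basis_subset_L10 L10_subset_span
  by (simp add: span_mono span_minimal subset_antisym)

lemma dim_L10: "dim L10 = 10"
  using E10_basis_subset_L10 L10_subset_span zbasis_L10 card_E10_basis
  by (intro dim_unique[of E10_basis]) (simp_all add: zbasis_def)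

lemma L10_eq:
  "L10 = {x. Poly_Mapping.keys x \<subseteq> {1..10} \<and> (\<forall>i. Poly_Mapping.lookup x i \<in> \<int>)}" (is "_ = ?R")
proof
  interpret Z: module "zscale :: int \<Rightarrow> (nat \<Rightarrow>\<^sub>0 real) \<Rightarrow> _" by (rule module_zscale)
  have "Z.subspace ?R"
    by (auto simp: Z.subspace_def lookup_add keys_subset_iff)
  moreover have "vertex_vector ` {1..10} \<subseteq> ?R"
    by (auto simp: in_keys_iff lookup_vertex_vector split: if_splits)
  ultimately show "L10 \<subseteq> ?R"
    unfolding L10_def diagram_lattice_def e_diagram_def by (simp add: Z.span_minimal)
  show "?R \<subseteq> L10"
  proof
    fix x assume x: "x \<in> ?R"
    have "x = (\<Sum>i\<in>{1..10}. zscale \<lfloor>Poly_Mapping.lookup x i\<rfloor> (vertex_vector i))"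
      using x
      by (intro poly_mapping_eqI)
         (auto simp: lookup_sum lookup_vertex_vector in_keys_iff subset_iff
           if_distrib[of "\<lambda>c. _ * c"] cong: if_cong)
    also have "\<dots> \<in> L10"
      unfolding L10_def diagram_lattice_def e_diagram_def
      by (intro Z.span_sum Z.span_scale Z.span_base) auto
    finally show "x \<in> L10" .
  qed
qed

lemma gram_E10: "diagram_gram (e_diagram 10) i j =
   (if i = j then - 2 else if (2 \<le> i \<and> j \<le> 10 \<and> j = Suc i) \<or> (2 \<le> j \<and> i \<le> 10 \<and> i = Suc j)
      \<or> (i, j) = (1, 4) \<or> (i, j) = (4, 1) then 1 else 0)"
  by (auto simp: diagram_gram_def e_diagram_def chain_edges_def)

lemma atLeastAtMost_1_10: "{1..10::nat} = {1,2,3,4,5,6,7,8,9,10}"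
  by (rule set_eqI) (simp, presburger)

lemma L10_form_explicit:
  assumes "Poly_Mapping.keys x \<subseteq> {1..10}" "Poly_Mapping.keys y \<subseteq> {1..10}"
  shows "L10_form x y = - 2 * (Poly_Mapping.lookup x 1 * Poly_Mapping.lookup y 1 + Poly_Mapping.lookup x 2 * Poly_Mapping.lookup y 2 + Poly_Mapping.lookup x 3 * Poly_Mapping.lookup y 3 + Poly_Mapping.lookup x 4 * Poly_Mapping.lookup y 4 + Poly_Mapping.lookup x 5 * Poly_Mapping.lookup y 5 + Poly_Mapping.lookup x 6 * Poly_Mapping.lookup y 6 + Poly_Mapping.lookup x 7 * Poly_Mapping.lookup y 7 + Poly_Mapping.lookup x 8 * Poly_Mapping.lookup y 8 + Poly_Mapping.lookup x 9 * Poly_Mapping.lookup y 9 + Poly_Mapping.lookup x 10 * Poly_Mapping.lookup y 10)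
     + ((Poly_Mapping.lookup x 2 * Poly_Mapping.lookup y 3 + Poly_Mapping.lookup x 3 * Poly_Mapping.lookup y 2) + (Poly_Mapping.lookup x 3 * Poly_Mapping.lookup y 4 + Poly_Mapping.lookup x 4 * Poly_Mapping.lookup y 3) + (Poly_Mapping.lookup x 4 * Poly_Mapping.lookup y 5 + Poly_Mapping.lookup x 5 * Poly_Mapping.lookup y 4) + (Poly_Mapping.lookup x 5 * Poly_Mapping.lookup y 6 + Poly_Mapping.lookup x 6 * Poly_Mapping.lookup y 5) + (Poly_Mapping.lookup x 6 * Poly_Mapping.lookup y 7 + Poly_Mapping.lookup x 7 * Poly_Mapping.lookup y 6) + (Poly_Mapping.lookup x 7 * Poly_Mapping.lookup y 8 + Poly_Mapping.lookup x 8 * Poly_Mapping.lookup y 7) + (Poly_Mapping.lookup x 8 * Poly_Mapping.lookup y 9 + Poly_Mapping.lookup x 9 * Poly_Mapping.lookup y 8) + (Poly_Mapping.lookup x 9 * Poly_Mapping.lookup y 10 + Poly_Mapping.lookup x 10 * Poly_Mapping.lookup y 9) + (Poly_Mapping.lookup x 1 * Poly_Mapping.lookup y 4 + Poly_Mapping.lookup x 4 * Poly_Mapping.lookup y 1))"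
  unfolding L10_form_def diagram_form_superset[OF finite_atLeastAtMost assms(1) finite_atLeastAtMost assms(2)]
  unfolding atLeastAtMost_1_10 by (simp add: gram_E10 algebra_simps)

lemma supp_e: "i \<in> {1..10} \<Longrightarrow> Poly_Mapping.keys (vertex_vector i) \<subseteq> {1..10}"
  by (simp add: vertex_vector_def)

lemma L10_coords:
  assumes supp: "Poly_Mapping.keys v \<subseteq> {1..10}"
    and bI: "\<And>j. j \<in> {1..10} \<Longrightarrow> L10_form v (vertex_vector j) \<in> \<int>"
  shows "v \<in> L10"
proof -
  define b where "b j = L10_form v (vertex_vector j)" for j
    have b1: "b 1 = (-2) * Poly_Mapping.lookup v 1 + (1) * Poly_Mapping.lookup v 4"
      unfolding b_def by (subst L10_form_explicit[OF supp supp_e]) (simp_all add: lookup_vertex_vector)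
    have b2: "b 2 = (-2) * Poly_Mapping.lookup v 2 + (1) * Poly_Mapping.lookup v 3"
      unfolding b_def by (subst L10_form_explicit[OF supp supp_e]) (simp_all add: lookup_vertex_vector)
    have b3: "b 3 = (1) * Poly_Mapping.lookup v 2 + (-2) * Poly_Mapping.lookup v 3 + (1) * Poly_Mapping.lookup v 4"
      unfolding b_def by (subst L10_form_explicit[OF supp supp_e]) (simp_all add: lookup_vertex_vector)
    have b4: "b 4 = (1) * Poly_Mapping.lookup v 1 + (1) * Poly_Mapping.lookup v 3 + (-2) * Poly_Mapping.lookup v 4 + (1) * Poly_Mapping.lookup v 5"
      unfolding b_def by (subst L10_form_explicit[OF supp supp_e]) (simp_all add: lookup_vertex_vector)
    have b5: "b 5 = (1) * Poly_Mapping.lookup v 4 + (-2) * Poly_Mapping.lookup v 5 + (1) * Poly_Mapping.lookup v 6"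
      unfolding b_def by (subst L10_form_explicit[OF supp supp_e]) (simp_all add: lookup_vertex_vector)
    have b6: "b 6 = (1) * Poly_Mapping.lookup v 5 + (-2) * Poly_Mapping.lookup v 6 + (1) * Poly_Mapping.lookup v 7"
      unfolding b_def by (subst L10_form_explicit[OF supp supp_e]) (simp_all add: lookup_vertex_vector)
    have b7: "b 7 = (1) * Poly_Mapping.lookup v 6 + (-2) * Poly_Mapping.lookup v 7 + (1) * Poly_Mapping.lookup v 8"
      unfolding b_def by (subst L10_form_explicit[OF supp supp_e]) (simp_all add: lookup_vertex_vector)
    have b8: "b 8 = (1) * Poly_Mapping.lookup v 7 + (-2) * Poly_Mapping.lookup v 8 + (1) * Poly_Mapping.lookup v 9"
      unfolding b_def by (subst L10_form_explicit[OF supp supp_e]) (simp_all add: lookup_vertex_vector)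
    have b9: "b 9 = (1) * Poly_Mapping.lookup v 8 + (-2) * Poly_Mapping.lookup v 9 + (1) * Poly_Mapping.lookup v 10"
      unfolding b_def by (subst L10_form_explicit[OF supp supp_e]) (simp_all add: lookup_vertex_vector)
    have b10: "b 10 = (1) * Poly_Mapping.lookup v 9 + (-2) * Poly_Mapping.lookup v 10"
      unfolding b_def by (subst L10_form_explicit[OF supp supp_e]) (simp_all add: lookup_vertex_vector)
  note b = b1 b2 b3 b4 b5 b6 b7 b8 b9 b10
  have bI: "b j \<in> \<int>" if "j \<in> {1..10}" for j using bI[OF that] by (simp add: b_def)
    have "Poly_Mapping.lookup v 1 = (10) * b 1 + (7) * b 2 + (14) * b 3 + (21) * b 4 + (18) * b 5 + (15) * b 6 + (12) * b 7 + (9) * b 8 + (6) * b 9 + (3) * b 10"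
      unfolding b by (simp add: algebra_simps)
    then have i1: "Poly_Mapping.lookup v 1 \<in> \<int>" by (simp add: bI)
    have "Poly_Mapping.lookup v 2 = (7) * b 1 + (4) * b 2 + (9) * b 3 + (14) * b 4 + (12) * b 5 + (10) * b 6 + (8) * b 7 + (6) * b 8 + (4) * b 9 + (2) * b 10"
      unfolding b by (simp add: algebra_simps)
    then have i2: "Poly_Mapping.lookup v 2 \<in> \<int>" by (simp add: bI)
    have "Poly_Mapping.lookup v 3 = (14) * b 1 + (9) * b 2 + (18) * b 3 + (28) * b 4 + (24) * b 5 + (20) * b 6 + (16) * b 7 + (12) * b 8 + (8) * b 9 + (4) * b 10"
      unfolding b by (simp add: algebra_simps)
    then have i3: "Poly_Mapping.lookup v 3 \<in> \<int>" by (simp add: bI)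
    have "Poly_Mapping.lookup v 4 = (21) * b 1 + (14) * b 2 + (28) * b 3 + (42) * b 4 + (36) * b 5 + (30) * b 6 + (24) * b 7 + (18) * b 8 + (12) * b 9 + (6) * b 10"
      unfolding b by (simp add: algebra_simps)
    then have i4: "Poly_Mapping.lookup v 4 \<in> \<int>" by (simp add: bI)
    have "Poly_Mapping.lookup v 5 = (18) * b 1 + (12) * b 2 + (24) * b 3 + (36) * b 4 + (30) * b 5 + (25) * b 6 + (20) * b 7 + (15) * b 8 + (10) * b 9 + (5) * b 10"
      unfolding b by (simp add: algebra_simps)
    then have i5: "Poly_Mapping.lookup v 5 \<in> \<int>" by (simp add: bI)
    have "Poly_Mapping.lookup v 6 = (15) * b 1 + (10) * b 2 + (20) * b 3 + (30) * b 4 + (25) * b 5 + (20) * b 6 + (16) * b 7 + (12) * b 8 + (8) * b 9 + (4) * b 10"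
      unfolding b by (simp add: algebra_simps)
    then have i6: "Poly_Mapping.lookup v 6 \<in> \<int>" by (simp add: bI)
    have "Poly_Mapping.lookup v 7 = (12) * b 1 + (8) * b 2 + (16) * b 3 + (24) * b 4 + (20) * b 5 + (16) * b 6 + (12) * b 7 + (9) * b 8 + (6) * b 9 + (3) * b 10"
      unfolding b by (simp add: algebra_simps)
    then have i7: "Poly_Mapping.lookup v 7 \<in> \<int>" by (simp add: bI)
    have "Poly_Mapping.lookup v 8 = (9) * b 1 + (6) * b 2 + (12) * b 3 + (18) * b 4 + (15) * b 5 + (12) * b 6 + (9) * b 7 + (6) * b 8 + (4) * b 9 + (2) * b 10"
      unfolding b by (simp add: algebra_simps)
    then have i8: "Poly_Mapping.lookup v 8 \<in> \<int>" by (simp add: bI)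
    have "Poly_Mapping.lookup v 9 = (6) * b 1 + (4) * b 2 + (8) * b 3 + (12) * b 4 + (10) * b 5 + (8) * b 6 + (6) * b 7 + (4) * b 8 + (2) * b 9 + (1) * b 10"
      unfolding b by (simp add: algebra_simps)
    then have i9: "Poly_Mapping.lookup v 9 \<in> \<int>" by (simp add: bI)
    have "Poly_Mapping.lookup v 10 = (3) * b 1 + (2) * b 2 + (4) * b 3 + (6) * b 4 + (5) * b 5 + (4) * b 6 + (3) * b 7 + (2) * b 8 + (1) * b 9 + (0) * b 10"
      unfolding b by (simp add: algebra_simps)
    then have i10: "Poly_Mapping.lookup v 10 \<in> \<int>" by (simp add: bI)
  have "Poly_Mapping.lookup v i \<in> \<int>" for i
  proof (cases "i \<in> {1..10}")
    case True
    then show ?thesis unfolding atLeastAtMost_1_10 using i1 i2 i3 i4 i5 i6 i7 i8 i9 i10 by auto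
  next
    case False
    then have "Poly_Mapping.lookup v i = 0" using supp by (auto simp: in_keys_iff subset_iff)
    then show ?thesis by simp
  qed
  then show ?thesis using supp by (simp add: L10_eq)
qed

lemma L10_nondegenerate:
  assumes supp: "Poly_Mapping.keys v \<subseteq> {1..10}"
    and b0: "\<And>j. j \<in> {1..10} \<Longrightarrow> L10_form v (vertex_vector j) = 0"
  shows "v = 0"
proof -
  define b where "b j = L10_form v (vertex_vector j)" for j
    have b1: "b 1 = (-2) * Poly_Mapping.lookup v 1 + (1) * Poly_Mapping.lookup v 4"
      unfolding b_def by (subst L10_form_explicit[OF supp supp_e]) (simp_all add: lookup_vertex_vector)
    have b2: "b 2 = (-2) * Poly_Mapping.lookup v 2 + (1) * Poly_Mapping.lookup v 3"
      unfolding b_def by (subst L10_form_explicit[OF supp supp_e]) (simp_all add: lookup_vertex_vector)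
    have b3: "b 3 = (1) * Poly_Mapping.lookup v 2 + (-2) * Poly_Mapping.lookup v 3 + (1) * Poly_Mapping.lookup v 4"
      unfolding b_def by (subst L10_form_explicit[OF supp supp_e]) (simp_all add: lookup_vertex_vector)
    have b4: "b 4 = (1) * Poly_Mapping.lookup v 1 + (1) * Poly_Mapping.lookup v 3 + (-2) * Poly_Mapping.lookup v 4 + (1) * Poly_Mapping.lookup v 5"
      unfolding b_def by (subst L10_form_explicit[OF supp supp_e]) (simp_all add: lookup_vertex_vector)
    have b5: "b 5 = (1) * Poly_Mapping.lookup v 4 + (-2) * Poly_Mapping.lookup v 5 + (1) * Poly_Mapping.lookup v 6"
      unfolding b_def by (subst L10_form_explicit[OF supp supp_e]) (simp_all add: lookup_vertex_vector)
    have b6: "b 6 = (1) * Poly_Mapping.lookup v 5 + (-2) * Poly_Mapping.lookup v 6 + (1) * Poly_Mapping.lookup v 7"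
      unfolding b_def by (subst L10_form_explicit[OF supp supp_e]) (simp_all add: lookup_vertex_vector)
    have b7: "b 7 = (1) * Poly_Mapping.lookup v 6 + (-2) * Poly_Mapping.lookup v 7 + (1) * Poly_Mapping.lookup v 8"
      unfolding b_def by (subst L10_form_explicit[OF supp supp_e]) (simp_all add: lookup_vertex_vector)
    have b8: "b 8 = (1) * Poly_Mapping.lookup v 7 + (-2) * Poly_Mapping.lookup v 8 + (1) * Poly_Mapping.lookup v 9"
      unfolding b_def by (subst L10_form_explicit[OF supp supp_e]) (simp_all add: lookup_vertex_vector)
    have b9: "b 9 = (1) * Poly_Mapping.lookup v 8 + (-2) * Poly_Mapping.lookup v 9 + (1) * Poly_Mapping.lookup v 10"
      unfolding b_def by (subst L10_form_explicit[OF supp supp_e]) (simp_all add: lookup_vertex_vector)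
    have b10: "b 10 = (1) * Poly_Mapping.lookup v 9 + (-2) * Poly_Mapping.lookup v 10"
      unfolding b_def by (subst L10_form_explicit[OF supp supp_e]) (simp_all add: lookup_vertex_vector)
  note b = b1 b2 b3 b4 b5 b6 b7 b8 b9 b10
  have z: "b j = 0" if "j \<in> {1..10}" for j using b0[OF that] by (simp add: b_def)
  have "\<forall>i\<in>{1..10}. Poly_Mapping.lookup v i = 0"
    unfolding atLeastAtMost_1_10
    using z[of 1] z[of 2] z[of 3] z[of 4] z[of 5] z[of 6] z[of 7] z[of 8] z[of 9] z[of 10]
    unfolding b by simp
  then have "Poly_Mapping.lookup v i = 0" for i
    using supp unfolding keys_subset_iff by blast
  then show ?thesis by (intro poly_mapping_eqI) simp
qed

lemma L10_form_sym: "L10_form x y = L10_form y x"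
proof -
  have "diagram_gram (e_diagram 10) i j = diagram_gram (e_diagram 10) j i" for i j
    by (auto simp: gram_E10)
  then show ?thesis
    unfolding L10_form_def diagram_form_def
    by (subst sum.swap) (simp add: mult_ac)
qed

lemma vertex_vector_L10: "i \<in> {1..10} \<Longrightarrow> vertex_vector i \<in> L10"
  by (auto simp: L10_eq supp_e lookup_vertex_vector in_keys_iff split: if_splits)

lemma is_lattice_L10: "is_lattice L10_form L10"
proof -
  have "L10_form x y \<in> \<int>" if "x \<in> L10" "y \<in> L10" for x y
    using that by (simp add: L10_eq L10_form_explicit)
  moreover have "x = 0" if "x \<in> L10" "\<forall>y\<in>L10. L10_form x y = 0" for x
    using that vertex_vector_L10 by (intro L10_nondegenerate) (simp add: L10_eq, blast)
  moreover have "bilinear L10_form" by (simp add: L10_form_def bilinear_diagram_form)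
  ultimately show ?thesis
    unfolding is_lattice_def using zbasis_L10 L10_form_sym by blast
qed

lemma even_L10: "even_on L10_form L10"
  unfolding even_on_def
proof
  fix x assume x: "x \<in> L10"
  then have "- (Poly_Mapping.lookup x 1 ^ 2 + Poly_Mapping.lookup x 2 ^ 2 + Poly_Mapping.lookup x 3 ^ 2 + Poly_Mapping.lookup x 4 ^ 2 + Poly_Mapping.lookup x 5 ^ 2 + Poly_Mapping.lookup x 6 ^ 2 + Poly_Mapping.lookup x 7 ^ 2 + Poly_Mapping.lookup x 8 ^ 2 + Poly_Mapping.lookup x 9 ^ 2 + Poly_Mapping.lookup x 10 ^ 2) + (Poly_Mapping.lookup x 2 * Poly_Mapping.lookup x 3 + Poly_Mapping.lookup x 3 * Poly_Mapping.lookup x 4 + Poly_Mapping.lookup x 4 * Poly_Mapping.lookup x 5 + Poly_Mapping.lookup x 5 * Poly_Mapping.lookup x 6 + Poly_Mapping.lookup x 6 * Poly_Mapping.lookup x 7 + Poly_Mapping.lookup x 7 * Poly_Mapping.lookup x 8 + Poly_Mapping.lookup x 8 * Poly_Mapping.lookup x 9 + Poly_Mapping.lookup x 9 * Poly_Mapping.lookup x 10 + Poly_Mapping.lookup x 1 * Poly_Mapping.lookup x 4) \<in> \<int>" (is "?d \<in> _") unfolding L10_eq by simp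
  then obtain k where "?d = of_int k" unfolding Ints_def by blast
  moreover have "L10_form x x = 2 * ?d"
    using x by (simp add: L10_eq L10_form_explicit power2_eq_square algebra_simps)
  ultimately have "L10_form x x = 2 * of_int k" by (simp only:)
  then show "\<exists>k::int. L10_form x x = 2 * of_int k" by blast
qed

lemma unimodular_L10: "unimodular L10_form L10"
proof -
  interpret Q: module "qscale :: rat \<Rightarrow> (nat \<Rightarrow>\<^sub>0 real) \<Rightarrow> _" by (rule module_qscale)
  have "Q.subspace {x. Poly_Mapping.keys x \<subseteq> {1..10}}"
    by (auto simp: Q.subspace_def lookup_add keys_subset_iff)
  then have "qspan L10 \<subseteq> {x. Poly_Mapping.keys x \<subseteq> {1..10}}"
    by (intro Q.span_minimal) (auto simp: L10_eq)
  then have "dual_lattice L10_form L10 \<subseteq> L10"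
    unfolding dual_lattice_def using L10_coords vertex_vector_L10 by blast
  moreover have "L10 \<subseteq> dual_lattice L10_form L10"
    using is_lattice_L10 Q.span_base by (auto simp: dual_lattice_def is_lattice_def)
  ultimately show ?thesis by (simp add: unimodular_def)
qed

text \<open>Sums \<open>a\<^sub>1 + 2 a\<^sub>2 + \<dots> + k a\<^sub>k\<close> over the chain \<open>a\<^sub>k = e\<^sub>k\<^sub>+\<^sub>1\<close> are pairwise orthogonal of
  negative norm; a vector orthogonal to the chain completes them to a basis.\<close>

lemma hyperbolic_L10: "hyperbolic L10_form L10"
proof -
  define c :: "nat \<Rightarrow> nat \<Rightarrow> real" where
    "c k i = (if k = 0 then [0, 10, 7, 14, 21, 18, 15, 12, 9, 6, 3] ! i
       else if 2 \<le> i \<and> i \<le> Suc k then real (i - 1) else 0)" for k i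
  define f :: "nat \<Rightarrow> (nat \<Rightarrow>\<^sub>0 real)" where
    "f k = (\<Sum>i\<in>{1..10}. c k i *\<^sub>R vertex_vector i)" for k
  have lf: "Poly_Mapping.lookup (f k) i = c k i" if "i \<in> {1..10}" for k i
    using that by (simp add: f_def lookup_sum lookup_vertex_vector
        if_distrib[of "\<lambda>z. _ * z"] cong: if_cong)
  have kf: "Poly_Mapping.keys (f k) \<subseteq> {1..10}" for k
    by (auto simp: keys_subset_iff f_def lookup_sum lookup_vertex_vector intro!: sum.neutral)
  have form: "L10_form (f k) (f l) = (if k \<noteq> l then 0 else if k = 0 then 10 else - real (k * Suc k))"
    if "k \<in> {0..9}" "l \<in> {0..9}" for k l
  proof -
    have "k = 0 \<or> k = 1 \<or> k = 2 \<or> k = 3 \<or> k = 4 \<or> k = 5 \<or> k = 6 \<or> k = 7 \<or> k = 8 \<or> k = 9"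
      "l = 0 \<or> l = 1 \<or> l = 2 \<or> l = 3 \<or> l = 4 \<or> l = 5 \<or> l = 6 \<or> l = 7 \<or> l = 8 \<or> l = 9"
      using that by auto
    then show ?thesis
      unfolding L10_form_explicit[OF kf kf]
      by (elim disjE) (simp_all add: lf c_def)
  qed
  have pos: "L10_form (f 0) (f 0) > 0" using form[of 0 0] by simp
  have neg: "L10_form (f k) (f k) < 0" if "k \<in> {1..9}" for k
  proof -
    have "L10_form (f k) (f k) = - real (k * Suc k)" using that by (subst form) auto
    moreover have "real (k * Suc k) > 0" using that by (subst of_nat_0_less_iff) simp
    ultimately show ?thesis by (simp only: neg_less_0_iff_less)
  qed
  have orth: "L10_form (f k) (f l) = 0" if "k \<in> {0..9}" "l \<in> {0..9}" "k \<noteq> l" for k l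
    using form[of k l] that by simp
  have nz: "L10_form (f k) (f k) \<noteq> 0" if "k \<in> {0..9}" for k
    using pos neg[of k] that by (cases "k = 0") auto
  let ?b = "f ` {0..9}"
  have inj: "inj_on f {0..9}"
  proof (rule inj_onI)
    fix k l assume kl: "k \<in> {0..9}" "l \<in> {0..9}" "f k = f l"
    then show "k = l" using nz[of k] orth[of k l] by auto
  qed
  have indep: "independent ?b"
  proof (rule independent_if_separated)
    fix v assume "v \<in> ?b"
    then obtain k where k: "k \<in> {0..9}" "v = f k" by auto
    show "\<exists>\<phi> :: (nat \<Rightarrow>\<^sub>0 real) \<Rightarrow> real. linear \<phi> \<and> \<phi> v \<noteq> 0 \<and> (\<forall>w\<in>?b - {v}. \<phi> w = 0)"
    proof (intro exI[of _ "L10_form v"] conjI ballI)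
      show "linear (L10_form v)"
        using bilinear_diagram_form[of "e_diagram 10"] by (simp add: L10_form_def bilinear_def)
      show "L10_form v v \<noteq> 0" using nz k by simp
      show "L10_form v w = 0" if w: "w \<in> ?b - {v}" for w
      proof -
        obtain l where l: "l \<in> {0..9}" "w = f l" using w by (elim DiffE imageE)
        then have "k \<noteq> l" using w k by (intro notI) simp
        then show ?thesis using orth k l by simp
      qed
    qed
  qed
  have card_b: "card ?b = 10" by (simp add: card_image[OF inj])
  have "f k \<in> span L10" for k
    unfolding f_def
    by (intro span_sum span_scale span_base vertex_vector_L10)
  then have sub: "?b \<subseteq> span L10" by auto
  have span_b: "span ?b = span L10"
  proof
    show "span ?b \<subseteq> span L10" using sub by (simp add: span_minimal subspace_span)
    show "span L10 \<subseteq> span ?b"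
    proof (rule subsetI, rule ccontr)
      fix x assume x: "x \<in> span L10" "x \<notin> span ?b"
      then have "independent (insert x ?b)" using indep by (simp add: independent_insertI)
      moreover have "insert x ?b \<subseteq> span E10_basis" using x sub span_L10 by simp
      ultimately have "card (insert x ?b) \<le> card E10_basis"
        using zbasis_L10 independent_span_bound by (auto simp: zbasis_def)
      moreover have "x \<notin> ?b" using x by (metis span_base)
      ultimately show False using card_b card_E10_basis by simp
    qed
  qed
  have "{0..9::nat} = insert 0 {1..9}" by (rule set_eqI) (simp, presburger)
  then have split: "?b = insert (f 0) (f ` {1..9})" by simp
  have P: "{x \<in> ?b. L10_form x x > 0} = {f 0}" "{x \<in> ?b. L10_form x x < 0} = f ` {1..9}"
    unfolding split using pos neg by (fastforce dest: less_asym)+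
  have "card (f ` {1..9}) = 9"
    by (subst card_image[OF inj_on_subset[OF inj]]) auto
  moreover have "\<forall>x\<in>?b. \<forall>y\<in>?b. x \<noteq> y \<longrightarrow> L10_form x y = 0"
  proof (intro ballI impI)
    fix x y assume xy: "x \<in> ?b" "y \<in> ?b" "x \<noteq> y"
    then obtain k l where kl: "k \<in> {0..9}" "x = f k" "l \<in> {0..9}" "y = f l" by (elim imageE)
    then have "k \<noteq> l" using xy by (intro notI) simp
    then show "L10_form x y = 0" using orth kl by simp
  qed
  ultimately have "has_signature L10_form L10 1 9"
    unfolding has_signature_def using indep card_b span_b
    by (intro exI[of _ ?b]) (simp add: P)
  then show ?thesis by (simp add: hyperbolic_def dim_L10)
qed

end

theory Submission
  imports Defs "HOL-Computational_Algebra.Primes"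
begin

text \<open>
  Let \<open>W10\<close> be the group generated by the reflections in the roots of \<open>L10\<close>. It preserves the positive
  cones, and it turns out to be large enough to decide everything.

  \<^bold>\<open>Primitive closures.\<close> As the basis vectors \<open>ev i\<close> have fundamental weights of norm at least \<open>0\<close>, the
  coefficients of a root of \<open>L10\<close> all have the same sign (lemma \<open>L10_root_signs\<close>). Hence the roots orthogonal to
  a vector of the chamber, that is to a vector having non-negative products with all \<open>ev i\<close>, are combinations of
  those \<open>ev i\<close> that are orthogonal to it. The span of an ADE-configuration \<open>\<Phi>\<close> is negative definite, so that
  some vector of positive norm is orthogonal to \<open>\<Phi>\<close>. Moving it into the chamber, and repeating the argument
  inside a negative definite root lattice, one moves \<open>\<Phi>\<close> into the span of \<open>card \<Phi>\<close> of the vectors \<open>ev i\<close>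
  (lemma \<open>roots_into_E10\<close>). As part of a basis they span a primitive sublattice, which is therefore the closure
  of \<open>\<Phi>\<close>: it is a root lattice, and its diagram is a sub-diagram of \<open>E\<^sub>1\<^sub>0\<close>.

  \<^bold>\<open>The closure is determined by its type.\<close> The longest element of a finite parabolic subgroup of \<open>W10\<close> maps the
  simple roots of the subgroup to their negatives, permuted by a symmetry of the diagram. Such flips move sets
  of simple roots around. Finitely many of them suffice to move every set of simple roots with negative definite
  span to one of the sets in an explicit list, whose types are pairwise different (lemmas
  \<open>canonical_subset_exists\<close> and \<open>canonical_types_distinct\<close>).

  \<^bold>\<open>The configuration in its closure.\<close> Configurations that span the same lattice are conjugate under the Weyl
  group of this lattice (lemma \<open>simple_systems_conjugate\<close>). By the theorem of Borel and de Siebenthal (lemma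
  \<open>finite_index_step\<close>), a configuration that spans a proper sublattice of finite index can be moved into the
  sublattice that arises when some component of the diagram is extended by minus its highest root and a vertex
  whose coefficient in the highest root is prime is removed. Components of type \<open>A\<close> have no such vertices. For
  the components of type \<open>D\<close> and \<open>E\<close>, iterating this step leads to finite tables; a canonical set has at most one such
  component. In each table the types are pairwise different, so that the types of \<open>\<Phi>\<close> and of its closure
  determine the orbit of \<open>\<Phi>\<close>. Conversely, isometries preserve both types. The tables are verified by evaluation
  on coordinate vectors.

  \<^bold>\<open>Existence.\<close> A closure of type \<open>t'\<close> with a configuration of type \<open>t\<close> is the same as an even overlattice of the
  lattice of \<open>t\<close>, isomorphic to that of \<open>t'\<close>, together with an embedding of the latter as the span of a set of
  basis vectors \<open>ev i\<close> (lemmas \<open>type_conditions_necessary\<close> and \<open>type_conditions_sufficient\<close>).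
\<close>

section \<open>Integral, rational and real spans\<close>

interpretation Z: module "zscale :: int \<Rightarrow> 'v::real_vector \<Rightarrow> 'v"
  by (rule module_zscale)

interpretation Q: module "qscale :: rat \<Rightarrow> 'v::real_vector \<Rightarrow> 'v"
  by (rule module_qscale)

lemma qspan_subspace_zspan: "Z.subspace (qspan S)"
proof (rule Z.subspaceI)
  show "zscale k x \<in> qspan S" if "x \<in> qspan S" for k x
    using Q.span_scale[OF that, of "of_int k"] by simp
qed (auto intro: Q.span_add Q.span_zero)

lemma zspan_subset_qspan: "zspan S \<subseteq> qspan S"
  by (intro Z.span_minimal qspan_subspace_zspan) (auto intro: Q.span_base)

lemma qspan_subset_span: "qspan S \<subseteq> span S"
  by (intro Q.span_minimal Q.subspaceI) (auto intro: span_base span_add span_zero span_scale)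

lemma zspan_subset_span: "zspan S \<subseteq> span S"
  using zspan_subset_qspan qspan_subset_span by blast

lemma span_zspan: "span (zspan S) = span S"
  using zspan_subset_span[of S] Z.span_superset[of S]
  by (meson span_mono span_minimal subspace_span subset_antisym order_trans)

lemma qspan_subset_iff: "A \<subseteq> qspan S \<longleftrightarrow> qspan A \<subseteq> qspan S"
  using Q.span_minimal[OF _ Q.subspace_span, of A S] order_trans[OF Q.span_superset, of A] by blast

lemma qspan_zspan: "qspan (zspan S) = qspan S"
  using Q.span_minimal[OF zspan_subset_qspan Q.subspace_span, of S]
    Q.span_mono[OF Z.span_superset, of S] by (rule subset_antisym)

lemma zspan_finiteE:
  assumes "finite S" "x \<in> zspan S"
  obtains c :: "'v::real_vector \<Rightarrow> int" where "x = (\<Sum>v\<in>S. of_int (c v) *\<^sub>R v)"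
  using assms unfolding Z.span_finite[OF assms(1)] by blast

lemma zspan_sumI: "(\<Sum>v\<in>S. of_int (c v) *\<^sub>R v) \<in> zspan S"
  by (intro Z.span_sum Z.span_scale Z.span_base)

lemma qspan_scaleI: "c \<in> \<rat> \<Longrightarrow> x \<in> qspan S \<Longrightarrow> c *\<^sub>R x \<in> qspan S"
  by (auto elim!: Rats_cases intro: Q.span_scale)

lemma qspan_clear_denominator:
  assumes "x \<in> qspan S"
  shows "\<exists>N::nat. 0 < N \<and> of_nat N *\<^sub>R x \<in> zspan S"
  using assms
proof (induction rule: Q.span_induct_alt)
  case base
  show ?case by (rule exI[of _ 1]) (simp add: Z.span_zero)
next
  case (step q v y)
  then obtain N where N: "0 < N" "of_nat N *\<^sub>R y \<in> zspan S" by blast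
  obtain a b where ab: "quotient_of q = (a, b)" by fastforce
  then have b: "0 < b" using quotient_of_denom_pos by blast
  have q: "of_rat q = (of_int a / of_int b :: real)"
    using quotient_of_div[OF ab] by (simp add: of_rat_divide)
  have "of_nat (nat b * N) *\<^sub>R (qscale q v + y)
      = zscale (int N * a) v + zscale b (of_nat N *\<^sub>R y)"
    using b by (simp add: q algebra_simps)
  also have "\<dots> \<in> zspan S"
    by (intro Z.span_add Z.span_scale Z.span_base step N)
  finally show ?case using b N by (intro exI[of _ "nat b * N"]) simp
qed

lemma linear_zspan_image:
  assumes "linear g" shows "g ` zspan S = zspan (g ` S)"
proof -
  interpret g: module_hom zscale zscale g
    using assms by unfold_locales (simp_all add: linear_add linear_scale)
  show ?thesis by (simp add: g.span_image)
qed

lemma linear_qspan_image: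
  assumes "linear g" shows "g ` qspan S = qspan (g ` S)"
proof -
  interpret g: module_hom qscale qscale g
    using assms by unfold_locales (simp_all add: linear_add linear_scale)
  show ?thesis by (simp add: g.span_image)
qed

text \<open>The quantities minimised below are non-negative up to a shift and have bounded denominators,
  so a minimum is attained although the sets are infinite.\<close>

lemma discrete_has_minimum:
  fixes S :: "real set"
  assumes "S \<noteq> {}" "0 < N" "\<And>s. s \<in> S \<Longrightarrow> of_nat N * s \<in> \<int>" "\<And>s. s \<in> S \<Longrightarrow> b \<le> s"
  shows "\<exists>m\<in>S. \<forall>s\<in>S. m \<le> s"
proof -
  let ?f = "\<lambda>s. nat (\<lfloor>of_nat N * s\<rfloor> - \<lfloor>of_nat N * b\<rfloor>)"
  obtain m where m: "m \<in> S" "\<And>s. s \<in> S \<Longrightarrow> ?f m \<le> ?f s"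
    using ex_has_least_nat[of "\<lambda>s. s \<in> S" _ ?f] assms(1) by blast
  have "m \<le> s" if s: "s \<in> S" for s
  proof -
    have ge: "\<lfloor>of_nat N * b\<rfloor> \<le> \<lfloor>of_nat N * x\<rfloor>" if "x \<in> S" for x
      using assms(2) assms(4)[OF that] by (intro floor_mono mult_left_mono) auto
    have "\<lfloor>of_nat N * m\<rfloor> \<le> \<lfloor>of_nat N * s\<rfloor>"
      using m(2)[OF s] ge[OF s] ge[OF m(1)] by linarith
    moreover have "of_int \<lfloor>of_nat N * x\<rfloor> = of_nat N * x" if "x \<in> S" for x
      using assms(3)[OF that] by (rule of_int_floor)
    ultimately have "of_nat N * m \<le> of_nat N * s"
      using s m(1) by (metis of_int_le_iff)
    then show ?thesis using assms(2) by simp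
  qed
  then show ?thesis using m(1) by blast
qed

section \<open>Reflections and the groups that they generate\<close>

locale symmetric_form =
  fixes B :: "'v::real_vector \<Rightarrow> 'v \<Rightarrow> real"
  assumes bilinear_B: "bilinear B" and B_sym: "B x y = B y x"
begin

lemma B_linear_right: "linear (B x)" and B_linear_left: "linear (\<lambda>x. B x y)"
  using bilinear_B by (auto simp: bilinear_def)

lemma B_simps [simp]:
  "B (x + y) z = B x z + B y z" "B z (x + y) = B z x + B z y"
  "B (x - y) z = B x z - B y z" "B z (x - y) = B z x - B z y"
  "B (c *\<^sub>R x) z = c * B x z" "B z (c *\<^sub>R x) = c * B z x"
  "B (- x) z = - B x z" "B z (- x) = - B z x" "B 0 z = 0" "B z 0 = 0"
  using bilinear_B
  by (simp_all add: bilinear_ladd bilinear_radd bilinear_lsub bilinear_rsub bilinear_lmul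
      bilinear_rmul bilinear_lneg bilinear_rneg bilinear_lzero bilinear_rzero)

lemma B_sum_left: "B (\<Sum>i\<in>I. f i) z = (\<Sum>i\<in>I. B (f i) z)"
  by (rule linear_sum[OF B_linear_left])

lemma B_sum_right: "B z (\<Sum>i\<in>I. f i) = (\<Sum>i\<in>I. B z (f i))"
  by (rule linear_sum[OF B_linear_right])

lemma B_zero_on_span: "(\<And>y. y \<in> S \<Longrightarrow> B x y = 0) \<Longrightarrow> y \<in> span S \<Longrightarrow> B x y = 0"
  using linear_eq_0_on_span[OF B_linear_right] by blast

definition reflect :: "'v \<Rightarrow> 'v \<Rightarrow> 'v" where
  "reflect r x = x + B x r *\<^sub>R r"

lemma linear_reflect: "linear (reflect r)"
  by (rule linearI) (simp_all add: reflect_def algebra_simps)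

lemma reflect_isometry: "B r r = - 2 \<Longrightarrow> B (reflect r x) (reflect r y) = B x y"
  by (simp add: reflect_def algebra_simps B_sym[of r y])

lemma reflect_reflect: "B r r = - 2 \<Longrightarrow> reflect r (reflect r x) = x"
  by (simp add: reflect_def algebra_simps)

inductive_set weyl :: "'v set \<Rightarrow> ('v \<Rightarrow> 'v) set" for A where
  weyl_id: "id \<in> weyl A"
| weyl_step: "g \<in> weyl A \<Longrightarrow> r \<in> A \<Longrightarrow> reflect r \<circ> g \<in> weyl A"

lemma weyl_linear: "g \<in> weyl A \<Longrightarrow> linear g"
proof (induction rule: weyl.induct)
  case weyl_id
  show ?case by (rule linear_id)
next
  case (weyl_step g r)
  then show ?case by (intro linear_compose linear_reflect)
qed

lemma weyl_isometry: "g \<in> weyl A \<Longrightarrow> (\<And>r. r \<in> A \<Longrightarrow> B r r = - 2) \<Longrightarrow> B (g x) (g y) = B x y"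
  by (induction rule: weyl.induct) (simp_all add: reflect_isometry)

lemma weyl_mono: "A \<subseteq> A' \<Longrightarrow> weyl A \<subseteq> weyl A'"
proof
  fix g assume "A \<subseteq> A'" "g \<in> weyl A"
  from this(2,1) show "g \<in> weyl A'" by induction (auto intro: weyl.intros)
qed

lemma weyl_comp: "g \<in> weyl A \<Longrightarrow> h \<in> weyl A \<Longrightarrow> g \<circ> h \<in> weyl A"
  by (induction rule: weyl.induct) (auto intro: weyl.intros simp: comp_assoc)

lemma weyl_reflect: "r \<in> A \<Longrightarrow> reflect r \<in> weyl A"
  using weyl_step[OF weyl_id] by simp

lemma weyl_inverse:
  assumes "g \<in> weyl A" "\<And>r. r \<in> A \<Longrightarrow> B r r = - 2"
  shows "\<exists>h\<in>weyl A. g \<circ> h = id \<and> h \<circ> g = id"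
  using assms
proof (induction rule: weyl.induct)
  case weyl_id
  show ?case by (intro bexI[of _ id] weyl.weyl_id) simp
next
  case (weyl_step g r)
  then obtain h where h: "h \<in> weyl A" "g \<circ> h = id" "h \<circ> g = id" by blast
  have "reflect r \<circ> reflect r = id" using weyl_step by (auto simp: reflect_reflect)
  then have "(reflect r \<circ> g) \<circ> (h \<circ> reflect r) = id" "(h \<circ> reflect r) \<circ> (reflect r \<circ> g) = id"
    using h by (simp_all add: fun_eq_iff)
  moreover have "h \<circ> reflect r \<in> weyl A"
    using h weyl_step by (intro weyl_comp weyl_reflect)
  ultimately show ?case by blast
qed

lemma weyl_bij: "g \<in> weyl A \<Longrightarrow> (\<And>r. r \<in> A \<Longrightarrow> B r r = - 2) \<Longrightarrow> bij g"
  using weyl_inverse by (metis o_bij)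

lemma weyl_inj: "g \<in> weyl A \<Longrightarrow> (\<And>r. r \<in> A \<Longrightarrow> B r r = - 2) \<Longrightarrow> inj g"
  using weyl_bij bij_is_inj by blast

lemma weyl_fixes_orthogonal: "g \<in> weyl A \<Longrightarrow> (\<And>r. r \<in> A \<Longrightarrow> B x r = 0) \<Longrightarrow> g x = x"
proof (induction rule: weyl.induct)
  case (weyl_step g r)
  then show ?case by (simp add: reflect_def)
qed simp

lemma weyl_preserves:
  assumes "g \<in> weyl A" "Z.subspace M" "A \<subseteq> M" "\<And>x r. x \<in> M \<Longrightarrow> r \<in> A \<Longrightarrow> B x r \<in> \<int>" "x \<in> M"
  shows "g x \<in> M"
  using assms
proof (induction rule: weyl.induct)
  case (weyl_step g r)
  then have "g x \<in> M" by simp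
  moreover obtain k where "B (g x) r = of_int k"
    using weyl_step calculation by (meson Ints_cases)
  ultimately show ?case
    using weyl_step Z.subspace_add[OF weyl_step.prems(1)] Z.subspace_scale[OF weyl_step.prems(1)]
    by (auto simp: reflect_def)
qed simp

lemma weyl_image:
  assumes "g \<in> weyl A" "\<And>r. r \<in> A \<Longrightarrow> B r r = - 2" "Z.subspace M" "A \<subseteq> M"
    "\<And>x r. x \<in> M \<Longrightarrow> r \<in> A \<Longrightarrow> B x r \<in> \<int>"
  shows "g ` M = M"
proof
  show "g ` M \<subseteq> M" using weyl_preserves assms by blast
  obtain h where h: "h \<in> weyl A" "g \<circ> h = id" using weyl_inverse assms(1,2) by blast
  then have "x = g (h x)" "h x \<in> M" if "x \<in> M" for x
    using weyl_preserves[OF h(1) assms(3-5) that] by (auto simp: fun_eq_iff)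
  then show "M \<subseteq> g ` M" by blast
qed

section \<open>Simple systems of roots\<close>

definition neg_def :: "'v set \<Rightarrow> bool" where
  "neg_def S \<longleftrightarrow> (\<forall>x\<in>span S. x \<noteq> 0 \<longrightarrow> B x x < 0)"

definition simple_system :: "'v set \<Rightarrow> bool" where
  "simple_system \<Delta> \<longleftrightarrow> finite \<Delta> \<and> independent \<Delta> \<and> neg_def \<Delta> \<and> (\<forall>r\<in>\<Delta>. B r r = - 2)
     \<and> (\<forall>r\<in>\<Delta>. \<forall>s\<in>\<Delta>. r \<noteq> s \<longrightarrow> B r s \<in> {0, 1})"

lemma simple_systemD:
  assumes "simple_system \<Delta>"
  shows "finite \<Delta>" "independent \<Delta>" "neg_def \<Delta>" "r \<in> \<Delta> \<Longrightarrow> B r r = - 2"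
    "r \<in> \<Delta> \<Longrightarrow> s \<in> \<Delta> \<Longrightarrow> r \<noteq> s \<Longrightarrow> B r s \<in> {0, 1}"
  using assms by (auto simp: simple_system_def)

lemma neg_defD: "neg_def S \<Longrightarrow> x \<in> span S \<Longrightarrow> x \<noteq> 0 \<Longrightarrow> B x x < 0"
  by (simp add: neg_def_def)

lemma neg_def_nonpos: "neg_def S \<Longrightarrow> x \<in> span S \<Longrightarrow> B x x \<le> 0"
  using neg_defD[of S x] by (cases "x = 0") auto

lemma neg_def_zero: "neg_def S \<Longrightarrow> x \<in> span S \<Longrightarrow> (\<And>y. y \<in> S \<Longrightarrow> B x y = 0) \<Longrightarrow> x = 0"
  using B_zero_on_span[of S x x] neg_defD[of S x] by (cases "x = 0") auto

lemma neg_def_subset: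
  assumes "neg_def S" "T \<subseteq> span S" shows "neg_def T"
  unfolding neg_def_def
proof (intro ballI impI)
  fix x assume x: "x \<in> span T" "x \<noteq> 0"
  have "span T \<subseteq> span S" by (rule span_minimal[OF assms(2) subspace_span])
  then show "B x x < 0" using neg_defD[OF assms(1) subsetD x(2)] x(1) by simp
qed

lemma simple_system_subset:
  assumes "simple_system \<Delta>" "\<Delta>' \<subseteq> \<Delta>" shows "simple_system \<Delta>'"
proof -
  have "neg_def \<Delta>'"
    by (rule neg_def_subset[OF simple_systemD(3)[OF assms(1)] order_trans[OF assms(2) span_superset]])
  then show ?thesis
    using assms(2) finite_subset[OF assms(2) simple_systemD(1)[OF assms(1)]]
      independent_mono[OF simple_systemD(2)[OF assms(1)] assms(2)] simple_systemD(4,5)[OF assms(1)]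
    unfolding simple_system_def by (simp add: subset_iff)
qed

lemma integral_simple_pair:
  assumes "simple_system \<Delta>" "r \<in> \<Delta>" "s \<in> \<Delta>"
  shows "B r s \<in> \<int>"
  using simple_systemD(4,5)[OF assms(1)] assms(2,3) by (cases "r = s") force+

lemma zspan_integral:
  assumes "\<And>r s. r \<in> S \<Longrightarrow> s \<in> S \<Longrightarrow> B r s \<in> \<int>" "x \<in> zspan S" "y \<in> zspan S"
  shows "B x y \<in> \<int>"
proof -
  have 1: "B r y \<in> \<int>" if "r \<in> S" for r
    using assms(3) by (induction rule: Z.span_induct_alt) (auto simp: assms(1) that)
  show ?thesis
    using assms(2) by (induction rule: Z.span_induct_alt) (auto simp: 1)
qed

lemma zspan_even:
  assumes "\<And>r s. r \<in> S \<Longrightarrow> s \<in> S \<Longrightarrow> B r s \<in> \<int>" "\<And>r. r \<in> S \<Longrightarrow> B r r = - 2" "x \<in> zspan S"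
  shows "\<exists>k::int. B x x = 2 * of_int k"
proof -
  let ?P = "\<lambda>x. x \<in> zspan S \<and> (\<exists>k::int. B x x = 2 * of_int k)"
  have "?P x"
    using assms(3)
  proof (rule Z.span_induct_alt[where h = ?P])
    show "?P 0" by (rule conjI[OF Z.span_zero], rule exI[of _ 0], simp)
  next
    fix c r y
    assume r: "r \<in> S" and P: "?P y"
    obtain k where k: "y \<in> zspan S" "B y y = 2 * of_int k" using P by (elim conjE exE)
    have r': "r \<in> zspan S" using r by (rule Z.span_base)
    obtain l where l: "B r y = of_int l"
      using zspan_integral[OF _ r' k(1)] assms(1) by (blast elim: Ints_cases)
    have "B (zscale c r + y) (zscale c r + y) = 2 * of_int (k - c * c + c * l)"
      using k(2) l assms(2)[OF r] by (simp add: B_sym[of y r] algebra_simps)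
    then show "?P (zscale c r + y)"
      by (intro conjI exI) (rule Z.span_add[OF Z.span_scale[OF r'] k(1)])
  qed
  then show ?thesis by (rule conjunct2)
qed

end

lemma span_eq_if_card_eq:
  fixes S T :: "'v::real_vector set"
  assumes "finite T" "independent S" "S \<subseteq> span T" "card S = card T"
  shows "span S = span T"
proof (rule subset_antisym)
  show "span S \<subseteq> span T" by (rule span_minimal[OF assms(3) subspace_span])
  have "T \<subseteq> span S"
  proof (rule subsetI, rule ccontr)
    fix e assume e: "e \<in> T" "e \<notin> span S"
    have "independent (insert e S)" using e(2) assms(2) by (simp add: independent_insertI)
    moreover have "insert e S \<subseteq> span T" using e(1) assms(3) by (simp add: span_base)
    ultimately have "finite (insert e S) \<and> card (insert e S) \<le> card T"
      by (rule independent_span_bound[OF assms(1)])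
    moreover have "e \<notin> S" using e(2) span_base[of e S] by auto
    ultimately show False using assms(4) by (auto simp: card_insert_disjoint)
  qed
  then show "span T \<subseteq> span S" by (rule span_minimal[OF _ subspace_span])
qed

context symmetric_form
begin

lemma qspan_rational:
  assumes "\<And>r. r \<in> S \<Longrightarrow> B r y \<in> \<rat>" "x \<in> qspan S"
  shows "B x y \<in> \<rat>"
  using assms(2) by (induction rule: Q.span_induct_alt) (auto simp: assms(1))

text \<open>Gram--Schmidt, one vector at a time: as the form is definite on the span, the component of the
  new vector orthogonal to the previous ones pairs non-trivially with it.\<close>

lemma vector_with_given_products:
  assumes "finite S" "independent S" "neg_def S" "\<And>r s. r \<in> S \<Longrightarrow> s \<in> S \<Longrightarrow> B r s \<in> \<rat>"
    "\<And>r. r \<in> S \<Longrightarrow> a r \<in> \<rat>"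
  shows "\<exists>v\<in>qspan S. \<forall>r\<in>S. B v r = a r"
  using assms
proof (induction S arbitrary: a rule: finite_induct)
  case empty
  then show ?case using Q.span_zero by auto
next
  case (insert e S)
  have ind: "independent S" and e: "e \<notin> span S"
    using insert.prems(1) insert.hyps(2) by (simp_all add: independent_insert)
  have nd: "neg_def S"
    by (rule neg_def_subset[OF insert.prems(2) order_trans[OF _ span_superset]]) auto
  have IH: "\<exists>v\<in>qspan S. \<forall>r\<in>S. B v r = a' r" if "\<And>r. r \<in> S \<Longrightarrow> a' r \<in> \<rat>" for a'
    using insert.IH[OF ind nd _ that] insert.prems(3) by simp
  obtain v where v: "v \<in> qspan S" "\<And>r. r \<in> S \<Longrightarrow> B v r = a r"
    using IH[of a] insert.prems(4) by auto
  obtain u where u: "u \<in> qspan S" "\<And>r. r \<in> S \<Longrightarrow> B u r = B e r"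
    using IH[of "B e"] insert.prems(3) by auto
  define p where "p = e - u"
  have uS: "u \<in> span S" using u(1) qspan_subset_span by blast
  have p_orth: "B p r = 0" if "r \<in> S" for r using u(2)[OF that] by (simp add: p_def)
  have "p \<noteq> 0" using e uS by (auto simp: p_def)
  moreover have "u \<in> span (insert e S)" using uS span_mono[of S "insert e S"] by auto
  then have "p \<in> span (insert e S)" unfolding p_def by (intro span_diff[OF span_base]) simp_all
  ultimately have "B p p < 0" using neg_defD[OF insert.prems(2)] by simp
  moreover have "B p u = 0" using B_zero_on_span[OF p_orth uS] .
  then have "B p p = B p e" unfolding p_def[of] by (simp add: p_def)
  ultimately have pe: "B p e \<noteq> 0" by simp
  define t where "t = (a e - B v e) / B p e"
  have qS: "qspan S \<subseteq> qspan (insert e S)" by (rule Q.span_mono) auto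
  have pq: "p \<in> qspan (insert e S)"
    unfolding p_def using u(1) qS by (intro Q.span_diff) (auto intro: Q.span_base)
  have "B v e \<in> \<rat>" using insert.prems(3) by (intro qspan_rational[OF _ v(1)]) simp
  moreover have "B p e \<in> \<rat>" using insert.prems(3) by (intro qspan_rational[OF _ pq]) auto
  ultimately have "t \<in> \<rat>" using insert.prems(4)[of e] by (simp add: t_def)
  then have "v + t *\<^sub>R p \<in> qspan (insert e S)"
    using v(1) qS pq by (intro Q.span_add qspan_scaleI) auto
  moreover have "B (v + t *\<^sub>R p) r = a r" if "r \<in> insert e S" for r
    using that v(2) p_orth pe by (auto simp: t_def)
  ultimately show ?case by blast
qed

lemma simple_vector_with_given_products:
  assumes "simple_system \<Delta>" "\<And>r. r \<in> \<Delta> \<Longrightarrow> a r \<in> \<rat>"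
  obtains v where "v \<in> qspan \<Delta>" "\<And>r. r \<in> \<Delta> \<Longrightarrow> B v r = a r"
proof -
  have "B r s \<in> \<rat>" if "r \<in> \<Delta>" "s \<in> \<Delta>" for r s
    using integral_simple_pair[OF assms(1) that] Ints_subset_Rats by auto
  then have "\<exists>v\<in>qspan \<Delta>. \<forall>r\<in>\<Delta>. B v r = a r"
    by (rule vector_with_given_products[OF simple_systemD(1-3)[OF assms(1)] _ assms(2)])
  then show thesis using that by blast
qed

text \<open>Terms on the diagonal vanish, and the others are products of non-negative numbers.\<close>

lemma disjoint_supports_product_nonneg:
  fixes a b :: "'v \<Rightarrow> real"
  assumes "\<And>r s. r \<in> S \<Longrightarrow> s \<in> S \<Longrightarrow> r \<noteq> s \<Longrightarrow> 0 \<le> B r s"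
    "\<And>r. r \<in> S \<Longrightarrow> 0 \<le> a r" "\<And>r. r \<in> S \<Longrightarrow> 0 \<le> b r" "\<And>r. r \<in> S \<Longrightarrow> a r = 0 \<or> b r = 0"
  shows "0 \<le> B (\<Sum>r\<in>S. a r *\<^sub>R r) (\<Sum>r\<in>S. b r *\<^sub>R r)"
proof -
  have "0 \<le> b s * (a r * B r s)" if "r \<in> S" "s \<in> S" for r s
  proof (cases "r = s")
    case True
    then show ?thesis using assms(4)[OF that(1)] by auto
  next
    case False
    then show ?thesis using assms(1-3) that by (intro mult_nonneg_nonneg) auto
  qed
  then have "0 \<le> (\<Sum>s\<in>S. \<Sum>r\<in>S. b s * (a r * B r s))" by (intro sum_nonneg)
  then show ?thesis by (simp add: B_sum_left B_sum_right sum_distrib_left)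
qed

lemma simple_norm_le:
  assumes "simple_system \<Delta>" "x \<in> zspan \<Delta>" "x \<noteq> 0"
  shows "B x x \<le> - 2"
proof -
  obtain k where k: "B x x = 2 * of_int k"
    using zspan_even[OF integral_simple_pair[OF assms(1)] simple_systemD(4)[OF assms(1)] assms(2)]
    by blast
  have "x \<in> span \<Delta>" using assms(2) zspan_subset_span by auto
  then have "B x x < 0" using neg_defD[OF simple_systemD(3)[OF assms(1)] _ assms(3)] by simp
  then show ?thesis using k by simp
qed

lemma simple_zspan_integral:
  "simple_system \<Delta> \<Longrightarrow> x \<in> zspan \<Delta> \<Longrightarrow> y \<in> zspan \<Delta> \<Longrightarrow> B x y \<in> \<int>"
  using zspan_integral[OF integral_simple_pair] by simp

text \<open>Split a root as \<open>b - d\<close> into its positive and negative parts. If both are non-zero, both have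
  norm at most \<open>-2\<close>, and as \<open>b\<close> and \<open>d\<close> have non-negative product, \<open>b - d\<close> has norm at
  most \<open>-4\<close>.\<close>

lemma simple_root_signs:
  assumes "simple_system \<Delta>" "B r r = - 2" "r = (\<Sum>e\<in>\<Delta>. of_int (c e) *\<^sub>R e)"
  shows "(\<forall>e\<in>\<Delta>. 0 \<le> c e) \<or> (\<forall>e\<in>\<Delta>. c e \<le> 0)"
proof (rule ccontr)
  assume "\<not> ?thesis"
  then obtain e f where ef: "e \<in> \<Delta>" "c e < 0" "f \<in> \<Delta>" "0 < c f" by force
  define b where "b = (\<Sum>e\<in>\<Delta>. of_int (max (c e) 0) *\<^sub>R e)"
  define d where "d = (\<Sum>e\<in>\<Delta>. of_int (max (- c e) 0) *\<^sub>R e)"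
  have "r = b - d"
    unfolding assms(3) b_def d_def sum_subtractf[symmetric] scaleR_diff_left[symmetric]
    by (intro sum.cong refl) (simp add: max_def)
  have coeff: "of_int (k e) = (0::real)" if "(\<Sum>e\<in>\<Delta>. of_int (k e) *\<^sub>R e) = 0" "e \<in> \<Delta>" for k e
    using independentD[OF simple_systemD(2,1)[OF assms(1)] subset_refl, of "\<lambda>e. of_int (k e)" e] that
    by simp
  have "b \<noteq> 0" using coeff[of "\<lambda>e. max (c e) 0" f] ef unfolding b_def by auto
  moreover have "d \<noteq> 0" using coeff[of "\<lambda>e. max (- c e) 0" e] ef unfolding d_def by auto
  ultimately have "B b b \<le> - 2" "B d d \<le> - 2"
    unfolding b_def d_def by (intro simple_norm_le[OF assms(1) zspan_sumI]; simp)+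
  moreover have "0 \<le> B b d"
    unfolding b_def d_def using simple_systemD(5)[OF assms(1)]
    by (intro disjoint_supports_product_nonneg) force+
  moreover have "B r r = B b b + B d d - 2 * B b d"
    by (simp add: \<open>r = b - d\<close> B_sym[of d b])
  ultimately show False using assms(2) by simp
qed

lemma simple_weyl_isometry: "simple_system \<Delta> \<Longrightarrow> g \<in> weyl \<Delta> \<Longrightarrow> B (g x) (g y) = B x y"
  using weyl_isometry simple_systemD(4) by blast

lemma simple_weyl_zspan:
  assumes "simple_system \<Delta>" "g \<in> weyl \<Delta>" shows "g ` zspan \<Delta> = zspan \<Delta>"
proof (rule weyl_image[OF assms(2) simple_systemD(4)[OF assms(1)] Z.subspace_span Z.span_superset])
  show "B x r \<in> \<int>" if "x \<in> zspan \<Delta>" "r \<in> \<Delta>" for x r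
    using simple_zspan_integral[OF assms(1) that(1) Z.span_base[OF that(2)]] .
qed

lemma simple_weyl_zspan_mem:
  "simple_system \<Delta> \<Longrightarrow> g \<in> weyl \<Delta> \<Longrightarrow> x \<in> zspan \<Delta> \<Longrightarrow> g x \<in> zspan \<Delta>"
  using simple_weyl_zspan by blast

lemma weyl_scale: "g \<in> weyl A \<Longrightarrow> g (c *\<^sub>R x) = c *\<^sub>R g x"
  using weyl_linear linear_scale by blast

text \<open>Where \<open>B c\<close> is minimal on the orbit of \<open>v\<close>, a further reflection in \<open>e\<close>, which adds
  \<open>B v e\<close> to this value, cannot decrease it.\<close>

lemma dominant_in_orbit:
  assumes "\<And>e. e \<in> A \<Longrightarrow> B e e = - 2" "\<And>e. e \<in> A \<Longrightarrow> B c e = 1"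
    "0 < N" "\<And>g. g \<in> weyl A \<Longrightarrow> of_nat N * B (g v) c \<in> \<int>"
    "\<And>g. g \<in> weyl A \<Longrightarrow> b \<le> B (g v) c"
  shows "\<exists>g\<in>weyl A. \<forall>e\<in>A. 0 \<le> B (g v) e"
proof -
  let ?S = "(\<lambda>g. B (g v) c) ` weyl A"
  have "\<exists>m\<in>?S. \<forall>s\<in>?S. m \<le> s"
    by (rule discrete_has_minimum[of _ N b]) (use assms(3-5) weyl_id in auto)
  then obtain g where g: "g \<in> weyl A" "\<And>h. h \<in> weyl A \<Longrightarrow> B (g v) c \<le> B (h v) c" by auto
  have "0 \<le> B (g v) e" if "e \<in> A" for e
    using g(2)[OF weyl_step[OF g(1) that]] assms(2)[OF that]
    by (simp add: reflect_def B_sym[of e c])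
  then show ?thesis using g(1) by blast
qed

text \<open>The form is definite on the span and the norm is constant on the orbit, so the products of the
  orbit with a fixed vector are bounded.\<close>

lemma simple_dominant_in_orbit:
  assumes "simple_system \<Delta>" "v \<in> qspan \<Delta>"
  shows "\<exists>g\<in>weyl \<Delta>. \<forall>e\<in>\<Delta>. 0 \<le> B (g v) e"
proof -
  note S = simple_systemD[OF assms(1)]
  obtain c where c: "c \<in> qspan \<Delta>" "\<And>e. e \<in> \<Delta> \<Longrightarrow> B c e = 1"
    using simple_vector_with_given_products[OF assms(1), of "\<lambda>_. 1"] by auto
  obtain M where M: "0 < M" "of_nat M *\<^sub>R v \<in> zspan \<Delta>"
    using qspan_clear_denominator[OF assms(2)] by blast
  obtain N where N: "0 < N" "of_nat N *\<^sub>R c \<in> zspan \<Delta>"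
    using qspan_clear_denominator[OF c(1)] by blast
  show ?thesis
  proof (rule dominant_in_orbit[OF S(4) c(2), where N = "M * N" and b = "(B v v + B c c) / 2"])
    fix g assume g: "g \<in> weyl \<Delta>"
    have gM: "of_nat M *\<^sub>R g v \<in> zspan \<Delta>"
      using simple_weyl_zspan_mem[OF assms(1) g M(2)] by (simp add: weyl_scale[OF g])
    have "of_nat (M * N) * B (g v) c = B (of_nat M *\<^sub>R g v) (of_nat N *\<^sub>R c)" by simp
    then show "of_nat (M * N) * B (g v) c \<in> \<int>"
      using simple_zspan_integral[OF assms(1) gM N(2)] by (simp only:)
    have "g v \<in> span \<Delta>"
      using span_scale[OF subsetD[OF zspan_subset_span gM], of "1 / of_nat M"] M(1) by simp
    moreover have "c \<in> span \<Delta>" using c(1) qspan_subset_span by auto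
    ultimately have "B (g v - c) (g v - c) \<le> 0"
      by (intro neg_def_nonpos[OF S(3)] span_diff)
    moreover have "B (g v) (g v) = B v v" by (rule simple_weyl_isometry[OF assms(1) g])
    ultimately show "(B v v + B c c) / 2 \<le> B (g v) c" by (simp add: B_sym[of c "g v"])
  qed (use M N in auto)
qed

lemma simple_system_image:
  assumes "simple_system \<Delta>" "linear g" "\<And>x y. B (g x) (g y) = B x y"
  shows "simple_system (g ` \<Delta>)" "inj_on g (span \<Delta>)"
proof -
  note S = simple_systemD[OF assms(1)]
  have z: "x = 0" if "x \<in> span \<Delta>" "g x = 0" for x
    using neg_defD[OF S(3) that(1)] assms(3)[of x x] that(2) by (cases "x = 0") simp_all
  show inj: "inj_on g (span \<Delta>)"
  proof (rule inj_onI)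
    fix x y assume "x \<in> span \<Delta>" "y \<in> span \<Delta>" "g x = g y"
    then show "x = y" using z[of "x - y"] by (simp add: span_diff linear_diff[OF assms(2)])
  qed
  have injS: "inj_on g \<Delta>" by (rule inj_on_subset[OF inj span_superset])
  have "independent (g ` \<Delta>)"
    by (rule linear_independent_injective_image[OF assms(2) S(2) inj])
  moreover have "neg_def (g ` \<Delta>)"
    unfolding neg_def_def linear_span_image[OF assms(2)]
  proof (intro ballI impI)
    fix y assume y: "y \<in> g ` span \<Delta>" "y \<noteq> 0"
    then obtain x where x: "x \<in> span \<Delta>" "y = g x" by blast
    then have "x \<noteq> 0" using y(2) linear_0[OF assms(2)] by auto
    then show "B y y < 0" using neg_defD[OF S(3) x(1)] by (simp add: x(2) assms(3))
  qed
  ultimately show "simple_system (g ` \<Delta>)"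
    using S(1,4) S(5) unfolding simple_system_def by (auto simp: assms(3))
qed

text \<open>A vector \<open>v\<close> having product \<open>1\<close> with the simple roots of the second system is moved into the
  chamber of the first one. Roots in the two systems are then positive in the same sense, and the
  simple roots are the indecomposable positive ones.\<close>

lemma simple_systems_conjugate:
  assumes "simple_system \<Delta>" "simple_system \<Gamma>" "zspan \<Gamma> = zspan \<Delta>"
  shows "\<exists>g\<in>weyl \<Delta>. g ` \<Gamma> = \<Delta>"
proof -
  note D = simple_systemD[OF assms(1)]
  have q: "qspan \<Gamma> = qspan \<Delta>" using assms(3) qspan_zspan[of \<Gamma>] qspan_zspan[of \<Delta>] by simp
  obtain v where v: "v \<in> qspan \<Delta>" "\<And>e. e \<in> \<Gamma> \<Longrightarrow> B v e = 1"
    using simple_vector_with_given_products[OF assms(2), of "\<lambda>_. 1"] q by auto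
  obtain g where g: "g \<in> weyl \<Delta>" "\<And>e. e \<in> \<Delta> \<Longrightarrow> 0 \<le> B (g v) e"
    using simple_dominant_in_orbit[OF assms(1) v(1)] by blast
  have iso: "B (g x) (g y) = B x y" for x y by (rule simple_weyl_isometry[OF assms(1) g(1)])
  define \<Gamma>' where "\<Gamma>' = g ` \<Gamma>"
  have G: "simple_system \<Gamma>'"
    unfolding \<Gamma>'_def by (rule simple_system_image[OF assms(2) weyl_linear[OF g(1)] iso])
  note G' = simple_systemD[OF G]
  have zs: "zspan \<Gamma>' = zspan \<Delta>"
    using simple_weyl_zspan[OF assms(1) g(1)] assms(3)
    by (simp add: \<Gamma>'_def linear_zspan_image[OF weyl_linear[OF g(1)], symmetric])
  have v1: "B (g v) e = 1" if "e \<in> \<Gamma>'" for e using that v(2) iso by (auto simp: \<Gamma>'_def)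
  have D_pos: "\<exists>n::int. 0 < n \<and> B (g v) e = of_int n" if e: "e \<in> \<Delta>" for e
  proof -
    obtain c where c: "e = (\<Sum>f\<in>\<Gamma>'. of_int (c f) *\<^sub>R f)"
      using zspan_finiteE[OF G'(1)] Z.span_base[OF e] zs by metis
    have sum: "B (g v) e = of_int (\<Sum>f\<in>\<Gamma>'. c f)"
      unfolding c by (simp add: B_sum_right v1)
    have "e \<noteq> 0" using D(4)[OF e] by auto
    then have nz: "\<exists>f\<in>\<Gamma>'. c f \<noteq> 0" unfolding c by (metis (no_types, lifting) of_int_0 scaleR_zero_left sum.neutral)
    consider "\<forall>f\<in>\<Gamma>'. 0 \<le> c f" | "\<forall>f\<in>\<Gamma>'. c f \<le> 0"
      using simple_root_signs[OF G D(4)[OF e] c] by blast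
    then show ?thesis
    proof cases
      case 1
      then have "0 < (\<Sum>f\<in>\<Gamma>'. c f)"
        using nz by (metis G'(1) order_le_less sum_pos2)
      then show ?thesis using sum by blast
    next
      case 2
      then have "(\<Sum>f\<in>\<Gamma>'. - c f) > 0"
        using nz by (metis (no_types, lifting) G'(1) neg_0_le_iff_le neg_0_less_iff_less order_le_less sum_pos2)
      then have "B (g v) e < 0" unfolding sum of_int_less_0_iff by (simp add: sum_negf)
      then show ?thesis using g(2)[OF e] by simp
    qed
  qed
  have "\<Gamma>' \<subseteq> \<Delta>"
  proof
    fix f assume f: "f \<in> \<Gamma>'"
    obtain c where c: "f = (\<Sum>e\<in>\<Delta>. of_int (c e) *\<^sub>R e)"
      using zspan_finiteE[OF D(1)] Z.span_base[OF f] zs by metis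
    have sum: "(\<Sum>e\<in>\<Delta>. of_int (c e) * B (g v) e) = 1"
      using v1[OF f] unfolding c by (simp add: B_sum_right)
    have pos: "0 \<le> c e" if "e \<in> \<Delta>" for e
    proof -
      have "\<not> (\<forall>e\<in>\<Delta>. c e \<le> 0)"
      proof
        assume "\<forall>e\<in>\<Delta>. c e \<le> 0"
        then have "(\<Sum>e\<in>\<Delta>. of_int (c e) * B (g v) e) \<le> 0"
          by (intro sum_nonpos) (auto intro!: mult_nonpos_nonneg g(2))
        then show False using sum by simp
      qed
      then show ?thesis using simple_root_signs[OF assms(1) G'(4)[OF f] c] that by blast
    qed
    \<comment> \<open>A sum of positive integers that equals \<open>1\<close> has one term, and its coefficient is \<open>1\<close>.\<close>
    obtain e where e: "e \<in> \<Delta>" "c e \<noteq> 0"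
      using sum by (metis (no_types, lifting) mult_zero_left of_int_0 sum.neutral zero_neq_one)
    have ge: "of_int (c x) \<le> of_int (c x) * B (g v) x" if x: "x \<in> \<Delta>" for x
    proof -
      obtain n :: int where "0 < n" "B (g v) x = of_int n" using D_pos[OF x] by blast
      then have "1 \<le> B (g v) x" by simp
      then show ?thesis using pos[OF x] mult_left_mono[of 1 "B (g v) x" "of_int (c x)"] by simp
    qed
    have "(\<Sum>x\<in>\<Delta>. of_int (c x)) \<le> (1::real)"
      unfolding sum[symmetric] by (intro sum_mono ge)
    then have "(\<Sum>x\<in>\<Delta>. c x) \<le> 1" by (metis of_int_le_1_iff of_int_sum)
    moreover have "(\<Sum>x\<in>\<Delta>. c x) = c e + (\<Sum>x\<in>\<Delta> - {e}. c x)"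
      by (rule sum.remove[OF D(1) e(1)])
    moreover have "0 \<le> (\<Sum>x\<in>\<Delta> - {e}. c x)" by (intro sum_nonneg pos) auto
    ultimately have ce: "c e = 1" "(\<Sum>x\<in>\<Delta> - {e}. c x) = 0"
      using e(2) pos[OF e(1)] by linarith+
    have "c x = 0" if "x \<in> \<Delta> - {e}" for x
      using ce(2) sum_nonneg_eq_0_iff[of "\<Delta> - {e}" c] pos D(1) that by auto
    then have "f = e" unfolding c sum.remove[OF D(1) e(1)] using ce(1) by simp
    then show "f \<in> \<Delta>" using e(1) by simp
  qed
  moreover have "card \<Gamma>' = card \<Delta>"
  proof -
    have "span \<Gamma>' = span \<Delta>" using zs span_zspan[of \<Gamma>'] span_zspan[of \<Delta>] by simp
    then have "dim \<Gamma>' = dim \<Delta>" using dim_span[of \<Gamma>'] dim_span[of \<Delta>] by simp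
    then show ?thesis using dim_eq_card_independent[OF D(2)] dim_eq_card_independent[OF G'(2)] by simp
  qed
  ultimately have "\<Gamma>' = \<Delta>" by (rule card_subset_eq[OF D(1)])
  then show ?thesis using g(1) unfolding \<Gamma>'_def by blast
qed

end

lemma qspan_trans: "x \<in> qspan A \<Longrightarrow> A \<subseteq> qspan S \<Longrightarrow> x \<in> qspan S"
  using Q.span_minimal[OF _ Q.subspace_span, of A S] by (rule subsetD)

lemma zspan_trans: "x \<in> zspan A \<Longrightarrow> A \<subseteq> zspan S \<Longrightarrow> x \<in> zspan S"
  using Z.span_minimal[OF _ Z.subspace_span, of A S] by (rule subsetD)

context symmetric_form
begin

lemma sum_restrict_zspan:
  assumes "finite S" "T \<subseteq> S" "\<And>e. e \<in> S - T \<Longrightarrow> c e = (0::int)"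
  shows "(\<Sum>e\<in>S. of_int (c e) *\<^sub>R e) \<in> zspan T"
proof -
  have "(\<Sum>e\<in>S. of_int (c e) *\<^sub>R e) = (\<Sum>e\<in>T. of_int (c e) *\<^sub>R e)"
    by (rule sum.mono_neutral_right[OF assms(1,2)]) (simp add: assms(3))
  then show ?thesis by (simp only: zspan_sumI)
qed

text \<open>All terms of \<open>B v r = \<Sum>e. c e * B v e\<close> have the same sign, so they vanish with the sum.\<close>

lemma root_orthogonal_to_dominant:
  assumes "finite A" "r = (\<Sum>e\<in>A. of_int (c e) *\<^sub>R e)" "(\<forall>e\<in>A. 0 \<le> c e) \<or> (\<forall>e\<in>A. c e \<le> 0)"
    "\<And>e. e \<in> A \<Longrightarrow> 0 \<le> B v e" "B v r = 0"
  shows "r \<in> zspan {e \<in> A. B v e = 0}"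
proof -
  have sum: "(\<Sum>e\<in>A. of_int (c e) * B v e) = 0"
    using assms(5) by (simp add: assms(2) B_sum_right)
  have "\<forall>e\<in>A. of_int (c e) * B v e = 0"
  proof (cases "\<forall>e\<in>A. 0 \<le> c e")
    case True
    then show ?thesis using sum assms(4) by (subst (asm) sum_nonneg_eq_0_iff[OF assms(1)]) auto
  next
    case False
    then have "\<forall>e\<in>A. c e \<le> 0" using assms(3) by blast
    moreover have "(\<Sum>e\<in>A. - (of_int (c e) * B v e)) = 0" using sum by (simp add: sum_negf)
    ultimately show ?thesis using assms(4)
      by (subst (asm) sum_nonneg_eq_0_iff[OF assms(1)]) (auto simp: mult_le_0_iff)
  qed
  then show ?thesis unfolding assms(2) by (intro sum_restrict_zspan[OF assms(1)]) auto
qed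

text \<open>Roots orthogonal to a dominant vector are combinations of the simple roots orthogonal to it.
  As long as \<open>\<Phi>\<close> has smaller rank than \<open>\<Delta>\<close>, a vector orthogonal to \<open>\<Phi>\<close>, made dominant, moves
  \<open>\<Phi>\<close> into a proper subsystem.\<close>

lemma roots_into_parabolic:
  assumes "simple_system \<Delta>" "finite \<Phi>" "\<Phi> \<subseteq> zspan \<Delta>" "independent \<Phi>"
    "\<And>r. r \<in> \<Phi> \<Longrightarrow> B r r = - 2"
  shows "\<exists>g\<in>weyl \<Delta>. \<exists>\<Delta>'\<subseteq>\<Delta>. g ` \<Phi> \<subseteq> zspan \<Delta>' \<and> card \<Delta>' = card \<Phi>"
  using assms
proof (induction "card \<Delta>" arbitrary: \<Delta> \<Phi> rule: less_induct)
  case less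
  note D = simple_systemD[OF less.prems(1)]
  have sp: "\<Phi> \<subseteq> span \<Delta>" using less.prems(3) zspan_subset_span by (rule order_trans)
  show ?case
  proof (cases "card \<Phi> = card \<Delta>")
    case True
    then show ?thesis using less.prems(3) by (intro bexI[OF _ weyl_id] exI[of _ \<Delta>]) simp
  next
    case False
    have "card \<Phi> \<le> card \<Delta>"
      using independent_span_bound[OF D(1) less.prems(4) sp] by simp
    then have lt: "card \<Phi> < card \<Delta>" using False by simp
    have "\<not> \<Delta> \<subseteq> span \<Phi>"
    proof
      assume "\<Delta> \<subseteq> span \<Phi>"
      then show False using independent_span_bound[OF less.prems(2) D(2)] lt by simp
    qed
    then obtain e where e: "e \<in> \<Delta>" "e \<notin> span \<Phi>" by (auto simp: subset_iff)
    have nd: "neg_def \<Phi>" by (rule neg_def_subset[OF D(3) sp])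
    have rat: "B x y \<in> \<rat>" if "x \<in> zspan \<Delta>" "y \<in> zspan \<Delta>" for x y
      using simple_zspan_integral[OF less.prems(1) that] Ints_subset_Rats by (rule rev_subsetD)
    have ez: "e \<in> zspan \<Delta>" using e(1) by (rule Z.span_base)
    have "\<exists>u\<in>qspan \<Phi>. \<forall>r\<in>\<Phi>. B u r = B e r"
      by (rule vector_with_given_products[OF less.prems(2,4) nd])
        (use rat ez subsetD[OF less.prems(3)] in simp_all)
    then obtain u where u: "u \<in> qspan \<Phi>" "\<And>r. r \<in> \<Phi> \<Longrightarrow> B u r = B e r"
      by (elim bexE) simp
    define y where "y = e - u"
    have yq: "y \<in> qspan \<Delta>" unfolding y_def
    proof (rule Q.span_diff)
      show "e \<in> qspan \<Delta>" using e(1) by (rule Q.span_base)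
      have "\<Phi> \<subseteq> qspan \<Delta>" using less.prems(3) zspan_subset_qspan by (rule order_trans)
      then show "u \<in> qspan \<Delta>" by (rule qspan_trans[OF u(1)])
    qed
    have "y \<noteq> 0" using e(2) u(1) qspan_subset_span[of \<Phi>] by (auto simp: y_def)
    obtain g where g: "g \<in> weyl \<Delta>" "\<And>e. e \<in> \<Delta> \<Longrightarrow> 0 \<le> B (g y) e"
      using simple_dominant_in_orbit[OF less.prems(1) yq] by auto
    note iso = simple_weyl_isometry[OF less.prems(1) g(1)]
    have lin: "linear g" by (rule weyl_linear[OF g(1)])
    have injg: "inj g" using weyl_inj[OF g(1)] D(4) by simp
    define \<Delta>1 where "\<Delta>1 = {e \<in> \<Delta>. B (g y) e = 0}"
    have "\<Delta>1 \<noteq> \<Delta>"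
    proof
      assume eq: "\<Delta>1 = \<Delta>"
      have "y \<in> span \<Delta>" using yq qspan_subset_span by (rule rev_subsetD)
      then have "g y \<in> g ` span \<Delta>" by (rule imageI)
      also have "g ` span \<Delta> = span (g ` zspan \<Delta>)"
        using linear_span_image[OF lin, of "zspan \<Delta>"] by (simp add: span_zspan)
      also have "\<dots> = span \<Delta>"
        using simple_weyl_zspan[OF less.prems(1) g(1)] by (simp add: span_zspan)
      finally have "g y = 0"
        by (rule neg_def_zero[OF D(3)]) (use eq in \<open>auto simp: \<Delta>1_def\<close>)
      then show False
        using injg \<open>y \<noteq> 0\<close> linear_0[OF lin] by (metis injD)
    qed
    then have sub: "\<Delta>1 \<subset> \<Delta>" by (auto simp: \<Delta>1_def)
    have into: "g ` \<Phi> \<subseteq> zspan \<Delta>1"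
    proof (rule image_subsetI)
      fix r assume r: "r \<in> \<Phi>"
      have "r \<in> zspan \<Delta>" using r less.prems(3) by (rule rev_subsetD)
      then have "g r \<in> zspan \<Delta>" by (rule simple_weyl_zspan_mem[OF less.prems(1) g(1)])
      then obtain c where c: "g r = (\<Sum>e\<in>\<Delta>. of_int (c e) *\<^sub>R e)"
        by (rule zspan_finiteE[OF D(1)])
      have "B (g r) (g r) = - 2" using less.prems(5)[OF r] by (simp add: iso)
      then have signs: "(\<forall>e\<in>\<Delta>. 0 \<le> c e) \<or> (\<forall>e\<in>\<Delta>. c e \<le> 0)"
        by (rule simple_root_signs[OF less.prems(1) _ c])
      have "B (g y) (g r) = 0" using u(2)[OF r] by (simp add: iso y_def)
      then show "g r \<in> zspan \<Delta>1"
        unfolding \<Delta>1_def using g(2) by (intro root_orthogonal_to_dominant[OF D(1) c signs])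
    qed
    have "\<exists>h\<in>weyl \<Delta>1. \<exists>\<Delta>'\<subseteq>\<Delta>1. h ` (g ` \<Phi>) \<subseteq> zspan \<Delta>' \<and> card \<Delta>' = card (g ` \<Phi>)"
    proof (rule less.hyps)
      show "card \<Delta>1 < card \<Delta>" by (rule psubset_card_mono[OF D(1) sub])
      show "simple_system \<Delta>1" by (rule simple_system_subset[OF less.prems(1)]) (use sub in auto)
      show "finite (g ` \<Phi>)" using less.prems(2) by simp
      show "g ` \<Phi> \<subseteq> zspan \<Delta>1" by (rule into)
      show "independent (g ` \<Phi>)"
        by (rule linear_independent_injective_image[OF lin less.prems(4) inj_on_subset[OF injg subset_UNIV]])
      show "B r r = - 2" if "r \<in> g ` \<Phi>" for r using that less.prems(5) iso by auto
    qed
    then obtain h \<Delta>' where h: "h \<in> weyl \<Delta>1" "\<Delta>' \<subseteq> \<Delta>1" "h ` (g ` \<Phi>) \<subseteq> zspan \<Delta>'"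
      "card \<Delta>' = card (g ` \<Phi>)" by (elim bexE exE conjE)
    have "h \<in> weyl \<Delta>" using h(1) weyl_mono[of \<Delta>1 \<Delta>] sub by auto
    then have "h \<circ> g \<in> weyl \<Delta>" by (rule weyl_comp[OF _ g(1)])
    moreover have "(h \<circ> g) ` \<Phi> \<subseteq> zspan \<Delta>'" using h(3) by (simp add: image_comp)
    moreover have "card \<Delta>' = card \<Phi>"
      using h(4) card_image[OF inj_on_subset[OF injg subset_UNIV]] by simp
    moreover have "\<Delta>' \<subseteq> \<Delta>" using h(2) sub by auto
    ultimately show ?thesis by (intro bexI[of _ "h \<circ> g"] exI[of _ \<Delta>'] conjI)
  qed
qed

section \<open>Sublattices of finite index\<close>

text \<open>Let \<open>d\<close> be the part of \<open>\<theta> - r\<close> with negative coefficients. Dominance of \<open>\<theta>\<close> forces the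
  product of \<open>r\<close> and \<open>d\<close> to be so large that \<open>r - d\<close> has non-negative norm, hence \<open>r = d\<close>. As the
  coefficients of \<open>\<theta>\<close> are positive, this is possible for \<open>d = 0\<close> only.\<close>

lemma highest_root_bound:
  assumes "simple_system K" "\<And>e. e \<in> K \<Longrightarrow> 0 < m e" "\<theta> = (\<Sum>e\<in>K. of_int (m e) *\<^sub>R e)"
    "\<And>e. e \<in> K \<Longrightarrow> B \<theta> e \<le> 0" "r = (\<Sum>e\<in>K. of_int (c e) *\<^sub>R e)" "B r r = - 2" "e \<in> K"
  shows "c e \<le> m e"
proof (rule ccontr)
  assume "\<not> c e \<le> m e"
  note K = simple_systemD[OF assms(1)]
  define b where "b = (\<Sum>e\<in>K. of_int (max (m e - c e) 0) *\<^sub>R e)"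
  define d where "d = (\<Sum>e\<in>K. of_int (max (c e - m e) 0) *\<^sub>R e)"
  have coeff: "of_int (k e) = (0::real)" if "(\<Sum>e\<in>K. of_int (k e) *\<^sub>R e) = 0" for k
    using independentD[OF K(2,1) subset_refl, of "\<lambda>e. of_int (k e)" e] that assms(7) by simp
  have "d \<noteq> 0" using coeff[of "\<lambda>e. max (c e - m e) 0"] \<open>\<not> c e \<le> m e\<close> unfolding d_def by auto
  have dz: "d \<in> zspan K" unfolding d_def by (rule zspan_sumI)
  have rz: "r \<in> zspan K" unfolding assms(5) by (rule zspan_sumI)
  have "B d d \<le> - 2" by (rule simple_norm_le[OF assms(1) dz \<open>d \<noteq> 0\<close>])
  have eq: "\<theta> - r = b - d"
    unfolding assms(3,5) b_def d_def sum_subtractf[symmetric] scaleR_diff_left[symmetric]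
    by (intro sum.cong refl) (simp add: max_def)
  have "0 \<le> B b d"
    unfolding b_def d_def using K(5)
    by (intro disjoint_supports_product_nonneg) force+
  moreover have "B \<theta> d \<le> 0"
    unfolding d_def B_sum_right using assms(4) by (intro sum_nonpos) (auto simp: mult_le_0_iff)
  moreover have "B r d = B \<theta> d - B b d + B d d"
  proof -
    have "r = \<theta> - b + d" using eq by (simp add: algebra_simps)
    then show ?thesis by simp
  qed
  ultimately have "0 \<le> B (r - d) (r - d)"
    using assms(6) \<open>B d d \<le> - 2\<close> by (simp add: B_sym[of d r])
  moreover have "r - d \<in> span K" by (rule subsetD[OF zspan_subset_span Z.span_diff[OF rz dz]])
  ultimately have "r - d = 0" using neg_defD[OF K(3)] by fastforce
  then have "(\<Sum>e\<in>K. of_int (c e - max (c e - m e) 0) *\<^sub>R e) = 0"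
    unfolding assms(5) d_def sum_subtractf[symmetric] scaleR_diff_left[symmetric] by simp
  then have "c e = max (c e - m e) 0" using coeff by fastforce
  then show False using \<open>\<not> c e \<le> m e\<close> assms(2)[OF assms(7)] by simp
qed

text \<open>A root is not the sum of two orthogonal non-zero vectors, as both have norm at most \<open>-2\<close>.\<close>

lemma root_in_component:
  assumes "simple_system \<Delta>" "\<Union>\<K> = \<Delta>"
    "\<And>K L x y. K \<in> \<K> \<Longrightarrow> L \<in> \<K> \<Longrightarrow> K \<noteq> L \<Longrightarrow> x \<in> K \<Longrightarrow> y \<in> L \<Longrightarrow> B x y = 0"
    "r = (\<Sum>e\<in>\<Delta>. of_int (c e) *\<^sub>R e)" "B r r = - 2"
  shows "\<exists>K\<in>\<K>. \<forall>e\<in>\<Delta> - K. c e = 0"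
proof -
  note D = simple_systemD[OF assms(1)]
  have "\<exists>e\<in>\<Delta>. c e \<noteq> 0"
  proof (rule ccontr)
    assume "\<not> ?thesis"
    then have "r = 0" by (simp add: assms(4))
    then show False using assms(5) by simp
  qed
  then obtain e K where e: "e \<in> \<Delta>" "c e \<noteq> 0" and K: "K \<in> \<K>" "e \<in> K" using assms(2) by blast
  have KD: "K \<subseteq> \<Delta>" using K(1) assms(2) by blast
  let ?a = "\<Sum>e\<in>K. of_int (c e) *\<^sub>R e" and ?b = "\<Sum>e\<in>\<Delta> - K. of_int (c e) *\<^sub>R e"
  have r: "r = ?a + ?b" using sum.subset_diff[OF KD D(1)] by (simp add: assms(4) add.commute)
  have coeff: "of_int (k e) = (0::real)" if "(\<Sum>e\<in>S. of_int (k e) *\<^sub>R e) = 0" "e \<in> S" "S \<subseteq> \<Delta>" for k e S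
    using independentD[OF D(2) finite_subset[OF that(3) D(1)] that(3), of "\<lambda>e. of_int (k e)" e] that
    by simp
  have az: "?a \<in> zspan \<Delta>" using zspan_sumI Z.span_mono[OF KD] by (rule rev_subsetD)
  have bz: "?b \<in> zspan \<Delta>" using zspan_sumI Z.span_mono[OF Diff_subset] by (rule rev_subsetD)
  have "B x y = 0" if "x \<in> K" "y \<in> \<Delta> - K" for x y
  proof -
    obtain L where "L \<in> \<K>" "y \<in> L" using \<open>y \<in> \<Delta> - K\<close> assms(2) by blast
    then show ?thesis using assms(3)[OF K(1), of L x y] that by auto
  qed
  then have ab: "B ?a ?b = 0" by (simp add: B_sum_left B_sum_right)
  have "?a \<noteq> 0" using coeff[of c K e] e K KD by auto
  then have "B ?a ?a \<le> - 2" by (rule simple_norm_le[OF assms(1) az])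
  moreover have "B r r = B ?a ?a + B ?b ?b + 2 * B ?a ?b"
    unfolding r by (simp only: B_simps B_sym[of ?b ?a])
  ultimately have "0 \<le> B ?b ?b" using assms(5) ab by simp
  then have "?b = 0" using simple_norm_le[OF assms(1) bz] by fastforce
  then have "\<forall>e\<in>\<Delta> - K. c e = 0" using coeff[of c "\<Delta> - K"] by auto
  then show ?thesis using K(1) by blast
qed

definition root_set :: "'v set \<Rightarrow> 'v set" where
  "root_set M = {r \<in> M. B r r = - 2}"

lemma root_setD: "r \<in> root_set M \<Longrightarrow> r \<in> M" "r \<in> root_set M \<Longrightarrow> B r r = - 2"
  by (auto simp: root_set_def)

lemma simple_weyl_subset: "simple_system \<Delta> \<Longrightarrow> weyl \<Delta> \<subseteq> weyl (root_set (zspan \<Delta>))"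
  by (rule weyl_mono) (auto simp: root_set_def Z.span_base dest: simple_systemD(4))

lemma weyl_root_set_zspan:
  assumes "simple_system \<Delta>" "g \<in> weyl (root_set (zspan \<Delta>))" "x \<in> zspan \<Delta>"
  shows "g x \<in> zspan \<Delta>"
  by (rule weyl_preserves[OF assms(2) Z.subspace_span _ _ assms(3)])
    (use simple_zspan_integral[OF assms(1)] in \<open>auto simp: root_set_def\<close>)

text \<open>If \<open>\<Phi>\<close> spans a proper sublattice of finite index, some dual vector of \<open>\<Phi>\<close> is not integral on
  the whole lattice. A multiple of it has prime denominator.\<close>

lemma functional_of_prime_denominator:
  assumes "simple_system \<Delta>" "finite \<Phi>" "\<Phi> \<subseteq> zspan \<Delta>" "independent \<Phi>" "card \<Phi> = card \<Delta>"
    "zspan \<Phi> \<noteq> zspan \<Delta>"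
  shows "\<exists>v\<in>qspan \<Delta>. \<exists>p::nat. prime p \<and> (\<forall>r\<in>\<Phi>. B v r \<in> \<int>) \<and> (\<exists>e\<in>\<Delta>. B v e \<notin> \<int>)
    \<and> (\<forall>e\<in>\<Delta>. of_nat p * B v e \<in> \<int>)"
proof -
  note D = simple_systemD[OF assms(1)]
  have sp: "\<Phi> \<subseteq> span \<Delta>" using assms(3) zspan_subset_span by (rule order_trans)
  have spans: "span \<Phi> = span \<Delta>" by (rule span_eq_if_card_eq[OF D(1) assms(4) sp assms(5)])
  have nd: "neg_def \<Phi>" by (rule neg_def_subset[OF D(3) sp])
  have rat: "B x y \<in> \<rat>" if "x \<in> \<Phi>" "y \<in> \<Phi>" for x y
    using simple_zspan_integral[OF assms(1) subsetD[OF assms(3) that(1)] subsetD[OF assms(3) that(2)]]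
      Ints_subset_Rats by (rule rev_subsetD)
  have "\<forall>f\<in>\<Phi>. \<exists>v\<in>qspan \<Phi>. \<forall>r\<in>\<Phi>. B v r = (if r = f then 1 else 0)"
    by (intro ballI vector_with_given_products[OF assms(2,4) nd]) (auto simp: rat)
  then obtain d where d: "\<And>f. f \<in> \<Phi> \<Longrightarrow> d f \<in> qspan \<Phi>"
    "\<And>f r. f \<in> \<Phi> \<Longrightarrow> r \<in> \<Phi> \<Longrightarrow> B (d f) r = (if r = f then 1 else 0)"
    by metis
  have "\<exists>f\<in>\<Phi>. \<exists>e\<in>\<Delta>. B (d f) e \<notin> \<int>"
  proof (rule ccontr)
    assume "\<not> ?thesis"
    then have int: "B (d f) e \<in> \<int>" if "f \<in> \<Phi>" "e \<in> \<Delta>" for f e using that by blast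
    have "\<Delta> \<subseteq> zspan \<Phi>"
    proof
      fix e assume e: "e \<in> \<Delta>"
      then have "e \<in> span \<Phi>" using spans by (simp add: span_base)
      then obtain x where x: "e = (\<Sum>r\<in>\<Phi>. x r *\<^sub>R r)"
        unfolding span_finite[OF assms(2)] by blast
      have "x f = B (d f) e" if f: "f \<in> \<Phi>" for f
      proof -
        have "B (d f) e = (\<Sum>r\<in>\<Phi>. x r * (if r = f then 1 else 0))"
          unfolding x B_sum_right by (intro sum.cong refl) (simp add: d(2)[OF f])
        then show ?thesis
          using f assms(2) by (simp add: if_distrib[of "\<lambda>z. _ * z"] cong: if_cong)
      qed
      then have "x f \<in> \<int>" if "f \<in> \<Phi>" for f using that int e by simp
      then have "e = (\<Sum>r\<in>\<Phi>. of_int \<lfloor>x r\<rfloor> *\<^sub>R r)" unfolding x by simp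
      then show "e \<in> zspan \<Phi>" by (metis zspan_sumI)
    qed
    then have "zspan \<Delta> \<subseteq> zspan \<Phi>" using zspan_trans by auto
    moreover have "zspan \<Phi> \<subseteq> zspan \<Delta>" using zspan_trans assms(3) by auto
    ultimately show False using assms(6) by simp
  qed
  then obtain f where f: "f \<in> \<Phi>" "\<exists>e\<in>\<Delta>. B (d f) e \<notin> \<int>" by blast
  have dq: "d f \<in> qspan \<Delta>"
    by (rule qspan_trans[OF d(1)[OF f(1)] order_trans[OF assms(3) zspan_subset_qspan]])
  let ?P = "\<lambda>n::nat. 0 < n \<and> (\<forall>e\<in>\<Delta>. of_nat n * B (d f) e \<in> \<int>)"
  obtain N where N: "0 < N" "of_nat N *\<^sub>R d f \<in> zspan \<Delta>" using qspan_clear_denominator[OF dq] by blast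
  have "of_nat N * B (d f) e \<in> \<int>" if "e \<in> \<Delta>" for e
    using simple_zspan_integral[OF assms(1) N(2) Z.span_base[OF that]] by simp
  then have "?P N" using N(1) by simp
  define n where "n = (LEAST n. ?P n)"
  have n: "?P n" unfolding n_def by (rule LeastI[of ?P, OF \<open>?P N\<close>])
  have n_min: "\<not> ?P k" if "k < n" for k using that not_less_Least unfolding n_def by blast
  have "n \<noteq> 1" using n f(2) by auto
  then obtain p where p: "prime p" "p dvd n" using prime_factor_nat by blast
  then obtain q where q: "n = p * q" by blast
  have "0 < q" "q < n" using n q p(1) prime_gt_1_nat[OF p(1)] by auto
  let ?v = "of_nat q *\<^sub>R d f"
  have "?v \<in> qspan \<Delta>" by (rule qspan_scaleI[OF _ dq]) simp
  moreover have "\<forall>r\<in>\<Phi>. B ?v r \<in> \<int>" using d(2)[OF f(1)] by simp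
  moreover have "\<exists>e\<in>\<Delta>. B ?v e \<notin> \<int>" using n_min[OF \<open>q < n\<close>] \<open>0 < q\<close> by simp
  moreover have "\<forall>e\<in>\<Delta>. of_nat p * B ?v e \<in> \<int>" using n unfolding q by (simp add: mult.assoc)
  ultimately show ?thesis using p(1) by blast
qed

text \<open>A fundamental alcove of the affine Weyl group: \<open>c\<close> lies in its interior, and a point of the orbit
  nearest to \<open>c\<close> lies in its closure, since every wall separating the two could be used to reflect
  the point closer.\<close>

lemma alcove_representative:
  assumes "simple_system \<Delta>" "v \<in> qspan \<Delta>" "T \<subseteq> root_set (zspan \<Delta>)" "c \<in> qspan \<Delta>"
    "\<And>e. e \<in> \<Delta> \<Longrightarrow> 0 < B c e" "\<And>t. t \<in> T \<Longrightarrow> B c t < 1"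
  shows "\<exists>g\<in>weyl (root_set (zspan \<Delta>)). \<exists>x\<in>zspan \<Delta>.
    (\<forall>e\<in>\<Delta>. 0 \<le> B (g v + x) e) \<and> (\<forall>t\<in>T. B (g v + x) t \<le> 1)"
proof -
  note D = simple_systemD[OF assms(1)]
  let ?W = "weyl (root_set (zspan \<Delta>))"
  define f where "f u = - B (u - c) (u - c)" for u
  define U where "U = {g v + x | g x. g \<in> ?W \<and> x \<in> zspan \<Delta>}"
  have UI: "g v + x \<in> U" if "g \<in> ?W" "x \<in> zspan \<Delta>" for g x using that unfolding U_def by blast
  obtain M where M: "0 < M" "of_nat M *\<^sub>R v \<in> zspan \<Delta>"
    using qspan_clear_denominator[OF assms(2)] by blast
  obtain N where N: "0 < N" "of_nat N *\<^sub>R c \<in> zspan \<Delta>"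
    using qspan_clear_denominator[OF assms(4)] by blast
  have "\<exists>m\<in>f ` U. \<forall>s\<in>f ` U. m \<le> s"
  proof (rule discrete_has_minimum)
    show "f ` U \<noteq> {}" using UI[OF weyl_id Z.span_zero] by blast
    show "0 < M * N * (M * N)" using M(1) N(1) by simp
    fix s assume "s \<in> f ` U"
    then obtain g x where g: "g \<in> ?W" and x: "x \<in> zspan \<Delta>" and s: "s = f (g v + x)"
      unfolding U_def by blast
    define y where "y = zscale (int N) (of_nat M *\<^sub>R g v) + zscale (int (M * N)) x
        - zscale (int M) (of_nat N *\<^sub>R c)"
    have "of_nat M *\<^sub>R g v \<in> zspan \<Delta>"
      using weyl_root_set_zspan[OF assms(1) g M(2)] by (simp add: weyl_scale[OF g])
    then have y: "y \<in> zspan \<Delta>"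
      unfolding y_def by (intro Z.span_diff Z.span_add Z.span_scale x N(2))
    have y_eq: "y = of_nat (M * N) *\<^sub>R (g v + x - c)" by (simp add: y_def algebra_simps)
    have "B y y = of_nat (M * N) * (of_nat (M * N) * B (g v + x - c) (g v + x - c))"
      unfolding y_eq by (simp only: B_simps(5,6))
    then have "of_nat (M * N * (M * N)) * s = - B y y"
      by (simp only: s f_def of_nat_mult mult.assoc mult_minus_right)
    then show "of_nat (M * N * (M * N)) * s \<in> \<int>"
      using simple_zspan_integral[OF assms(1) y y] by simp
    have "y \<in> span \<Delta>" using y zspan_subset_span by (rule rev_subsetD)
    then have "(1 / of_nat (M * N)) *\<^sub>R y \<in> span \<Delta>" by (rule span_scale)
    then have "g v + x - c \<in> span \<Delta>" using M(1) N(1) by (simp add: y_eq)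
    then have "B (g v + x - c) (g v + x - c) \<le> 0" by (rule neg_def_nonpos[OF D(3)])
    then show "0 \<le> s" unfolding s f_def by linarith
  qed
  then obtain u where u: "u \<in> U" "\<And>w. w \<in> U \<Longrightarrow> f u \<le> f w" by auto
  obtain g x where gx: "g \<in> ?W" "x \<in> zspan \<Delta>" "u = g v + x" using u(1) unfolding U_def by blast
  \<comment> \<open>Affine reflections of \<open>u\<close> in the wall \<open>B _ r = k\<close>.\<close>
  have refl: "u + (B u r - of_int k) *\<^sub>R r \<in> U" if r: "r \<in> root_set (zspan \<Delta>)" for r k
  proof -
    obtain l where l: "B x r = of_int l"
      using simple_zspan_integral[OF assms(1) gx(2) root_setD(1)[OF r]] by (elim Ints_cases)
    have "(reflect r \<circ> g) v + (x + zscale (l - k) r) \<in> U"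
      by (intro UI weyl_step[OF gx(1) r] Z.span_add gx(2) Z.span_scale root_setD(1)[OF r])
    also have "(reflect r \<circ> g) v + (x + zscale (l - k) r) = u + (B u r - of_int k) *\<^sub>R r"
      by (simp add: reflect_def gx(3) l algebra_simps)
    finally show ?thesis .
  qed
  have diff: "f (u + t *\<^sub>R r) - f u = 2 * t * (t - B u r + B c r)" if "B r r = - 2" for t r
    using that by (simp add: f_def algebra_simps B_sym[of r u] B_sym[of r c])
  have "0 \<le> B u e" if e: "e \<in> \<Delta>" for e
  proof -
    have "e \<in> root_set (zspan \<Delta>)" using D(4)[OF e] Z.span_base[OF e] by (simp add: root_set_def)
    then have "0 \<le> f (u + B u e *\<^sub>R e) - f u" using u(2) refl[of e 0] by simp
    then have "0 \<le> B u e * B c e" by (simp add: diff D(4)[OF e] mult.commute)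
    then show ?thesis using assms(5)[OF e] by (simp add: zero_le_mult_iff)
  qed
  moreover have "B u t \<le> 1" if t: "t \<in> T" for t
  proof -
    have t': "t \<in> root_set (zspan \<Delta>)" using t assms(3) by (rule rev_subsetD)
    then have "0 \<le> f (u + (B u t - 1) *\<^sub>R t) - f u" using u(2) refl[of t 1] by simp
    then have "0 \<le> (2 * B u t - 2) * (B c t - 1)" by (simp add: diff root_setD(2)[OF t'])
    then show ?thesis using assms(6)[OF t] by (simp add: zero_le_mult_iff)
  qed
  ultimately show ?thesis using gx by blast
qed

text \<open>The theorem of Borel and de Siebenthal. The functional of prime denominator is moved into the
  alcove. A root on which it takes an integral value is then a combination of the simple roots on which
  it vanishes and of the highest roots on which it takes the value \<open>1\<close>. Counting shows that it
  vanishes on all but one of the simple roots of the component where it is not integral.\<close>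

lemma finite_index_step:
  fixes m :: "'v \<Rightarrow> int"
  assumes simple: "simple_system \<Delta>" and union: "\<Union>\<K> = \<Delta>"
    and orth: "\<And>K L x y. K \<in> \<K> \<Longrightarrow> L \<in> \<K> \<Longrightarrow> K \<noteq> L \<Longrightarrow> x \<in> K \<Longrightarrow> y \<in> L \<Longrightarrow> B x y = 0"
    and m_pos: "\<And>e. e \<in> \<Delta> \<Longrightarrow> 0 < m e"
    and \<theta>_def: "\<And>K. K \<in> \<K> \<Longrightarrow> \<theta> K = (\<Sum>e\<in>K. of_int (m e) *\<^sub>R e)"
    and \<theta>_root: "\<And>K. K \<in> \<K> \<Longrightarrow> B (\<theta> K) (\<theta> K) = - 2"
    and \<theta>_dom: "\<And>K e. K \<in> \<K> \<Longrightarrow> e \<in> K \<Longrightarrow> B (\<theta> K) e \<le> 0"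
    and \<Phi>: "finite \<Phi>" "\<Phi> \<subseteq> root_set (zspan \<Delta>)" "independent \<Phi>" "card \<Phi> = card \<Delta>"
      "zspan \<Phi> \<noteq> zspan \<Delta>"
  shows "\<exists>g\<in>weyl (root_set (zspan \<Delta>)). \<exists>K\<in>\<K>. \<exists>j\<in>K.
    prime (nat (m j)) \<and> g ` \<Phi> \<subseteq> zspan (insert (- \<theta> K) (\<Delta> - {j}))"
proof -
  note D = simple_systemD[OF simple]
  let ?W = "weyl (root_set (zspan \<Delta>))"
  have KD: "K \<subseteq> \<Delta>" if "K \<in> \<K>" for K using that union by blast
  have KS: "simple_system K" if "K \<in> \<K>" for K by (rule simple_system_subset[OF simple KD[OF that]])
  have finK: "finite K" if "K \<in> \<K>" for K using KD[OF that] D(1) by (rule finite_subset)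
  have disj: "K = L" if "K \<in> \<K>" "L \<in> \<K>" "e \<in> K" "e \<in> L" for K L e
    using orth[of K L e e] D(4)[of e] KD[of K] that by force
  have \<Phi>z: "\<Phi> \<subseteq> zspan \<Delta>" using \<Phi>(2) by (auto simp: root_set_def)
  have \<theta>K: "\<theta> K \<in> zspan K" if "K \<in> \<K>" for K unfolding \<theta>_def[OF that] by (rule zspan_sumI)
  have \<theta>z: "\<theta> K \<in> zspan \<Delta>" if "K \<in> \<K>" for K
    using \<theta>K[OF that] Z.span_mono[OF KD[OF that]] by (rule rev_subsetD)
  obtain v p where v: "v \<in> qspan \<Delta>" and p: "prime p" and vP: "\<And>r. r \<in> \<Phi> \<Longrightarrow> B v r \<in> \<int>"
    and vN: "\<exists>e\<in>\<Delta>. B v e \<notin> \<int>" and vp: "\<And>e. e \<in> \<Delta> \<Longrightarrow> of_nat p * B v e \<in> \<int>"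
    using functional_of_prime_denominator[OF simple \<Phi>(1) \<Phi>z \<Phi>(3-5)] by blast
  define h where "h = 1 + (\<Sum>e\<in>\<Delta>. m e)"
  have sum_m: "0 \<le> (\<Sum>e\<in>S. m e)" if "S \<subseteq> \<Delta>" for S
    using that m_pos by (intro sum_nonneg) (meson less_imp_le subsetD)
  have h: "0 < h" using sum_m[of \<Delta>] by (simp add: h_def)
  obtain c where c: "c \<in> qspan \<Delta>" "\<And>e. e \<in> \<Delta> \<Longrightarrow> B c e = 1 / of_int h"
    using simple_vector_with_given_products[OF simple, of "\<lambda>_. 1 / of_int h"] by auto
  have c\<theta>: "B c (\<theta> K) < 1" if K: "K \<in> \<K>" for K
  proof -
    have "B c (\<theta> K) = of_int (\<Sum>e\<in>K. m e) / of_int h"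
      unfolding \<theta>_def[OF K] B_sum_right of_int_sum sum_divide_distrib
      using c(2) KD[OF K] by (intro sum.cong refl) (auto simp: subset_iff)
    moreover have "(\<Sum>e\<in>K. m e) \<le> (\<Sum>e\<in>\<Delta>. m e)"
      using m_pos by (intro sum_mono2[OF D(1) KD[OF K]]) (meson DiffD1 less_imp_le)
    then have "real_of_int (\<Sum>e\<in>K. m e) < of_int h" unfolding h_def of_int_less_iff by linarith
    ultimately show ?thesis using h by (simp del: of_int_sum)
  qed
  have "\<theta> ` \<K> \<subseteq> root_set (zspan \<Delta>)" using \<theta>z \<theta>_root by (auto simp: root_set_def)
  then have "\<exists>g\<in>?W. \<exists>x\<in>zspan \<Delta>.
    (\<forall>e\<in>\<Delta>. 0 \<le> B (g v + x) e) \<and> (\<forall>t\<in>\<theta> ` \<K>. B (g v + x) t \<le> 1)"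
    by (rule alcove_representative[OF simple v _ c(1)]) (use c(2) h c\<theta> in auto)
  then obtain g x where g: "g \<in> ?W" and x: "x \<in> zspan \<Delta>"
    and ge: "\<And>e. e \<in> \<Delta> \<Longrightarrow> 0 \<le> B (g v + x) e" and le: "\<And>K. K \<in> \<K> \<Longrightarrow> B (g v + x) (\<theta> K) \<le> 1"
    by blast
  define u where "u = g v + x"
  have u0: "0 \<le> B u e" if "e \<in> \<Delta>" for e using ge[OF that] by (simp add: u_def)
  have u1: "B u (\<theta> K) \<le> 1" if "K \<in> \<K>" for K using le[OF that] by (simp add: u_def)
  have lin: "linear g" by (rule weyl_linear[OF g])
  have iso: "B (g y) (g z) = B y z" for y z
    by (rule weyl_isometry[OF g]) (auto simp: root_set_def)
  have gz: "g y \<in> zspan \<Delta>" if "y \<in> zspan \<Delta>" for y by (rule weyl_root_set_zspan[OF simple g that])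
  obtain k where k: "k \<in> ?W" "g \<circ> k = id" "k \<circ> g = id"
    using weyl_inverse[OF g] by (auto simp: root_set_def)
  have kz: "k y \<in> zspan \<Delta>" if "y \<in> zspan \<Delta>" for y by (rule weyl_root_set_zspan[OF simple k(1) that])
  have gk: "g (k y) = y" for y using k(2) by (metis comp_apply id_apply)
  have xI: "B x y \<in> \<int>" if "y \<in> zspan \<Delta>" for y by (rule simple_zspan_integral[OF simple x that])
  have uP: "B u (g r) \<in> \<int>" if "r \<in> \<Phi>" for r
    using vP[OF that] xI[OF gz[OF subsetD[OF \<Phi>z that]]] by (simp add: u_def iso)
  have "of_nat p * B v y \<in> \<int>" if "y \<in> zspan \<Delta>" for y
  proof -
    have "B (of_nat p *\<^sub>R v) y \<in> \<int>"
      using that by (induction rule: Z.span_induct_alt) (auto simp: vp algebra_simps mult.left_commute)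
    then show ?thesis by simp
  qed
  then have "of_nat p * B (g v) (g (k y)) \<in> \<int>" if "y \<in> zspan \<Delta>" for y
    using kz[OF that] by (simp add: iso)
  then have up: "of_nat p * B u y \<in> \<int>" if "y \<in> zspan \<Delta>" for y
    using that xI[OF that] by (simp add: gk u_def algebra_simps)
  have "\<exists>e\<in>\<Delta>. B u e \<notin> \<int>"
  proof (rule ccontr)
    assume "\<not> ?thesis"
    then have *: "B u e \<in> \<int>" if "e \<in> \<Delta>" for e using that by blast
    have uI: "B u y \<in> \<int>" if "y \<in> zspan \<Delta>" for y
      using that by (induction rule: Z.span_induct_alt) (auto simp: *)
    have "B v e \<in> \<int>" if e: "e \<in> \<Delta>" for e
    proof -
      have ge: "g e \<in> zspan \<Delta>" by (rule gz[OF Z.span_base[OF e]])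
      have "B v e = B u (g e) - B x (g e)" by (simp add: u_def iso)
      then show ?thesis using uI[OF ge] xI[OF ge] by simp
    qed
    then show False using vN by blast
  qed
  then obtain j where j: "j \<in> \<Delta>" "B u j \<notin> \<int>" by blast
  then obtain K where K: "K \<in> \<K>" "j \<in> K" using union by blast
  define Z where "Z = {e \<in> \<Delta>. B u e = 0}"
  define \<K>1 where "\<K>1 = {K \<in> \<K>. B u (\<theta> K) = 1}"
  have into_pos: "r \<in> zspan (Z \<union> \<theta> ` \<K>1)"
    if r: "r = (\<Sum>e\<in>\<Delta>. of_int (a e) *\<^sub>R e)" "B r r = - 2" "B u r \<in> \<int>" "\<forall>e\<in>\<Delta>. 0 \<le> a e" for r a
  proof -
    have "\<exists>L\<in>\<K>. \<forall>e\<in>\<Delta> - L. a e = 0"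
      by (rule root_in_component[OF simple union _ r(1,2)]) (rule orth)
    then obtain L where L: "L \<in> \<K>" "\<forall>e\<in>\<Delta> - L. a e = 0" by blast
    have rL: "r = (\<Sum>e\<in>L. of_int (a e) *\<^sub>R e)"
      unfolding r(1) by (rule sum.mono_neutral_right[OF D(1) KD[OF L(1)]]) (use L(2) in simp)
    have mL: "0 < m e" if "e \<in> L" for e using that m_pos KD[OF L(1)] by blast
    have am: "a e \<le> m e" if "e \<in> L" for e
      by (rule highest_root_bound[OF KS[OF L(1)] _ \<theta>_def[OF L(1)] _ rL r(2) that])
        (auto simp: mL \<theta>_dom[OF L(1)])
    have L0: "0 \<le> B u e" "0 \<le> a e" if "e \<in> L" for e using that u0 r(4) KD[OF L(1)] by blast+
    have sum_r: "B u r = (\<Sum>e\<in>L. of_int (a e) * B u e)" by (simp add: rL B_sum_right)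
    have diff: "B u (\<theta> L) - B u r = (\<Sum>e\<in>L. of_int (m e - a e) * B u e)"
      unfolding sum_r \<theta>_def[OF L(1)] B_sum_right sum_subtractf[symmetric]
      by (intro sum.cong refl) (simp add: algebra_simps)
    have "0 \<le> B u r" unfolding sum_r using L0 by (intro sum_nonneg) auto
    moreover have d0: "0 \<le> B u (\<theta> L) - B u r"
      unfolding diff using L0 am by (intro sum_nonneg mult_nonneg_nonneg) auto
    ultimately have "0 \<le> B u r" "B u r \<le> 1" using u1[OF L(1)] by auto
    then consider "B u r = 0" | "B u r = 1" using r(3) by (elim Ints_cases) force
    then show ?thesis
    proof cases
      case 1
      then have "\<forall>e\<in>L. of_int (a e) * B u e = 0"
        unfolding sum_r using L0 by (subst (asm) sum_nonneg_eq_0_iff[OF finK[OF L(1)]]) auto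
      then have "r \<in> zspan {e \<in> L. B u e = 0}"
        unfolding rL by (intro sum_restrict_zspan[OF finK[OF L(1)]]) auto
      then show ?thesis by (rule subsetD[OF Z.span_mono, rotated]) (use KD[OF L(1)] in \<open>auto simp: Z_def\<close>)
    next
      case 2
      then have 3: "B u (\<theta> L) = 1" using d0 u1[OF L(1)] by simp
      then have "(\<Sum>e\<in>L. of_int (m e - a e) * B u e) = 0" using diff 2 by linarith
      then have "\<forall>e\<in>L. of_int (m e - a e) * B u e = 0"
        using L0 am by (subst (asm) sum_nonneg_eq_0_iff[OF finK[OF L(1)]]) auto
      then have "(\<Sum>e\<in>L. of_int (m e - a e) *\<^sub>R e) \<in> zspan {e \<in> L. B u e = 0}"
        by (intro sum_restrict_zspan[OF finK[OF L(1)]]) auto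
      then have "\<theta> L - r \<in> zspan {e \<in> L. B u e = 0}"
        unfolding rL \<theta>_def[OF L(1)] by (simp add: sum_subtractf[symmetric] scaleR_diff_left)
      then have 4: "\<theta> L - r \<in> zspan (Z \<union> \<theta> ` \<K>1)"
        by (rule subsetD[OF Z.span_mono, rotated]) (use KD[OF L(1)] in \<open>auto simp: Z_def\<close>)
      have "\<theta> L \<in> zspan (Z \<union> \<theta> ` \<K>1)" using L(1) 3 by (intro Z.span_base) (auto simp: \<K>1_def)
      then show ?thesis using Z.span_diff[OF _ 4] by fastforce
    qed
  qed
  have into: "g ` \<Phi> \<subseteq> zspan (Z \<union> \<theta> ` \<K>1)"
  proof (rule image_subsetI)
    fix r assume r: "r \<in> \<Phi>"
    then have "g r \<in> zspan \<Delta>" by (intro gz subsetD[OF \<Phi>z])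
    then obtain a where a: "g r = (\<Sum>e\<in>\<Delta>. of_int (a e) *\<^sub>R e)" by (rule zspan_finiteE[OF D(1)])
    have n: "B (g r) (g r) = - 2" using r \<Phi>(2) by (auto simp: iso root_set_def)
    consider "\<forall>e\<in>\<Delta>. 0 \<le> a e" | "\<forall>e\<in>\<Delta>. a e \<le> 0" using simple_root_signs[OF simple n a] by blast
    then show "g r \<in> zspan (Z \<union> \<theta> ` \<K>1)"
    proof cases
      case 1
      then show ?thesis by (rule into_pos[OF a n uP[OF r]])
    next
      case 2
      have "- g r = (\<Sum>e\<in>\<Delta>. of_int (- a e) *\<^sub>R e)" by (simp add: a sum_negf)
      then have "- g r \<in> zspan (Z \<union> \<theta> ` \<K>1)"
        by (rule into_pos) (use n uP[OF r] 2 in auto)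
      then show ?thesis using Z.span_neg[of "- g r"] by simp
    qed
  qed
  have fin\<K>: "finite \<K>" using union D(1) by (metis finite_UnionD)
  then have fin1: "finite \<K>1" by (simp add: \<K>1_def)
  have finZ: "finite Z" using D(1) by (simp add: Z_def)
  have injg: "inj g" using weyl_inj[OF g] by (auto simp: root_set_def)
  have "card (g ` \<Phi>) \<le> card (Z \<union> \<theta> ` \<K>1)"
  proof -
    have "independent (g ` \<Phi>)"
      by (rule linear_independent_injective_image[OF lin \<Phi>(3) inj_on_subset[OF injg subset_UNIV]])
    moreover have "g ` \<Phi> \<subseteq> span (Z \<union> \<theta> ` \<K>1)" by (rule order_trans[OF into zspan_subset_span])
    ultimately show ?thesis using independent_span_bound finZ fin1 by (metis finite_UnI finite_imageI)
  qed
  also have "\<dots> \<le> card Z + card \<K>1"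
    using card_Un_le[of Z "\<theta> ` \<K>1"] card_image_le[OF fin1, of \<theta>] by linarith
  finally have "card \<Delta> \<le> card Z + card \<K>1"
    using card_image[OF inj_on_subset[OF injg subset_UNIV], of \<Phi>] \<Phi>(4) by simp
  moreover have "card \<Delta> = card Z + card (\<Delta> - Z)"
    using card_Diff_subset[OF finZ, of \<Delta>] card_mono[OF D(1), of Z] by (auto simp: Z_def)
  ultimately have cardN: "card (\<Delta> - Z) \<le> card \<K>1" by simp
  have jN: "j \<in> \<Delta> - Z" using j by (auto simp: Z_def)
  have K1: "K \<in> \<K>1 \<and> (\<forall>e\<in>K - {j}. B u e = 0)"
  proof (rule ccontr)
    assume neg: "\<not> ?thesis"
    have "\<exists>e. e \<in> L \<and> e \<in> \<Delta> - Z - {j}" if L: "L \<in> \<K>1" for L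
    proof (cases "L = K")
      case True
      then show ?thesis using neg L KD[OF K(1)] by (auto simp: Z_def)
    next
      case False
      have L': "L \<in> \<K>" "B u (\<theta> L) = 1" using L by (auto simp: \<K>1_def)
      have "\<exists>e\<in>L. B u e \<noteq> 0"
      proof (rule ccontr)
        assume "\<not> ?thesis"
        then have "B u (\<theta> L) = 0" unfolding \<theta>_def[OF L'(1)] B_sum_right by simp
        then show False using L'(2) by simp
      qed
      then obtain e where "e \<in> L" "B u e \<noteq> 0" by blast
      moreover have "e \<noteq> j" using disj[OF L'(1) K(1) \<open>e \<in> L\<close>] K(2) False by blast
      ultimately show ?thesis using KD[OF L'(1)] by (auto simp: Z_def)
    qed
    then obtain f where f: "\<And>L. L \<in> \<K>1 \<Longrightarrow> f L \<in> L \<and> f L \<in> \<Delta> - Z - {j}" by metis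
    have "inj_on f \<K>1"
    proof (rule inj_onI)
      fix L M assume LM: "L \<in> \<K>1" "M \<in> \<K>1" "f L = f M"
      then have "f L \<in> L" "f L \<in> M" using f[OF LM(1)] f[OF LM(2)] by auto
      then show "L = M" using disj LM(1,2) by (auto simp: \<K>1_def)
    qed
    moreover have "f ` \<K>1 \<subseteq> \<Delta> - Z - {j}" using f by blast
    ultimately have "card \<K>1 \<le> card (\<Delta> - Z - {j})"
      using D(1) by (intro card_inj_on_le[of f]) auto
    also have "\<dots> < card (\<Delta> - Z)" by (rule card_Diff1_less[OF _ jN]) (simp add: D(1))
    finally show False using cardN by simp
  qed
  have "B u (\<theta> K) = (\<Sum>e\<in>K. of_int (m e) * B u e)" by (simp add: \<theta>_def[OF K(1)] B_sum_right)
  also have "\<dots> = of_int (m j) * B u j"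
    using K1 by (subst sum.remove[OF finK[OF K(1)] K(2)]) simp
  finally have mj: "of_int (m j) * B u j = 1" using K1 by (simp add: \<K>1_def)
  obtain n where n: "of_nat p * B u j = of_int n" using up[OF Z.span_base[OF j(1)]] by (elim Ints_cases)
  have "of_nat p = of_nat p * (of_int (m j) * B u j)" by (simp add: mj)
  also have "\<dots> = of_int (m j * n)" using n by (simp add: mult.left_commute)
  finally have "int p = m j * n" by (metis of_int_eq_iff of_int_of_nat_eq)
  then have "int (nat (m j)) dvd int p" using m_pos[OF j(1)] by simp
  then have "nat (m j) dvd p" by (simp only: int_dvd_int_iff)
  moreover have "nat (m j) \<noteq> 1"
  proof
    assume "nat (m j) = 1"
    then have "m j = 1" using m_pos[OF j(1)] by simp
    then show False using mj j(2) by simp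
  qed
  ultimately have "nat (m j) = p" using p by (meson prime_nat_iff)
  then have prime: "prime (nat (m j))" using p by simp
  have "Z \<union> \<theta> ` \<K>1 \<subseteq> zspan (insert (- \<theta> K) (\<Delta> - {j}))" (is "_ \<subseteq> ?T")
  proof -
    have "e \<in> ?T" if "e \<in> Z" for e using that jN by (intro Z.span_base) (auto simp: Z_def)
    moreover have "\<theta> L \<in> ?T" if L: "L \<in> \<K>1" for L
    proof (cases "L = K")
      case True
      have "- \<theta> K \<in> ?T" by (rule Z.span_base) simp
      then show ?thesis using True Z.span_neg[of "- \<theta> K"] by simp
    next
      case False
      have L': "L \<in> \<K>" using L by (simp add: \<K>1_def)
      then have "L \<subseteq> insert (- \<theta> K) (\<Delta> - {j})" using KD[OF L'] disj[OF L' K(1) _ K(2)] False by auto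
      then show ?thesis by (rule subsetD[OF Z.span_mono \<theta>K[OF L']])
    qed
    ultimately show ?thesis by auto
  qed
  then have "g ` \<Phi> \<subseteq> ?T" using zspan_trans[OF subsetD[OF into]] by (intro subsetI)
  then show ?thesis using g K prime by blast
qed

end

section \<open>Diagrams and their ADE-types\<close>

lemma diagram_iso_sym: "diagram_iso D D' \<Longrightarrow> diagram_iso D' D"
proof -
  assume "diagram_iso D D'"
  then obtain f where f: "bij_betw f (fst D) (fst D')"
    "\<forall>u\<in>fst D. \<forall>v\<in>fst D. (u, v) \<in> snd D \<longleftrightarrow> (f u, f v) \<in> snd D'"
    unfolding diagram_iso_def by blast
  let ?g = "inv_into (fst D) f"
  have g: "bij_betw ?g (fst D') (fst D)" by (rule bij_betw_inv_into[OF f(1)])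
  have "f (?g u) = u" "?g u \<in> fst D" if "u \<in> fst D'" for u
    using bij_betw_inv_into_right[OF f(1) that] bij_betwE[OF g] that by auto
  then show ?thesis using g f(2) unfolding diagram_iso_def by (intro exI[of _ ?g]) auto
qed

lemma diagram_iso_trans: "diagram_iso D D' \<Longrightarrow> diagram_iso D' D'' \<Longrightarrow> diagram_iso D D''"
proof -
  assume "diagram_iso D D'" "diagram_iso D' D''"
  then obtain f g where f: "bij_betw f (fst D) (fst D')"
    "\<forall>u\<in>fst D. \<forall>v\<in>fst D. (u, v) \<in> snd D \<longleftrightarrow> (f u, f v) \<in> snd D'"
    and g: "bij_betw g (fst D') (fst D'')"
    "\<forall>u\<in>fst D'. \<forall>v\<in>fst D'. (u, v) \<in> snd D' \<longleftrightarrow> (g u, g v) \<in> snd D''"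
    unfolding diagram_iso_def by blast
  have "f u \<in> fst D'" if "u \<in> fst D" for u using bij_betwE[OF f(1)] that by blast
  then show ?thesis
    using bij_betw_trans[OF f(1) g(1)] f(2) g(2) unfolding diagram_iso_def
    by (intro exI[of _ "g \<circ> f"]) auto
qed

fun symbol_rank :: "ade_symbol \<Rightarrow> nat" where
  "symbol_rank (Type_A l) = l"
| "symbol_rank (Type_D m) = m"
| "symbol_rank (Type_E n) = n"

lemma symbol_vertices: "fst (symbol_diagram X) = {1..symbol_rank X}"
  by (cases X) (simp_all add: a_diagram_def d_diagram_def e_diagram_def)

lemma symbol_edges_subset:
  "ade_symbol_ok X \<Longrightarrow> snd (symbol_diagram X) \<subseteq> {1..symbol_rank X} \<times> {1..symbol_rank X}"
  by (cases X) (auto simp: a_diagram_def d_diagram_def e_diagram_def chain_edges_def)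

lemma symbol_edges_irrefl: "ade_symbol_ok X \<Longrightarrow> (i, i) \<notin> snd (symbol_diagram X)"
  by (cases X) (auto simp: a_diagram_def d_diagram_def e_diagram_def chain_edges_def)

lemma symbol_edges_sym:
  "(i, j) \<in> snd (symbol_diagram X) \<Longrightarrow> (j, i) \<in> snd (symbol_diagram X)"
  by (cases X) (auto simp: a_diagram_def d_diagram_def e_diagram_def chain_edges_def)

lemma symbol_rank_pos: "ade_symbol_ok X \<Longrightarrow> 1 \<le> symbol_rank X"
  by (cases X) auto

lemma chain_connected:
  assumes "a \<le> i" "i \<le> j" "j \<le> b"
  shows "(i, j) \<in> (chain_edges a b)\<^sup>*" "(j, i) \<in> (chain_edges a b)\<^sup>*"
proof -
  have "(i, j) \<in> (chain_edges a b)\<^sup>* \<and> (j, i) \<in> (chain_edges a b)\<^sup>*"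
    using assms(2,3)
  proof (induction j rule: dec_induct)
    case (step k)
    then have "(k, Suc k) \<in> chain_edges a b" "(Suc k, k) \<in> chain_edges a b"
      using assms(1) by (auto simp: chain_edges_def)
    then show ?case using step
      by (meson Suc_leD converse_rtrancl_into_rtrancl rtrancl.rtrancl_into_rtrancl)
  qed simp
  then show "(i, j) \<in> (chain_edges a b)\<^sup>*" "(j, i) \<in> (chain_edges a b)\<^sup>*" by auto
qed

lemma chain_connected': "i \<in> {a..b} \<Longrightarrow> j \<in> {a..b} \<Longrightarrow> (i, j) \<in> (chain_edges a b)\<^sup>*"
  using chain_connected[of a i j b] chain_connected[of a j i b] by (cases "i \<le> j") auto

lemma rtrancl_one_more_vertex:
  assumes "\<And>i j. i \<in> V \<Longrightarrow> j \<in> V \<Longrightarrow> (i, j) \<in> E\<^sup>*" "w \<in> V" "(w, z) \<in> F" "(z, w) \<in> F" "E \<subseteq> F"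
    "i \<in> insert z V" "j \<in> insert z V"
  shows "(i, j) \<in> F\<^sup>*"
proof -
  have to_w: "(i, w) \<in> F\<^sup>*" if "i \<in> insert z V" for i
    using that assms(1)[of i w] assms(2,4) rtrancl_mono[OF assms(5)] by auto
  have from_w: "(w, i) \<in> F\<^sup>*" if "i \<in> insert z V" for i
    using that assms(1)[of w i] assms(2,3) rtrancl_mono[OF assms(5)] by auto
  show ?thesis using to_w[OF assms(6)] from_w[OF assms(7)] by (rule rtrancl_trans)
qed

lemma symbol_connected:
  assumes "ade_symbol_ok X" "i \<in> {1..symbol_rank X}" "j \<in> {1..symbol_rank X}"
  shows "(i, j) \<in> (snd (symbol_diagram X))\<^sup>*"
proof (cases X)
  case (Type_A l)
  then show ?thesis using assms chain_connected'[of i 1 l j] by (simp add: a_diagram_def)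
next
  case (Type_D m)
  have m: "4 \<le> m" using assms(1) Type_D by simp
  have eq: "{1..symbol_rank X} = insert m {1..m - 1}" using m Type_D by auto
  show ?thesis
    by (rule rtrancl_one_more_vertex[of "{1..m - 1}" "chain_edges 1 (m - 1)" "m - 2" m])
      (use m Type_D assms(2,3) in \<open>auto simp: d_diagram_def chain_connected' eq\<close>)
next
  case (Type_E n)
  have n: "6 \<le> n" using assms(1) Type_E by auto
  have eq: "{1..symbol_rank X} = insert 1 {2..n}" using n Type_E by auto
  show ?thesis
    by (rule rtrancl_one_more_vertex[of "{2..n}" "chain_edges 2 n" 4 1])
      (use n Type_E assms(2,3) in \<open>auto simp: e_diagram_def chain_connected' eq\<close>)
qed

text \<open>Ranks, branch vertices, and branch vertices with two leaves as neighbours tell the connected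
  diagrams apart.\<close>

definition has_branch :: "'a diagram \<Rightarrow> bool" where
  "has_branch D \<longleftrightarrow> (\<exists>c\<in>fst D. \<exists>x\<in>fst D. \<exists>y\<in>fst D. \<exists>z\<in>fst D. x \<noteq> y \<and> x \<noteq> z \<and> y \<noteq> z
     \<and> (c, x) \<in> snd D \<and> (c, y) \<in> snd D \<and> (c, z) \<in> snd D)"

definition has_short_branch :: "'a diagram \<Rightarrow> bool" where
  "has_short_branch D \<longleftrightarrow> (\<exists>c\<in>fst D. \<exists>x\<in>fst D. \<exists>y\<in>fst D. \<exists>z\<in>fst D. x \<noteq> y \<and> x \<noteq> z \<and> y \<noteq> z
     \<and> (c, x) \<in> snd D \<and> (c, y) \<in> snd D \<and> (c, z) \<in> snd D
     \<and> (\<forall>u\<in>fst D. (x, u) \<in> snd D \<or> (y, u) \<in> snd D \<longrightarrow> u = c))"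

lemma diagram_iso_branch:
  assumes "diagram_iso D D'" "has_branch D" shows "has_branch D'"
proof -
  obtain f where f: "bij_betw f (fst D) (fst D')"
    "\<And>u v. u \<in> fst D \<Longrightarrow> v \<in> fst D \<Longrightarrow> (u, v) \<in> snd D \<longleftrightarrow> (f u, f v) \<in> snd D'"
    using assms(1) unfolding diagram_iso_def by blast
  have im: "f u \<in> fst D'" if "u \<in> fst D" for u using bij_betwE[OF f(1)] that by blast
  have inj: "f u = f v \<longleftrightarrow> u = v" if "u \<in> fst D" "v \<in> fst D" for u v
    using f(1) that by (auto simp: bij_betw_def inj_on_eq_iff)
  obtain c x y z where cxyz: "c \<in> fst D" "x \<in> fst D" "y \<in> fst D" "z \<in> fst D" "x \<noteq> y" "x \<noteq> z" "y \<noteq> z"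
    "(c, x) \<in> snd D" "(c, y) \<in> snd D" "(c, z) \<in> snd D"
    using assms(2) unfolding has_branch_def by blast
  show ?thesis unfolding has_branch_def
    by (rule bexI[of _ "f c"], rule bexI[of _ "f x"], rule bexI[of _ "f y"], rule bexI[of _ "f z"])
      (use cxyz in \<open>simp_all add: inj im f(2)[symmetric]\<close>)
qed

lemma diagram_iso_short_branch:
  assumes "diagram_iso D D'" "has_short_branch D" shows "has_short_branch D'"
proof -
  obtain f where f: "bij_betw f (fst D) (fst D')"
    "\<And>u v. u \<in> fst D \<Longrightarrow> v \<in> fst D \<Longrightarrow> (u, v) \<in> snd D \<longleftrightarrow> (f u, f v) \<in> snd D'"
    using assms(1) unfolding diagram_iso_def by blast
  have im: "f u \<in> fst D'" if "u \<in> fst D" for u using bij_betwE[OF f(1)] that by blast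
  have inj: "f u = f v \<longleftrightarrow> u = v" if "u \<in> fst D" "v \<in> fst D" for u v
    using f(1) that by (auto simp: bij_betw_def inj_on_eq_iff)
  have surj: "fst D' = f ` fst D" using f(1) by (auto simp: bij_betw_def)
  obtain c x y z where cxyz: "c \<in> fst D" "x \<in> fst D" "y \<in> fst D" "z \<in> fst D" "x \<noteq> y" "x \<noteq> z" "y \<noteq> z"
    "(c, x) \<in> snd D" "(c, y) \<in> snd D" "(c, z) \<in> snd D"
    "\<forall>u\<in>fst D. (x, u) \<in> snd D \<or> (y, u) \<in> snd D \<longrightarrow> u = c"
    using assms(2) unfolding has_short_branch_def by (elim bexE conjE)
  have leaf: "\<forall>u\<in>fst D'. (f x, u) \<in> snd D' \<or> (f y, u) \<in> snd D' \<longrightarrow> u = f c"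
  proof (intro ballI impI)
    fix w assume w: "w \<in> fst D'" "(f x, w) \<in> snd D' \<or> (f y, w) \<in> snd D'"
    then obtain u where u: "u \<in> fst D" "w = f u" unfolding surj by (elim imageE)
    then have "(x, u) \<in> snd D \<or> (y, u) \<in> snd D" using w(2) f(2) cxyz(2,3) by simp
    then have "u = c" using cxyz(11) u(1) by blast
    then show "w = f c" using u(2) by simp
  qed
  have "f x \<noteq> f y \<and> f x \<noteq> f z \<and> f y \<noteq> f z
      \<and> (f c, f x) \<in> snd D' \<and> (f c, f y) \<in> snd D' \<and> (f c, f z) \<in> snd D'"
    using cxyz(1-10) by (simp add: inj f(2)[symmetric])
  then show ?thesis unfolding has_short_branch_def using leaf im cxyz(1-4) by blast
qed

lemma branch_A: "\<not> has_branch (a_diagram l)"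
proof
  assume "has_branch (a_diagram l)"
  then obtain c x y z where H: "x \<noteq> y" "x \<noteq> z" "y \<noteq> z"
    "(c, x) \<in> chain_edges 1 l" "(c, y) \<in> chain_edges 1 l" "(c, z) \<in> chain_edges 1 l"
    unfolding has_branch_def a_diagram_def fst_conv snd_conv by (elim bexE conjE)
  have nbr: "u = Suc c \<or> c = Suc u" if "(c, u) \<in> chain_edges 1 l" for u
    using that by (simp add: chain_edges_def)
  show False using nbr[OF H(4)] nbr[OF H(5)] nbr[OF H(6)] H(1-3) by (elim disjE) simp_all
qed

lemma branch_D: "4 \<le> m \<Longrightarrow> has_short_branch (d_diagram m)"
  unfolding has_short_branch_def
  by (rule bexI[of _ "m - 2"], rule bexI[of _ "m - 1"], rule bexI[of _ m], rule bexI[of _ "m - 3"])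
    (auto simp: d_diagram_def chain_edges_def)

lemma short_branch_imp_branch: "has_short_branch D \<Longrightarrow> has_branch D"
  unfolding has_short_branch_def has_branch_def by blast

lemma branch_E: "6 \<le> n \<Longrightarrow> has_branch (e_diagram n)"
  unfolding has_branch_def
  by (rule bexI[of _ 4], rule bexI[of _ 1], rule bexI[of _ 3], rule bexI[of _ 5])
    (auto simp: e_diagram_def chain_edges_def)

lemma short_branch_E:
  assumes "6 \<le> n" shows "\<not> has_short_branch (e_diagram n)"
proof
  assume "has_short_branch (e_diagram n)"
  then obtain c x y z where H: "x \<noteq> y" "x \<noteq> z" "y \<noteq> z"
    "(c, x) \<in> snd (e_diagram n)" "(c, y) \<in> snd (e_diagram n)" "(c, z) \<in> snd (e_diagram n)"
    and leaf: "\<forall>u\<in>fst (e_diagram n). (x, u) \<in> snd (e_diagram n) \<or> (y, u) \<in> snd (e_diagram n) \<longrightarrow> u = c"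
    unfolding has_short_branch_def by (elim bexE conjE)
  have nbr: "(u = Suc c \<or> c = Suc u \<or> c = 1 \<and> u = 4 \<or> c = 4 \<and> u = 1) \<and> (c = 1 \<longrightarrow> u = 4)"
    if "(c, u) \<in> snd (e_diagram n)" for u
    using that by (auto simp: e_diagram_def chain_edges_def)
  have c: "c = 4" using nbr[OF H(4)] nbr[OF H(5)] nbr[OF H(6)] H(1-3) by presburger
  have "x = 3 \<or> y = 3 \<or> x = 5 \<or> y = 5"
    using nbr[OF H(4)] nbr[OF H(5)] H(1) c by presburger
  moreover have "(3, 2) \<in> snd (e_diagram n)" "(5, 6) \<in> snd (e_diagram n)"
    "2 \<in> fst (e_diagram n)" "6 \<in> fst (e_diagram n)"
    using assms by (simp_all add: e_diagram_def chain_edges_def)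
  ultimately have "2 = c \<or> 6 = c" using leaf by metis
  then show False using c by simp
qed

lemma symbol_branch_iff:
  assumes "ade_symbol_ok X"
  shows "has_branch (symbol_diagram X) \<longleftrightarrow> (\<forall>l. X \<noteq> Type_A l)"
    "has_short_branch (symbol_diagram X) \<longleftrightarrow> (\<exists>m. X = Type_D m)"
proof (atomize (full), cases X)
  case (Type_A l)
  then show "(has_branch (symbol_diagram X) \<longleftrightarrow> (\<forall>l. X \<noteq> Type_A l))
    \<and> (has_short_branch (symbol_diagram X) \<longleftrightarrow> (\<exists>m. X = Type_D m))"
    using branch_A[of l] short_branch_imp_branch[of "a_diagram l"] by auto
next
  case (Type_D m)
  then show "(has_branch (symbol_diagram X) \<longleftrightarrow> (\<forall>l. X \<noteq> Type_A l))
    \<and> (has_short_branch (symbol_diagram X) \<longleftrightarrow> (\<exists>m. X = Type_D m))"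
    using branch_D[of m] short_branch_imp_branch[of "d_diagram m"] assms by auto
next
  case (Type_E n)
  then have "6 \<le> n" using assms by auto
  then show "(has_branch (symbol_diagram X) \<longleftrightarrow> (\<forall>l. X \<noteq> Type_A l))
    \<and> (has_short_branch (symbol_diagram X) \<longleftrightarrow> (\<exists>m. X = Type_D m))"
    using branch_E[of n] short_branch_E[of n] Type_E by auto
qed

lemma symbol_diagram_inj:
  assumes "ade_symbol_ok X" "ade_symbol_ok Y" "diagram_iso (symbol_diagram X) (symbol_diagram Y)"
  shows "X = Y"
proof -
  have "card (fst (symbol_diagram X)) = card (fst (symbol_diagram Y))"
    using assms(3) bij_betw_same_card unfolding diagram_iso_def by blast
  then have rank: "symbol_rank X = symbol_rank Y" by (simp add: symbol_vertices)
  have "has_branch (symbol_diagram X) = has_branch (symbol_diagram Y)"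
    "has_short_branch (symbol_diagram X) = has_short_branch (symbol_diagram Y)"
    using diagram_iso_branch[OF assms(3)] diagram_iso_branch[OF diagram_iso_sym[OF assms(3)]]
      diagram_iso_short_branch[OF assms(3)] diagram_iso_short_branch[OF diagram_iso_sym[OF assms(3)]]
    by auto
  then have "(\<forall>l. X \<noteq> Type_A l) = (\<forall>l. Y \<noteq> Type_A l)" "(\<exists>m. X = Type_D m) = (\<exists>m. Y = Type_D m)"
    using symbol_branch_iff[OF assms(1)] symbol_branch_iff[OF assms(2)] by simp_all
  then show ?thesis using rank by (cases X; cases Y) auto
qed

text \<open>An indexed decomposition of a diagram into connected diagrams: \<open>f k i\<close> is the vertex \<open>i\<close> of the
  \<open>k\<close>-th summand.\<close>

definition ade_decomposition ::
  "'a diagram \<Rightarrow> 'k set \<Rightarrow> ('k \<Rightarrow> ade_symbol) \<Rightarrow> ('k \<Rightarrow> nat \<Rightarrow> 'a) \<Rightarrow> bool" where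
  "ade_decomposition D I X f \<longleftrightarrow> finite I \<and> snd D \<subseteq> fst D \<times> fst D \<and> (\<forall>k\<in>I. ade_symbol_ok (X k))
     \<and> fst D = (\<Union>k\<in>I. f k ` {1..symbol_rank (X k)})
     \<and> (\<forall>k\<in>I. \<forall>l\<in>I. \<forall>i\<in>{1..symbol_rank (X k)}. \<forall>j\<in>{1..symbol_rank (X l)}.
          (f k i = f l j \<longleftrightarrow> k = l \<and> i = j)
          \<and> ((f k i, f l j) \<in> snd D \<longleftrightarrow> k = l \<and> (i, j) \<in> snd (symbol_diagram (X k))))"

lemma ade_decompositionD:
  assumes "ade_decomposition D I X f"
  shows "finite I" "snd D \<subseteq> fst D \<times> fst D" "k \<in> I \<Longrightarrow> ade_symbol_ok (X k)"
    "fst D = (\<Union>k\<in>I. f k ` {1..symbol_rank (X k)})"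
    "k \<in> I \<Longrightarrow> l \<in> I \<Longrightarrow> i \<in> {1..symbol_rank (X k)} \<Longrightarrow> j \<in> {1..symbol_rank (X l)} \<Longrightarrow>
      f k i = f l j \<longleftrightarrow> k = l \<and> i = j"
    "k \<in> I \<Longrightarrow> l \<in> I \<Longrightarrow> i \<in> {1..symbol_rank (X k)} \<Longrightarrow> j \<in> {1..symbol_rank (X l)} \<Longrightarrow>
      (f k i, f l j) \<in> snd D \<longleftrightarrow> k = l \<and> (i, j) \<in> snd (symbol_diagram (X k))"
proof -
  note H = assms[unfolded ade_decomposition_def]
  note H2 = H[THEN conjunct2] note H3 = H2[THEN conjunct2] note H4 = H3[THEN conjunct2]
  show "finite I" by (rule H[THEN conjunct1])
  show "snd D \<subseteq> fst D \<times> fst D" by (rule H2[THEN conjunct1])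
  show "ade_symbol_ok (X k)" if "k \<in> I" using H3[THEN conjunct1] that by (rule bspec)
  show "fst D = (\<Union>k\<in>I. f k ` {1..symbol_rank (X k)})" by (rule H4[THEN conjunct1])
  assume *: "k \<in> I" "l \<in> I" "i \<in> {1..symbol_rank (X k)}" "j \<in> {1..symbol_rank (X l)}"
  note L = H4[THEN conjunct2, THEN bspec, OF *(1), THEN bspec, OF *(2), THEN bspec, OF *(3), THEN bspec, OF *(4)]
  show "f k i = f l j \<longleftrightarrow> k = l \<and> i = j" by (rule L[THEN conjunct1])
  show "(f k i, f l j) \<in> snd D \<longleftrightarrow> k = l \<and> (i, j) \<in> snd (symbol_diagram (X k))"
    by (rule L[THEN conjunct2])
qed

lemma ade_decomposition_component:
  assumes "ade_decomposition D I X f" "k \<in> I" "i \<in> {1..symbol_rank (X k)}"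
  shows "{v \<in> fst D. (f k i, v) \<in> (snd D)\<^sup>*} = f k ` {1..symbol_rank (X k)}"
proof (rule subset_antisym)
  note A = ade_decompositionD[OF assms(1)]
  have "v \<in> f k ` {1..symbol_rank (X k)}" if "(f k i, v) \<in> (snd D)\<^sup>*" for v
    using that
  proof (induction rule: rtrancl_induct)
    case base
    then show ?case using assms(3) by blast
  next
    case (step u v)
    then obtain i' where i': "i' \<in> {1..symbol_rank (X k)}" "u = f k i'" by blast
    have "v \<in> fst D" using step(2) A(2) by blast
    then obtain l j where l: "l \<in> I" "j \<in> {1..symbol_rank (X l)}" "v = f l j" unfolding A(4) by blast
    then have "k = l" using A(6)[OF assms(2) l(1) i'(1) l(2)] step(2) i'(2) by simp
    then show ?case using l by simp
  qed
  then show "{v \<in> fst D. (f k i, v) \<in> (snd D)\<^sup>*} \<subseteq> f k ` {1..symbol_rank (X k)}" by blast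
  show "f k ` {1..symbol_rank (X k)} \<subseteq> {v \<in> fst D. (f k i, v) \<in> (snd D)\<^sup>*}"
  proof (rule image_subsetI)
    fix j assume j: "j \<in> {1..symbol_rank (X k)}"
    have "(i, j) \<in> (snd (symbol_diagram (X k)))\<^sup>*"
      by (rule symbol_connected[OF A(3)[OF assms(2)] assms(3) j])
    then have "(f k i, f k j) \<in> (snd D)\<^sup>*"
    proof (induction rule: rtrancl_induct)
      case (step a b)
      have ab: "a \<in> {1..symbol_rank (X k)}" "b \<in> {1..symbol_rank (X k)}"
        using step(2) symbol_edges_subset[OF A(3)[OF assms(2)]] by auto
      have "(f k a, f k b) \<in> snd D" using A(6)[OF assms(2) assms(2) ab] step(2) by simp
      then show ?case using step(3) by simp
    qed simp
    then show "f k j \<in> {v \<in> fst D. (f k i, v) \<in> (snd D)\<^sup>*}" using A(4) assms(2) j by blast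
  qed
qed

lemma ade_decomposition_components:
  assumes "ade_decomposition D I X f"
  shows "diagram_components D = (\<lambda>k. f k ` {1..symbol_rank (X k)}) ` I" (is "_ = ?C ` I")
proof -
  note A = ade_decompositionD[OF assms]
  let ?r = "{(u, v) \<in> fst D \<times> fst D. (u, v) \<in> (snd D)\<^sup>*}"
  have cls: "?r `` {f k i} = ?C k" if "k \<in> I" "i \<in> {1..symbol_rank (X k)}" for k i
  proof -
    have "f k i \<in> fst D" using A(4) that by blast
    then have "?r `` {f k i} = {v \<in> fst D. (f k i, v) \<in> (snd D)\<^sup>*}" by auto
    then show ?thesis using ade_decomposition_component[OF assms that] by simp
  qed
  show ?thesis
  proof (intro subset_antisym subsetI)
    fix C assume "C \<in> diagram_components D"
    then obtain u where u: "u \<in> fst D" "C = ?r `` {u}" unfolding diagram_components_def by (rule quotientE)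
    then obtain k i where "k \<in> I" "i \<in> {1..symbol_rank (X k)}" "u = f k i" unfolding A(4) by blast
    then show "C \<in> ?C ` I" using cls u(2) by blast
  next
    fix C assume "C \<in> ?C ` I"
    then obtain k where k: "k \<in> I" "C = ?C k" by blast
    have 1: "1 \<in> {1..symbol_rank (X k)}" using symbol_rank_pos[OF A(3)[OF k(1)]] by simp
    then have "f k 1 \<in> fst D" using A(4) k(1) by blast
    then have "?r `` {f k 1} \<in> fst D // ?r" by (rule quotientI)
    then show "C \<in> diagram_components D" unfolding diagram_components_def using cls[OF k(1) 1] k(2) by simp
  qed
qed

lemma ade_decomposition_component_type:
  assumes "ade_decomposition D I X f" "k \<in> I"
  shows "component_has_type D (f k ` {1..symbol_rank (X k)}) Y \<longleftrightarrow> Y = X k"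
proof -
  note A = ade_decompositionD[OF assms(1)]
  let ?C = "f k ` {1..symbol_rank (X k)}"
  have inj: "inj_on (f k) {1..symbol_rank (X k)}" using A(5)[OF assms(2,2)] by (auto intro: inj_onI)
  have "diagram_iso (symbol_diagram (X k)) (sub_diagram D ?C)"
    unfolding diagram_iso_def
    by (rule exI[of _ "f k"])
      (use A(6)[OF assms(2,2)] inj in \<open>auto simp: sub_diagram_def symbol_vertices bij_betw_def\<close>)
  then have iso: "diagram_iso (sub_diagram D ?C) (symbol_diagram (X k))"
    "diagram_iso (symbol_diagram (X k)) (sub_diagram D ?C)"
    using diagram_iso_sym by blast+
  show ?thesis
  proof
    assume "component_has_type D ?C Y"
    then have Y: "ade_symbol_ok Y" "diagram_iso (sub_diagram D ?C) (symbol_diagram Y)"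
      by (auto simp: component_has_type_def)
    show "Y = X k"
      by (rule symbol_diagram_inj[OF A(3)[OF assms(2)] Y(1) diagram_iso_trans[OF iso(2) Y(2)], symmetric])
  next
    assume "Y = X k"
    then show "component_has_type D ?C Y" using iso A(3)[OF assms(2)] by (simp add: component_has_type_def)
  qed
qed

lemma ade_decomposition_type:
  assumes "ade_decomposition D I X f"
  shows "is_ade_diagram D" "diagram_type D = image_mset X (mset_set I)"
proof -
  note A = ade_decompositionD[OF assms]
  note T = ade_decomposition_component_type[OF assms]
  let ?C = "\<lambda>k. f k ` {1..symbol_rank (X k)}"
  show "is_ade_diagram D"
    unfolding is_ade_diagram_def ade_decomposition_components[OF assms] using T by blast
  have inj: "inj_on ?C I"
  proof (rule inj_onI)
    fix k l assume kl: "k \<in> I" "l \<in> I" "?C k = ?C l"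
    have 1: "1 \<in> {1..symbol_rank (X k)}" using symbol_rank_pos[OF A(3)[OF kl(1)]] by simp
    then have "f k 1 \<in> ?C l" using kl(3) by blast
    then obtain j where j: "j \<in> {1..symbol_rank (X l)}" "f k 1 = f l j" by blast
    then show "k = l" using A(5)[OF kl(1,2) 1 j(1)] by blast
  qed
  have "diagram_type D = image_mset (\<lambda>C. THE X. component_has_type D C X) (image_mset ?C (mset_set I))"
    unfolding diagram_type_def ade_decomposition_components[OF assms]
    by (simp only: image_mset_mset_set[OF inj])
  also have "\<dots> = image_mset X (mset_set I)"
    unfolding image_mset.compositionality comp_def
    by (intro image_mset_cong) (use T A(1) in auto)
  finally show "diagram_type D = image_mset X (mset_set I)" .
qed

lemma ade_decomposition_exists:
  assumes "is_ade_diagram D" "finite (fst D)" "snd D \<subseteq> fst D \<times> fst D" "sym (snd D)"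
  shows "\<exists>X f. ade_decomposition D (diagram_components D) X f"
proof -
  define r where "r = {(u, v) \<in> fst D \<times> fst D. (u, v) \<in> (snd D)\<^sup>*}"
  define I where "I = diagram_components D"
  have I: "I = fst D // r" by (simp add: I_def diagram_components_def r_def)
  have "sym ((snd D)\<^sup>*)" by (rule sym_rtrancl[OF assms(4)])
  then have eq: "equiv (fst D) r"
    unfolding r_def by (intro equivI) (auto simp: refl_on_def sym_def trans_def)
  have "\<forall>C\<in>I. \<exists>X. component_has_type D C X"
    using assms(1) by (simp add: is_ade_diagram_def I_def)
  from bchoice[OF this] obtain X where X': "\<forall>C\<in>I. component_has_type D C (X C)" by (elim exE)
  note X = bspec[OF X']
  have "\<forall>C\<in>I. \<exists>f. bij_betw f {1..symbol_rank (X C)} C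
    \<and> (\<forall>i\<in>{1..symbol_rank (X C)}. \<forall>j\<in>{1..symbol_rank (X C)}.
      (i, j) \<in> snd (symbol_diagram (X C)) \<longleftrightarrow> (f i, f j) \<in> snd D)"
  proof
    fix C assume C: "C \<in> I"
    have "diagram_iso (symbol_diagram (X C)) (sub_diagram D C)"
    proof (rule diagram_iso_sym)
      show "diagram_iso (sub_diagram D C) (symbol_diagram (X C))"
        using X[OF C] by (simp add: component_has_type_def)
    qed
    then obtain f where f: "bij_betw f {1..symbol_rank (X C)} C"
      "\<forall>i\<in>{1..symbol_rank (X C)}. \<forall>j\<in>{1..symbol_rank (X C)}.
        (i, j) \<in> snd (symbol_diagram (X C)) \<longleftrightarrow> (f i, f j) \<in> snd D \<inter> C \<times> C"
      unfolding diagram_iso_def sub_diagram_def fst_conv snd_conv symbol_vertices by (elim exE conjE)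
    have "f i \<in> C" if "i \<in> {1..symbol_rank (X C)}" for i using bij_betwE[OF f(1)] that by (rule bspec)
    then show "\<exists>f. bij_betw f {1..symbol_rank (X C)} C
    \<and> (\<forall>i\<in>{1..symbol_rank (X C)}. \<forall>j\<in>{1..symbol_rank (X C)}.
      (i, j) \<in> snd (symbol_diagram (X C)) \<longleftrightarrow> (f i, f j) \<in> snd D)"
      using f by (intro exI[of _ f]) simp
  qed
  from bchoice[OF this] obtain f where f': "\<forall>C\<in>I. bij_betw (f C) {1..symbol_rank (X C)} C
    \<and> (\<forall>i\<in>{1..symbol_rank (X C)}. \<forall>j\<in>{1..symbol_rank (X C)}.
      (i, j) \<in> snd (symbol_diagram (X C)) \<longleftrightarrow> (f C i, f C j) \<in> snd D)"
    by (elim exE)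
  have f: "bij_betw (f C) {1..symbol_rank (X C)} C" if "C \<in> I" for C
    using bspec[OF f' that] by (rule conjunct1)
  have f2: "(i, j) \<in> snd (symbol_diagram (X C)) \<longleftrightarrow> (f C i, f C j) \<in> snd D"
    if "C \<in> I" "i \<in> {1..symbol_rank (X C)}" "j \<in> {1..symbol_rank (X C)}" for C i j
    using bspec[OF f' that(1)] that(2,3) by simp
  have mem: "f C i \<in> C" if "C \<in> I" "i \<in> {1..symbol_rank (X C)}" for C i
    using bij_betwE[OF f[OF that(1)]] that(2) by (rule bspec)
  have "ade_decomposition D I X f"
    unfolding ade_decomposition_def
  proof (intro conjI ballI)
    show "finite I" unfolding I using assms(2) eq by (intro finite_quotient) (auto simp: equiv_def refl_on_def r_def)
    show "snd D \<subseteq> fst D \<times> fst D" by (rule assms(3))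
    show "ade_symbol_ok (X C)" if "C \<in> I" for C using X[OF that] by (simp add: component_has_type_def)
    have "(\<Union>C\<in>I. f C ` {1..symbol_rank (X C)}) = \<Union>I"
      using f by (simp add: bij_betw_def)
    then show "fst D = (\<Union>C\<in>I. f C ` {1..symbol_rank (X C)})"
      using Union_quotient[OF eq] by (simp add: I)
    fix C C' i j assume *: "C \<in> I" "C' \<in> I" "i \<in> {1..symbol_rank (X C)}" "j \<in> {1..symbol_rank (X C')}"
    show "f C i = f C' j \<longleftrightarrow> C = C' \<and> i = j"
    proof
      assume e: "f C i = f C' j"
      have "C = C' \<or> C \<inter> C' = {}" using quotient_disj[OF eq] *(1,2) by (simp add: I)
      then have "C = C'" using mem[OF *(1,3)] mem[OF *(2,4)] e by auto
      then show "C = C' \<and> i = j"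
        using e *(3,4) f[OF *(1)] by (auto simp: bij_betw_def inj_on_eq_iff)
    qed auto
    show "(f C i, f C' j) \<in> snd D \<longleftrightarrow> C = C' \<and> (i, j) \<in> snd (symbol_diagram (X C))"
    proof
      assume e: "(f C i, f C' j) \<in> snd D"
      then have "(f C i, f C' j) \<in> r" using assms(3) by (auto simp: r_def)
      then have "C = C'"
        using quotient_eqI[OF eq _ _ mem[OF *(1,3)] mem[OF *(2,4)]] *(1,2) by (simp add: I)
      then show "C = C' \<and> (i, j) \<in> snd (symbol_diagram (X C))" using f2[OF *(1,3), of j] *(4) e by blast
    next
      assume "C = C' \<and> (i, j) \<in> snd (symbol_diagram (X C))"
      then show "(f C i, f C' j) \<in> snd D" using f2[OF *(1,3), of j] *(4) by blast
    qed
  qed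
  then show ?thesis unfolding I_def by blast
qed

lemma diagram_iso_decomposition:
  assumes "ade_decomposition D I X f" "diagram_iso D D'" "snd D' \<subseteq> fst D' \<times> fst D'"
  shows "\<exists>f'. ade_decomposition D' I X f'"
proof -
  note A = ade_decompositionD[OF assms(1)]
  obtain g where g: "bij_betw g (fst D) (fst D')"
    "\<And>u v. u \<in> fst D \<Longrightarrow> v \<in> fst D \<Longrightarrow> (u, v) \<in> snd D \<longleftrightarrow> (g u, g v) \<in> snd D'"
    using assms(2) unfolding diagram_iso_def by blast
  have mem: "f k i \<in> fst D" if "k \<in> I" "i \<in> {1..symbol_rank (X k)}" for k i
    unfolding A(4) using that by blast
  have "ade_decomposition D' I X (\<lambda>k i. g (f k i))"
    unfolding ade_decomposition_def
  proof (intro conjI ballI)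
    show "fst D' = (\<Union>k\<in>I. (\<lambda>i. g (f k i)) ` {1..symbol_rank (X k)})"
    proof -
      have "fst D' = g ` fst D" using g(1) by (simp add: bij_betw_def)
      then show ?thesis unfolding A(4) image_UN image_image .
    qed
    fix k l i j assume *: "k \<in> I" "l \<in> I" "i \<in> {1..symbol_rank (X k)}" "j \<in> {1..symbol_rank (X l)}"
    show "g (f k i) = g (f l j) \<longleftrightarrow> k = l \<and> i = j"
      using inj_on_eq_iff[OF bij_betw_imp_inj_on[OF g(1)] mem[OF *(1,3)] mem[OF *(2,4)]] A(5)[OF *]
      by (rule trans)
    show "(g (f k i), g (f l j)) \<in> snd D' \<longleftrightarrow> k = l \<and> (i, j) \<in> snd (symbol_diagram (X k))"
      using g(2)[OF mem[OF *(1,3)] mem[OF *(2,4)]] A(6)[OF *] by simp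
  qed (use A(1,3) assms(3) in auto)
  then show ?thesis by blast
qed

lemma count_image_mset_set:
  "finite I \<Longrightarrow> count (image_mset X (mset_set I)) s = card {k \<in> I. X k = s}"
  by (simp add: count_image_mset Int_def vimage_def conj_commute)

text \<open>Both diagrams have equally many summands of each type. Match these summands.\<close>

lemma diagram_iso_if_same_type:
  assumes "ade_decomposition D I X f" "ade_decomposition D' J Y f'"
    "image_mset X (mset_set I) = image_mset Y (mset_set J)"
  shows "diagram_iso D D'"
proof -
  note A = ade_decompositionD[OF assms(1)]
  note A' = ade_decompositionD[OF assms(2)]
  have "\<exists>b. bij_betw b {k \<in> I. X k = s} {k \<in> J. Y k = s}" for s
    using arg_cong[OF assms(3), of "\<lambda>M. count M s"] A(1) A'(1)
    by (intro finite_same_card_bij) (simp_all add: count_image_mset_set)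
  then have "\<forall>s. \<exists>b. bij_betw b {k \<in> I. X k = s} {k \<in> J. Y k = s}" by blast
  from choice[OF this] obtain b where b': "\<forall>s. bij_betw (b s) {k \<in> I. X k = s} {k \<in> J. Y k = s}"
    by (elim exE)
  note b = spec[OF b']
  define h where "h k = b (X k) k" for k
  have h: "h k \<in> J" "Y (h k) = X k" if "k \<in> I" for k
    using bij_betwE[OF b[of "X k"]] that by (auto simp: h_def)
  have h_inj: "k = l" if "k \<in> I" "l \<in> I" "h k = h l" for k l
  proof -
    have "X k = X l" using h(2)[OF that(1)] h(2)[OF that(2)] that(3) by simp
    then show ?thesis
      using b[of "X k"] that by (auto simp: h_def bij_betw_def inj_on_def)
  qed
  have h_surj: "\<exists>k\<in>I. h k = l" if "l \<in> J" for l
  proof -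
    have "l \<in> b (Y l) ` {k \<in> I. X k = Y l}" using b[of "Y l"] that by (simp add: bij_betw_def)
    then obtain k where "k \<in> I" "X k = Y l" "l = b (Y l) k" by blast
    then show ?thesis by (intro bexI[of _ k]) (simp_all add: h_def)
  qed
  have "\<forall>v\<in>fst D. \<exists>p. fst p \<in> I \<and> snd p \<in> {1..symbol_rank (X (fst p))} \<and> v = f (fst p) (snd p)"
  proof
    fix v assume "v \<in> fst D"
    then obtain k i where "k \<in> I" "i \<in> {1..symbol_rank (X k)}" "v = f k i" unfolding A(4) by blast
    then show "\<exists>p. fst p \<in> I \<and> snd p \<in> {1..symbol_rank (X (fst p))} \<and> v = f (fst p) (snd p)"
      by (intro exI[of _ "(k, i)"]) simp
  qed
  from bchoice[OF this] obtain p where p': "\<forall>v\<in>fst D.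
      fst (p v) \<in> I \<and> snd (p v) \<in> {1..symbol_rank (X (fst (p v)))} \<and> v = f (fst (p v)) (snd (p v))"
    by (elim exE)
  have p: "fst (p v) \<in> I" "snd (p v) \<in> {1..symbol_rank (X (fst (p v)))}"
    "f (fst (p v)) (snd (p v)) = v" if "v \<in> fst D" for v
  proof -
    note P = bspec[OF p' that]
    show "fst (p v) \<in> I" by (rule P[THEN conjunct1])
    show "snd (p v) \<in> {1..symbol_rank (X (fst (p v)))}" by (rule P[THEN conjunct2, THEN conjunct1])
    show "f (fst (p v)) (snd (p v)) = v" by (rule P[THEN conjunct2, THEN conjunct2, symmetric])
  qed
  define g where "g v = f' (h (fst (p v))) (snd (p v))" for v
  have g: "g (f k i) = f' (h k) i" if "k \<in> I" "i \<in> {1..symbol_rank (X k)}" for k i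
  proof -
    have v: "f k i \<in> fst D" unfolding A(4) using that by blast
    have "k = fst (p (f k i)) \<and> i = snd (p (f k i))"
      using A(5)[OF that(1) p(1)[OF v] that(2) p(2)[OF v]] p(3)[OF v, symmetric] by (rule iffD1)
    then show ?thesis by (simp add: g_def)
  qed
  show ?thesis
    unfolding diagram_iso_def
  proof (intro exI[of _ g] conjI ballI)
    show "bij_betw g (fst D) (fst D')"
    proof (rule bij_betw_imageI)
      show "inj_on g (fst D)"
      proof (rule inj_onI)
        fix u v assume uv: "u \<in> fst D" "v \<in> fst D" "g u = g v"
        have "h (fst (p u)) = h (fst (p v)) \<and> snd (p u) = snd (p v)"
          using A'(5)[of "h (fst (p u))" "h (fst (p v))" "snd (p u)" "snd (p v)"] uv(3)
            h[OF p(1)[OF uv(1)]] h[OF p(1)[OF uv(2)]] p(2)[OF uv(1)] p(2)[OF uv(2)] by (simp add: g_def)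
        then show "u = v"
          using h_inj[OF p(1)[OF uv(1)] p(1)[OF uv(2)]] p(3)[OF uv(1)] p(3)[OF uv(2)] by metis
      qed
      show "g ` fst D = fst D'"
      proof (intro subset_antisym subsetI)
        fix w assume "w \<in> g ` fst D"
        then obtain v where v: "v \<in> fst D" "w = g v" by blast
        have "snd (p v) \<in> {1..symbol_rank (Y (h (fst (p v))))}"
          using h(2)[OF p(1)[OF v(1)]] p(2)[OF v(1)] by simp
        then show "w \<in> fst D'" unfolding A'(4) v(2) g_def using h(1)[OF p(1)[OF v(1)]] by blast
      next
        fix w assume "w \<in> fst D'"
        then obtain l i where l: "l \<in> J" "i \<in> {1..symbol_rank (Y l)}" "w = f' l i" unfolding A'(4) by blast
        obtain k where k: "k \<in> I" "h k = l" using h_surj[OF l(1)] by blast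
        have i: "i \<in> {1..symbol_rank (X k)}" using h(2)[OF k(1)] k(2) l(2) by simp
        then have "w = g (f k i)" using g[OF k(1) i] k(2) l(3) by simp
        moreover have "f k i \<in> fst D" unfolding A(4) using k(1) i by blast
        ultimately show "w \<in> g ` fst D" by blast
      qed
    qed
    fix u v assume uv: "u \<in> fst D" "v \<in> fst D"
    have "(u, v) \<in> snd D \<longleftrightarrow> fst (p u) = fst (p v)
        \<and> (snd (p u), snd (p v)) \<in> snd (symbol_diagram (X (fst (p u))))"
      using A(6)[OF p(1)[OF uv(1)] p(1)[OF uv(2)] p(2)[OF uv(1)] p(2)[OF uv(2)]]
        p(3)[OF uv(1)] p(3)[OF uv(2)] by simp
    moreover have "(g u, g v) \<in> snd D' \<longleftrightarrow> h (fst (p u)) = h (fst (p v))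
        \<and> (snd (p u), snd (p v)) \<in> snd (symbol_diagram (X (fst (p u))))"
      using A'(6)[of "h (fst (p u))" "h (fst (p v))" "snd (p u)" "snd (p v)"]
        h[OF p(1)[OF uv(1)]] h[OF p(1)[OF uv(2)]] p(2)[OF uv(1)] p(2)[OF uv(2)] by (simp add: g_def)
    moreover have "h (fst (p u)) = h (fst (p v)) \<longleftrightarrow> fst (p u) = fst (p v)"
      using h_inj[OF p(1)[OF uv(1)] p(1)[OF uv(2)]] by auto
    ultimately show "(u, v) \<in> snd D \<longleftrightarrow> (g u, g v) \<in> snd D'" by simp
  qed
qed

lemma type_diagram_decomposition:
  assumes "is_ade_type t"
  shows "ade_decomposition (type_diagram t) {(X, k). k < count t X} fst (\<lambda>(X, k) i. (X, k, i))"
    "image_mset fst (mset_set {(X, k). k < count t X}) = t"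
proof -
  let ?I = "{(X, k). k < count t X}"
  have "?I \<subseteq> set_mset t \<times> {..<size t}"
    by (auto simp: count_greater_zero_iff[symmetric] intro: less_le_trans[OF _ count_le_size] simp del: count_greater_zero_iff)
  then have fin: "finite ?I" by (rule finite_subset) simp
  have ok: "ade_symbol_ok X" if "k < count t X" for X k
    using assms that unfolding is_ade_type_def by (metis count_eq_zero_iff not_less_zero)
  show "ade_decomposition (type_diagram t) ?I fst (\<lambda>(X, k) i. (X, k, i))"
    unfolding ade_decomposition_def
  proof (intro conjI)
    show "snd (type_diagram t) \<subseteq> fst (type_diagram t) \<times> fst (type_diagram t)"
    proof
      fix e assume "e \<in> snd (type_diagram t)"
      then obtain X k i j where e: "e = ((X, k, i), (X, k, j))" "k < count t X" "(i, j) \<in> snd (symbol_diagram X)"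
        by (auto simp: type_diagram_def)
      then show "e \<in> fst (type_diagram t) \<times> fst (type_diagram t)"
        using symbol_edges_subset[OF ok[OF e(2)]] by (auto simp: type_diagram_def symbol_vertices)
    qed
    show "fst (type_diagram t) = (\<Union>k\<in>?I. (case k of (X, k) \<Rightarrow> \<lambda>i. (X, k, i)) ` {1..symbol_rank (fst k)})"
      by (auto simp: type_diagram_def symbol_vertices)
  qed (use fin ok in \<open>auto simp: type_diagram_def\<close>)
  have "{p \<in> ?I. fst p = s} = Pair s ` {..<count t s}" for s by auto
  then have "card {p \<in> ?I. fst p = s} = count t s" for s by (simp add: card_image inj_on_def)
  then show "image_mset fst (mset_set ?I) = t"
    by (intro multiset_eqI) (simp only: count_image_mset_set[OF fin])
qed

lemma type_diagram_type: "is_ade_type t \<Longrightarrow> diagram_type (type_diagram t) = t"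
  and type_diagram_ade: "is_ade_type t \<Longrightarrow> is_ade_diagram (type_diagram t)"
  using ade_decomposition_type[OF type_diagram_decomposition(1)] type_diagram_decomposition(2) by simp_all

lemma diagram_iso_type_diagram:
  assumes "is_ade_diagram D" "finite (fst D)" "snd D \<subseteq> fst D \<times> fst D" "sym (snd D)"
  shows "is_ade_type (diagram_type D)" "diagram_iso (type_diagram (diagram_type D)) D"
proof -
  obtain X f where dec: "ade_decomposition D (diagram_components D) X f"
    using ade_decomposition_exists[OF assms] by blast
  note T = ade_decomposition_type(2)[OF dec]
  show t: "is_ade_type (diagram_type D)"
    unfolding is_ade_type_def T using ade_decompositionD(1,3)[OF dec] by auto
  show "diagram_iso (type_diagram (diagram_type D)) D"
    by (rule diagram_iso_if_same_type[OF type_diagram_decomposition(1)[OF t] dec])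
      (simp add: T type_diagram_decomposition(2)[OF t[unfolded T]])
qed

lemma diagram_iso_imp_same_type:
  assumes "is_ade_diagram D" "finite (fst D)" "snd D \<subseteq> fst D \<times> fst D" "sym (snd D)"
    "diagram_iso D D'" "snd D' \<subseteq> fst D' \<times> fst D'"
  shows "is_ade_diagram D'" "diagram_type D' = diagram_type D"
proof -
  obtain X f where dec: "ade_decomposition D (diagram_components D) X f"
    using ade_decomposition_exists[OF assms(1-4)] by blast
  obtain f' where dec': "ade_decomposition D' (diagram_components D) X f'"
    using diagram_iso_decomposition[OF dec assms(5,6)] by blast
  show "is_ade_diagram D'" "diagram_type D' = diagram_type D"
    using ade_decomposition_type[OF dec] ade_decomposition_type[OF dec'] by simp_all
qed

section \<open>ADE-configurations are negative definite\<close>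

definition gram_sum :: "(nat \<Rightarrow> nat \<Rightarrow> real) \<Rightarrow> nat set \<Rightarrow> (nat \<Rightarrow> real) \<Rightarrow> real" where
  "gram_sum G S y = (\<Sum>i\<in>S. \<Sum>j\<in>S. y i * y j * G i j)"

lemma gram_sum_insert:
  assumes "finite S" "n \<notin> S" "\<And>i. i \<in> S \<Longrightarrow> G n i = G i n"
  shows "gram_sum G (insert n S) y = gram_sum G S y + G n n * (y n)\<^sup>2 + 2 * y n * (\<Sum>i\<in>S. y i * G i n)"
proof -
  have "(\<Sum>i\<in>S. y n * y i * G n i) = y n * (\<Sum>i\<in>S. y i * G i n)"
    unfolding sum_distrib_left by (intro sum.cong refl) (simp add: assms(3))
  moreover have "(\<Sum>i\<in>S. y i * y n * G i n) = y n * (\<Sum>i\<in>S. y i * G i n)"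
    unfolding sum_distrib_left by (intro sum.cong refl) simp
  ultimately show ?thesis
    using assms(1,2) by (simp add: gram_sum_def sum.distrib power2_eq_square algebra_simps)
qed

lemma gram_sum_chain:
  assumes "1 \<le> l" "\<And>i j. i \<in> {1..l} \<Longrightarrow> j \<in> {1..l} \<Longrightarrow>
    G i j = (if i = j then - 2 else if j = Suc i \<or> i = Suc j then 1 else 0)"
  shows "gram_sum G {1..l} y = - ((y 1)\<^sup>2 + (y l)\<^sup>2 + (\<Sum>i\<in>{1..<l}. (y i - y (Suc i))\<^sup>2))"
  using assms
proof (induction l rule: dec_induct)
  case base
  then show ?case by (simp add: gram_sum_def power2_eq_square)
next
  case (step l)
  have IH: "gram_sum G {1..l} y = - ((y 1)\<^sup>2 + (y l)\<^sup>2 + (\<Sum>i\<in>{1..<l}. (y i - y (Suc i))\<^sup>2))"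
    by (rule step.IH) (use step.prems in simp)
  have G: "G (Suc l) (Suc l) = - 2" using step.prems[of "Suc l" "Suc l"] step.hyps by simp
  have "(\<Sum>i\<in>{1..l}. y i * G i (Suc l)) = (\<Sum>i\<in>{1..l}. if i = l then y i else 0)"
    using step.prems by (intro sum.cong refl) auto
  then have s: "(\<Sum>i\<in>{1..l}. y i * G i (Suc l)) = y l" using step.hyps by simp
  have e: "{1..Suc l} = insert (Suc l) {1..l}" by auto
  have "gram_sum G {1..Suc l} y = gram_sum G {1..l} y - 2 * (y (Suc l))\<^sup>2 + 2 * y (Suc l) * y l"
  proof -
    have "G (Suc l) i = G i (Suc l)" if "i \<in> {1..l}" for i
      using step.prems[of "Suc l" i] step.prems[of i "Suc l"] that by auto
    then have "gram_sum G (insert (Suc l) {1..l}) y = gram_sum G {1..l} y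
        + G (Suc l) (Suc l) * (y (Suc l))\<^sup>2 + 2 * y (Suc l) * (\<Sum>i\<in>{1..l}. y i * G i (Suc l))"
      by (intro gram_sum_insert) auto
    then show ?thesis unfolding e s G by simp
  qed
  moreover have "(\<Sum>i\<in>{1..<Suc l}. (y i - y (Suc i))\<^sup>2)
      = (\<Sum>i\<in>{1..<l}. (y i - y (Suc i))\<^sup>2) + (y l - y (Suc l))\<^sup>2"
    using step.hyps by simp
  ultimately show ?case unfolding IH by (simp add: power2_eq_square algebra_simps)
qed

lemma chain_zero:
  fixes y :: "nat \<Rightarrow> real"
  assumes "y 1 = 0" "\<And>i. i \<in> {1..<l} \<Longrightarrow> y i - y (Suc i) = 0" "i \<in> {1..l}"
  shows "y i = 0"
proof -
  have "1 \<le> i" using assms(3) by simp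
  then have "i \<le> l \<longrightarrow> y i = 0"
  proof (induction i rule: dec_induct)
    case (step n)
    have "y n - y (Suc n) = 0" if "Suc n \<le> l" by (rule assms(2)) (use step.hyps that in simp)
    then show ?case using step.IH by auto
  qed (use assms(1) in simp)
  then show ?thesis using assms(3) by simp
qed

text \<open>Completing squares, starting from the ends of the arms.\<close>

lemma symbol_gram_neg_def:
  assumes "ade_symbol_ok X" "0 \<le> gram_sum (diagram_gram (symbol_diagram X)) {1..symbol_rank X} y"
    "i \<in> {1..symbol_rank X}"
  shows "y i = 0"
proof (cases X)
  case (Type_A l)
  have l: "1 \<le> l" using assms(1) Type_A by simp
  have "gram_sum (diagram_gram (a_diagram l)) {1..l} y
      = - ((y 1)\<^sup>2 + (y l)\<^sup>2 + (\<Sum>i\<in>{1..<l}. (y i - y (Suc i))\<^sup>2))"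
    by (rule gram_sum_chain[OF l]) (auto simp: diagram_gram_def a_diagram_def chain_edges_def)
  moreover have s: "0 \<le> (\<Sum>i\<in>{1..<l}. (y i - y (Suc i))\<^sup>2)" by (intro sum_nonneg) simp
  moreover have "0 \<le> gram_sum (diagram_gram (a_diagram l)) {1..l} y" using assms(2) Type_A by simp
  ultimately have "(y 1)\<^sup>2 = 0" "(\<Sum>i\<in>{1..<l}. (y i - y (Suc i))\<^sup>2) = 0"
    using zero_le_power2[of "y 1"] zero_le_power2[of "y l"] by linarith+
  moreover have "y j - y (Suc j) = 0" if "j \<in> {1..<l}" for j
    using calculation(2) that by (subst (asm) sum_nonneg_eq_0_iff) auto
  moreover have "i \<in> {1..l}" using assms(3) Type_A by simp
  ultimately show ?thesis by (intro chain_zero[of y l i]) simp_all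
next
  case (Type_D m)
  have m: "4 \<le> m" using assms(1) Type_D by simp
  let ?G = "diagram_gram (d_diagram m)"
  define s where "s = (\<Sum>i\<in>{1..<m - 2}. (y i - y (Suc i))\<^sup>2)"
  have e: "{1..m} = insert m {1..m - 1}" "{1..<m - 1} = insert (m - 2) {1..<m - 2}" using m by auto
  have "gram_sum ?G {1..m - 1} y
      = - ((y 1)\<^sup>2 + (y (m - 1))\<^sup>2 + (\<Sum>i\<in>{1..<m - 1}. (y i - y (Suc i))\<^sup>2))"
    by (rule gram_sum_chain) (use m in \<open>auto simp: diagram_gram_def d_diagram_def chain_edges_def\<close>)
  moreover have "(\<Sum>i\<in>{1..<m - 1}. (y i - y (Suc i))\<^sup>2) = s + (y (m - 2) - y (m - 1))\<^sup>2"
  proof -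
    have "Suc (m - 2) = m - 1" using m by simp
    then show ?thesis unfolding e(2) s_def by simp
  qed
  ultimately have c: "gram_sum ?G {1..m - 1} y
      = - ((y 1)\<^sup>2 + (y (m - 1))\<^sup>2 + s + (y (m - 2) - y (m - 1))\<^sup>2)" by simp
  have "(\<Sum>i\<in>{1..m - 1}. y i * ?G i m) = (\<Sum>i\<in>{1..m - 1}. if i = m - 2 then y i else 0)"
    using m by (intro sum.cong refl) (auto simp: diagram_gram_def d_diagram_def chain_edges_def)
  also have "\<dots> = y (m - 2)" using m by (subst sum.delta) auto
  finally have t: "(\<Sum>i\<in>{1..m - 1}. y i * ?G i m) = y (m - 2)" .
  have "gram_sum ?G {1..m} y = gram_sum ?G {1..m - 1} y - 2 * (y m)\<^sup>2 + 2 * y m * y (m - 2)"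
  proof -
    have "gram_sum ?G (insert m {1..m - 1}) y = gram_sum ?G {1..m - 1} y
        + ?G m m * (y m)\<^sup>2 + 2 * y m * (\<Sum>i\<in>{1..m - 1}. y i * ?G i m)"
      using m by (intro gram_sum_insert) (auto simp: diagram_gram_def d_diagram_def chain_edges_def)
    moreover have "?G m m = - 2" by (simp add: diagram_gram_def)
    ultimately show ?thesis unfolding e(1) t by simp
  qed
  then have "gram_sum ?G {1..m} y
      = - ((y 1)\<^sup>2 + s + (y (m - 2) - y (m - 1) - y m)\<^sup>2 + (y (m - 1) - y m)\<^sup>2)"
    unfolding c by (simp add: power2_eq_square algebra_simps)
  then have "(y 1)\<^sup>2 + s + (y (m - 2) - y (m - 1) - y m)\<^sup>2 + (y (m - 1) - y m)\<^sup>2 \<le> 0"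
    using assms(2) Type_D by simp
  moreover have "0 \<le> s" unfolding s_def by (intro sum_nonneg) simp
  ultimately have z: "(y 1)\<^sup>2 = 0" "s = 0" "(y (m - 2) - y (m - 1) - y m)\<^sup>2 = 0" "(y (m - 1) - y m)\<^sup>2 = 0"
    using zero_le_power2[of "y 1"] zero_le_power2[of "y (m - 2) - y (m - 1) - y m"]
      zero_le_power2[of "y (m - 1) - y m"] by linarith+
  have low: "y j = 0" if "j \<in> {1..m - 2}" for j
  proof (rule chain_zero[OF _ _ that])
    show "y 1 = 0" using z(1) by simp
    show "y i - y (Suc i) = 0" if "i \<in> {1..<m - 2}" for i
      using z(2) that unfolding s_def by (subst (asm) sum_nonneg_eq_0_iff) auto
  qed
  have "y (m - 2) = 0" using low m by simp
  then have "y (m - 1) = 0" "y m = 0" using z(3,4) by simp_all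
  moreover have "i \<in> {1..m - 2} \<or> i = m - 1 \<or> i = m" using assms(3) Type_D by auto
  ultimately show ?thesis using low by auto
next
  case (Type_E n)
  have n: "n \<in> {6, 7, 8}" using assms(1) Type_E by simp
  define z where "z k = (if k \<in> {1..n} then y k else 0)" for k
  have "gram_sum (diagram_gram (e_diagram n)) {1..n} y
      = gram_sum (diagram_gram (e_diagram 8)) {1..n} z"
    unfolding gram_sum_def using n
    by (intro sum.cong refl) (auto simp: z_def diagram_gram_def e_diagram_def chain_edges_def)
  also have "\<dots> = (\<Sum>i\<in>{1..8}. \<Sum>j\<in>{1..n}. z i * z j * diagram_gram (e_diagram 8) i j)"
    unfolding gram_sum_def using n by (intro sum.mono_neutral_left) (auto simp: z_def)
  also have "\<dots> = gram_sum (diagram_gram (e_diagram 8)) {1..8} z"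
    unfolding gram_sum_def using n by (intro sum.cong refl sum.mono_neutral_left) (auto simp: z_def)
  also have "\<dots> = - ((2 * z 2 - z 3)\<^sup>2 / 2 + (3 * z 3 - 2 * z 4)\<^sup>2 / 6 + (2 * z 1 - z 4)\<^sup>2 / 2
      + (2 * z 8 - z 7)\<^sup>2 / 2 + (3 * z 7 - 2 * z 6)\<^sup>2 / 6 + (4 * z 6 - 3 * z 5)\<^sup>2 / 12
      + (5 * z 5 - 4 * z 4)\<^sup>2 / 20 + (z 4)\<^sup>2 / 30)"
  proof -
    have e: "{1..8::nat} = {1, 2, 3, 4, 5, 6, 7, 8}" by (rule set_eqI) (simp, presburger)
    show ?thesis unfolding gram_sum_def e
      by (simp add: diagram_gram_def e_diagram_def chain_edges_def power2_eq_square field_simps)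
  qed
  finally have le: "(2 * z 2 - z 3)\<^sup>2 / 2 + (3 * z 3 - 2 * z 4)\<^sup>2 / 6 + (2 * z 1 - z 4)\<^sup>2 / 2
      + (2 * z 8 - z 7)\<^sup>2 / 2 + (3 * z 7 - 2 * z 6)\<^sup>2 / 6 + (4 * z 6 - 3 * z 5)\<^sup>2 / 12
      + (5 * z 5 - 4 * z 4)\<^sup>2 / 20 + (z 4)\<^sup>2 / 30 \<le> 0"
    using assms(2) Type_E by simp
  have sq: "0 \<le> x\<^sup>2" for x :: real by simp
  have "(2 * z 2 - z 3)\<^sup>2 = 0" "(3 * z 3 - 2 * z 4)\<^sup>2 = 0" "(2 * z 1 - z 4)\<^sup>2 = 0"
    "(2 * z 8 - z 7)\<^sup>2 = 0" "(3 * z 7 - 2 * z 6)\<^sup>2 = 0" "(4 * z 6 - 3 * z 5)\<^sup>2 = 0"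
    "(5 * z 5 - 4 * z 4)\<^sup>2 = 0" "(z 4)\<^sup>2 = 0"
    using le sq[of "2 * z 2 - z 3"] sq[of "3 * z 3 - 2 * z 4"] sq[of "2 * z 1 - z 4"]
      sq[of "2 * z 8 - z 7"] sq[of "3 * z 7 - 2 * z 6"] sq[of "4 * z 6 - 3 * z 5"]
      sq[of "5 * z 5 - 4 * z 4"] sq[of "z 4"] by linarith+
  then have "z k = 0" if "k \<in> {1, 2, 3, 4, 5, 6, 7, 8}" for k using that by auto
  moreover have "i \<in> {1..n}" using assms(3) Type_E by simp
  moreover have "i \<in> {1, 2, 3, 4, 5, 6, 7, 8}" using \<open>i \<in> {1..n}\<close> n by auto
  ultimately have "z i = 0" by blast
  then show ?thesis using \<open>i \<in> {1..n}\<close> by (simp add: z_def)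
qed

context symmetric_form
begin

lemma dynkin_diagram_wf:
  "snd (dynkin_diagram B \<Phi>) \<subseteq> fst (dynkin_diagram B \<Phi>) \<times> fst (dynkin_diagram B \<Phi>)"
  "sym (snd (dynkin_diagram B \<Phi>))" "fst (dynkin_diagram B \<Phi>) = \<Phi>"
  by (auto simp: dynkin_diagram_def sym_def B_sym)

text \<open>A vector in the span of the roots splits into orthogonal parts, one for each component of the
  diagram. If its norm is non-negative, all coefficients vanish. This gives both that the form is
  definite and that the roots are independent.\<close>

lemma ade_simple_system:
  assumes "finite \<Phi>" "\<And>r. r \<in> \<Phi> \<Longrightarrow> B r r = - 2"
    "\<And>r s. r \<in> \<Phi> \<Longrightarrow> s \<in> \<Phi> \<Longrightarrow> r \<noteq> s \<Longrightarrow> B r s \<in> {0, 1}" "is_ade_diagram (dynkin_diagram B \<Phi>)"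
  shows "simple_system \<Phi>"
proof -
  let ?D = "dynkin_diagram B \<Phi>"
  have "finite (fst ?D)" using assms(1) by (simp add: dynkin_diagram_def)
  then obtain X f where dec: "ade_decomposition ?D (diagram_components ?D) X f"
    using ade_decomposition_exists[OF assms(4) _ dynkin_diagram_wf(1,2)] by blast
  define I where "I = diagram_components ?D"
  note A = ade_decompositionD[OF dec, folded I_def]
  let ?V = "\<lambda>k. {1..symbol_rank (X k)}"
  have \<Phi>: "\<Phi> = (\<Union>k\<in>I. f k ` ?V k)" using A(4) by (simp add: dynkin_diagram_def)
  have mem: "f k i \<in> \<Phi>" if "k \<in> I" "i \<in> ?V k" for k i unfolding \<Phi> using that by blast
  have Bf: "B (f k i) (f l j) = (if k = l then diagram_gram (symbol_diagram (X k)) i j else 0)"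
    if "k \<in> I" "l \<in> I" "i \<in> ?V k" "j \<in> ?V l" for k l i j
  proof (cases "f k i = f l j")
    case True
    then show ?thesis
      using A(5)[OF that] assms(2)[OF mem[OF that(1,3)]] by (simp add: diagram_gram_def)
  next
    case False
    have "B (f k i) (f l j) = (if (f k i, f l j) \<in> snd ?D then 1 else 0)"
      using assms(3)[OF mem[OF that(1,3)] mem[OF that(2,4)] False] mem[OF that(1,3)] mem[OF that(2,4)] False
      by (auto simp: dynkin_diagram_def)
    then show ?thesis using A(5)[OF that] A(6)[OF that] False by (auto simp: diagram_gram_def)
  qed
  have norm: "B (\<Sum>r\<in>\<Phi>. c r *\<^sub>R r) (\<Sum>r\<in>\<Phi>. c r *\<^sub>R r)
      = (\<Sum>k\<in>I. gram_sum (diagram_gram (symbol_diagram (X k))) (?V k) (\<lambda>i. c (f k i)))" for c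
  proof -
    have sum_\<Phi>: "(\<Sum>r\<in>\<Phi>. h r) = (\<Sum>k\<in>I. \<Sum>i\<in>?V k. h (f k i))" for h :: "'v \<Rightarrow> 'w::comm_monoid_add"
    proof -
      have "(\<Sum>r\<in>\<Phi>. h r) = (\<Sum>k\<in>I. \<Sum>r\<in>f k ` ?V k. h r)"
        unfolding \<Phi>
      proof (rule sum.UNION_disjoint)
        show "\<forall>k\<in>I. \<forall>l\<in>I. k \<noteq> l \<longrightarrow> f k ` ?V k \<inter> f l ` ?V l = {}"
        proof (intro ballI impI equals0I)
          fix k l v assume kl: "k \<in> I" "l \<in> I" "k \<noteq> l" "v \<in> f k ` ?V k \<inter> f l ` ?V l"
          then obtain i j where ij: "i \<in> ?V k" "j \<in> ?V l" "v = f k i" "v = f l j"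
            by (elim IntE imageE)
          then have "f k i = f l j" by simp
          then show False using A(5)[OF kl(1,2) ij(1,2)] kl(3) by simp
        qed
      qed (use A(1) in auto)
      also have "\<dots> = (\<Sum>k\<in>I. \<Sum>i\<in>?V k. h (f k i))"
      proof (intro sum.cong refl)
        fix k assume k: "k \<in> I"
        have "inj_on (f k) (?V k)" using A(5)[OF k k] by (auto intro: inj_onI)
        then show "sum h (f k ` ?V k) = (\<Sum>i\<in>?V k. h (f k i))" by (simp add: sum.reindex)
      qed
      finally show ?thesis .
    qed
    have swap: "c r * (c s * B s r) = c r * c s * B r s" for r s by (subst B_sym[of s r]) simp
    have "B (\<Sum>r\<in>\<Phi>. c r *\<^sub>R r) (\<Sum>r\<in>\<Phi>. c r *\<^sub>R r) = (\<Sum>r\<in>\<Phi>. \<Sum>s\<in>\<Phi>. c r * c s * B r s)"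
      unfolding B_sum_right unfolding B_sum_left B_simps sum_distrib_left
      by (simp only: swap)
    also have "\<dots> = (\<Sum>k\<in>I. \<Sum>i\<in>?V k. \<Sum>l\<in>I. \<Sum>j\<in>?V l. c (f k i) * c (f l j) * B (f k i) (f l j))"
      by (simp only: sum_\<Phi>)
    also have "\<dots> = (\<Sum>k\<in>I. \<Sum>i\<in>?V k. \<Sum>l\<in>I. if l = k then
        \<Sum>j\<in>?V k. c (f k i) * c (f k j) * diagram_gram (symbol_diagram (X k)) i j else 0)"
      using Bf by (intro sum.cong refl) auto
    also have "\<dots> = (\<Sum>k\<in>I. gram_sum (diagram_gram (symbol_diagram (X k))) (?V k) (\<lambda>i. c (f k i)))"
      using A(1) by (simp add: gram_sum_def)
    finally show ?thesis .
  qed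
  have zero: "c r = 0" if le: "0 \<le> B (\<Sum>r\<in>\<Phi>. c r *\<^sub>R r) (\<Sum>r\<in>\<Phi>. c r *\<^sub>R r)" and r: "r \<in> \<Phi>" for c r
  proof -
    let ?g = "\<lambda>k. gram_sum (diagram_gram (symbol_diagram (X k))) (?V k) (\<lambda>i. c (f k i))"
    have le0: "?g k \<le> 0" if "k \<in> I" for k
    proof (rule ccontr)
      assume "\<not> ?g k \<le> 0"
      moreover from this have "c (f k i) = 0" if "i \<in> ?V k" for i
        using symbol_gram_neg_def[OF A(3)[OF \<open>k \<in> I\<close>], of "\<lambda>i. c (f k i)" i] that by simp
      then have "?g k = 0" by (simp add: gram_sum_def)
      ultimately show False by simp
    qed
    have "(\<Sum>k\<in>I. - ?g k) \<le> 0" using le by (simp add: norm sum_negf)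
    moreover have "0 \<le> (\<Sum>k\<in>I. - ?g k)" using le0 by (intro sum_nonneg) simp
    ultimately have "(\<Sum>k\<in>I. - ?g k) = 0" by simp
    then have g0: "?g k = 0" if "k \<in> I" for k
      using sum_nonneg_eq_0_iff[OF A(1), of "\<lambda>k. - ?g k"] le0 that by simp
    obtain k i where ki: "k \<in> I" "i \<in> ?V k" "r = f k i" using r unfolding \<Phi> by blast
    then show ?thesis
      using symbol_gram_neg_def[OF A(3)[OF ki(1)], of "\<lambda>i. c (f k i)" i] g0[OF ki(1)] by simp
  qed
  have "independent \<Phi>"
  proof (rule independent_if_scalars_zero[OF assms(1)])
    fix c r assume "(\<Sum>r\<in>\<Phi>. c r *\<^sub>R r) = 0" "r \<in> \<Phi>"
    then show "c r = 0" using zero[of c r] by simp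
  qed
  moreover have "neg_def \<Phi>"
    unfolding neg_def_def
  proof (intro ballI impI)
    fix x assume x: "x \<in> span \<Phi>" "x \<noteq> 0"
    then obtain c where c: "x = (\<Sum>r\<in>\<Phi>. c r *\<^sub>R r)" unfolding span_finite[OF assms(1)] by blast
    show "B x x < 0"
    proof (rule ccontr)
      assume "\<not> B x x < 0"
      then have "c r = 0" if "r \<in> \<Phi>" for r using zero[of c r] that by (simp add: c)
      then show False using x(2) by (simp add: c)
    qed
  qed
  ultimately show ?thesis using assms(1-3) by (simp add: simple_system_def)
qed

end

section \<open>The chamber of \<open>L10\<close>\<close>

interpretation L: symmetric_form L10_form
  by unfold_locales (simp_all add: L10_form_def bilinear_diagram_form L10_form_sym[unfolded L10_form_def])

abbreviation ev :: "nat \<Rightarrow> (nat \<Rightarrow>\<^sub>0 real)" where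
  "ev \<equiv> vertex_vector"

abbreviation W10 :: "((nat \<Rightarrow>\<^sub>0 real) \<Rightarrow> (nat \<Rightarrow>\<^sub>0 real)) set" where
  "W10 \<equiv> L.weyl (L.root_set L10)"

lemma L10_zspan: "L10 = zspan (ev ` {1..10})"
  using zbasis_L10 by (simp add: zbasis_def E10_basis_def)

lemma L10_subspace: "Z.subspace L10"
  unfolding L10_zspan by (rule Z.subspace_span)

lemma L10_integral: "x \<in> L10 \<Longrightarrow> y \<in> L10 \<Longrightarrow> L10_form x y \<in> \<int>"
  using is_lattice_L10 by (simp add: is_lattice_def)

lemma L10_form_ev:
  "L10_form (ev i) (ev j) = diagram_gram (e_diagram 10) i j"
  by (simp add: L10_form_def diagram_form_vertex_vector)

lemma W10_linear: "g \<in> W10 \<Longrightarrow> linear g"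
  by (rule L.weyl_linear)

lemma W10_isometry: "g \<in> W10 \<Longrightarrow> L10_form (g x) (g y) = L10_form x y"
  by (erule L.weyl_isometry) (rule L.root_setD(2))

lemma W10_inverse: "g \<in> W10 \<Longrightarrow> \<exists>h\<in>W10. g \<circ> h = id \<and> h \<circ> g = id"
  by (erule L.weyl_inverse) (rule L.root_setD(2))

lemma W10_inj: "g \<in> W10 \<Longrightarrow> inj g"
  by (erule L.weyl_inj) (rule L.root_setD(2))

lemma W10_image: "g \<in> W10 \<Longrightarrow> g ` L10 = L10"
  by (erule L.weyl_image) (auto simp: L.root_set_def L10_subspace L10_integral)

lemma W10_mem: "g \<in> W10 \<Longrightarrow> x \<in> L10 \<Longrightarrow> g x \<in> L10"
  using W10_image by blast

lemma zspan_subset_L10: "S \<subseteq> L10 \<Longrightarrow> zspan S \<subseteq> L10"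
  by (rule Z.span_minimal[OF _ L10_subspace])

lemma weyl_subset_W10: "S \<subseteq> L.root_set L10 \<Longrightarrow> L.weyl S \<subseteq> W10"
  by (rule L.weyl_mono)

text \<open>A reflection fixes each positive cone, because the segment from \<open>x\<close> to its image stays where
  the form is positive.\<close>

lemma reflect_segment_positive:
  assumes "L10_form r r = - 2" "0 < L10_form x x" "0 \<le> t" "t \<le> 1"
  shows "0 < L10_form (x + (t * L10_form x r) *\<^sub>R r) (x + (t * L10_form x r) *\<^sub>R r)"
proof -
  have "L10_form (x + (t * L10_form x r) *\<^sub>R r) (x + (t * L10_form x r) *\<^sub>R r)
      = L10_form x x + 2 * (t * (1 - t)) * (L10_form x r)\<^sup>2"
    by (simp add: assms(1) L10_form_sym[of r x] power2_eq_square algebra_simps)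
  moreover have "0 \<le> 2 * (t * (1 - t)) * (L10_form x r)\<^sup>2" using assms(3,4) by simp
  ultimately show ?thesis using assms(2) by linarith
qed

lemma W10_subset_O_plus: "W10 \<subseteq> O_plus L10_form L10"
proof
  fix g assume g: "g \<in> W10"
  let ?S = "{x \<in> span L10. 0 < L10_form x x}"
  have "?S \<noteq> {}"
  proof -
    obtain b where b: "span b = span L10" "card {x \<in> b. 0 < L10_form x x} = 1"
      using hyperbolic_L10 unfolding hyperbolic_def has_signature_def by blast
    then obtain p where "p \<in> b" "0 < L10_form p p" by (auto simp: card_1_singleton_iff)
    moreover have "p \<in> span L10" using \<open>p \<in> b\<close> b(1) span_base by blast
    ultimately show ?thesis by blast
  qed
  then obtain z where z: "z \<in> ?S" by blast
  define P where "P = connected_component_set ?S z"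
  have P: "P \<in> components ?S" unfolding P_def components_def using z by blast
  have sub: "h ` P \<subseteq> P" if "h \<in> W10" for h
    using that
  proof (induction rule: L.weyl.induct)
    case (weyl_step h r)
    have r: "r \<in> L10" "L10_form r r = - 2" using L.root_setD weyl_step(2) by auto
    show ?case
    proof (rule image_subsetI)
      fix x assume "x \<in> P"
      then have y: "h x \<in> P" using weyl_step.IH by blast
      let ?y = "h x"
      have yS: "?y \<in> ?S" using y connected_component_subset[of ?S z] unfolding P_def by blast
      have "closed_segment ?y (L.reflect r ?y) \<subseteq> ?S"
      proof
        fix w assume "w \<in> closed_segment ?y (L.reflect r ?y)"
        then obtain t where t: "0 \<le> t" "t \<le> 1" "w = (1 - t) *\<^sub>R ?y + t *\<^sub>R L.reflect r ?y"
          unfolding closed_segment_def by blast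
        have w: "w = ?y + (t * L10_form ?y r) *\<^sub>R r"
          unfolding t(3) L.reflect_def by (simp add: algebra_simps)
        have "w \<in> span L10"
          unfolding w by (rule span_add[OF _ span_scale[OF span_base[OF r(1)]]]) (use yS in simp)
        moreover have "0 < L10_form w w"
          unfolding w by (rule reflect_segment_positive[OF r(2) _ t(1,2)]) (use yS in simp)
        ultimately show "w \<in> ?S" by simp
      qed
      then have "connected_component ?S ?y (L.reflect r ?y)"
        unfolding connected_component_def
        by (intro exI[of _ "closed_segment ?y (L.reflect r ?y)"]) simp
      then have "connected_component ?S z (L.reflect r ?y)"
        using y unfolding P_def by (simp add: connected_component_trans)
      then show "(L.reflect r \<circ> h) x \<in> P" by (simp add: P_def)
    qed
  qed simp
  have "g ` P = P"
  proof
    obtain h where h: "h \<in> W10" "g \<circ> h = id" using W10_inverse[OF g] by blast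
    have "P = g ` (h ` P)" using h(2) by (simp add: image_comp)
    also have "\<dots> \<subseteq> g ` P" by (rule image_mono[OF sub[OF h(1)]])
    finally show "P \<subseteq> g ` P" .
  qed (rule sub[OF g])
  moreover have "lattice_isometry L10_form L10 L10_form L10 g"
    unfolding lattice_isometry_def bij_betw_def
    using W10_linear[OF g] W10_image[OF g] W10_isometry[OF g] inj_on_subset[OF W10_inj[OF g]] by blast
  ultimately show "g \<in> O_plus L10_form L10"
    using P unfolding O_plus_def positive_cones_def by blast
qed

text \<open>The form has only one positive square, so that it is not positive semi-definite on a plane.\<close>

lemma no_semidefinite_plane:
  assumes "x \<in> span L10" "w \<in> span L10" "0 \<le> L10_form w w" "L10_form x w = 0" "0 \<le> L10_form x x"
  shows "\<exists>a b. (a \<noteq> 0 \<or> b \<noteq> 0) \<and> a *\<^sub>R x + b *\<^sub>R w = 0"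
proof -
  obtain b where b: "finite b" "span b = span L10" "\<And>x y. x \<in> b \<Longrightarrow> y \<in> b \<Longrightarrow> x \<noteq> y \<Longrightarrow> L10_form x y = 0"
    "card {x \<in> b. 0 < L10_form x x} = 1" "1 + card {x \<in> b. L10_form x x < 0} = card b"
    using hyperbolic_L10 unfolding hyperbolic_def has_signature_def
    by (elim exE conjE) (simp add: dim_L10)
  obtain p where p: "{x \<in> b. 0 < L10_form x x} = {p}" using b(4) by (auto simp: card_1_singleton_iff)
  then have pb: "p \<in> b" "0 < L10_form p p" by auto
  have "{x \<in> b. L10_form x x < 0} = b - {p}"
  proof (rule card_subset_eq)
    show "card {x \<in> b. L10_form x x < 0} = card (b - {p})" using b(1,5) pb(1) by simp
  qed (use b(1) p pb in \<open>auto dest: less_asym\<close>)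
  then have neg: "L10_form v v < 0" if "v \<in> b - {p}" for v using that by blast
  have zero: "y = 0" if y: "y \<in> span L10" "L10_form y p = 0" "0 \<le> L10_form y y" for y
  proof -
    obtain c where c: "y = (\<Sum>v\<in>b. c v *\<^sub>R v)" using y(1) b(2) span_finite[OF b(1)] by auto
    have yv: "L10_form y v = c v * L10_form v v" if v: "v \<in> b" for v
    proof -
      have "L10_form y v = (\<Sum>u\<in>b. if u = v then c v * L10_form v v else 0)"
        unfolding c L.B_sum_left using b(3)[OF _ v] by (intro sum.cong refl) auto
      then show ?thesis using b(1) v by simp
    qed
    have cp: "c p = 0" using yv[OF pb(1)] y(2) pb(2) by simp
    have "L10_form y y = (\<Sum>v\<in>b. c v * L10_form y v)" by (subst (2) c) (simp add: L.B_sum_right)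
    also have "\<dots> = (\<Sum>v\<in>b. c v * (c v * L10_form v v))" using yv by (intro sum.cong refl) simp
    finally have "(\<Sum>v\<in>b. - (c v * (c v * L10_form v v))) \<le> 0" using y(3) by (simp add: sum_negf)
    moreover have t: "0 \<le> - (c v * (c v * L10_form v v))" if "v \<in> b" for v
      using neg[of v] that cp
      by (cases "v = p") (auto simp: mult.assoc[symmetric] mult_le_0_iff)
    ultimately have "(\<Sum>v\<in>b. - (c v * (c v * L10_form v v))) = 0"
      by (meson order_antisym sum_nonneg)
    then have "\<forall>v\<in>b. - (c v * (c v * L10_form v v)) = 0"
      using sum_nonneg_eq_0_iff[OF b(1), of "\<lambda>v. - (c v * (c v * L10_form v v))"] t by simp
    then have "c v = 0" if "v \<in> b" for v
      using that cp neg[of v] by (cases "v = p") force+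
    then show "y = 0" by (simp add: c)
  qed
  let ?a = "L10_form w p" and ?b = "- L10_form x p"
  show ?thesis
  proof (cases "L10_form x p = 0")
    case True
    then have "x = 0" using zero[OF assms(1)] assms(5) by simp
    then show ?thesis by (intro exI[of _ 1] exI[of _ 0]) simp
  next
    case False
    let ?y = "?a *\<^sub>R x + ?b *\<^sub>R w"
    have "L10_form ?y ?y = ?a * ?a * L10_form x x + ?b * ?b * L10_form w w"
      using assms(4) by (simp add: L10_form_sym[of w x] algebra_simps)
    then have "0 \<le> L10_form ?y ?y" using assms(3,5) by simp
    moreover have "?y \<in> span L10" by (intro span_add span_scale assms(1,2))
    moreover have "L10_form ?y p = 0" by simp
    ultimately have "?y = 0" by (intro zero)
    then show ?thesis using False by (intro exI[of _ ?a] exI[of _ ?b]) simp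
  qed
qed

text \<open>Otherwise the two vectors would span a plane on which the form is positive semi-definite.\<close>

lemma orthogonal_to_positive:
  assumes "x \<in> span L10" "w \<in> span L10" "0 < L10_form w w" "L10_form x w = 0" "x \<noteq> 0"
  shows "L10_form x x < 0"
proof (rule ccontr)
  assume "\<not> L10_form x x < 0"
  then obtain a b where ab: "a \<noteq> 0 \<or> b \<noteq> 0" "a *\<^sub>R x + b *\<^sub>R w = 0"
    using no_semidefinite_plane[OF assms(1,2)] assms(3,4) by fastforce
  have "L10_form (a *\<^sub>R x + b *\<^sub>R w) w = b * L10_form w w" using assms(4) by simp
  then have "b = 0" using ab(2) assms(3) by simp
  then show False using ab assms(5) by simp
qed

text \<open>Coordinate vectors with respect to the basis \<open>E\<^sub>1\<^sub>0\<close>.\<close>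

definition lvec :: "int list \<Rightarrow> (nat \<Rightarrow>\<^sub>0 real)" where
  "lvec xs = (\<Sum>i<length xs. of_int (xs ! i) *\<^sub>R ev (Suc i))"

lemma lookup_vec:
  "Poly_Mapping.lookup (lvec xs) k = (if 1 \<le> k \<and> k \<le> length xs then of_int (xs ! (k - 1)) else 0)"
proof -
  have "Poly_Mapping.lookup (lvec xs) k = (\<Sum>i<length xs. if i = k - 1 \<and> 1 \<le> k then of_int (xs ! i) else 0)"
    unfolding lvec_def lookup_sum lookup_scaleR lookup_vertex_vector
    by (intro sum.cong refl) auto
  then show ?thesis by (cases "1 \<le> k") auto
qed

lemma vec_L10: "length xs = 10 \<Longrightarrow> lvec xs \<in> L10"
  by (auto simp: L10_eq lookup_vec keys_subset_iff)

lemma keys_vec: "length xs = 10 \<Longrightarrow> Poly_Mapping.keys (lvec xs) \<subseteq> {1..10}"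
  by (auto simp: lookup_vec keys_subset_iff)

lemma cases_1_10:
  fixes k :: nat
  assumes "k \<in> {1..10}"
  shows "k = 1 \<or> k = 2 \<or> k = 3 \<or> k = 4 \<or> k = 5 \<or> k = 6 \<or> k = 7 \<or> k = 8 \<or> k = 9 \<or> k = 10"
  using assms unfolding atLeastAtMost_1_10 by simp

fun ev_products :: "int list \<Rightarrow> int list" where
  "ev_products [a, b, c, d, e, f, g, h, i, j] =
     [d - 2 * a, c - 2 * b, b + d - 2 * c, a + c + e - 2 * d, d + f - 2 * e, e + g - 2 * f,
      f + h - 2 * g, g + i - 2 * h, h + j - 2 * i, i - 2 * j]"
| "ev_products _ = []"

lemma length_10E:
  assumes "length xs = 10"
  obtains a b c d e f g h i j where "xs = [a, b, c, d, e, f, g, h, i, j]"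
  using assms by (auto simp: numeral_eq_Suc length_Suc_conv)

lemma L10_form_ev_right:
  assumes "Poly_Mapping.keys x \<subseteq> {1..10}"
  shows "L10_form x (ev 1) = Poly_Mapping.lookup x 4 - 2 * Poly_Mapping.lookup x 1"
    "L10_form x (ev 2) = Poly_Mapping.lookup x 3 - 2 * Poly_Mapping.lookup x 2"
    "L10_form x (ev 3) = Poly_Mapping.lookup x 2 + Poly_Mapping.lookup x 4 - 2 * Poly_Mapping.lookup x 3"
    "L10_form x (ev 4) = Poly_Mapping.lookup x 1 + Poly_Mapping.lookup x 3 + Poly_Mapping.lookup x 5 - 2 * Poly_Mapping.lookup x 4"
    "L10_form x (ev 5) = Poly_Mapping.lookup x 4 + Poly_Mapping.lookup x 6 - 2 * Poly_Mapping.lookup x 5"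
    "L10_form x (ev 6) = Poly_Mapping.lookup x 5 + Poly_Mapping.lookup x 7 - 2 * Poly_Mapping.lookup x 6"
    "L10_form x (ev 7) = Poly_Mapping.lookup x 6 + Poly_Mapping.lookup x 8 - 2 * Poly_Mapping.lookup x 7"
    "L10_form x (ev 8) = Poly_Mapping.lookup x 7 + Poly_Mapping.lookup x 9 - 2 * Poly_Mapping.lookup x 8"
    "L10_form x (ev 9) = Poly_Mapping.lookup x 8 + Poly_Mapping.lookup x 10 - 2 * Poly_Mapping.lookup x 9"
    "L10_form x (ev 10) = Poly_Mapping.lookup x 9 - 2 * Poly_Mapping.lookup x 10"
  by (subst L10_form_explicit[OF assms supp_e]; simp add: lookup_vertex_vector)+

lemma L10_form_vec_ev:
  assumes "length xs = 10" "k \<in> {1..10}"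
  shows "L10_form (lvec xs) (ev k) = of_int (ev_products xs ! (k - 1))"
proof -
  obtain a b c d e f g h i j where xs: "xs = [a, b, c, d, e, f, g, h, i, j]"
    using length_10E[OF assms(1)] .
  show ?thesis
    using cases_1_10[OF assms(2)] L10_form_ev_right[OF keys_vec[OF assms(1)]]
    by (elim disjE) (simp_all add: lookup_vec xs)
qed

lemma L10_form_vec_right:
  assumes "length xs = 10"
  shows "L10_form x (lvec xs) = (\<Sum>i<10. of_int (xs ! i) * L10_form x (ev (Suc i)))"
  by (simp add: lvec_def L.B_sum_right assms)

definition pair_product :: "int list \<Rightarrow> int list \<Rightarrow> int" where
  "pair_product xs ys = sum_list (map2 (*) (ev_products xs) ys)"

lemma length_ev_products: "length xs = 10 \<Longrightarrow> length (ev_products xs) = 10"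
  by (erule length_10E) simp

lemma L10_form_vec:
  assumes "length xs = 10" "length ys = 10"
  shows "L10_form (lvec xs) (lvec ys) = of_int (pair_product xs ys)"
proof -
  have "pair_product xs ys = (\<Sum>i<10. ys ! i * ev_products xs ! i)"
    unfolding pair_product_def sum_list_sum_nth
    by (simp add: assms length_ev_products atLeast0LessThan mult.commute)
  then show ?thesis
    unfolding L10_form_vec_right[OF assms(2)]
    by (simp add: L10_form_vec_ev[OF assms(1)])
qed

text \<open>The fundamental weights, that is the dual basis of \<open>E\<^sub>1\<^sub>0\<close>, and their sum, the Weyl vector.\<close>

definition weights :: "int list list" where
  "weights =
    [[10, 7, 14, 21, 18, 15, 12, 9, 6, 3],
     [7, 4, 9, 14, 12, 10, 8, 6, 4, 2],
     [14, 9, 18, 28, 24, 20, 16, 12, 8, 4],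
     [21, 14, 28, 42, 36, 30, 24, 18, 12, 6],
     [18, 12, 24, 36, 30, 25, 20, 15, 10, 5],
     [15, 10, 20, 30, 25, 20, 16, 12, 8, 4],
     [12, 8, 16, 24, 20, 16, 12, 9, 6, 3],
     [9, 6, 12, 18, 15, 12, 9, 6, 4, 2],
     [6, 4, 8, 12, 10, 8, 6, 4, 2, 1],
     [3, 2, 4, 6, 5, 4, 3, 2, 1, 0]]"

definition weyl_vector :: "nat \<Rightarrow>\<^sub>0 real" where
  "weyl_vector = lvec [115, 76, 153, 231, 195, 160, 126, 93, 61, 30]"

lemma weyl_vector:
  "weyl_vector \<in> L10" "L10_form weyl_vector weyl_vector = 1240"
  "i \<in> {1..10} \<Longrightarrow> L10_form weyl_vector (ev i) = 1"
proof -
  show "weyl_vector \<in> L10" by (simp add: weyl_vector_def vec_L10)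
  show "L10_form weyl_vector weyl_vector = 1240"
    unfolding weyl_vector_def by (subst L10_form_vec) (simp_all add: pair_product_def)
  assume i: "i \<in> {1..10}"
  have "i = 1 \<or> i = 2 \<or> i = 3 \<or> i = 4 \<or> i = 5 \<or> i = 6 \<or> i = 7 \<or> i = 8 \<or> i = 9 \<or> i = 10"
    by (rule cases_1_10[OF i])
  then show "L10_form weyl_vector (ev i) = 1"
    unfolding weyl_vector_def by (subst L10_form_vec_ev) (use i in auto)
qed

lemma weight_product:
  assumes "j \<in> {1..10}" "x \<in> L10"
  shows "L10_form x (lvec (weights ! (j - 1))) = Poly_Mapping.lookup x j"
proof -
  note j = cases_1_10[OF assms(1)]
  have k: "Poly_Mapping.keys x \<subseteq> {1..10}" using assms(2) by (simp add: L10_eq)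
  have "length (weights ! (j - 1)) = 10" using j by (elim disjE) (simp_all add: weights_def)
  then have "Poly_Mapping.keys (lvec (weights ! (j - 1))) \<subseteq> {1..10}" by (rule keys_vec)
  from L10_form_explicit[OF k this] show ?thesis
    using j by (elim disjE) (simp_all add: weights_def lookup_vec)
qed

lemma ev_L10: "i \<in> {1..10} \<Longrightarrow> ev i \<in> L10"
  by (rule vertex_vector_L10)

lemma ev_root: "i \<in> {1..10} \<Longrightarrow> ev i \<in> L.root_set L10"
  by (simp add: L.root_set_def ev_L10 L10_form_ev diagram_gram_def)

lemma L10_span: "x \<in> L10 \<Longrightarrow> x \<in> span L10"
  by (rule span_base)

definition pos_part :: "(nat \<Rightarrow>\<^sub>0 real) \<Rightarrow> (nat \<Rightarrow>\<^sub>0 real)" where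
  "pos_part x = (\<Sum>i\<in>{1..10}. max (Poly_Mapping.lookup x i) 0 *\<^sub>R ev i)"

lemma lookup_pos_part:
  "Poly_Mapping.lookup (pos_part x) i = (if i \<in> {1..10} then max (Poly_Mapping.lookup x i) 0 else 0)"
proof -
  have "Poly_Mapping.lookup (pos_part x) i
      = (\<Sum>j\<in>{1..10}. if j = i then max (Poly_Mapping.lookup x j) 0 else 0)"
    unfolding pos_part_def lookup_sum lookup_scaleR lookup_vertex_vector
    by (intro sum.cong refl) auto
  then show ?thesis by simp
qed

lemma pos_part_L10: "x \<in> L10 \<Longrightarrow> pos_part x \<in> L10"
  by (auto simp: L10_eq keys_subset_iff lookup_pos_part max_def)

lemma pos_part_diff: "x \<in> L10 \<Longrightarrow> x = pos_part x - pos_part (- x)"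
  by (rule poly_mapping_eqI) (auto simp: lookup_minus lookup_pos_part L10_eq keys_subset_iff max_def)

lemma pos_part_product: "0 \<le> L10_form (pos_part x) (pos_part (- x))"
proof -
  have "0 \<le> max (Poly_Mapping.lookup x i) 0 * (max (Poly_Mapping.lookup (- x) j) 0 * L10_form (ev i) (ev j))"
    for i j
    by (cases "i = j") (auto simp: L10_form_ev diagram_gram_def max_def intro!: mult_nonneg_nonneg)
  then show ?thesis
    unfolding pos_part_def L.B_sum_right unfolding L.B_sum_left L.B_simps sum_distrib_left
    by (intro sum_nonneg) (simp add: mult.left_commute)
qed

lemma L10_norm_le: "x \<in> L10 \<Longrightarrow> L10_form x x < 0 \<Longrightarrow> L10_form x x \<le> - 2"
proof -
  assume x: "x \<in> L10" "L10_form x x < 0"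
  obtain k where "L10_form x x = 2 * of_int k" using even_L10 x(1) unfolding even_on_def by blast
  then show ?thesis using x(2) by simp
qed

text \<open>The positive part of \<open>r\<close> is orthogonal to the fundamental weight of a simple root on which \<open>r\<close>
  is negative. All these weights have non-negative norm, and the only isotropic one is that of the last
  simple root; when the positive part is a multiple of it, \<open>r\<close> is far from having norm \<open>-2\<close>.\<close>

lemma pos_part_norm:
  assumes r: "r \<in> L10" "L10_form r r = - 2" and p: "p \<in> {1..10}" "0 < Poly_Mapping.lookup r p"
    and q: "q \<in> {1..10}" "Poly_Mapping.lookup r q < 0"
  shows "L10_form (pos_part r) (pos_part r) \<le> - 2"
proof (rule L10_norm_le[OF pos_part_L10[OF r(1)]], rule ccontr)
  let ?b = "pos_part r" and ?w = "lvec (weights ! (q - 1))"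
  assume nonneg: "\<not> L10_form ?b ?b < 0"
  have b: "?b \<in> L10" by (rule pos_part_L10[OF r(1)])
  have len: "length (weights ! (k - 1)) = 10" if "k \<in> {1..10}" for k
    using cases_1_10[OF that] by (elim disjE) (simp_all add: weights_def)
  have w: "?w \<in> L10" by (rule vec_L10[OF len[OF q(1)]])
  have bw: "L10_form ?b ?w = 0"
    using weight_product[OF q(1) b] q(2) by (simp add: lookup_pos_part)
  have bp: "0 < Poly_Mapping.lookup ?b p" using p by (simp add: lookup_pos_part)
  then have b0: "?b \<noteq> 0" by auto
  have ww: "L10_form ?w ?w = Poly_Mapping.lookup ?w q" by (rule weight_product[OF q(1) w])
  have diag: "0 < Poly_Mapping.lookup ?w q \<or> q = 10"
    using cases_1_10[OF q(1)] by (elim disjE) (simp_all add: lookup_vec weights_def)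
  have "\<not> 0 < L10_form ?w ?w"
    using orthogonal_to_positive[OF L10_span[OF b] L10_span[OF w] _ bw b0] nonneg by blast
  then have q10: "q = 10" using diag unfolding ww by blast
  then have ww0: "L10_form ?w ?w = 0" unfolding ww by (simp add: lookup_vec weights_def)
  have w': "?w = lvec [3, 2, 4, 6, 5, 4, 3, 2, 1, 0]" by (simp add: q10 weights_def)
  obtain x y where xy: "x \<noteq> 0 \<or> y \<noteq> 0" "x *\<^sub>R ?b + y *\<^sub>R ?w = 0"
    using no_semidefinite_plane[OF L10_span[OF b] L10_span[OF w] _ bw] ww0 nonneg by auto
  have l: "x * Poly_Mapping.lookup ?b i + y * Poly_Mapping.lookup ?w i = 0" for i
    using arg_cong[OF xy(2), of "\<lambda>z. Poly_Mapping.lookup z i"] by (simp add: lookup_add)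
  have w9: "Poly_Mapping.lookup ?w 9 = 1" unfolding w' by (simp add: lookup_vec)
  have "x \<noteq> 0" using xy(1) l[of 9] w9 by auto
  define c where "c = - y / x"
  have bc: "?b = c *\<^sub>R ?w"
  proof (rule poly_mapping_eqI)
    fix i show "Poly_Mapping.lookup ?b i = Poly_Mapping.lookup (c *\<^sub>R ?w) i"
      using l[of i] \<open>x \<noteq> 0\<close> by (simp add: c_def field_simps)
  qed
  have b9: "0 < Poly_Mapping.lookup ?b 9"
  proof -
    have "0 \<le> Poly_Mapping.lookup ?w p"
      using cases_1_10[OF p(1)] unfolding w' by (elim disjE) (simp_all add: lookup_vec)
    then have "0 < c" using bp bc by (metis lookup_scaleR zero_less_mult_pos2 mult_zero_right order_le_less less_irrefl)
    then show ?thesis using w9 bc by (metis lookup_scaleR mult.right_neutral)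
  qed
  then have r9: "0 < Poly_Mapping.lookup r 9" "Poly_Mapping.lookup ?b 9 = Poly_Mapping.lookup r 9"
    by (auto simp: lookup_pos_part max_def split: if_splits)
  have d: "pos_part (- r) = (- Poly_Mapping.lookup r 10) *\<^sub>R ev 10"
  proof (rule poly_mapping_eqI)
    fix i
    have "0 \<le> Poly_Mapping.lookup r i" if i: "i \<in> {1..10}" "i \<noteq> 10"
    proof -
      have "0 < Poly_Mapping.lookup ?w i"
        using cases_1_10[OF i(1)] i(2) unfolding w' by (elim disjE) (simp_all add: lookup_vec)
      moreover have "0 < c" using b9 w9 bc by (metis lookup_scaleR mult.right_neutral)
      ultimately have "0 < Poly_Mapping.lookup ?b i" using bc by (metis lookup_scaleR mult_pos_pos)
      then show ?thesis by (auto simp: lookup_pos_part max_def split: if_splits)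
    qed
    then show "Poly_Mapping.lookup (pos_part (- r)) i
        = Poly_Mapping.lookup ((- Poly_Mapping.lookup r 10) *\<^sub>R ev 10) i"
      using q(2) q10 by (auto simp: lookup_pos_part lookup_vertex_vector max_def)
  qed
  have int: "Poly_Mapping.lookup r i \<in> \<int>" for i using r(1) by (simp add: L10_eq)
  obtain m where m: "Poly_Mapping.lookup r 10 = of_int m" using int[of 10] by (elim Ints_cases)
  obtain n where n: "Poly_Mapping.lookup r 9 = of_int n" using int[of 9] by (elim Ints_cases)
  have mn: "m \<le> - 1" "1 \<le> n" using q(2) q10 m r9 n by simp_all
  have "Poly_Mapping.keys ?b \<subseteq> {1..10}" using b by (simp add: L10_eq)
  from L10_form_ev_right(10)[OF this] have b10: "L10_form ?b (ev 10) = of_int n"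
    using r9(2) n q(2) q10 by (simp add: lookup_pos_part)
  have bb: "L10_form ?b ?b = 0" using ww0 by (simp add: bc)
  have "r = ?b - pos_part (- r)" by (rule pos_part_diff[OF r(1)])
  also have "\<dots> = ?b + of_int m *\<^sub>R ev 10" by (simp add: d m)
  finally have r_eq: "r = ?b + of_int m *\<^sub>R ev 10" .
  have "L10_form r r = L10_form ?b ?b + 2 * of_int m * L10_form ?b (ev 10)
      + of_int m * of_int m * L10_form (ev 10) (ev 10)"
    by (subst (1 2) r_eq) (simp add: L10_form_sym[of "ev 10" ?b] algebra_simps)
  also have "\<dots> = of_int (2 * (m * n) - 2 * (m * m))"
    by (simp add: bb b10 L10_form_ev diagram_gram_def)
  finally have "2 * (m * n) - 2 * (m * m) = - 2" using r(2) by linarith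
  moreover have "m * n \<le> - 1" using mn mult_mono[of 1 "- m" 1 n] by simp
  moreover have "1 \<le> m * m" using mn mult_mono[of 1 "- m" 1 "- m"] by simp
  ultimately show False by linarith
qed

text \<open>If both signs occurred, the positive and the negative part would have norm at most \<open>-2\<close>; as their
  product is non-negative, their difference would have norm at most \<open>-4\<close>.\<close>

lemma L10_root_signs:
  assumes "r \<in> L10" "L10_form r r = - 2"
  shows "(\<forall>i\<in>{1..10}. 0 \<le> Poly_Mapping.lookup r i) \<or> (\<forall>i\<in>{1..10}. Poly_Mapping.lookup r i \<le> 0)"
proof (rule ccontr)
  assume "\<not> ?thesis"
  then obtain p q where pq: "p \<in> {1..10}" "0 < Poly_Mapping.lookup r p"
    "q \<in> {1..10}" "Poly_Mapping.lookup r q < 0" by (auto simp: not_le)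
  have neg: "- r \<in> L10" using Z.subspace_neg[OF L10_subspace assms(1)] .
  have 1: "L10_form (pos_part r) (pos_part r) \<le> - 2" by (rule pos_part_norm[OF assms pq])
  have 2: "L10_form (pos_part (- r)) (pos_part (- r)) \<le> - 2"
    by (rule pos_part_norm[OF neg _ pq(3) _ pq(1)]) (use assms(2) pq in auto)
  have "r = pos_part r - pos_part (- r)" by (rule pos_part_diff[OF assms(1)])
  then have "L10_form r r = L10_form (pos_part r - pos_part (- r)) (pos_part r - pos_part (- r))" by simp
  also have "\<dots> = L10_form (pos_part r) (pos_part r) + L10_form (pos_part (- r)) (pos_part (- r))
      - 2 * L10_form (pos_part r) (pos_part (- r))"
    by (simp add: L10_form_sym[of "pos_part (- r)" "pos_part r"])
  finally show False using 1 2 pos_part_product[of r] assms(2) by linarith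
qed

text \<open>On the segment from \<open>x\<close> to its reflection, the product with the Weyl vector cannot vanish, since the
  form is negative on the complement of the Weyl vector.\<close>

lemma W10_weyl_vector_pos:
  assumes "g \<in> W10" "x \<in> span L10" "0 < L10_form x x" "0 < L10_form x weyl_vector"
  shows "0 < L10_form (g x) weyl_vector"
proof -
  have "g x \<in> span L10 \<and> 0 < L10_form (g x) weyl_vector"
    using assms
  proof (induction rule: L.weyl.induct)
    case (weyl_step g r)
    let ?y = "g x" and ?\<rho> = weyl_vector
    have r: "r \<in> L10" "L10_form r r = - 2" using L.root_setD[OF weyl_step(2)] by auto
    have y: "?y \<in> span L10" "0 < L10_form ?y ?\<rho>" using weyl_step.IH weyl_step.prems by auto
    have yy: "0 < L10_form ?y ?y" using W10_isometry[OF weyl_step(1)] weyl_step.prems by simp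
    have mem: "?y + c *\<^sub>R r \<in> span L10" for c
      by (rule span_add[OF y(1) span_scale[OF span_base[OF r(1)]]])
    have "0 < L10_form (L.reflect r ?y) ?\<rho>"
    proof (rule ccontr)
      assume "\<not> ?thesis"
      then have le: "L10_form ?y ?\<rho> + L10_form ?y r * L10_form r ?\<rho> \<le> 0"
        by (simp add: L.reflect_def)
      define d where "d = - (L10_form ?y r * L10_form r ?\<rho>)"
      define t where "t = L10_form ?y ?\<rho> / d"
      have d: "L10_form ?y ?\<rho> \<le> d" "0 < d" using le y(2) unfolding d_def by linarith+
      have t: "0 \<le> t" "t \<le> 1" using y(2) d unfolding t_def by simp_all
      let ?z = "?y + (t * L10_form ?y r) *\<^sub>R r"
      have "L10_form ?z ?\<rho> = L10_form ?y ?\<rho> - t * d" by (simp add: d_def)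
      also have "\<dots> = 0" using d by (simp add: t_def)
      finally have z\<rho>: "L10_form ?z ?\<rho> = 0" .
      have zz: "0 < L10_form ?z ?z" by (rule reflect_segment_positive[OF r(2) yy t])
      then have "?z \<noteq> 0" by (metis L.B_simps(9) less_irrefl)
      then have "L10_form ?z ?z < 0"
        by (intro orthogonal_to_positive[OF mem L10_span[OF weyl_vector(1)] _ z\<rho>])
          (simp_all add: weyl_vector(2))
      then show False using zz by simp
    qed
    then show ?case using mem by (simp add: L.reflect_def)
  qed simp
  then show ?thesis ..
qed

text \<open>The orbit stays in the positive cone of the Weyl vector, so that the products with this vector are
  positive integers. An element of the orbit with minimal product is dominant.\<close>

lemma dominant_representative:
  assumes "u \<in> L10" "0 < L10_form u u" "0 < L10_form u weyl_vector"
  shows "\<exists>g\<in>W10. \<forall>i\<in>{1..10}. 0 \<le> L10_form (g u) (ev i)"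
proof -
  have sub: "L.weyl (ev ` {1..10}) \<subseteq> W10" by (rule weyl_subset_W10) (use ev_root in auto)
  have "\<exists>g\<in>L.weyl (ev ` {1..10}). \<forall>e\<in>ev ` {1..10}. 0 \<le> L10_form (g u) e"
  proof (rule L.dominant_in_orbit[where c = weyl_vector and N = 1 and b = 0])
    show "L10_form e e = - 2" if "e \<in> ev ` {1..10}" for e
      using that L.root_setD(2)[OF ev_root] by blast
    show "L10_form weyl_vector e = 1" if "e \<in> ev ` {1..10}" for e
      using that weyl_vector(3) by blast
    fix g assume g: "g \<in> L.weyl (ev ` {1..10})"
    then have gW: "g \<in> W10" using sub by blast
    show "of_nat 1 * L10_form (g u) weyl_vector \<in> \<int>"
      using L10_integral[OF W10_mem[OF gW assms(1)] weyl_vector(1)] by simp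
    show "0 \<le> L10_form (g u) weyl_vector"
      using W10_weyl_vector_pos[OF gW L10_span[OF assms(1)] assms(2,3)] by simp
  qed simp
  then show ?thesis using sub by blast
qed

text \<open>The orthogonal complement of a vector of positive norm is negative definite.\<close>

lemma ev_simple_system:
  assumes "S \<subseteq> {1..10}" "u \<in> span L10" "0 < L10_form u u" "\<And>i. i \<in> S \<Longrightarrow> L10_form u (ev i) = 0"
  shows "L.simple_system (ev ` S)"
  unfolding L.simple_system_def
proof (intro conjI ballI impI)
  have sub: "ev ` S \<subseteq> L10" using assms(1) ev_L10 by auto
  show "finite (ev ` S)" using assms(1) by (meson finite_atLeastAtMost finite_imageI finite_subset)
  show "independent (ev ` S)" by (rule independent_vertex_vectors)
  show "L.neg_def (ev ` S)"
    unfolding L.neg_def_def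
  proof (intro ballI impI)
    fix x assume x: "x \<in> span (ev ` S)" "x \<noteq> 0"
    have "L10_form u x = 0" by (rule L.B_zero_on_span[OF _ x(1)]) (use assms(4) in auto)
    moreover have "x \<in> span L10" using x(1) span_mono[OF sub] by (rule rev_subsetD)
    ultimately show "L10_form x x < 0"
      using orthogonal_to_positive[OF _ assms(2,3) _ x(2)] L10_form_sym[of x u] by simp
  qed
  show "L10_form r r = - 2" if "r \<in> ev ` S" for r
    using that assms(1) L.root_setD(2)[OF ev_root] by auto
  show "L10_form r s \<in> {0, 1}" if "r \<in> ev ` S" "s \<in> ev ` S" "r \<noteq> s" for r s
  proof -
    note rs = that
    obtain i j where "r = ev i" "s = ev j" using rs(1,2) by (elim imageE)
    then show ?thesis using rs(3) by (cases "i = j") (auto simp: L10_form_ev diagram_gram_def)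
  qed
qed

text \<open>The component of the Weyl vector orthogonal to \<open>\<Phi>\<close> has positive norm. Made dominant by an element of
  the Weyl group, it is orthogonal to no roots but combinations of the simple roots orthogonal to it.\<close>

lemma roots_into_E10:
  assumes "L.simple_system \<Phi>" "\<Phi> \<subseteq> L10"
  shows "\<exists>g\<in>W10. \<exists>S\<subseteq>{1..10}. L.simple_system (ev ` S) \<and> g ` \<Phi> \<subseteq> zspan (ev ` S) \<and> card S = card \<Phi>"
proof -
  note P = L.simple_systemD[OF assms(1)]
  have rat: "L10_form x r \<in> \<rat>" if "x \<in> L10" "r \<in> \<Phi>" for x r
    using L10_integral[OF that(1) subsetD[OF assms(2) that(2)]] Ints_subset_Rats by (rule rev_subsetD)
  have "\<exists>p\<in>qspan \<Phi>. \<forall>r\<in>\<Phi>. L10_form p r = L10_form weyl_vector r"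
    by (rule L.vector_with_given_products[OF P(1-3)])
      (use rat weyl_vector(1) subsetD[OF assms(2)] in simp_all)
  then obtain p where p: "p \<in> qspan \<Phi>" "\<And>r. r \<in> \<Phi> \<Longrightarrow> L10_form p r = L10_form weyl_vector r"
    by (elim bexE) simp
  define v where "v = weyl_vector - p"
  have ps: "p \<in> span \<Phi>" using p(1) qspan_subset_span by (rule rev_subsetD)
  have orth: "L10_form v r = 0" if "r \<in> \<Phi>" for r using p(2)[OF that] by (simp add: v_def)
  have vp: "L10_form v p = 0" by (rule L.B_zero_on_span[OF orth ps])
  have "L10_form p p \<le> 0" by (rule L.neg_def_nonpos[OF P(3) ps])
  moreover have "L10_form v v = L10_form v weyl_vector" using vp by (simp add: v_def)
  moreover have "L10_form weyl_vector p = L10_form p p" using vp by (simp add: v_def)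
  then have "L10_form v weyl_vector = 1240 - L10_form p p"
    using L10_form_sym[of p weyl_vector] by (simp add: v_def weyl_vector(2))
  ultimately have vv: "0 < L10_form v v" "0 < L10_form v weyl_vector" by linarith+
  obtain N where N: "0 < N" "of_nat N *\<^sub>R p \<in> zspan \<Phi>" using qspan_clear_denominator[OF p(1)] by blast
  define u where "u = of_nat N *\<^sub>R v"
  have "u = zscale (int N) weyl_vector - of_nat N *\<^sub>R p" by (simp add: u_def v_def algebra_simps)
  also have "\<dots> \<in> L10"
    by (rule Z.subspace_diff[OF L10_subspace Z.subspace_scale[OF L10_subspace weyl_vector(1)]
          subsetD[OF zspan_subset_L10[OF assms(2)] N(2)]])
  finally have uL: "u \<in> L10" .
  have uu: "0 < L10_form u u" "0 < L10_form u weyl_vector" using vv N(1) by (simp_all add: u_def)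
  obtain g where g: "g \<in> W10" "\<And>i. i \<in> {1..10} \<Longrightarrow> 0 \<le> L10_form (g u) (ev i)"
    using dominant_representative[OF uL uu] by blast
  note iso = W10_isometry[OF g(1)]
  define S0 where "S0 = {i \<in> {1..10}. L10_form (g u) (ev i) = 0}"
  have S0: "L.simple_system (ev ` S0)"
    by (rule ev_simple_system[of _ "g u"]) (use uu(1) L10_span[OF W10_mem[OF g(1) uL]] in \<open>auto simp: S0_def iso\<close>)
  have into: "g ` \<Phi> \<subseteq> zspan (ev ` S0)"
  proof (rule image_subsetI)
    fix r assume r: "r \<in> \<Phi>"
    have gr: "g r \<in> L10" "L10_form (g r) (g r) = - 2"
      using W10_mem[OF g(1)] assms(2) r P(4) by (auto simp: iso)
    define c where "c e = \<lfloor>Poly_Mapping.lookup (g r) (inv_into {1..10} ev e)\<rfloor>" for e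
    have inj: "inj_on ev {1..10}" by (rule inj_on_subset[OF inj_vertex_vector subset_UNIV])
    have c: "c (ev i) = \<lfloor>Poly_Mapping.lookup (g r) i\<rfloor>" if "i \<in> {1..10}" for i
      using inv_into_f_f[OF inj that] by (simp add: c_def)
    have "g r = (\<Sum>i\<in>{1..10}. of_int (c (ev i)) *\<^sub>R ev i)"
    proof (rule poly_mapping_eqI)
      fix k
      have "Poly_Mapping.lookup (\<Sum>i\<in>{1..10}. of_int (c (ev i)) *\<^sub>R ev i) k
          = (\<Sum>i\<in>{1..10}. if i = k then Poly_Mapping.lookup (g r) k else 0)"
        unfolding lookup_sum lookup_scaleR lookup_vertex_vector
        by (intro sum.cong refl) (use gr(1) in \<open>auto simp: c L10_eq\<close>)
      then show "Poly_Mapping.lookup (g r) k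
          = Poly_Mapping.lookup (\<Sum>i\<in>{1..10}. of_int (c (ev i)) *\<^sub>R ev i) k"
        using gr(1) by (auto simp: L10_eq keys_subset_iff)
    qed
    then have gr_eq: "g r = (\<Sum>e\<in>ev ` {1..10}. of_int (c e) *\<^sub>R e)"
      by (simp only: sum.reindex[OF inj] comp_def)
    have "(\<forall>e\<in>ev ` {1..10}. 0 \<le> c e) \<or> (\<forall>e\<in>ev ` {1..10}. c e \<le> 0)"
      using L10_root_signs[OF gr]
    proof
      assume "\<forall>i\<in>{1..10}. 0 \<le> Poly_Mapping.lookup (g r) i"
      then have "0 \<le> c (ev i)" if "i \<in> {1..10}" for i using c[OF that] that by simp
      then show ?thesis by blast
    next
      assume *: "\<forall>i\<in>{1..10}. Poly_Mapping.lookup (g r) i \<le> 0"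
      have "c (ev i) \<le> 0" if "i \<in> {1..10}" for i
      proof -
        have "Poly_Mapping.lookup (g r) i \<le> 0" using *[rule_format, OF that] .
        then show ?thesis unfolding c[OF that] floor_le_zero by linarith
      qed
      then show ?thesis by blast
    qed
    moreover have "L10_form (g u) (g r) = 0" using orth[OF r] by (simp add: iso u_def)
    ultimately have "g r \<in> zspan {e \<in> ev ` {1..10}. L10_form (g u) e = 0}"
      using g(2) by (intro L.root_orthogonal_to_dominant[OF _ gr_eq]) auto
    moreover have "{e \<in> ev ` {1..10}. L10_form (g u) e = 0} = ev ` S0" by (auto simp: S0_def)
    ultimately show "g r \<in> zspan (ev ` S0)" by simp
  qed
  have lin: "linear g" by (rule W10_linear[OF g(1)])
  have gP: "L.simple_system (g ` \<Phi>)" by (rule L.simple_system_image[OF assms(1) lin iso])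
  have card: "card (g ` \<Phi>) = card \<Phi>" by (rule card_image[OF inj_on_subset[OF W10_inj[OF g(1)] subset_UNIV]])
  obtain h \<Delta> where h: "h \<in> L.weyl (ev ` S0)" "\<Delta> \<subseteq> ev ` S0" "h ` g ` \<Phi> \<subseteq> zspan \<Delta>" "card \<Delta> = card \<Phi>"
    using L.roots_into_parabolic[OF S0 _ into] L.simple_systemD[OF gP] card by auto
  obtain S where S: "S \<subseteq> S0" "\<Delta> = ev ` S" using h(2) by (meson subset_imageE)
  have "h \<in> W10" using h(1) weyl_subset_W10[of "ev ` S0"] ev_root by (auto simp: S0_def)
  then have "h \<circ> g \<in> W10" by (rule L.weyl_comp[OF _ g(1)])
  moreover have "L.simple_system (ev ` S)" by (rule L.simple_system_subset[OF S0]) (use S in auto)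
  moreover have "(h \<circ> g) ` \<Phi> \<subseteq> zspan (ev ` S)" using h(3) S(2) by (simp add: image_comp)
  moreover have "card S = card \<Phi>"
    using h(4) S(2) card_image[OF inj_on_subset[OF inj_vertex_vector subset_UNIV], of S] by simp
  moreover have "S \<subseteq> {1..10}" using S(1) by (auto simp: S0_def)
  ultimately show ?thesis by blast
qed

text \<open>Part of a basis of a lattice spans a primitive sublattice.\<close>

lemma primitive_closure_ev:
  assumes "S \<subseteq> {1..10}" shows "qspan (ev ` S) \<inter> L10 = zspan (ev ` S)"
proof
  show "zspan (ev ` S) \<subseteq> qspan (ev ` S) \<inter> L10"
  proof (rule Int_greatest[OF zspan_subset_qspan zspan_subset_L10])
    show "ev ` S \<subseteq> L10" using assms ev_L10 by auto
  qed
  show "qspan (ev ` S) \<inter> L10 \<subseteq> zspan (ev ` S)"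
  proof
    fix x assume x: "x \<in> qspan (ev ` S) \<inter> L10"
    then have xs: "x \<in> span (ev ` S)" using qspan_subset_span[of "ev ` S"] by auto
    have z: "Poly_Mapping.lookup x i = 0" if i: "i \<notin> S" for i
    proof (rule linear_eq_0_on_span[OF _ _ xs])
      show "linear (\<lambda>x :: nat \<Rightarrow>\<^sub>0 real. Poly_Mapping.lookup x i)"
        by (rule linearI) (simp_all add: lookup_add)
      show "Poly_Mapping.lookup y i = 0" if "y \<in> ev ` S" for y
        using that i by (auto simp: lookup_vertex_vector)
    qed
    have fin: "finite S" using assms by (rule finite_subset) simp
    have "x = (\<Sum>i\<in>S. zscale \<lfloor>Poly_Mapping.lookup x i\<rfloor> (ev i))"
    proof (rule poly_mapping_eqI)
      fix k
      have "Poly_Mapping.lookup (\<Sum>i\<in>S. zscale \<lfloor>Poly_Mapping.lookup x i\<rfloor> (ev i)) k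
          = (\<Sum>i\<in>S. if i = k then Poly_Mapping.lookup x k else 0)"
        unfolding lookup_sum lookup_scaleR lookup_vertex_vector
        by (intro sum.cong refl) (use x in \<open>auto simp: L10_eq\<close>)
      then show "Poly_Mapping.lookup x k
          = Poly_Mapping.lookup (\<Sum>i\<in>S. zscale \<lfloor>Poly_Mapping.lookup x i\<rfloor> (ev i)) k"
        using fin z[of k] by auto
    qed
    also have "\<dots> \<in> zspan (ev ` S)" by (intro Z.span_sum Z.span_scale Z.span_base) auto
    finally show "x \<in> zspan (ev ` S)" .
  qed
qed

section \<open>Configurations, their closures and their types\<close>

context symmetric_form
begin

lemma rational_in_qspan:
  assumes "finite S" "independent S" "neg_def S" "\<And>r s. r \<in> S \<Longrightarrow> s \<in> S \<Longrightarrow> B r s \<in> \<rat>"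
    "x \<in> span S" "\<And>r. r \<in> S \<Longrightarrow> B x r \<in> \<rat>"
  shows "x \<in> qspan S"
proof -
  have "\<exists>v\<in>qspan S. \<forall>r\<in>S. B v r = B x r"
    by (rule vector_with_given_products[OF assms(1-3)]) (use assms(4,6) in simp_all)
  then obtain v where v: "v \<in> qspan S" "\<forall>r\<in>S. B v r = B x r" by (elim bexE)
  have "v \<in> span S" using v(1) qspan_subset_span by (rule rev_subsetD)
  then have "x - v \<in> span S" by (rule span_diff[OF assms(5)])
  then have "x - v = 0" by (rule neg_def_zero[OF assms(3)]) (use v(2) in simp)
  then show ?thesis using v(1) by simp
qed

lemma qspan_eq_if_card_eq:
  assumes "simple_system \<Delta>" "finite \<Phi>" "\<Phi> \<subseteq> zspan \<Delta>" "independent \<Phi>" "card \<Phi> = card \<Delta>"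
  shows "qspan \<Phi> = qspan \<Delta>"
proof
  note D = simple_systemD[OF assms(1)]
  have sp: "\<Phi> \<subseteq> span \<Delta>" using assms(3) zspan_subset_span by (rule order_trans)
  have rat: "B x y \<in> \<rat>" if "x \<in> zspan \<Delta>" "y \<in> zspan \<Delta>" for x y
    using simple_zspan_integral[OF assms(1) that] Ints_subset_Rats by (rule rev_subsetD)
  show "qspan \<Phi> \<subseteq> qspan \<Delta>"
    using order_trans[OF assms(3) zspan_subset_qspan] by (rule iffD1[OF qspan_subset_iff])
  have "e \<in> qspan \<Phi>" if e: "e \<in> \<Delta>" for e
  proof (rule rational_in_qspan[OF assms(2,4) neg_def_subset[OF D(3) sp]])
    show "e \<in> span \<Phi>"
      using span_eq_if_card_eq[OF D(1) assms(4) sp assms(5)] span_base[OF e] by simp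
    show "B r s \<in> \<rat>" if "r \<in> \<Phi>" "s \<in> \<Phi>" for r s
      by (rule rat[OF subsetD[OF assms(3) that(1)] subsetD[OF assms(3) that(2)]])
    show "B e r \<in> \<rat>" if "r \<in> \<Phi>" for r
      by (rule rat[OF Z.span_base[OF e] subsetD[OF assms(3) that]])
  qed
  then have "\<Delta> \<subseteq> qspan \<Phi>" by (rule subsetI)
  then show "qspan \<Delta> \<subseteq> qspan \<Phi>" by (rule iffD1[OF qspan_subset_iff])
qed

lemma dynkin_image_iso:
  assumes "\<And>x y. x \<in> \<Phi> \<Longrightarrow> y \<in> \<Phi> \<Longrightarrow> B' (g x) (g y) = B x y" "inj_on g \<Phi>"
  shows "diagram_iso (dynkin_diagram B \<Phi>) (dynkin_diagram B' (g ` \<Phi>))"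
  unfolding diagram_iso_def
proof (intro exI[of _ g] conjI ballI)
  show "bij_betw g (fst (dynkin_diagram B \<Phi>)) (fst (dynkin_diagram B' (g ` \<Phi>)))"
    using assms(2) by (simp add: dynkin_diagram_def bij_betw_def)
  fix u v assume "u \<in> fst (dynkin_diagram B \<Phi>)" "v \<in> fst (dynkin_diagram B \<Phi>)"
  then have uv: "u \<in> \<Phi>" "v \<in> \<Phi>" by (simp_all add: dynkin_diagram_def)
  then show "(u, v) \<in> snd (dynkin_diagram B \<Phi>) \<longleftrightarrow> (g u, g v) \<in> snd (dynkin_diagram B' (g ` \<Phi>))"
    using inj_on_eq_iff[OF assms(2) uv] by (simp add: dynkin_diagram_def assms(1))
qed

lemma config_type_iso:
  assumes "finite \<Phi>" "is_ade_diagram (dynkin_diagram B \<Phi>)" "diagram_iso (dynkin_diagram B \<Phi>) D"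
    "snd D \<subseteq> fst D \<times> fst D"
  shows "is_ade_diagram D" "diagram_type D = config_type B \<Phi>"
  using diagram_iso_imp_same_type[OF assms(2) _ dynkin_diagram_wf(1,2) assms(3,4)] assms(1)
  by (simp_all add: dynkin_diagram_wf(3) config_type_def)

lemma config_type_image:
  assumes "finite \<Phi>" "is_ade_diagram (dynkin_diagram B \<Phi>)"
    "\<And>x y. x \<in> \<Phi> \<Longrightarrow> y \<in> \<Phi> \<Longrightarrow> B (g x) (g y) = B x y" "inj_on g \<Phi>"
  shows "is_ade_diagram (dynkin_diagram B (g ` \<Phi>))" "config_type B (g ` \<Phi>) = config_type B \<Phi>"
  using config_type_iso[OF assms(1,2) dynkin_image_iso[of \<Phi> B g] dynkin_diagram_wf(1)] assms(3,4)
  by (simp_all add: config_type_def)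

lemma ade_config_simple: "ade_config B L \<Phi> \<Longrightarrow> simple_system \<Phi>"
  by (intro ade_simple_system) (auto simp: ade_config_def roots_def)

lemma simple_ade_config:
  assumes "simple_system \<Delta>" "is_ade_diagram (dynkin_diagram B \<Delta>)" "\<Delta> \<subseteq> L"
  shows "ade_config B L \<Delta>"
  unfolding ade_config_def roots_def using simple_systemD[OF assms(1)] assms(2,3) by auto

text \<open>The type of a negative definite root lattice is well defined, as its bases of simple roots are
  conjugate.\<close>

lemma lattice_type_simple:
  assumes "simple_system \<Delta>" "is_ade_diagram (dynkin_diagram B \<Delta>)"
  shows "lattice_type B (zspan \<Delta>) = config_type B \<Delta>"
  unfolding lattice_type_def
proof (rule the_equality)
  note D = simple_systemD[OF assms(1)]
  have "ade_config B (zspan \<Delta>) \<Delta>" by (rule simple_ade_config[OF assms Z.span_superset])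
  moreover have "zbasis (zspan \<Delta>) \<Delta>" using D by (simp add: zbasis_def)
  ultimately show "\<exists>\<Phi>. ade_config B (zspan \<Delta>) \<Phi> \<and> zbasis (zspan \<Delta>) \<Phi> \<and> config_type B \<Phi> = config_type B \<Delta>"
    by (intro exI[of _ \<Delta>]) simp
  fix t assume "\<exists>\<Phi>. ade_config B (zspan \<Delta>) \<Phi> \<and> zbasis (zspan \<Delta>) \<Phi> \<and> config_type B \<Phi> = t"
  then obtain \<Phi> where \<Phi>: "ade_config B (zspan \<Delta>) \<Phi>" "zspan \<Phi> = zspan \<Delta>" "config_type B \<Phi> = t"
    unfolding zbasis_def by (elim exE conjE)
  have S: "simple_system \<Phi>" by (rule ade_config_simple[OF \<Phi>(1)])
  obtain g where g: "g \<in> weyl \<Delta>" "g ` \<Phi> = \<Delta>" using simple_systems_conjugate[OF assms(1) S \<Phi>(2)] by (elim bexE)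
  have "inj g" using weyl_inj[OF g(1)] D(4) by simp
  then have inj: "inj_on g \<Phi>" by (rule inj_on_subset) simp
  have ade: "is_ade_diagram (dynkin_diagram B \<Phi>)" using \<Phi>(1) by (simp add: ade_config_def)
  have "config_type B (g ` \<Phi>) = config_type B \<Phi>"
    using simple_weyl_isometry[OF assms(1) g(1)]
    by (intro config_type_image(2)[OF simple_systemD(1)[OF S] ade _ inj]) simp
  then show "t = config_type B \<Delta>" using \<Phi>(3) g(2) by simp
qed

lemma simple_root_lattice:
  assumes "simple_system \<Delta>" shows "is_root_lattice B (zspan \<Delta>)"
proof -
  note D = simple_systemD[OF assms]
  have "x = 0" if "x \<in> zspan \<Delta>" "\<forall>y\<in>zspan \<Delta>. B x y = 0" for x
    by (rule neg_def_zero[OF D(3) subsetD[OF zspan_subset_span that(1)]])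
      (use that(2) Z.span_base in blast)
  then have "is_lattice B (zspan \<Delta>)"
    unfolding is_lattice_def zbasis_def
    using bilinear_B B_sym simple_zspan_integral[OF assms] D(1,2) by blast
  moreover have "zspan (roots B (zspan \<Delta>)) = zspan \<Delta>"
  proof
    show "zspan (roots B (zspan \<Delta>)) \<subseteq> zspan \<Delta>"
      by (rule Z.span_minimal[OF _ Z.subspace_span]) (auto simp: roots_def)
    show "zspan \<Delta> \<subseteq> zspan (roots B (zspan \<Delta>))"
      by (rule Z.span_mono) (auto simp: roots_def D(4) intro: Z.span_base)
  qed
  ultimately show ?thesis by (simp add: is_root_lattice_def)
qed

end

lemma ade_config_L10D:
  assumes "ade_config L10_form L10 \<Phi>"
  shows "L.simple_system \<Phi>" "\<Phi> \<subseteq> L10" "is_ade_diagram (dynkin_diagram L10_form \<Phi>)" "finite \<Phi>"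
  using L.ade_config_simple[OF assms] assms by (auto simp: ade_config_def roots_def)

lemma primitive_closure_image:
  assumes "g \<in> W10"
  shows "g ` primitive_closure L10 R = primitive_closure L10 (g ` R)"
  unfolding primitive_closure_def
  by (simp add: image_Int[OF W10_inj[OF assms]] W10_image[OF assms] linear_qspan_image[OF W10_linear[OF assms]])

text \<open>A configuration and the simple roots in whose span it lies have the same number of elements, so both
  have the same rational span, and the simple roots span a primitive sublattice.\<close>

lemma config_closure:
  assumes "ade_config L10_form L10 \<Phi>"
  shows "\<exists>g\<in>W10. \<exists>S\<subseteq>{1..10}. L.simple_system (ev ` S) \<and> g ` \<Phi> \<subseteq> zspan (ev ` S) \<and> card S = card \<Phi>
    \<and> g ` primitive_closure L10 (zspan \<Phi>) = zspan (ev ` S)"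
proof -
  note P = ade_config_L10D[OF assms]
  obtain g S where g: "g \<in> W10" "S \<subseteq> {1..10}" "L.simple_system (ev ` S)" "g ` \<Phi> \<subseteq> zspan (ev ` S)"
    "card S = card \<Phi>"
    using roots_into_E10[OF P(1,2)] by (elim bexE exE conjE)
  have gP: "L.simple_system (g ` \<Phi>)"
    by (rule L.simple_system_image[OF P(1) W10_linear[OF g(1)] W10_isometry[OF g(1)]])
  have "card (g ` \<Phi>) = card \<Phi>" by (rule card_image[OF inj_on_subset[OF W10_inj[OF g(1)] subset_UNIV]])
  moreover have "card (ev ` S) = card S" by (rule card_image[OF inj_on_subset[OF inj_vertex_vector subset_UNIV]])
  ultimately have "card (g ` \<Phi>) = card (ev ` S)" using g(5) by simp
  then have "qspan (g ` \<Phi>) = qspan (ev ` S)"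
    using L.simple_systemD[OF gP] by (intro L.qspan_eq_if_card_eq[OF g(3) _ g(4)])
  then have "g ` primitive_closure L10 (zspan \<Phi>) = zspan (ev ` S)"
    unfolding primitive_closure_image[OF g(1)] linear_zspan_image[OF W10_linear[OF g(1)]]
    by (simp add: primitive_closure_def qspan_zspan primitive_closure_ev[OF g(2)])
  then show ?thesis using g by blast
qed

lemma closure_is_root_lattice:
  assumes "ade_config L10_form L10 \<Phi>"
  shows "\<exists>\<Delta>. L.simple_system \<Delta> \<and> primitive_closure L10 (zspan \<Phi>) = zspan \<Delta>"
proof -
  obtain g S where g: "g \<in> W10" "L.simple_system (ev ` S)"
    "g ` primitive_closure L10 (zspan \<Phi>) = zspan (ev ` S)"
    using config_closure[OF assms] by (elim bexE exE conjE)
  obtain h where h: "h \<in> W10" "h \<circ> g = id" using W10_inverse[OF g(1)] by (elim bexE conjE)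
  have "primitive_closure L10 (zspan \<Phi>) = h ` g ` primitive_closure L10 (zspan \<Phi>)"
    by (simp add: image_comp h(2))
  also have "\<dots> = zspan (h ` ev ` S)" unfolding g(3) by (rule linear_zspan_image[OF W10_linear[OF h(1)]])
  finally have "primitive_closure L10 (zspan \<Phi>) = zspan (h ` ev ` S)" .
  moreover have "L.simple_system (h ` ev ` S)"
    by (rule L.simple_system_image[OF g(2) W10_linear[OF h(1)] W10_isometry[OF h(1)]])
  ultimately show ?thesis by blast
qed

section \<open>Computations with coordinate vectors\<close>

fun simple_reflection :: "nat \<Rightarrow> int list \<Rightarrow> int list" where
  "simple_reflection k [a, b, c, d, e, f, g, h, i, j] =
    (if k = 1 then [d - a, b, c, d, e, f, g, h, i, j]
     else if k = 2 then [a, c - b, c, d, e, f, g, h, i, j]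
     else if k = 3 then [a, b, b + d - c, d, e, f, g, h, i, j]
     else if k = 4 then [a, b, c, a + c + e - d, e, f, g, h, i, j]
     else if k = 5 then [a, b, c, d, d + f - e, f, g, h, i, j]
     else if k = 6 then [a, b, c, d, e, e + g - f, g, h, i, j]
     else if k = 7 then [a, b, c, d, e, f, f + h - g, h, i, j]
     else if k = 8 then [a, b, c, d, e, f, g, g + i - h, i, j]
     else if k = 9 then [a, b, c, d, e, f, g, h, h + j - i, j]
     else [a, b, c, d, e, f, g, h, i, i - j])"
| "simple_reflection _ _ = []"

definition apply_word :: "nat list \<Rightarrow> int list \<Rightarrow> int list" where
  "apply_word w x = fold simple_reflection w x"

definition unit_list :: "nat \<Rightarrow> int list" where
  "unit_list i = map (\<lambda>j. if j = i then 1 else 0) [1..<11]"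

text \<open>A flip is a word of simple reflections, followed by the list of the vertices \<open>j\<close> such that the
  word maps \<open>ev 1\<close>, \<open>ev 2\<close>, \<dots> to \<open>ev j\<close> or \<open>- ev j\<close>; the entry \<open>0\<close> means that there is no such
  \<open>j\<close>. The words represent longest elements of parabolic subgroups of type \<open>A\<close>, \<open>D\<^sub>5\<close>, \<open>D\<^sub>9\<close> and
  \<open>E\<^sub>6\<close>, which act on the simple roots of the subgroup by an automorphism of its diagram and a
  sign.\<close>

definition flips :: "(nat list \<times> nat list) list" where
  "flips = [
    ([2, 3, 4, 5, 6, 7, 8, 9, 10, 2, 3, 4, 5, 6, 7, 8, 9, 2, 3, 4, 5, 6, 7, 8, 2, 3, 4, 5, 6, 7, 2, 3, 4, 5, 6, 2, 3, 4, 5, 2, 3, 4, 2, 3, 2],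
      [0, 10, 9, 8, 7, 6, 5, 4, 3, 2]),
    ([1, 4, 5, 6, 7, 8, 9, 10, 1, 4, 5, 6, 7, 8, 9, 1, 4, 5, 6, 7, 8, 1, 4, 5, 6, 7, 1, 4, 5, 6, 1, 4, 5, 1, 4, 1],
      [10, 2, 0, 9, 8, 7, 6, 5, 4, 1]),
    ([1, 4, 3, 2, 1, 4, 3, 1, 4, 1],
      [2, 1, 4, 3, 0, 6, 7, 8, 9, 10]),
    ([5, 6, 7, 8, 9, 10, 5, 6, 7, 8, 9, 5, 6, 7, 8, 5, 6, 7, 5, 6, 5],
      [1, 2, 3, 0, 10, 9, 8, 7, 6, 5]),
    ([2, 3, 4, 5, 6, 1, 4, 5, 3, 4, 2, 3, 1, 4, 5, 6, 1, 4, 5, 3, 4, 2, 3, 1, 4, 5, 3, 4, 2, 3, 1, 4, 2, 3, 2, 1],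
      [1, 6, 5, 4, 3, 2, 0, 8, 9, 10]),
    ([7, 8, 9, 10, 7, 8, 9, 7, 8, 7],
      [1, 2, 3, 4, 5, 0, 10, 9, 8, 7]),
    ([2, 3, 2],
      [1, 3, 2, 0, 5, 6, 7, 8, 9, 10]),
    ([4, 5, 6, 7, 8, 9, 10, 4, 5, 6, 7, 8, 9, 4, 5, 6, 7, 8, 4, 5, 6, 7, 4, 5, 6, 4, 5, 4],
      [0, 2, 0, 10, 9, 8, 7, 6, 5, 4]),
    ([10, 9, 8, 7, 6, 5, 4, 3, 1, 4, 5, 6, 7, 8, 9, 10, 9, 8, 7, 6, 5, 4, 3, 1, 4, 5, 6, 7, 8, 9, 8, 7, 6, 5, 4, 3, 1, 4, 5, 6, 7, 8, 7, 6, 5, 4, 3, 1, 4, 5, 6, 7, 6, 5, 4, 3, 1, 4, 5, 6, 5, 4, 3, 1, 4, 5, 4, 3, 1, 4, 3, 1],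
      [3, 0, 1, 4, 5, 6, 7, 8, 9, 10]),
    ([6, 7, 8, 9, 10, 6, 7, 8, 9, 6, 7, 8, 6, 7, 6],
      [1, 2, 3, 4, 0, 10, 9, 8, 7, 6]),
    ([3, 4, 5, 6, 3, 4, 5, 3, 4, 3],
      [0, 0, 6, 5, 4, 3, 0, 8, 9, 10]),
    ([5, 6, 5],
      [1, 2, 3, 0, 6, 5, 0, 8, 9, 10]),
    ([3, 4, 5, 6, 7, 8, 9, 10, 3, 4, 5, 6, 7, 8, 9, 3, 4, 5, 6, 7, 8, 3, 4, 5, 6, 7, 3, 4, 5, 6, 3, 4, 5, 3, 4, 3],
      [0, 0, 10, 9, 8, 7, 6, 5, 4, 3]),
    ([8, 9, 10, 8, 9, 8],
      [1, 2, 3, 4, 5, 6, 0, 10, 9, 8]),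
    ([9, 10, 9],
      [1, 2, 3, 4, 5, 6, 7, 0, 10, 9]),
    ([2, 3, 4, 5, 2, 3, 4, 2, 3, 2],
      [0, 5, 4, 3, 2, 0, 7, 8, 9, 10]),
    ([4, 5, 6, 7, 4, 5, 6, 4, 5, 4],
      [0, 2, 0, 7, 6, 5, 4, 0, 9, 10]),
    ([7, 8, 7],
      [1, 2, 3, 4, 5, 0, 8, 7, 0, 10]),
    ([5, 6, 7, 5, 6, 5],
      [1, 2, 3, 0, 7, 6, 5, 0, 9, 10]),
    ([1, 4, 5, 3, 4, 2, 3, 1, 4, 5, 3, 4, 2, 3, 1, 4, 2, 3, 2, 1],
      [5, 2, 3, 4, 1, 0, 7, 8, 9, 10]),
    ([3, 4, 5, 3, 4, 3],
      [0, 0, 5, 4, 3, 0, 7, 8, 9, 10]),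
    ([4, 5, 4],
      [0, 2, 0, 5, 4, 0, 7, 8, 9, 10]),
    ([6, 7, 6],
      [1, 2, 3, 4, 0, 7, 6, 0, 9, 10]),
    ([4, 5, 6, 4, 5, 4],
      [0, 2, 0, 6, 5, 4, 0, 8, 9, 10]),
    ([1, 4, 5, 6, 1, 4, 5, 1, 4, 1],
      [6, 2, 0, 5, 4, 1, 0, 8, 9, 10])]"

definition flip_ok :: "nat list \<times> nat list \<Rightarrow> bool" where
  "flip_ok p \<longleftrightarrow> (case p of (w, f) \<Rightarrow> list_all (\<lambda>k. k \<in> set [1..<11]) w \<and> length f = 10
     \<and> distinct (filter (\<lambda>j. j \<noteq> 0) f)
     \<and> list_all (\<lambda>(i, j). j = 0 \<or> j \<in> set [1..<11]
         \<and> apply_word w (unit_list i) \<in> set [unit_list j, map uminus (unit_list j)]) (zip [1..<11] f))"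

lemma flips_ok: "list_all flip_ok flips"
  by code_simp

text \<open>Flips move sets of vertices around. The weights of the vertices are chosen such that a
  set of vertices with negative definite span is determined by its type if no flip moves it to a set of
  larger weight.\<close>

definition vertex_weight :: "nat \<Rightarrow> int" where
  "vertex_weight i = [0, 0, 1, 2, 4, 8, 9, 10, 11, 13, 15] ! i"

definition flip_gains :: "nat list \<times> nat list \<Rightarrow> int option list" where
  "flip_gains p = map (\<lambda>(i, j). if j = 0 then None else Some (vertex_weight j - vertex_weight i))
     (zip [1..<11] (snd p))"

text \<open>The gains are added up over the chosen vertices. A chosen vertex without an image rules the flip
  out.\<close>

fun increases :: "int \<Rightarrow> int option list \<Rightarrow> bool list \<Rightarrow> bool" where
  "increases s (d # ds) (b # bs) =
     (if b then (case d of None \<Rightarrow> False | Some x \<Rightarrow> increases (s + x) ds bs) else increases s ds bs)"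
| "increases s _ _ \<longleftrightarrow> 0 < s"

definition stuck_subsets :: "int option list list \<Rightarrow> bool list list" where
  "stuck_subsets G = filter (\<lambda>b. b \<noteq> replicate 10 True \<and> b \<noteq> replicate 9 True @ [False]
     \<and> \<not> list_ex (\<lambda>g. increases 0 g b) G) (List.n_lists 10 [False, True])"

definition table_vertices :: "nat \<Rightarrow> nat list" where
  "table_vertices x = [[], [1, 3, 4, 5], [1, 3, 4, 5, 6], [1, 2, 3, 4, 5], [1, 3, 4, 5, 6, 7], [1, 3, 4, 5, 6, 7, 8], [1, 3, 4, 5, 6, 7, 8, 9], [1, 3, 4, 5, 6, 7, 8, 9, 10], [1, 2, 3, 4, 5, 6], [1, 2, 3, 4, 5, 6, 7], [1, 2, 3, 4, 5, 6, 7, 8]] ! x"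

text \<open>For each possible component \<open>X\<close> of type \<open>D\<close> or \<open>E\<close> of a canonical set (and for \<open>X\<close> empty):
  the configurations of finite index in its lattice up to the Weyl group, sorted by index, and the
  links between them. A link \<open>(a, k, i, b, w)\<close> says that the word \<open>w\<close> maps into the configuration
  \<open>b\<close> what arises from the configuration \<open>a\<close> when its component \<open>k\<close> is extended by minus the highest
  root and its vertex \<open>i\<close> is removed.\<close>

definition index_tables ::
  "((ade_symbol \<times> int list list) list list \<times> (nat \<times> nat \<times> nat \<times> nat \<times> nat list) list) list"
where
  "index_tables = [
    ([[]],
     []),
    ([[(Type_D 4, [[0, 0, 0, 0, 1, 0, 0, 0, 0, 0], [0, 0, 0, 1, 0, 0, 0, 0, 0, 0], [1, 0, 0, 0, 0, 0, 0, 0, 0, 0], [0, 0, 1, 0, 0, 0, 0, 0, 0, 0]])],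
      [(Type_A 1, [[0, 0, 0, 0, 1, 0, 0, 0, 0, 0]]), (Type_A 1, [[1, 0, 0, 0, 0, 0, 0, 0, 0, 0]]), (Type_A 1, [[0, 0, 1, 0, 0, 0, 0, 0, 0, 0]]), (Type_A 1, [[-1, 0, -1, -2, -1, 0, 0, 0, 0, 0]])]],
     [(0, 0, 1, 1, [])]),
    ([[(Type_D 5, [[0, 0, 0, 0, 0, 1, 0, 0, 0, 0], [0, 0, 0, 0, 1, 0, 0, 0, 0, 0], [0, 0, 0, 1, 0, 0, 0, 0, 0, 0], [1, 0, 0, 0, 0, 0, 0, 0, 0, 0], [0, 0, 1, 0, 0, 0, 0, 0, 0, 0]])],
      [(Type_A 3, [[1, 0, 0, 0, 0, 0, 0, 0, 0, 0], [0, 0, 0, 1, 0, 0, 0, 0, 0, 0], [0, 0, 1, 0, 0, 0, 0, 0, 0, 0]]), (Type_A 1, [[0, 0, 0, 0, 0, 1, 0, 0, 0, 0]]), (Type_A 1, [[-1, 0, -1, -2, -2, -1, 0, 0, 0, 0]])]],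
     [(0, 0, 1, 1, []),
      (0, 0, 2, 1, [3, 4, 1, 5, 4, 3, 6, 5, 4, 1])]),
    ([[(Type_D 5, [[0, 1, 0, 0, 0, 0, 0, 0, 0, 0], [0, 0, 1, 0, 0, 0, 0, 0, 0, 0], [0, 0, 0, 1, 0, 0, 0, 0, 0, 0], [1, 0, 0, 0, 0, 0, 0, 0, 0, 0], [0, 0, 0, 0, 1, 0, 0, 0, 0, 0]])],
      [(Type_A 3, [[1, 0, 0, 0, 0, 0, 0, 0, 0, 0], [0, 0, 0, 1, 0, 0, 0, 0, 0, 0], [0, 0, 0, 0, 1, 0, 0, 0, 0, 0]]), (Type_A 1, [[0, 1, 0, 0, 0, 0, 0, 0, 0, 0]]), (Type_A 1, [[-1, -1, -2, -2, -1, 0, 0, 0, 0, 0]])]],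
     [(0, 0, 1, 1, []),
      (0, 0, 2, 1, [5, 4, 1, 3, 2, 4, 3, 5, 4, 1])]),
    ([[(Type_D 6, [[0, 0, 0, 0, 0, 0, 1, 0, 0, 0], [0, 0, 0, 0, 0, 1, 0, 0, 0, 0], [0, 0, 0, 0, 1, 0, 0, 0, 0, 0], [0, 0, 0, 1, 0, 0, 0, 0, 0, 0], [1, 0, 0, 0, 0, 0, 0, 0, 0, 0], [0, 0, 1, 0, 0, 0, 0, 0, 0, 0]])],
      [(Type_D 4, [[0, 0, 1, 0, 0, 0, 0, 0, 0, 0], [0, 0, 0, 1, 0, 0, 0, 0, 0, 0], [0, 0, 0, 0, 1, 0, 0, 0, 0, 0], [1, 0, 0, 0, 0, 0, 0, 0, 0, 0]]), (Type_A 1, [[0, 0, 0, 0, 0, 0, 1, 0, 0, 0]]), (Type_A 1, [[-1, 0, -1, -2, -2, -2, -1, 0, 0, 0]])],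
      [(Type_A 3, [[0, 0, 0, 0, 0, 0, 1, 0, 0, 0], [0, 0, 0, 0, 0, 1, 0, 0, 0, 0], [-1, 0, -1, -2, -2, -2, -1, 0, 0, 0]]), (Type_A 3, [[1, 0, 0, 0, 0, 0, 0, 0, 0, 0], [0, 0, 0, 1, 0, 0, 0, 0, 0, 0], [0, 0, 1, 0, 0, 0, 0, 0, 0, 0]])],
      [(Type_A 1, [[0, 0, 1, 0, 0, 0, 0, 0, 0, 0]]), (Type_A 1, [[0, 0, 0, 0, 1, 0, 0, 0, 0, 0]]), (Type_A 1, [[1, 0, 0, 0, 0, 0, 0, 0, 0, 0]]), (Type_A 1, [[0, 0, 0, 0, 0, 0, 1, 0, 0, 0]]), (Type_A 1, [[-1, 0, -1, -2, -2, -2, -1, 0, 0, 0]]), (Type_A 1, [[-1, 0, -1, -2, -1, 0, 0, 0, 0, 0]])]],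
     [(0, 0, 1, 1, []),
      (0, 0, 2, 2, []),
      (0, 0, 3, 1, [3, 4, 1, 5, 4, 3, 6, 5, 4, 1, 7, 6, 5, 4, 3]),
      (1, 0, 1, 3, [])]),
    ([[(Type_D 7, [[0, 0, 0, 0, 0, 0, 0, 1, 0, 0], [0, 0, 0, 0, 0, 0, 1, 0, 0, 0], [0, 0, 0, 0, 0, 1, 0, 0, 0, 0], [0, 0, 0, 0, 1, 0, 0, 0, 0, 0], [0, 0, 0, 1, 0, 0, 0, 0, 0, 0], [1, 0, 0, 0, 0, 0, 0, 0, 0, 0], [0, 0, 1, 0, 0, 0, 0, 0, 0, 0]])],
      [(Type_D 5, [[0, 0, 0, 0, 0, 1, 0, 0, 0, 0], [0, 0, 0, 0, 1, 0, 0, 0, 0, 0], [0, 0, 0, 1, 0, 0, 0, 0, 0, 0], [1, 0, 0, 0, 0, 0, 0, 0, 0, 0], [0, 0, 1, 0, 0, 0, 0, 0, 0, 0]]), (Type_A 1, [[0, 0, 0, 0, 0, 0, 0, 1, 0, 0]]), (Type_A 1, [[-1, 0, -1, -2, -2, -2, -2, -1, 0, 0]])],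
      [(Type_D 4, [[0, 0, 1, 0, 0, 0, 0, 0, 0, 0], [0, 0, 0, 1, 0, 0, 0, 0, 0, 0], [0, 0, 0, 0, 1, 0, 0, 0, 0, 0], [1, 0, 0, 0, 0, 0, 0, 0, 0, 0]]), (Type_A 3, [[0, 0, 0, 0, 0, 0, 0, 1, 0, 0], [0, 0, 0, 0, 0, 0, 1, 0, 0, 0], [-1, 0, -1, -2, -2, -2, -2, -1, 0, 0]])],
      [(Type_A 3, [[1, 0, 0, 0, 0, 0, 0, 0, 0, 0], [0, 0, 0, 1, 0, 0, 0, 0, 0, 0], [0, 0, 1, 0, 0, 0, 0, 0, 0, 0]]), (Type_A 1, [[0, 0, 0, 0, 0, 1, 0, 0, 0, 0]]), (Type_A 1, [[0, 0, 0, 0, 0, 0, 0, 1, 0, 0]]), (Type_A 1, [[-1, 0, -1, -2, -2, -2, -2, -1, 0, 0]]), (Type_A 1, [[-1, 0, -1, -2, -2, -1, 0, 0, 0, 0]])]],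
     [(0, 0, 1, 1, []),
      (0, 0, 2, 2, []),
      (0, 0, 3, 2, [3, 4, 1, 5, 4, 3, 6, 5, 4, 1, 7, 6, 5, 4, 3, 8, 7, 6, 5, 4, 1]),
      (0, 0, 4, 1, [3, 4, 1, 5, 4, 3, 6, 5, 4, 1, 7, 6, 5, 4, 3, 8, 7, 6, 5, 4, 1]),
      (1, 0, 1, 3, []),
      (1, 0, 2, 3, [3, 4, 1, 5, 4, 3, 6, 5, 4, 1]),
      (2, 0, 1, 3, [1, 6, 5, 4, 3, 7, 6, 5, 4, 1, 8, 7, 6, 5, 4, 3])]),
    ([[(Type_D 8, [[0, 0, 0, 0, 0, 0, 0, 0, 1, 0], [0, 0, 0, 0, 0, 0, 0, 1, 0, 0], [0, 0, 0, 0, 0, 0, 1, 0, 0, 0], [0, 0, 0, 0, 0, 1, 0, 0, 0, 0], [0, 0, 0, 0, 1, 0, 0, 0, 0, 0], [0, 0, 0, 1, 0, 0, 0, 0, 0, 0], [1, 0, 0, 0, 0, 0, 0, 0, 0, 0], [0, 0, 1, 0, 0, 0, 0, 0, 0, 0]])],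
      [(Type_D 6, [[0, 0, 0, 0, 0, 0, 1, 0, 0, 0], [0, 0, 0, 0, 0, 1, 0, 0, 0, 0], [0, 0, 0, 0, 1, 0, 0, 0, 0, 0], [0, 0, 0, 1, 0, 0, 0, 0, 0, 0], [1, 0, 0, 0, 0, 0, 0, 0, 0, 0], [0, 0, 1, 0, 0, 0, 0, 0, 0, 0]]), (Type_A 1, [[0, 0, 0, 0, 0, 0, 0, 0, 1, 0]]), (Type_A 1, [[-1, 0, -1, -2, -2, -2, -2, -2, -1, 0]])],
      [(Type_D 5, [[0, 0, 0, 0, 0, 1, 0, 0, 0, 0], [0, 0, 0, 0, 1, 0, 0, 0, 0, 0], [0, 0, 0, 1, 0, 0, 0, 0, 0, 0], [1, 0, 0, 0, 0, 0, 0, 0, 0, 0], [0, 0, 1, 0, 0, 0, 0, 0, 0, 0]]), (Type_A 3, [[0, 0, 0, 0, 0, 0, 0, 0, 1, 0], [0, 0, 0, 0, 0, 0, 0, 1, 0, 0], [-1, 0, -1, -2, -2, -2, -2, -2, -1, 0]])],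
      [(Type_D 4, [[-1, 0, -1, -2, -2, -2, -2, -2, -1, 0], [0, 0, 0, 0, 0, 0, 0, 1, 0, 0], [0, 0, 0, 0, 0, 0, 0, 0, 1, 0], [0, 0, 0, 0, 0, 0, 1, 0, 0, 0]]), (Type_D 4, [[0, 0, 1, 0, 0, 0, 0, 0, 0, 0], [0, 0, 0, 1, 0, 0, 0, 0, 0, 0], [0, 0, 0, 0, 1, 0, 0, 0, 0, 0], [1, 0, 0, 0, 0, 0, 0, 0, 0, 0]])],
      [(Type_D 4, [[0, 0, 1, 0, 0, 0, 0, 0, 0, 0], [0, 0, 0, 1, 0, 0, 0, 0, 0, 0], [0, 0, 0, 0, 1, 0, 0, 0, 0, 0], [1, 0, 0, 0, 0, 0, 0, 0, 0, 0]]), (Type_A 1, [[0, 0, 0, 0, 0, 0, 1, 0, 0, 0]]), (Type_A 1, [[0, 0, 0, 0, 0, 0, 0, 0, 1, 0]]), (Type_A 1, [[-1, 0, -1, -2, -2, -2, -2, -2, -1, 0]]), (Type_A 1, [[-1, 0, -1, -2, -2, -2, -1, 0, 0, 0]])],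
      [(Type_A 3, [[0, 0, 0, 0, 0, 0, 1, 0, 0, 0], [0, 0, 0, 0, 0, 1, 0, 0, 0, 0], [-1, 0, -1, -2, -2, -2, -1, 0, 0, 0]]), (Type_A 3, [[1, 0, 0, 0, 0, 0, 0, 0, 0, 0], [0, 0, 0, 1, 0, 0, 0, 0, 0, 0], [0, 0, 1, 0, 0, 0, 0, 0, 0, 0]]), (Type_A 1, [[0, 0, 0, 0, 0, 0, 0, 0, 1, 0]]), (Type_A 1, [[-1, 0, -1, -2, -2, -2, -2, -2, -1, 0]])],
      [(Type_A 1, [[0, 0, 1, 0, 0, 0, 0, 0, 0, 0]]), (Type_A 1, [[0, 0, 0, 0, 1, 0, 0, 0, 0, 0]]), (Type_A 1, [[1, 0, 0, 0, 0, 0, 0, 0, 0, 0]]), (Type_A 1, [[0, 0, 0, 0, 0, 0, 1, 0, 0, 0]]), (Type_A 1, [[0, 0, 0, 0, 0, 0, 0, 0, 1, 0]]), (Type_A 1, [[-1, 0, -1, -2, -2, -2, -2, -2, -1, 0]]), (Type_A 1, [[-1, 0, -1, -2, -2, -2, -1, 0, 0, 0]]), (Type_A 1, [[-1, 0, -1, -2, -1, 0, 0, 0, 0, 0]])]],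
     [(0, 0, 1, 1, []),
      (0, 0, 2, 2, []),
      (0, 0, 3, 3, []),
      (0, 0, 4, 2, [3, 4, 1, 5, 4, 3, 6, 5, 4, 1, 7, 6, 5, 4, 3, 8, 7, 6, 5, 4, 1, 9, 8, 7, 6, 5, 4, 3]),
      (0, 0, 5, 1, [3, 4, 1, 5, 4, 3, 6, 5, 4, 1, 7, 6, 5, 4, 3, 8, 7, 6, 5, 4, 1, 9, 8, 7, 6, 5, 4, 3]),
      (1, 0, 1, 4, []),
      (1, 0, 2, 5, []),
      (1, 0, 3, 4, [3, 4, 1, 5, 4, 3, 6, 5, 4, 1, 7, 6, 5, 4, 3]),
      (2, 0, 1, 5, [7, 6, 8, 7, 9, 8]),
      (2, 0, 2, 5, [3, 4, 1, 5, 4, 3, 6, 5, 4, 1, 7, 6, 8, 7, 9, 8]),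
      (3, 0, 1, 4, [7, 6, 5, 4, 1, 3, 4, 5, 6]),
      (3, 1, 1, 4, [1, 6, 5, 4, 3, 7, 6, 5, 4, 1, 8, 7, 6, 5, 4, 3, 9, 8, 7, 6, 5, 4, 1]),
      (4, 0, 1, 6, [])]),
    ([[(Type_D 9, [[0, 0, 0, 0, 0, 0, 0, 0, 0, 1], [0, 0, 0, 0, 0, 0, 0, 0, 1, 0], [0, 0, 0, 0, 0, 0, 0, 1, 0, 0], [0, 0, 0, 0, 0, 0, 1, 0, 0, 0], [0, 0, 0, 0, 0, 1, 0, 0, 0, 0], [0, 0, 0, 0, 1, 0, 0, 0, 0, 0], [0, 0, 0, 1, 0, 0, 0, 0, 0, 0], [1, 0, 0, 0, 0, 0, 0, 0, 0, 0], [0, 0, 1, 0, 0, 0, 0, 0, 0, 0]])],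
      [(Type_D 7, [[0, 0, 0, 0, 0, 0, 0, 1, 0, 0], [0, 0, 0, 0, 0, 0, 1, 0, 0, 0], [0, 0, 0, 0, 0, 1, 0, 0, 0, 0], [0, 0, 0, 0, 1, 0, 0, 0, 0, 0], [0, 0, 0, 1, 0, 0, 0, 0, 0, 0], [1, 0, 0, 0, 0, 0, 0, 0, 0, 0], [0, 0, 1, 0, 0, 0, 0, 0, 0, 0]]), (Type_A 1, [[0, 0, 0, 0, 0, 0, 0, 0, 0, 1]]), (Type_A 1, [[-1, 0, -1, -2, -2, -2, -2, -2, -2, -1]])],
      [(Type_D 6, [[0, 0, 0, 0, 0, 0, 1, 0, 0, 0], [0, 0, 0, 0, 0, 1, 0, 0, 0, 0], [0, 0, 0, 0, 1, 0, 0, 0, 0, 0], [0, 0, 0, 1, 0, 0, 0, 0, 0, 0], [1, 0, 0, 0, 0, 0, 0, 0, 0, 0], [0, 0, 1, 0, 0, 0, 0, 0, 0, 0]]), (Type_A 3, [[0, 0, 0, 0, 0, 0, 0, 0, 0, 1], [0, 0, 0, 0, 0, 0, 0, 0, 1, 0], [-1, 0, -1, -2, -2, -2, -2, -2, -2, -1]])],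
      [(Type_D 5, [[0, 0, 0, 0, 0, 1, 0, 0, 0, 0], [0, 0, 0, 0, 1, 0, 0, 0, 0, 0], [0, 0, 0, 1, 0, 0, 0, 0, 0, 0], [1, 0, 0, 0, 0, 0, 0, 0, 0, 0], [0, 0, 1, 0, 0, 0, 0, 0, 0, 0]]), (Type_D 4, [[-1, 0, -1, -2, -2, -2, -2, -2, -2, -1], [0, 0, 0, 0, 0, 0, 0, 0, 1, 0], [0, 0, 0, 0, 0, 0, 0, 0, 0, 1], [0, 0, 0, 0, 0, 0, 0, 1, 0, 0]])],
      [(Type_D 5, [[0, 0, 0, 0, 0, 1, 0, 0, 0, 0], [0, 0, 0, 0, 1, 0, 0, 0, 0, 0], [0, 0, 0, 1, 0, 0, 0, 0, 0, 0], [1, 0, 0, 0, 0, 0, 0, 0, 0, 0], [0, 0, 1, 0, 0, 0, 0, 0, 0, 0]]), (Type_A 1, [[0, 0, 0, 0, 0, 0, 0, 1, 0, 0]]), (Type_A 1, [[0, 0, 0, 0, 0, 0, 0, 0, 0, 1]]), (Type_A 1, [[-1, 0, -1, -2, -2, -2, -2, -2, -2, -1]]), (Type_A 1, [[-1, 0, -1, -2, -2, -2, -2, -1, 0, 0]])],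
      [(Type_D 4, [[0, 0, 1, 0, 0, 0, 0, 0, 0, 0], [0, 0, 0, 1, 0, 0, 0, 0, 0, 0], [0, 0, 0, 0, 1, 0, 0, 0, 0, 0], [1, 0, 0, 0, 0, 0, 0, 0, 0, 0]]), (Type_A 3, [[0, 0, 0, 0, 0, 0, 0, 1, 0, 0], [0, 0, 0, 0, 0, 0, 1, 0, 0, 0], [-1, 0, -1, -2, -2, -2, -2, -1, 0, 0]]), (Type_A 1, [[0, 0, 0, 0, 0, 0, 0, 0, 0, 1]]), (Type_A 1, [[-1, 0, -1, -2, -2, -2, -2, -2, -2, -1]])],
      [(Type_A 3, [[0, 0, 0, 0, 0, 0, 1, 0, 0, 0], [0, 0, 0, 0, 0, 1, 0, 0, 0, 0], [-1, 0, -1, -2, -2, -2, -1, 0, 0, 0]]), (Type_A 3, [[1, 0, 0, 0, 0, 0, 0, 0, 0, 0], [0, 0, 0, 1, 0, 0, 0, 0, 0, 0], [0, 0, 1, 0, 0, 0, 0, 0, 0, 0]]), (Type_A 3, [[0, 0, 0, 0, 0, 0, 0, 0, 0, 1], [0, 0, 0, 0, 0, 0, 0, 0, 1, 0], [-1, 0, -1, -2, -2, -2, -2, -2, -2, -1]])],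
      [(Type_A 3, [[1, 0, 0, 0, 0, 0, 0, 0, 0, 0], [0, 0, 0, 1, 0, 0, 0, 0, 0, 0], [0, 0, 1, 0, 0, 0, 0, 0, 0, 0]]), (Type_A 1, [[0, 0, 0, 0, 0, 1, 0, 0, 0, 0]]), (Type_A 1, [[0, 0, 0, 0, 0, 0, 0, 1, 0, 0]]), (Type_A 1, [[0, 0, 0, 0, 0, 0, 0, 0, 0, 1]]), (Type_A 1, [[-1, 0, -1, -2, -2, -2, -2, -2, -2, -1]]), (Type_A 1, [[-1, 0, -1, -2, -2, -2, -2, -1, 0, 0]]), (Type_A 1, [[-1, 0, -1, -2, -2, -1, 0, 0, 0, 0]])]],
     [(0, 0, 1, 1, []),
      (0, 0, 2, 2, []),
      (0, 0, 3, 3, []),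
      (0, 0, 4, 3, [1, 4, 3, 5, 4, 1, 6, 5, 4, 3, 7, 6, 5, 4, 1, 8, 7, 6, 5, 4, 3, 9, 8, 7, 6, 5, 4, 1, 10, 9, 8, 7, 6, 5, 4, 3]),
      (0, 0, 5, 2, [1, 4, 3, 5, 4, 1, 6, 5, 4, 3, 7, 6, 5, 4, 1, 8, 7, 6, 5, 4, 3, 9, 8, 7, 6, 5, 4, 1, 10, 9, 8, 7, 6, 5, 4, 3]),
      (0, 0, 6, 1, [3, 4, 1, 5, 4, 3, 6, 5, 4, 1, 7, 6, 5, 4, 3, 8, 7, 6, 5, 4, 1, 9, 8, 7, 6, 5, 4, 3, 10, 9, 8, 7, 6, 5, 4, 1]),
      (1, 0, 1, 4, []),
      (1, 0, 2, 5, []),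
      (1, 0, 3, 5, [3, 4, 1, 5, 4, 3, 6, 5, 4, 1, 7, 6, 5, 4, 3, 8, 7, 6, 5, 4, 1]),
      (1, 0, 4, 4, [3, 4, 1, 5, 4, 3, 6, 5, 4, 1, 7, 6, 5, 4, 3, 8, 7, 6, 5, 4, 1]),
      (2, 0, 1, 5, [8, 7, 9, 8, 10, 9]),
      (2, 0, 2, 6, []),
      (2, 0, 3, 5, [3, 4, 1, 5, 4, 3, 6, 5, 4, 1, 7, 6, 5, 4, 3, 8, 7, 9, 8, 10, 9]),
      (3, 0, 1, 5, [3, 4, 1, 7, 6, 5, 4, 3, 8, 7, 6, 5, 4, 1, 9, 8, 7, 6, 5, 4, 3, 10, 9, 8, 7, 6, 5, 4, 1]),
      (3, 0, 2, 5, [3, 4, 1, 5, 4, 6, 5, 7, 6, 5, 4, 1, 8, 7, 6, 5, 4, 3, 9, 8, 7, 6, 5, 4, 1, 10, 9, 8, 7, 6, 5, 4, 3]),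
      (3, 1, 1, 4, [8, 7, 6, 5, 4, 1, 3, 4, 5, 6, 7]),
      (4, 0, 1, 7, []),
      (4, 0, 2, 7, [3, 4, 1, 5, 4, 3, 6, 5, 4, 1]),
      (5, 0, 1, 7, [1, 6, 5, 4, 3, 7, 6, 5, 4, 1, 8, 7, 6, 5, 4, 3])]),
    ([[(Type_E 6, [[1, 0, 0, 0, 0, 0, 0, 0, 0, 0], [0, 1, 0, 0, 0, 0, 0, 0, 0, 0], [0, 0, 1, 0, 0, 0, 0, 0, 0, 0], [0, 0, 0, 1, 0, 0, 0, 0, 0, 0], [0, 0, 0, 0, 1, 0, 0, 0, 0, 0], [0, 0, 0, 0, 0, 1, 0, 0, 0, 0]])],
      [(Type_A 5, [[0, 1, 0, 0, 0, 0, 0, 0, 0, 0], [0, 0, 1, 0, 0, 0, 0, 0, 0, 0], [0, 0, 0, 1, 0, 0, 0, 0, 0, 0], [0, 0, 0, 0, 1, 0, 0, 0, 0, 0], [0, 0, 0, 0, 0, 1, 0, 0, 0, 0]]), (Type_A 1, [[-2, -1, -2, -3, -2, -1, 0, 0, 0, 0]])],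
      [(Type_A 2, [[1, 0, 0, 0, 0, 0, 0, 0, 0, 0], [-2, -1, -2, -3, -2, -1, 0, 0, 0, 0]]), (Type_A 2, [[0, 1, 0, 0, 0, 0, 0, 0, 0, 0], [0, 0, 1, 0, 0, 0, 0, 0, 0, 0]]), (Type_A 2, [[0, 0, 0, 0, 1, 0, 0, 0, 0, 0], [0, 0, 0, 0, 0, 1, 0, 0, 0, 0]])]],
     [(0, 0, 0, 1, []),
      (0, 0, 2, 1, [2, 3, 4, 1, 5, 4, 3, 2, 6, 5, 4, 1, 3, 4, 5, 6]),
      (0, 0, 3, 2, []),
      (0, 0, 4, 1, [6, 5, 4, 1, 3, 2, 4, 3, 5, 4, 1, 6, 5, 4, 3, 2])]),
    ([[(Type_E 7, [[1, 0, 0, 0, 0, 0, 0, 0, 0, 0], [0, 1, 0, 0, 0, 0, 0, 0, 0, 0], [0, 0, 1, 0, 0, 0, 0, 0, 0, 0], [0, 0, 0, 1, 0, 0, 0, 0, 0, 0], [0, 0, 0, 0, 1, 0, 0, 0, 0, 0], [0, 0, 0, 0, 0, 1, 0, 0, 0, 0], [0, 0, 0, 0, 0, 0, 1, 0, 0, 0]])],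
      [(Type_A 7, [[0, 0, 0, 0, 0, 0, 1, 0, 0, 0], [0, 0, 0, 0, 0, 1, 0, 0, 0, 0], [0, 0, 0, 0, 1, 0, 0, 0, 0, 0], [0, 0, 0, 1, 0, 0, 0, 0, 0, 0], [0, 0, 1, 0, 0, 0, 0, 0, 0, 0], [0, 1, 0, 0, 0, 0, 0, 0, 0, 0], [-2, -2, -3, -4, -3, -2, -1, 0, 0, 0]])],
      [(Type_D 6, [[0, 0, 0, 0, 0, 0, 1, 0, 0, 0], [0, 0, 0, 0, 0, 1, 0, 0, 0, 0], [0, 0, 0, 0, 1, 0, 0, 0, 0, 0], [0, 0, 0, 1, 0, 0, 0, 0, 0, 0], [1, 0, 0, 0, 0, 0, 0, 0, 0, 0], [0, 0, 1, 0, 0, 0, 0, 0, 0, 0]]), (Type_A 1, [[-2, -2, -3, -4, -3, -2, -1, 0, 0, 0]])],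
      [(Type_A 5, [[1, 0, 0, 0, 0, 0, 0, 0, 0, 0], [0, 0, 0, 1, 0, 0, 0, 0, 0, 0], [0, 0, 0, 0, 1, 0, 0, 0, 0, 0], [0, 0, 0, 0, 0, 1, 0, 0, 0, 0], [0, 0, 0, 0, 0, 0, 1, 0, 0, 0]]), (Type_A 2, [[0, 1, 0, 0, 0, 0, 0, 0, 0, 0], [-2, -2, -3, -4, -3, -2, -1, 0, 0, 0]])],
      [(Type_D 4, [[0, 0, 1, 0, 0, 0, 0, 0, 0, 0], [0, 0, 0, 1, 0, 0, 0, 0, 0, 0], [0, 0, 0, 0, 1, 0, 0, 0, 0, 0], [1, 0, 0, 0, 0, 0, 0, 0, 0, 0]]), (Type_A 1, [[0, 0, 0, 0, 0, 0, 1, 0, 0, 0]]), (Type_A 1, [[-2, -2, -3, -4, -3, -2, -1, 0, 0, 0]]), (Type_A 1, [[-1, 0, -1, -2, -2, -2, -1, 0, 0, 0]])],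
      [(Type_A 3, [[0, 0, 0, 0, 0, 0, 1, 0, 0, 0], [0, 0, 0, 0, 0, 1, 0, 0, 0, 0], [-1, 0, -1, -2, -2, -2, -1, 0, 0, 0]]), (Type_A 3, [[1, 0, 0, 0, 0, 0, 0, 0, 0, 0], [0, 0, 0, 1, 0, 0, 0, 0, 0, 0], [0, 0, 1, 0, 0, 0, 0, 0, 0, 0]]), (Type_A 1, [[-2, -2, -3, -4, -3, -2, -1, 0, 0, 0]])],
      [(Type_A 1, [[0, 0, 1, 0, 0, 0, 0, 0, 0, 0]]), (Type_A 1, [[0, 0, 0, 0, 1, 0, 0, 0, 0, 0]]), (Type_A 1, [[1, 0, 0, 0, 0, 0, 0, 0, 0, 0]]), (Type_A 1, [[0, 0, 0, 0, 0, 0, 1, 0, 0, 0]]), (Type_A 1, [[-2, -2, -3, -4, -3, -2, -1, 0, 0, 0]]), (Type_A 1, [[-1, 0, -1, -2, -2, -2, -1, 0, 0, 0]]), (Type_A 1, [[-1, 0, -1, -2, -1, 0, 0, 0, 0, 0]])]],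
     [(0, 0, 0, 1, []),
      (0, 0, 1, 2, []),
      (0, 0, 2, 3, []),
      (0, 0, 4, 3, [7, 6, 5, 4, 1, 3, 2, 4, 3, 5, 4, 1, 6, 5, 4, 3, 2, 7, 6, 5, 4, 1, 3, 4, 5, 6, 7]),
      (0, 0, 5, 2, [7, 6, 5, 4, 1, 3, 2, 4, 3, 5, 4, 1, 6, 5, 4, 3, 2, 7, 6, 5, 4, 1, 3, 4, 5, 6, 7]),
      (2, 0, 1, 4, []),
      (2, 0, 2, 5, []),
      (2, 0, 3, 4, [3, 4, 1, 5, 4, 3, 6, 5, 4, 1, 7, 6, 5, 4, 3]),
      (4, 0, 1, 6, [])]),
    ([[(Type_E 8, [[1, 0, 0, 0, 0, 0, 0, 0, 0, 0], [0, 1, 0, 0, 0, 0, 0, 0, 0, 0], [0, 0, 1, 0, 0, 0, 0, 0, 0, 0], [0, 0, 0, 1, 0, 0, 0, 0, 0, 0], [0, 0, 0, 0, 1, 0, 0, 0, 0, 0], [0, 0, 0, 0, 0, 1, 0, 0, 0, 0], [0, 0, 0, 0, 0, 0, 1, 0, 0, 0], [0, 0, 0, 0, 0, 0, 0, 1, 0, 0]])],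
      [(Type_D 8, [[-3, -2, -4, -6, -5, -4, -3, -2, 0, 0], [0, 0, 0, 0, 0, 0, 0, 1, 0, 0], [0, 0, 0, 0, 0, 0, 1, 0, 0, 0], [0, 0, 0, 0, 0, 1, 0, 0, 0, 0], [0, 0, 0, 0, 1, 0, 0, 0, 0, 0], [0, 0, 0, 1, 0, 0, 0, 0, 0, 0], [1, 0, 0, 0, 0, 0, 0, 0, 0, 0], [0, 0, 1, 0, 0, 0, 0, 0, 0, 0]])],
      [(Type_E 7, [[1, 0, 0, 0, 0, 0, 0, 0, 0, 0], [0, 1, 0, 0, 0, 0, 0, 0, 0, 0], [0, 0, 1, 0, 0, 0, 0, 0, 0, 0], [0, 0, 0, 1, 0, 0, 0, 0, 0, 0], [0, 0, 0, 0, 1, 0, 0, 0, 0, 0], [0, 0, 0, 0, 0, 1, 0, 0, 0, 0], [0, 0, 0, 0, 0, 0, 1, 0, 0, 0]]), (Type_A 1, [[-3, -2, -4, -6, -5, -4, -3, -2, 0, 0]])],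
      [(Type_A 8, [[0, 1, 0, 0, 0, 0, 0, 0, 0, 0], [0, 0, 1, 0, 0, 0, 0, 0, 0, 0], [0, 0, 0, 1, 0, 0, 0, 0, 0, 0], [0, 0, 0, 0, 1, 0, 0, 0, 0, 0], [0, 0, 0, 0, 0, 1, 0, 0, 0, 0], [0, 0, 0, 0, 0, 0, 1, 0, 0, 0], [0, 0, 0, 0, 0, 0, 0, 1, 0, 0], [-3, -2, -4, -6, -5, -4, -3, -2, 0, 0]])],
      [(Type_E 6, [[1, 0, 0, 0, 0, 0, 0, 0, 0, 0], [0, 1, 0, 0, 0, 0, 0, 0, 0, 0], [0, 0, 1, 0, 0, 0, 0, 0, 0, 0], [0, 0, 0, 1, 0, 0, 0, 0, 0, 0], [0, 0, 0, 0, 1, 0, 0, 0, 0, 0], [0, 0, 0, 0, 0, 1, 0, 0, 0, 0]]), (Type_A 2, [[0, 0, 0, 0, 0, 0, 0, 1, 0, 0], [-3, -2, -4, -6, -5, -4, -3, -2, 0, 0]])],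
      [(Type_D 6, [[0, 0, 0, 0, 0, 0, 1, 0, 0, 0], [0, 0, 0, 0, 0, 1, 0, 0, 0, 0], [0, 0, 0, 0, 1, 0, 0, 0, 0, 0], [0, 0, 0, 1, 0, 0, 0, 0, 0, 0], [1, 0, 0, 0, 0, 0, 0, 0, 0, 0], [0, 0, 1, 0, 0, 0, 0, 0, 0, 0]]), (Type_A 1, [[-3, -2, -4, -6, -5, -4, -3, -2, 0, 0]]), (Type_A 1, [[2, 2, 3, 4, 3, 2, 1, 0, 0, 0]])],
      [(Type_D 5, [[0, 0, 0, 0, 0, 1, 0, 0, 0, 0], [0, 0, 0, 0, 1, 0, 0, 0, 0, 0], [0, 0, 0, 1, 0, 0, 0, 0, 0, 0], [1, 0, 0, 0, 0, 0, 0, 0, 0, 0], [0, 0, 1, 0, 0, 0, 0, 0, 0, 0]]), (Type_A 3, [[-3, -2, -4, -6, -5, -4, -3, -2, 0, 0], [0, 0, 0, 0, 0, 0, 0, 1, 0, 0], [2, 2, 3, 4, 3, 2, 1, 0, 0, 0]])],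
      [(Type_D 4, [[2, 2, 3, 4, 3, 2, 1, 0, 0, 0], [0, 0, 0, 0, 0, 0, 0, 1, 0, 0], [-3, -2, -4, -6, -5, -4, -3, -2, 0, 0], [0, 0, 0, 0, 0, 0, 1, 0, 0, 0]]), (Type_D 4, [[0, 0, 1, 0, 0, 0, 0, 0, 0, 0], [0, 0, 0, 1, 0, 0, 0, 0, 0, 0], [0, 0, 0, 0, 1, 0, 0, 0, 0, 0], [1, 0, 0, 0, 0, 0, 0, 0, 0, 0]])],
      [(Type_A 7, [[0, 0, 0, 0, 0, 0, 1, 0, 0, 0], [0, 0, 0, 0, 0, 1, 0, 0, 0, 0], [0, 0, 0, 0, 1, 0, 0, 0, 0, 0], [0, 0, 0, 1, 0, 0, 0, 0, 0, 0], [0, 0, 1, 0, 0, 0, 0, 0, 0, 0], [0, 1, 0, 0, 0, 0, 0, 0, 0, 0], [-2, -2, -3, -4, -3, -2, -1, 0, 0, 0]]), (Type_A 1, [[-3, -2, -4, -6, -5, -4, -3, -2, 0, 0]])],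
      [(Type_A 4, [[1, 0, 0, 0, 0, 0, 0, 0, 0, 0], [0, 0, 0, 1, 0, 0, 0, 0, 0, 0], [0, 0, 1, 0, 0, 0, 0, 0, 0, 0], [0, 1, 0, 0, 0, 0, 0, 0, 0, 0]]), (Type_A 4, [[0, 0, 0, 0, 0, 1, 0, 0, 0, 0], [0, 0, 0, 0, 0, 0, 1, 0, 0, 0], [0, 0, 0, 0, 0, 0, 0, 1, 0, 0], [-3, -2, -4, -6, -5, -4, -3, -2, 0, 0]])],
      [(Type_A 5, [[1, 0, 0, 0, 0, 0, 0, 0, 0, 0], [0, 0, 0, 1, 0, 0, 0, 0, 0, 0], [0, 0, 0, 0, 1, 0, 0, 0, 0, 0], [0, 0, 0, 0, 0, 1, 0, 0, 0, 0], [0, 0, 0, 0, 0, 0, 1, 0, 0, 0]]), (Type_A 2, [[0, 1, 0, 0, 0, 0, 0, 0, 0, 0], [-2, -2, -3, -4, -3, -2, -1, 0, 0, 0]]), (Type_A 1, [[-3, -2, -4, -6, -5, -4, -3, -2, 0, 0]])],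
      [(Type_D 4, [[0, 0, 1, 0, 0, 0, 0, 0, 0, 0], [0, 0, 0, 1, 0, 0, 0, 0, 0, 0], [0, 0, 0, 0, 1, 0, 0, 0, 0, 0], [1, 0, 0, 0, 0, 0, 0, 0, 0, 0]]), (Type_A 1, [[0, 0, 0, 0, 0, 0, 1, 0, 0, 0]]), (Type_A 1, [[-3, -2, -4, -6, -5, -4, -3, -2, 0, 0]]), (Type_A 1, [[2, 2, 3, 4, 3, 2, 1, 0, 0, 0]]), (Type_A 1, [[-1, 0, -1, -2, -2, -2, -1, 0, 0, 0]])],
      [(Type_A 3, [[0, 0, 0, 0, 0, 0, 1, 0, 0, 0], [0, 0, 0, 0, 0, 1, 0, 0, 0, 0], [-1, 0, -1, -2, -2, -2, -1, 0, 0, 0]]), (Type_A 3, [[1, 0, 0, 0, 0, 0, 0, 0, 0, 0], [0, 0, 0, 1, 0, 0, 0, 0, 0, 0], [0, 0, 1, 0, 0, 0, 0, 0, 0, 0]]), (Type_A 1, [[-3, -2, -4, -6, -5, -4, -3, -2, 0, 0]]), (Type_A 1, [[2, 2, 3, 4, 3, 2, 1, 0, 0, 0]])],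
      [(Type_A 2, [[1, 0, 0, 0, 0, 0, 0, 0, 0, 0], [-2, -1, -2, -3, -2, -1, 0, 0, 0, 0]]), (Type_A 2, [[0, 1, 0, 0, 0, 0, 0, 0, 0, 0], [0, 0, 1, 0, 0, 0, 0, 0, 0, 0]]), (Type_A 2, [[0, 0, 0, 0, 1, 0, 0, 0, 0, 0], [0, 0, 0, 0, 0, 1, 0, 0, 0, 0]]), (Type_A 2, [[0, 0, 0, 0, 0, 0, 0, 1, 0, 0], [-3, -2, -4, -6, -5, -4, -3, -2, 0, 0]])],
      [(Type_A 1, [[0, 0, 1, 0, 0, 0, 0, 0, 0, 0]]), (Type_A 1, [[0, 0, 0, 0, 1, 0, 0, 0, 0, 0]]), (Type_A 1, [[1, 0, 0, 0, 0, 0, 0, 0, 0, 0]]), (Type_A 1, [[0, 0, 0, 0, 0, 0, 1, 0, 0, 0]]), (Type_A 1, [[-3, -2, -4, -6, -5, -4, -3, -2, 0, 0]]), (Type_A 1, [[2, 2, 3, 4, 3, 2, 1, 0, 0, 0]]), (Type_A 1, [[-1, 0, -1, -2, -2, -2, -1, 0, 0, 0]]), (Type_A 1, [[-1, 0, -1, -2, -1, 0, 0, 0, 0, 0]])]],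
     [(0, 0, 0, 3, []),
      (0, 0, 1, 1, []),
      (0, 0, 4, 9, []),
      (0, 0, 6, 4, []),
      (0, 0, 7, 2, []),
      (1, 0, 1, 5, []),
      (1, 0, 2, 6, []),
      (1, 0, 3, 7, []),
      (1, 0, 4, 6, [1, 2, 4, 3, 2, 5, 4, 1, 3, 4, 6, 5, 4, 1, 3, 2, 4, 3, 7, 6, 5, 4, 1, 3, 2, 4, 3, 5, 4, 6, 5, 8, 7, 6, 5, 4, 1, 3, 2, 4, 3, 5, 4, 1, 6, 5, 4, 3, 2, 7, 6, 5, 4, 3, 8, 7, 6, 5, 4, 1]),
      (1, 0, 5, 5, [1, 2, 4, 3, 2, 5, 4, 1, 3, 4, 6, 5, 4, 1, 3, 2, 4, 3, 7, 6, 5, 4, 1, 3, 2, 4, 3, 5, 4, 6, 5, 8, 7, 6, 5, 4, 1, 3, 2, 4, 3, 5, 4, 1, 6, 5, 4, 3, 2, 7, 6, 5, 4, 3, 8, 7, 6, 5, 4, 1]),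
      (2, 0, 0, 8, []),
      (2, 0, 1, 5, [2, 3, 4, 1, 5, 4, 3, 2, 6, 5, 4, 1, 3, 4, 5, 6, 7, 6, 5, 4, 1, 3, 2, 4, 3, 5, 4, 1, 6, 5, 4, 3, 2]),
      (2, 0, 2, 10, []),
      (2, 0, 4, 10, [7, 6, 5, 4, 1, 3, 2, 4, 3, 5, 4, 1, 6, 5, 4, 3, 2, 7, 6, 5, 4, 1, 3, 4, 5, 6, 7]),
      (2, 0, 5, 5, [6, 5, 4, 1, 3, 2, 4, 3, 5, 4, 1, 6, 5, 4, 3, 2, 7, 6, 5, 4, 1, 3, 4, 5, 6, 7]),
      (4, 0, 0, 10, [7, 6, 5, 4, 3, 2, 8, 7, 6, 5, 4, 1, 3, 4, 5, 6, 7, 8]),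
      (4, 0, 2, 10, [2, 3, 4, 1, 5, 4, 3, 2, 6, 5, 4, 1, 3, 4, 5, 6, 7, 6, 5, 4, 3, 2, 8, 7, 6, 5, 4, 1, 3, 4, 5, 6, 7, 8]),
      (4, 0, 3, 13, []),
      (4, 0, 4, 10, [6, 5, 4, 1, 3, 2, 4, 3, 5, 4, 1, 6, 5, 4, 3, 2, 7, 6, 5, 4, 3, 2, 8, 7, 6, 5, 4, 1, 3, 4, 5, 6, 7, 8]),
      (5, 0, 1, 11, []),
      (5, 0, 2, 12, []),
      (5, 0, 3, 11, [3, 4, 1, 5, 4, 3, 6, 5, 4, 1, 7, 6, 5, 4, 3]),
      (6, 0, 1, 12, [2, 3, 4, 1, 5, 4, 3, 2, 7, 6, 5, 4, 1, 3, 2, 4, 5, 6, 8, 7, 6, 5, 4, 1, 3, 2, 4, 3, 5, 4, 1, 6, 5, 4, 3, 2, 7, 8]),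
      (6, 0, 2, 12, [1, 2, 4, 3, 2, 5, 4, 1, 3, 4, 6, 5, 4, 1, 3, 2, 4, 3, 7, 6, 5, 4, 1, 3, 2, 4, 5, 6, 8, 7, 6, 5, 4, 1, 3, 2, 4, 3, 5, 4, 1, 6, 5, 4, 3, 2, 7, 8]),
      (7, 0, 1, 11, [7, 6, 5, 4, 1, 3, 4, 5, 6]),
      (7, 1, 1, 11, [1, 2, 3, 4, 1, 6, 5, 4, 1, 3, 2, 4, 3, 7, 6, 5, 4, 1, 3, 2, 4, 3, 5, 4, 6, 5, 8, 7, 6, 5, 4, 1, 3, 2, 4, 3, 5, 4, 1, 6, 5, 4, 3, 2, 7, 6, 5, 4, 3, 8, 7, 6, 5, 4, 1]),
      (11, 0, 1, 14, [])])]"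

text \<open>The stuck sets of vertices: the table of the component of type \<open>D\<close> or \<open>E\<close>, and the components
  of type \<open>A\<close>.\<close>

definition canonical_subsets :: "(nat \<times> nat list list) list" where
  "canonical_subsets = [
    (0, []),
    (1, []),
    (2, []),
    (8, []),
    (4, []),
    (9, []),
    (5, []),
    (10, []),
    (6, []),
    (0, [[10]]),
    (1, [[10]]),
    (2, [[10]]),
    (8, [[10]]),
    (4, [[10]]),
    (9, [[10]]),
    (0, [[8], [10]]),
    (1, [[8], [10]]),
    (0, [[6], [8], [10]]),
    (0, [[4], [6], [8], [10]]),
    (0, [[2], [4], [6], [8], [10]]),
    (2, [[8], [10]]),
    (8, [[8], [10]]),
    (5, [[10]]),
    (10, [[10]]),
    (0, [[9, 10]]),
    (1, [[9, 10]]),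
    (2, [[9, 10]]),
    (8, [[9, 10]]),
    (0, [[7], [9, 10]]),
    (0, [[5], [7], [9, 10]]),
    (0, [[3], [5], [7], [9, 10]]),
    (0, [[1], [3], [5], [7], [9, 10]]),
    (0, [[1], [5], [7], [2, 3], [9, 10]]),
    (1, [[7], [9, 10]]),
    (3, [[7], [9, 10]]),
    (0, [[6, 7], [9, 10]]),
    (0, [[4], [6, 7], [9, 10]]),
    (0, [[2], [4], [6, 7], [9, 10]]),
    (0, [[2], [1, 4], [6, 7], [9, 10]]),
    (0, [[3, 4], [6, 7], [9, 10]]),
    (0, [[6, 7], [9, 10], [1, 4, 3, 2]]),
    (4, [[9, 10]]),
    (9, [[9, 10]]),
    (0, [[8, 9, 10]]),
    (1, [[8, 9, 10]]),
    (0, [[6], [8, 9, 10]]),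
    (0, [[4], [6], [8, 9, 10]]),
    (0, [[2], [4], [6], [8, 9, 10]]),
    (0, [[5, 6], [8, 9, 10]]),
    (0, [[3], [5, 6], [8, 9, 10]]),
    (0, [[1], [3], [5, 6], [8, 9, 10]]),
    (0, [[2, 3], [5, 6], [8, 9, 10]]),
    (0, [[1], [2, 3], [5, 6], [8, 9, 10]]),
    (0, [[4, 5, 6], [8, 9, 10]]),
    (0, [[2], [4, 5, 6], [8, 9, 10]]),
    (2, [[8, 9, 10]]),
    (8, [[8, 9, 10]]),
    (0, [[7, 8, 9, 10]]),
    (0, [[5], [7, 8, 9, 10]]),
    (0, [[3], [5], [7, 8, 9, 10]]),
    (0, [[1], [3], [5], [7, 8, 9, 10]]),
    (0, [[1], [5], [2, 3], [7, 8, 9, 10]]),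
    (0, [[4, 5], [7, 8, 9, 10]]),
    (0, [[2], [4, 5], [7, 8, 9, 10]]),
    (0, [[2], [1, 4, 5], [7, 8, 9, 10]]),
    (0, [[3, 4, 5], [7, 8, 9, 10]]),
    (1, [[7, 8, 9, 10]]),
    (0, [[2, 3, 4, 5], [7, 8, 9, 10]]),
    (3, [[7, 8, 9, 10]]),
    (0, [[6, 7, 8, 9, 10]]),
    (0, [[4], [6, 7, 8, 9, 10]]),
    (0, [[2], [4], [6, 7, 8, 9, 10]]),
    (0, [[2], [1, 4], [6, 7, 8, 9, 10]]),
    (0, [[3, 4], [6, 7, 8, 9, 10]]),
    (0, [[2, 3, 4], [6, 7, 8, 9, 10]]),
    (0, [[1, 4, 3, 2], [6, 7, 8, 9, 10]]),
    (0, [[5, 6, 7, 8, 9, 10]]),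
    (0, [[3], [5, 6, 7, 8, 9, 10]]),
    (0, [[1], [3], [5, 6, 7, 8, 9, 10]]),
    (0, [[2, 3], [5, 6, 7, 8, 9, 10]]),
    (0, [[1], [2, 3], [5, 6, 7, 8, 9, 10]]),
    (0, [[4, 5, 6, 7, 8, 9, 10]]),
    (0, [[2], [4, 5, 6, 7, 8, 9, 10]]),
    (0, [[2], [1, 4, 5, 6, 7, 8, 9, 10]]),
    (0, [[3, 4, 5, 6, 7, 8, 9, 10]]),
    (7, []),
    (0, [[2, 3, 4, 5, 6, 7, 8, 9, 10]])]"

definition canonical_vertices :: "nat \<times> nat list list \<Rightarrow> nat list" where
  "canonical_vertices p = table_vertices (fst p) @ concat (snd p)"

lemma stuck_subsets_canonical:
  "stuck_subsets (map flip_gains flips)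
    = map (\<lambda>p. map (\<lambda>i. i \<in> set (canonical_vertices p)) [1..<11]) canonical_subsets"
  by code_simp

fun symbol_adjacent :: "ade_symbol \<Rightarrow> nat \<Rightarrow> nat \<Rightarrow> bool" where
  "symbol_adjacent (Type_A l) i j \<longleftrightarrow> j = Suc i \<or> i = Suc j"
| "symbol_adjacent (Type_D m) i j \<longleftrightarrow> (if i = m then Suc (Suc j) = m else if j = m then Suc (Suc i) = m
     else j = Suc i \<or> i = Suc j)"
| "symbol_adjacent (Type_E n) i j \<longleftrightarrow> (if i = 1 then j = 4 else if j = 1 then i = 4
     else j = Suc i \<or> i = Suc j)"

definition symbol_gram :: "ade_symbol \<Rightarrow> nat \<Rightarrow> nat \<Rightarrow> int" where
  "symbol_gram X i j = (if i = j then - 2 else if symbol_adjacent X i j then 1 else 0)"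

type_synonym listed_config = "(ade_symbol \<times> int list list) list"

text \<open>The vectors of a configuration, each with the index and the symbol of its component and with its
  vertex, numbered from \<open>1\<close>, in the diagram of this symbol.\<close>

definition flat_config :: "listed_config \<Rightarrow> (nat \<times> ade_symbol \<times> nat \<times> int list) list" where
  "flat_config C = concat (map (\<lambda>(k, X, vs). map (\<lambda>(i, v). (k, X, i, v)) (List.enumerate 1 vs)) (List.enumerate 0 C))"

definition dot :: "int list \<Rightarrow> int list \<Rightarrow> int" where
  "dot xs ys = sum_list (map2 (*) xs ys)"

definition gram_row_ok ::
  "int list \<Rightarrow> nat \<Rightarrow> ade_symbol \<Rightarrow> nat \<Rightarrow> (nat \<times> ade_symbol \<times> nat \<times> int list) list \<Rightarrow> bool" where
  "gram_row_ok e k X i ps \<longleftrightarrow>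
     list_all (\<lambda>(l, Y, j, v). dot e v = (if k = l then symbol_gram X i j else 0)) ps"

fun gram_ok :: "(nat \<times> ade_symbol \<times> nat \<times> int list) list \<Rightarrow> bool" where
  "gram_ok [] \<longleftrightarrow> True"
| "gram_ok ((k, X, i, v) # ps) \<longleftrightarrow> gram_row_ok (ev_products v) k X i ((k, X, i, v) # ps) \<and> gram_ok ps"

definition config_ok :: "listed_config \<Rightarrow> bool" where
  "config_ok C \<longleftrightarrow> list_all (\<lambda>(X, vs). ade_symbol_ok X \<and> length vs = symbol_rank X
     \<and> list_all (\<lambda>v. length v = 10) vs) C \<and> gram_ok (flat_config C)"

definition table_configs :: "nat \<Rightarrow> listed_config list" where
  "table_configs x = fst (index_tables ! x)"

definition table_links :: "nat \<Rightarrow> (nat \<times> nat \<times> nat \<times> nat \<times> nat list) list" where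
  "table_links x = snd (index_tables ! x)"

definition chain_configs :: "nat list list \<Rightarrow> listed_config" where
  "chain_configs a = map (\<lambda>vs. (Type_A (length vs), map unit_list vs)) a"

definition full_configs :: "nat \<times> nat list list \<Rightarrow> listed_config list" where
  "full_configs p = map (\<lambda>C. C @ chain_configs (snd p)) (table_configs (fst p))"

lemma canonical_configs_ok: "list_all (\<lambda>p. list_all config_ok (full_configs p)) canonical_subsets"
  by code_simp

text \<open>Integers stand for the symbols, so that types are compared by sorting lists of integers.\<close>

fun symbol_code :: "ade_symbol \<Rightarrow> int" where
  "symbol_code (Type_A l) = int l"
| "symbol_code (Type_D m) = 20 + int m"
| "symbol_code (Type_E n) = 40 + int n"

definition type_code :: "listed_config \<Rightarrow> int list" where
  "type_code C = sort (map (\<lambda>(X, vs). symbol_code X) C)"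

text \<open>The first configuration of a table is the set of simple roots itself. Thus the type of a primitive
  closure determines the canonical set of vertices \<dots>\<close>

lemma canonical_types_distinct:
  "distinct (map (\<lambda>p. type_code (hd (full_configs p))) canonical_subsets)"
  by code_simp

text \<open>\<dots> and within it, the type of a configuration determines its place in the table.\<close>

lemma table_types_distinct:
  "list_all (\<lambda>x. distinct (map type_code (table_configs x))) [0..<length index_tables]"
  by code_simp

fun highest_coeffs :: "ade_symbol \<Rightarrow> int list" where
  "highest_coeffs (Type_A l) = replicate l 1"
| "highest_coeffs (Type_D m) = 1 # replicate (m - 3) 2 @ [1, 1]"
| "highest_coeffs (Type_E n) = (if n = 6 then [2, 1, 2, 3, 2, 1]
     else if n = 7 then [2, 2, 3, 4, 3, 2, 1] else [3, 2, 4, 6, 5, 4, 3, 2])"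

definition listed_symbols :: "ade_symbol list" where
  "listed_symbols = map Type_A [1..<10] @ map Type_D [4..<10] @ map Type_E [6..<9]"

definition highest_ok :: "ade_symbol \<Rightarrow> bool" where
  "highest_ok X \<longleftrightarrow> (let n = symbol_rank X; c = highest_coeffs X;
       p = map (\<lambda>j. sum_list (map2 (\<lambda>m i. m * symbol_gram X i j) c [1..<Suc n])) [1..<Suc n] in
     length c = n \<and> list_all (\<lambda>m. 0 < m) c \<and> list_all (\<lambda>x. x \<le> 0) p \<and> sum_list (map2 (*) c p) = - 2)"

lemma listed_symbols_highest: "list_all highest_ok listed_symbols"
  by code_simp

lemma canonical_symbols:
  "list_all (\<lambda>p. list_all (\<lambda>C. list_all (\<lambda>(X, vs). X \<in> set listed_symbols) C) (full_configs p)) canonical_subsets"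
  by code_simp

definition combination :: "int list \<Rightarrow> int list list \<Rightarrow> int list" where
  "combination ms vs = foldr (\<lambda>(m, v) x. map2 (\<lambda>a b. m * a + b) v x) (zip ms vs) (replicate 10 0)"

text \<open>The component \<open>k\<close> is extended by minus its highest root and loses its vertex \<open>i\<close>, where \<open>i\<close> is
  counted from \<open>0\<close>, unlike the vertices of a diagram.\<close>

definition extended_config :: "listed_config \<Rightarrow> nat \<Rightarrow> nat \<Rightarrow> int list list" where
  "extended_config C k i = (case C ! k of (X, vs) \<Rightarrow>
     map uminus (combination (highest_coeffs X) vs) # removeAll (vs ! i) (concat (map snd C)))"

definition link_ok :: "nat list \<Rightarrow> listed_config list \<Rightarrow> nat \<times> nat \<times> nat \<times> nat \<times> nat list \<Rightarrow> bool" where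
  "link_ok X Cs r \<longleftrightarrow> (case r of (a, k, i, b, w) \<Rightarrow> a < b \<and> b < length Cs \<and> list_all (\<lambda>k. k \<in> set X) w
     \<and> list_all (\<lambda>v. apply_word w v \<in> set (concat (map snd (Cs ! b)))) (extended_config (Cs ! a) k i))"

lemma links_ok:
  "list_all (\<lambda>x. list_all (link_ok (table_vertices x) (table_configs x)) (table_links x)) [0..<length index_tables]"
  by code_simp

text \<open>All coefficients of highest roots are at most \<open>6\<close>, and the primes among these numbers are those
  different from \<open>1\<close>, \<open>4\<close> and \<open>6\<close>.\<close>

definition table_complete :: "nat \<Rightarrow> bool" where
  "table_complete x \<longleftrightarrow> (let rs = map (\<lambda>(a, k, i, b, w). (a, k, i)) (table_links x) in
     list_all (\<lambda>(a, C). list_all (\<lambda>(k, X, vs). list_all (\<lambda>(i, m). m \<in> set [1, 4, 6] \<or> (a, k, i) \<in> set rs)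
       (List.enumerate 0 (highest_coeffs X))) (List.enumerate 0 C)) (List.enumerate 0 (table_configs x)))"

lemma tables_complete: "list_all table_complete [0..<length index_tables]"
  by code_simp

definition table_ok :: "nat \<Rightarrow> bool" where
  "table_ok x \<longleftrightarrow> (let Cs = table_configs x; X = table_vertices x; vs = concat (map snd (hd Cs)) in
     Cs \<noteq> [] \<and> list_all (\<lambda>j. j \<in> set [1..<11]) X
     \<and> list_all (\<lambda>C. length (concat (map snd C)) = length X) Cs
     \<and> list_all (\<lambda>v. v \<in> set (map unit_list X)) vs \<and> list_all (\<lambda>i. unit_list i \<in> set vs) X)"

lemma tables_ok: "list_all table_ok [0..<length index_tables]"
  by code_simp

definition canonical_ok :: "nat \<times> nat list list \<Rightarrow> bool" where
  "canonical_ok p \<longleftrightarrow> (case p of (x, a) \<Rightarrow> x < length index_tables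
     \<and> list_all (\<lambda>j. j \<in> set [1..<11]) (canonical_vertices p)
     \<and> list_all (\<lambda>j. list_all (\<lambda>i. j \<noteq> i \<and> (ev_products (unit_list i)) ! (j - 1) = 0) (table_vertices x)) (concat a))"

lemma canonical_subsets_ok: "list_all canonical_ok canonical_subsets"
  by code_simp

section \<open>Equivalence of sets of simple roots\<close>

lemma lvec_explicit:
  "lvec [a, b, c, d, e, f, g, h, i, j] = of_int a *\<^sub>R ev 1 + of_int b *\<^sub>R ev 2 + of_int c *\<^sub>R ev 3
     + of_int d *\<^sub>R ev 4 + of_int e *\<^sub>R ev 5 + of_int f *\<^sub>R ev 6 + of_int g *\<^sub>R ev 7
     + of_int h *\<^sub>R ev 8 + of_int i *\<^sub>R ev 9 + of_int j *\<^sub>R ev 10"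
proof -
  have e: "{..<10::nat} = {0, 1, 2, 3, 4, 5, 6, 7, 8, 9}" by (rule set_eqI) (simp, presburger)
  show ?thesis by (simp add: lvec_def e numeral_eq_Suc algebra_simps)
qed

lemma lvec_map2:
  assumes "length u = length v"
  shows "lvec (map2 (\<lambda>a b. m * a + b) u v) = of_int m *\<^sub>R lvec u + lvec v"
  using assms
  by (simp add: lvec_def scaleR_sum_right sum.distrib[symmetric] scaleR_add_left)

lemma length_unit_list: "length (unit_list i) = 10"
  by (simp add: unit_list_def)

lemma lvec_unit_list: "i \<in> {1..10} \<Longrightarrow> lvec (unit_list i) = ev i"
  by (rule poly_mapping_eqI) (auto simp: lookup_vec length_unit_list unit_list_def lookup_vertex_vector)

lemma lvec_simple_reflection:
  assumes "length x = 10" "k \<in> {1..10}"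
  shows "lvec (simple_reflection k x) = L.reflect (ev k) (lvec x)" "length (simple_reflection k x) = 10"
proof -
  obtain a b c d e f g h i j where x: "x = [a, b, c, d, e, f, g, h, i, j]"
    using length_10E[OF assms(1)] .
  have upt: "[1..<11] = [1, 2, 3, 4, 5, 6, 7, 8, 9, 10 :: nat]" by (simp add: upt_rec)
  have "simple_reflection k x = map2 (\<lambda>a b. ev_products x ! (k - 1) * a + b) (unit_list k) x"
    using cases_1_10[OF assms(2)] unfolding x unit_list_def upt by (elim disjE) simp_all
  then show "lvec (simple_reflection k x) = L.reflect (ev k) (lvec x)"
    using lvec_map2[of "unit_list k" x "ev_products x ! (k - 1)"] assms(1)
    by (simp only: length_unit_list lvec_unit_list[OF assms(2)] L.reflect_def L10_form_vec_ev[OF assms]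
        add.commute simp_thms)
  show "length (simple_reflection k x) = 10" unfolding x by simp
qed

lemma lvec_apply_word:
  assumes "set w \<subseteq> {1..10}"
  shows "\<exists>g\<in>L.weyl (ev ` set w). \<forall>x. length x = 10 \<longrightarrow> lvec (apply_word w x) = g (lvec x) \<and> length (apply_word w x) = 10"
  using assms
proof (induction w)
  case Nil
  show ?case by (intro bexI[OF _ L.weyl_id]) (simp add: apply_word_def)
next
  case (Cons k w)
  then obtain g where g: "g \<in> L.weyl (ev ` set w)"
    "\<And>x. length x = 10 \<Longrightarrow> lvec (apply_word w x) = g (lvec x) \<and> length (apply_word w x) = 10" by auto
  have k: "k \<in> {1..10}" using Cons.prems by simp
  have "g \<in> L.weyl (ev ` set (k # w))" using g(1) L.weyl_mono[of "ev ` set w" "ev ` set (k # w)"] by auto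
  then have "g \<circ> L.reflect (ev k) \<in> L.weyl (ev ` set (k # w))"
    by (intro L.weyl_comp L.weyl_reflect) simp_all
  moreover have "lvec (apply_word (k # w) x) = (g \<circ> L.reflect (ev k)) (lvec x) \<and> length (apply_word (k # w) x) = 10"
    if x: "length x = 10" for x
    using g(2)[OF lvec_simple_reflection(2)[OF x k]] lvec_simple_reflection(1)[OF x k]
    by (simp add: apply_word_def)
  ultimately show ?case by blast
qed

lemma lvec_uminus: "lvec (map uminus x) = - lvec x"
  by (simp add: lvec_def sum_negf)

lemma weyl_ev_subset: "S \<subseteq> {1..10} \<Longrightarrow> L.weyl (ev ` S) \<subseteq> W10"
  by (rule weyl_subset_W10, rule image_subsetI, rule ev_root) (rule subsetD)

lemma flip_map:
  assumes "flip_ok (w, f)"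
  shows "\<exists>g\<in>W10. \<forall>i\<in>{1..10}. f ! (i - 1) \<noteq> 0 \<longrightarrow>
    f ! (i - 1) \<in> {1..10} \<and> (g (ev i) = ev (f ! (i - 1)) \<or> g (ev i) = - ev (f ! (i - 1)))"
proof -
  have ok: "set w \<subseteq> {1..10}" "length f = 10"
    using assms by (auto simp: flip_ok_def list_all_iff)
  obtain g where g: "g \<in> L.weyl (ev ` set w)"
    "\<And>x. length x = 10 \<Longrightarrow> lvec (apply_word w x) = g (lvec x) \<and> length (apply_word w x) = 10"
    using lvec_apply_word[OF ok(1)] by auto
  have "g \<in> W10" by (rule subsetD[OF weyl_ev_subset[OF ok(1)] g(1)])
  moreover have "f ! (i - 1) \<in> {1..10} \<and> (g (ev i) = ev (f ! (i - 1)) \<or> g (ev i) = - ev (f ! (i - 1)))"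
    if i: "i \<in> {1..10}" and nz: "f ! (i - 1) \<noteq> 0" for i
  proof -
    let ?j = "f ! (i - 1)"
    have "(i, ?j) \<in> set (zip [1..<11] f)"
      using i ok(2) by (auto simp: in_set_zip intro!: exI[of _ "i - 1"] simp del: upt.simps)
    then have "?j \<in> set [1..<11] \<and> apply_word w (unit_list i) \<in> set [unit_list ?j, map uminus (unit_list ?j)]"
      using assms nz unfolding flip_ok_def list_all_iff by fastforce
    then have j: "?j \<in> {1..10}"
      and "apply_word w (unit_list i) = unit_list ?j \<or> apply_word w (unit_list i) = map uminus (unit_list ?j)"
      by auto
    then have "g (lvec (unit_list i)) = lvec (unit_list ?j) \<or> g (lvec (unit_list i)) = - lvec (unit_list ?j)"
      using g(2)[OF length_unit_list[of i]] lvec_uminus by metis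
    then show ?thesis using j by (simp only: lvec_unit_list[OF i] lvec_unit_list[OF j] simp_thms)
  qed
  ultimately show ?thesis by blast
qed

lemma increases_sum:
  assumes "length ds = length bs" "increases s ds bs"
  shows "(\<forall>i<length bs. bs ! i \<longrightarrow> ds ! i \<noteq> None)
    \<and> 0 < s + (\<Sum>i<length bs. if bs ! i then the (ds ! i) else 0)"
  using assms
proof (induction ds bs arbitrary: s rule: list_induct2)
  case (Cons d ds b bs)
  have "increases (s + (if b then the d else 0)) ds bs" "b \<longrightarrow> d \<noteq> None"
    using Cons.prems by (auto split: if_splits option.splits)
  then have IH: "\<forall>i<length bs. bs ! i \<longrightarrow> ds ! i \<noteq> None"
    "0 < s + (if b then the d else 0) + (\<Sum>i<length bs. if bs ! i then the (ds ! i) else 0)"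
    using Cons.IH by blast+
  have "\<forall>i<length (b # bs). (b # bs) ! i \<longrightarrow> (d # ds) ! i \<noteq> None"
    using IH(1) \<open>b \<longrightarrow> d \<noteq> None\<close> by (auto simp: nth_Cons split: nat.split)
  moreover have "(\<Sum>i<length (b # bs). if (b # bs) ! i then the ((d # ds) ! i) else 0)
      = (if b then the d else 0) + (\<Sum>i<length bs. if bs ! i then the (ds ! i) else 0)"
    by (simp add: sum.lessThan_Suc_shift del: sum.lessThan_Suc cong: if_cong)
  ultimately show ?case using IH(2) by (simp only: add.assoc simp_thms)
qed simp

lemma neg_def_ev_simple: "S \<subseteq> {1..10} \<Longrightarrow> L.neg_def (ev ` S) \<Longrightarrow> L.simple_system (ev ` S)"
  unfolding L.simple_system_def
proof (intro conjI ballI impI)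
  assume S: "S \<subseteq> {1..10}"
  show "finite (ev ` S)" using S by (meson finite_atLeastAtMost finite_imageI finite_subset)
  show "independent (ev ` S)" by (rule independent_vertex_vectors)
  show "L10_form r r = - 2" if "r \<in> ev ` S" for r using that S L.root_setD(2)[OF ev_root] by auto
  fix r s assume rs: "r \<in> ev ` S" "s \<in> ev ` S" "r \<noteq> s"
  then obtain i j where "r = ev i" "s = ev j" by (elim imageE)
  then show "L10_form r s \<in> {0, 1}" using rs(3) by (cases "i = j") (auto simp: L10_form_ev diagram_gram_def)
qed

lemma distinct_filter_nth:
  assumes "distinct (filter P xs)" "a < length xs" "b < length xs" "xs ! a = xs ! b" "P (xs ! a)"
  shows "a = b"
proof -
  have False if "c < d" "d < length xs" "xs ! c = xs ! d" "P (xs ! c)" for c d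
  proof -
    have "xs = take d xs @ xs ! d # drop (Suc d) xs" by (rule id_take_nth_drop[OF that(2)])
    then have "filter P xs = filter P (take d xs) @ xs ! d # filter P (drop (Suc d) xs)"
      using that(3,4) by (metis filter.simps(2) filter_append)
    moreover have "xs ! d \<in> set (take d xs)"
      using that(1,2,3) by (auto simp: in_set_conv_nth intro!: exI[of _ c])
    ultimately show False using assms(1) that(3,4) by simp
  qed
  then show ?thesis using assms(2-5) by (metis linorder_neqE_nat)
qed

definition set_weight :: "nat set \<Rightarrow> int" where
  "set_weight S = (\<Sum>i\<in>S. vertex_weight i)"

lemma vertex_weight_nonneg: "i \<in> {1..10} \<Longrightarrow> 0 \<le> vertex_weight i"
  by (drule cases_1_10, elim disjE) (simp_all add: vertex_weight_def)

text \<open>A flip maps the simple roots in question to simple roots, up to signs. So it maps their span to the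
  span of other simple roots.\<close>

lemma flip_step:
  assumes S: "S \<subseteq> {1..10}" "L.neg_def (ev ` S)" and p: "p \<in> set flips"
    and inc: "increases 0 (flip_gains p) (map (\<lambda>i. i \<in> S) [1..<11])"
  shows "\<exists>g\<in>W10. \<exists>T\<subseteq>{1..10}. set_weight S < set_weight T \<and> L.neg_def (ev ` T)
    \<and> g ` zspan (ev ` S) = zspan (ev ` T)"
proof -
  obtain w f where wf: "p = (w, f)" by (cases p)
  have ok: "flip_ok (w, f)" using flips_ok p wf by (simp add: list_all_iff)
  then have len: "length f = 10" and dist: "distinct (filter (\<lambda>j. j \<noteq> 0) f)"
    by (simp_all add: flip_ok_def)
  define F where "F i = f ! (i - 1)" for i
  obtain g where g: "g \<in> W10" "\<And>i. i \<in> {1..10} \<Longrightarrow> F i \<noteq> 0 \<Longrightarrow>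
      F i \<in> {1..10} \<and> (g (ev i) = ev (F i) \<or> g (ev i) = - ev (F i))"
    using flip_map[OF ok] unfolding F_def by blast
  have lin: "linear g" by (rule W10_linear[OF g(1)])
  have gain: "flip_gains p ! (i - 1)
      = (if F i = 0 then None else Some (vertex_weight (F i) - vertex_weight i))" if "i \<in> {1..10}" for i
    using that len by (auto simp: flip_gains_def wf F_def simp del: upt.simps)
  have lg: "length (flip_gains p) = length (map (\<lambda>i. i \<in> S) [1..<11])" by (simp add: flip_gains_def wf len)
  have bn: "map (\<lambda>i. i \<in> S) [1..<11] ! (i - 1) \<longleftrightarrow> i \<in> S" if "i \<in> {1..10}" for i
    using that by (auto simp del: upt.simps)
  have nz: "F i \<noteq> 0" if "i \<in> S" for i
  proof -
    have i: "i \<in> {1..10}" using that S(1) by auto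
    then have "i - 1 < length (map (\<lambda>i. i \<in> S) [1..<11])" by auto
    then have "flip_gains p ! (i - 1) \<noteq> None" using increases_sum[OF lg inc] bn[OF i] that by blast
    then show ?thesis unfolding gain[OF i] by (metis)
  qed
  have "0 < (\<Sum>i<length (map (\<lambda>i. i \<in> S) [1..<11]). if map (\<lambda>i. i \<in> S) [1..<11] ! i then the (flip_gains p ! i) else 0)"
    using increases_sum[OF lg inc] by simp
  also have "\<dots> = (\<Sum>i<10. if Suc i \<in> S then vertex_weight (F (Suc i)) - vertex_weight (Suc i) else 0)"
  proof (rule sum.cong)
    show "{..<length (map (\<lambda>i. i \<in> S) [1..<11])} = {..<10}" by simp
    fix i :: nat assume "i \<in> {..<10}"
    then have k: "Suc i \<in> {1..10}" by simp
    have "map (\<lambda>i. i \<in> S) [1..<11] ! i \<longleftrightarrow> Suc i \<in> S" using bn[OF k] by (simp only: diff_Suc_1)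
    moreover have "the (flip_gains p ! i) = vertex_weight (F (Suc i)) - vertex_weight (Suc i)" if "Suc i \<in> S"
      using gain[OF k] nz[OF that] by (simp only: diff_Suc_1 if_False option.sel)
    ultimately show "(if map (\<lambda>i. i \<in> S) [1..<11] ! i then the (flip_gains p ! i) else 0)
        = (if Suc i \<in> S then vertex_weight (F (Suc i)) - vertex_weight (Suc i) else 0)"
      by (cases "Suc i \<in> S") (simp_all only: if_True if_False simp_thms)
  qed
  also have "\<dots> = (\<Sum>i\<in>{1..10}. if i \<in> S then vertex_weight (F i) - vertex_weight i else 0)"
    by (rule sum.reindex_bij_witness[of _ "\<lambda>i. i - 1" Suc]) auto
  also have "\<dots> = (\<Sum>i\<in>S. vertex_weight (F i) - vertex_weight i)"
    using S(1) by (simp add: sum.inter_restrict[symmetric] Int_absorb1)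
  finally have pos: "(\<Sum>i\<in>S. vertex_weight i) < (\<Sum>i\<in>S. vertex_weight (F i))" by (simp add: sum_subtractf)
  have inj: "inj_on F S"
  proof (rule inj_onI)
    fix i j assume ij: "i \<in> S" "j \<in> S" "F i = F j"
    have "i \<in> {1..10}" "j \<in> {1..10}" using ij(1,2) S(1) by (simp_all only: subsetD)
    then have r: "i - 1 < length f" "j - 1 < length f" "1 \<le> i" "1 \<le> j" by (auto simp: len)
    have "i - 1 = j - 1" using distinct_filter_nth[OF dist r(1,2)] ij(3) nz[OF ij(1)] by (simp add: F_def)
    then show "i = j" using r(3,4) by simp
  qed
  define T where "T = F ` S"
  have T: "T \<subseteq> {1..10}"
    unfolding T_def
  proof (rule image_subsetI)
    fix i assume i: "i \<in> S"
    show "F i \<in> {1..10}" using g(2)[OF subsetD[OF S(1) i] nz[OF i]] by (rule conjunct1)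
  qed
  have "set_weight T = (\<Sum>i\<in>S. vertex_weight (F i))" unfolding set_weight_def T_def by (simp add: sum.reindex[OF inj])
  then have w: "set_weight S < set_weight T" using pos by (simp add: set_weight_def)
  have gi: "g (ev i) = ev (F i) \<or> g (ev i) = - ev (F i)" if "i \<in> S" for i
    using g(2)[OF subsetD[OF S(1) that] nz[OF that]] by (rule conjunct2)
  have a: "g ` ev ` S \<subseteq> zspan (ev ` T)"
  proof
    fix x assume "x \<in> g ` ev ` S"
    then obtain i where i: "i \<in> S" and x: "x = g (ev i)" by (elim imageE) simp
    have m: "ev (F i) \<in> zspan (ev ` T)" by (rule Z.span_base) (use i in \<open>auto simp: T_def\<close>)
    show "x \<in> zspan (ev ` T)" unfolding x using gi[OF i] m Z.span_neg[OF m] by auto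
  qed
  have b: "ev ` T \<subseteq> zspan (g ` ev ` S)"
  proof
    fix x assume "x \<in> ev ` T"
    then obtain i where i: "i \<in> S" and x: "x = ev (F i)" unfolding T_def by (elim imageE) simp
    have m: "g (ev i) \<in> zspan (g ` ev ` S)" by (rule Z.span_base) (use i in auto)
    show "x \<in> zspan (g ` ev ` S)" unfolding x using gi[OF i] m Z.span_neg[OF m] by auto
  qed
  have eq: "g ` zspan (ev ` S) = zspan (ev ` T)"
    unfolding linear_zspan_image[OF lin]
    using Z.span_minimal[OF a Z.subspace_span] Z.span_minimal[OF b Z.subspace_span] by (rule subset_antisym)
  have "L.simple_system (g ` ev ` S)"
    by (rule L.simple_system_image[OF neg_def_ev_simple[OF S] lin W10_isometry[OF g(1)]])
  then have "L.neg_def (ev ` T)"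
    by (rule L.neg_def_subset[OF L.simple_systemD(3) order_trans[OF b zspan_subset_span]])
  then show ?thesis using g(1) T w eq by blast
qed

text \<open>The first nine vertices form the affine diagram of type \<open>E\<^sub>8\<close>, and the highest root of
  type \<open>E\<^sub>8\<close> plus the additional vertex is an isotropic vector.\<close>

lemma ev_1_9_not_neg_def:
  assumes "{1..9} \<subseteq> S" shows "\<not> L.neg_def (ev ` S)"
proof
  assume n: "L.neg_def (ev ` S)"
  let ?d = "lvec [3, 2, 4, 6, 5, 4, 3, 2, 1, 0]"
  have e: "ev i \<in> span (ev ` S)" if "i \<in> {1..9}" for i using that assms by (intro span_base) auto
  have "?d = 3 *\<^sub>R ev 1 + 2 *\<^sub>R ev 2 + 4 *\<^sub>R ev 3 + 6 *\<^sub>R ev 4 + 5 *\<^sub>R ev 5 + 4 *\<^sub>R ev 6 + 3 *\<^sub>R ev 7 + 2 *\<^sub>R ev 8 + 1 *\<^sub>R ev 9"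
    by (simp add: lvec_explicit)
  also have "\<dots> \<in> span (ev ` S)" by (intro span_add span_scale e) simp_all
  finally have "?d \<in> span (ev ` S)" .
  moreover have "L10_form ?d ?d = 0" by (subst L10_form_vec) (simp_all add: pair_product_def)
  moreover have "?d \<noteq> 0"
  proof
    assume "?d = 0"
    then have "Poly_Mapping.lookup ?d 1 = 0" by simp
    then show False by (simp add: lookup_vec)
  qed
  ultimately show False using L.neg_defD[OF n] by fastforce
qed

lemma canonical_vertices_subset: "p \<in> set canonical_subsets \<Longrightarrow> set (canonical_vertices p) \<subseteq> {1..10}"
proof -
  assume "p \<in> set canonical_subsets"
  then have "canonical_ok p" using canonical_subsets_ok by (simp only: list_all_iff)
  then have "\<forall>j\<in>set (canonical_vertices p). j \<in> set [1..<11]"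
    by (cases p) (simp only: canonical_ok_def list_all_iff prod.case, elim conjE, assumption)
  then show "set (canonical_vertices p) \<subseteq> {1..10}" by auto
qed

text \<open>As long as some flip increases the weight, apply it.\<close>

lemma canonical_subset_exists:
  assumes "S \<subseteq> {1..10}" "L.neg_def (ev ` S)"
  shows "\<exists>p\<in>set canonical_subsets. \<exists>g\<in>W10. g ` zspan (ev ` S) = zspan (ev ` set (canonical_vertices p))"
  using assms
proof (induction "nat (set_weight {1..10} - set_weight S)" arbitrary: S rule: less_induct)
  case less
  define b where "b = map (\<lambda>i. i \<in> S) [1..<11]"
  have le: "set_weight T \<le> set_weight {1..10}" if "T \<subseteq> {1..10}" for T
    unfolding set_weight_def using vertex_weight_nonneg by (intro sum_mono2[OF _ that]) auto
  show ?case
  proof (cases "\<exists>p\<in>set flips. increases 0 (flip_gains p) b")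
    case True
    then obtain q where q: "q \<in> set flips" "increases 0 (flip_gains q) b" by (elim bexE)
    obtain g T where g: "g \<in> W10" and T: "T \<subseteq> {1..10}" "set_weight S < set_weight T" "L.neg_def (ev ` T)"
      "g ` zspan (ev ` S) = zspan (ev ` T)"
      using flip_step[OF less.prems q(1) q(2)[unfolded b_def]] by (elim bexE exE conjE)
    have "nat (set_weight {1..10} - set_weight T) < nat (set_weight {1..10} - set_weight S)"
      using T(2) le[OF T(1)] by simp
    from less.hyps[OF this T(1,3)] obtain p h where p: "p \<in> set canonical_subsets" and h: "h \<in> W10"
      "h ` zspan (ev ` T) = zspan (ev ` set (canonical_vertices p))"
      by (elim bexE)
    have "(h \<circ> g) ` zspan (ev ` S) = zspan (ev ` set (canonical_vertices p))"
      by (simp only: image_comp[symmetric] T(4) h(2))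
    then show ?thesis by (rule bexI[OF bexI[OF _ L.weyl_comp[OF h(1) g]] p])
  next
    case False
    have iff: "i \<in> S \<longleftrightarrow> b ! (i - 1)" if "i \<in> {1..10}" for i
      using that by (auto simp: b_def simp del: upt.simps)
    have nine: "\<not> {1..9} \<subseteq> S" using ev_1_9_not_neg_def less.prems(2) by blast
    have rep: "{1..9} \<subseteq> S" if "\<forall>i<9. b ! i"
    proof
      fix i :: nat assume i: "i \<in> {1..9}"
      then have "i - 1 < 9" by auto
      then have "b ! (i - 1)" using that by blast
      then show "i \<in> S" using iff[of i] i by simp
    qed
    have "b \<noteq> replicate 10 True"
    proof
      assume "b = replicate 10 True"
      then have "\<forall>i<9. b ! i" by simp
      then show False using rep nine by blast
    qed
    moreover have "b \<noteq> replicate 9 True @ [False]"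
    proof
      assume "b = replicate 9 True @ [False]"
      then have "\<forall>i<9. b ! i" by (simp add: nth_append)
      then show False using rep nine by blast
    qed
    moreover have "b \<in> set (List.n_lists 10 [False, True])" by (auto simp: set_n_lists b_def)
    moreover have "\<not> list_ex (\<lambda>g. increases 0 g b) (map flip_gains flips)"
      using False by (auto simp: list_ex_iff)
    ultimately have "b \<in> set (stuck_subsets (map flip_gains flips))" by (simp add: stuck_subsets_def)
    then obtain p where p: "p \<in> set canonical_subsets" "b = map (\<lambda>i. i \<in> set (canonical_vertices p)) [1..<11]"
      unfolding stuck_subsets_canonical by auto
    have "i \<in> S \<longleftrightarrow> i \<in> set (canonical_vertices p)" if "i \<in> {1..10}" for i
      using iff[OF that] that unfolding p(2) by (auto simp del: upt.simps)
    then have "S = set (canonical_vertices p)"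
      using less.prems(1) canonical_vertices_subset[OF p(1)] by blast
    then show ?thesis using p(1) by (intro bexI[OF _ p(1)] bexI[OF _ L.weyl_id]) simp
  qed
qed

section \<open>Configurations given by lists\<close>

definition config_set :: "listed_config \<Rightarrow> (nat \<Rightarrow>\<^sub>0 real) set" where
  "config_set C = lvec ` set (concat (map snd C))"

definition config_root :: "listed_config \<Rightarrow> nat \<Rightarrow> nat \<Rightarrow> (nat \<Rightarrow>\<^sub>0 real)" where
  "config_root C k i = lvec (snd (C ! k) ! (i - 1))"

lemma mem_flat_config:
  "(k, X, i, v) \<in> set (flat_config C) \<longleftrightarrow>
     k < length C \<and> X = fst (C ! k) \<and> i \<in> {1..length (snd (C ! k))} \<and> v = snd (C ! k) ! (i - 1)"
  (is "?l \<longleftrightarrow> ?r")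
proof
  assume ?l
  then obtain vs where 1: "(k, X, vs) \<in> set (List.enumerate 0 C)" "(i, v) \<in> set (List.enumerate 1 vs)"
    by (auto simp: flat_config_def)
  have k: "k < length C" "C ! k = (X, vs)" using 1(1) by (simp_all add: in_set_enumerate_eq)
  have i: "1 \<le> i" "i < length vs + 1" "vs ! (i - 1) = v" using 1(2) by (simp_all add: in_set_enumerate_eq)
  show ?r using k i by simp
next
  assume r: ?r
  then have "(k, C ! k) \<in> set (List.enumerate 0 C)" by (simp add: in_set_enumerate_eq)
  then have 1: "(k, X, snd (C ! k)) \<in> set (List.enumerate 0 C)" using r by simp
  have "1 \<le> i" "i < length (snd (C ! k)) + 1" "snd (C ! k) ! (i - 1) = v" using r by simp_all
  then have 2: "(i, v) \<in> set (List.enumerate 1 (snd (C ! k)))" by (simp add: in_set_enumerate_eq)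
  have "(k, X, i, v) \<in> set (map (\<lambda>(i, v). (k, X, i, v)) (List.enumerate 1 (snd (C ! k))))"
    unfolding set_map by (rule image_eqI[OF _ 2]) simp
  then show ?l
    unfolding flat_config_def set_concat set_map by (intro UnionI[OF imageI[OF imageI[OF 1]]]) simp
qed

lemma symbol_gram_sym: "symbol_gram X i j = symbol_gram X j i"
  by (cases X) (auto simp: symbol_gram_def)

lemma symbol_adjacent_iff:
  assumes "ade_symbol_ok X" "i \<in> {1..symbol_rank X}" "j \<in> {1..symbol_rank X}" "i \<noteq> j"
  shows "symbol_adjacent X i j \<longleftrightarrow> (i, j) \<in> snd (symbol_diagram X)"
  using assms
  by (cases X) (auto simp: a_diagram_def d_diagram_def e_diagram_def chain_edges_def)

lemma L10_form_dot:
  "length v = 10 \<Longrightarrow> length u = 10 \<Longrightarrow> L10_form (lvec v) (lvec u) = of_int (dot (ev_products v) u)"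
  by (simp add: L10_form_vec pair_product_def dot_def)

lemma gram_ok_forward:
  assumes "gram_ok ps" "a \<le> b" "b < length ps" "ps ! a = (k, X, i, v)" "ps ! b = (l, Y, j, u)"
  shows "dot (ev_products v) u = (if k = l then symbol_gram X i j else 0)"
  using assms
proof (induction ps arbitrary: a b rule: gram_ok.induct)
  case (2 k' X' i' v' ps)
  show ?case
  proof (cases a)
    case 0
    have "(l, Y, j, u) \<in> set ((k', X', i', v') # ps)" using 2(4,6) by (metis nth_mem)
    then show ?thesis using 2(2,5) 0 unfolding gram_ok.simps gram_row_ok_def list_all_iff by auto
  next
    case (Suc a')
    then obtain b' where b': "b = Suc b'" using 2(3) by (cases b) auto
    show ?thesis using 2(1)[of a' b'] 2(2-6) Suc b' by simp
  qed
qed simp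

lemma config_okD:
  assumes "config_ok C" "k < length C"
  shows "ade_symbol_ok (fst (C ! k))" "length (snd (C ! k)) = symbol_rank (fst (C ! k))"
    "v \<in> set (snd (C ! k)) \<Longrightarrow> length v = 10"
  using assms nth_mem[OF assms(2)] unfolding config_ok_def list_all_iff by (cases "C ! k"; force)+

lemma config_products:
  assumes "config_ok C" "k < length C" "l < length C"
    "i \<in> {1..symbol_rank (fst (C ! k))}" "j \<in> {1..symbol_rank (fst (C ! l))}"
  shows "L10_form (config_root C k i) (config_root C l j)
    = (if k = l then of_int (symbol_gram (fst (C ! k)) i j) else 0)"
proof -
  let ?v = "snd (C ! k) ! (i - 1)" and ?u = "snd (C ! l) ! (j - 1)"
  note K = config_okD[OF assms(1,2)] and L = config_okD[OF assms(1,3)]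
  have "?v \<in> set (snd (C ! k))" by (rule nth_mem) (use assms(4) K(2) in auto)
  moreover have "?u \<in> set (snd (C ! l))" by (rule nth_mem) (use assms(5) L(2) in auto)
  ultimately have len: "length ?v = 10" "length ?u = 10" using K(3) L(3) by simp_all
  have "(k, fst (C ! k), i, ?v) \<in> set (flat_config C)" "(l, fst (C ! l), j, ?u) \<in> set (flat_config C)"
    unfolding mem_flat_config using assms K(2) L(2) by auto
  then obtain a b where a: "a < length (flat_config C)" "flat_config C ! a = (k, fst (C ! k), i, ?v)"
    and b: "b < length (flat_config C)" "flat_config C ! b = (l, fst (C ! l), j, ?u)"
    unfolding in_set_conv_nth by blast
  have g: "gram_ok (flat_config C)" using assms(1) by (simp add: config_ok_def)
  show ?thesis
  proof (cases "a \<le> b")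
    case True
    show ?thesis
      unfolding config_root_def L10_form_dot[OF len] gram_ok_forward[OF g True b(1) a(2) b(2)] by simp
  next
    case False
    then have ba: "b \<le> a" by simp
    show ?thesis
      unfolding config_root_def L10_form_sym[of "lvec ?v" "lvec ?u"] L10_form_dot[OF len(2,1)]
        gram_ok_forward[OF g ba a(1) b(2) a(2)] symbol_gram_sym[of _ j i] by auto
  qed
qed

lemma config_set_eq:
  assumes "config_ok C"
  shows "config_set C = (\<Union>k<length C. config_root C k ` {1..symbol_rank (fst (C ! k))})"
proof -
  have e: "config_root C k ` {1..symbol_rank (fst (C ! k))} = lvec ` set (snd (C ! k))" if "k < length C" for k
  proof -
    have "{1..symbol_rank (fst (C ! k))} = Suc ` {..<length (snd (C ! k))}"
      unfolding config_okD(2)[OF assms that] by (auto simp: image_Suc_lessThan)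
    then have "config_root C k ` {1..symbol_rank (fst (C ! k))} = (\<lambda>i. lvec (snd (C ! k) ! i)) ` {..<length (snd (C ! k))}"
      by (simp only: image_image config_root_def diff_Suc_1)
    also have "\<dots> = lvec ` (\<lambda>i. snd (C ! k) ! i) ` {..<length (snd (C ! k))}" by (simp only: image_image)
    also have "(\<lambda>i. snd (C ! k) ! i) ` {..<length (snd (C ! k))} = set (snd (C ! k))"
      by (auto simp: set_conv_nth)
    finally show ?thesis .
  qed
  have "set C = (\<lambda>k. C ! k) ` {..<length C}" by (auto simp: set_conv_nth)
  then have "config_set C = (\<Union>k<length C. lvec ` set (snd (C ! k)))"
    by (simp add: config_set_def image_UN)
  then show ?thesis using e by simp
qed

lemma card_config_set:
  assumes "config_ok C" "\<And>k l i j. k < length C \<Longrightarrow> l < length C \<Longrightarrow> i \<in> {1..symbol_rank (fst (C ! k))} \<Longrightarrow>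
    j \<in> {1..symbol_rank (fst (C ! l))} \<Longrightarrow> config_root C k i = config_root C l j \<Longrightarrow> k = l \<and> i = j"
  shows "card (config_set C) = length (concat (map snd C))"
proof -
  let ?V = "\<lambda>k. {1..symbol_rank (fst (C ! k))}"
  have "card (config_set C) = (\<Sum>k<length C. card (config_root C k ` ?V k))"
    unfolding config_set_eq[OF assms(1)]
  proof (rule card_UN_disjoint)
    show "\<forall>k\<in>{..<length C}. \<forall>l\<in>{..<length C}. k \<noteq> l \<longrightarrow> config_root C k ` ?V k \<inter> config_root C l ` ?V l = {}"
    proof (intro ballI impI equals0I)
      fix k l r assume *: "k \<in> {..<length C}" "l \<in> {..<length C}" "k \<noteq> l" "r \<in> config_root C k ` ?V k \<inter> config_root C l ` ?V l"
      then obtain i j where ij: "i \<in> ?V k" "j \<in> ?V l" "r = config_root C k i" "r = config_root C l j"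
        by (elim IntE imageE)
      then show False using assms(2)[of k l i j] * by simp
    qed
  qed simp_all
  also have "\<dots> = (\<Sum>k<length C. length (snd (C ! k)))"
  proof (intro sum.cong refl)
    fix k assume k: "k \<in> {..<length C}"
    have "inj_on (config_root C k) (?V k)" using assms(2)[of k k] k by (auto intro: inj_onI)
    then show "card (config_root C k ` ?V k) = length (snd (C ! k))"
      using config_okD(2)[OF assms(1)] k by (simp add: card_image)
  qed
  also have "\<dots> = length (concat (map snd C))"
    by (simp add: length_concat sum_list_sum_nth atLeast0LessThan)
  finally show ?thesis .
qed

lemma config_root_inj:
  assumes "config_ok C" "k < length C" "l < length C"
    "i \<in> {1..symbol_rank (fst (C ! k))}" "j \<in> {1..symbol_rank (fst (C ! l))}"
    "config_root C k i = config_root C l j"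
  shows "k = l \<and> i = j"
  using config_products[OF assms(1,2,3,4,5)] config_products[OF assms(1,2,2,4,4)] assms(6)
  by (auto simp: symbol_gram_def split: if_splits)

lemma config_decomposition:
  assumes "config_ok C"
  shows "ade_decomposition (dynkin_diagram L10_form (config_set C)) {..<length C} (\<lambda>k. fst (C ! k)) (config_root C)"
  unfolding ade_decomposition_def
proof (intro conjI ballI)
  show "snd (dynkin_diagram L10_form (config_set C))
      \<subseteq> fst (dynkin_diagram L10_form (config_set C)) \<times> fst (dynkin_diagram L10_form (config_set C))"
    by (rule L.dynkin_diagram_wf)
  show "ade_symbol_ok (fst (C ! k))" if "k \<in> {..<length C}" for k using config_okD(1)[OF assms] that by simp
  show "fst (dynkin_diagram L10_form (config_set C)) = (\<Union>k<length C. config_root C k ` {1..symbol_rank (fst (C ! k))})"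
    by (simp only: L.dynkin_diagram_wf(3) config_set_eq[OF assms])
  fix k l i j assume *: "k \<in> {..<length C}" "l \<in> {..<length C}"
    "i \<in> {1..symbol_rank (fst (C ! k))}" "j \<in> {1..symbol_rank (fst (C ! l))}"
  then have kl: "k < length C" "l < length C" by simp_all
  show inj: "config_root C k i = config_root C l j \<longleftrightarrow> k = l \<and> i = j"
    using config_root_inj[OF assms kl *(3,4)] by auto
  have mem: "config_root C k i \<in> config_set C" "config_root C l j \<in> config_set C"
    unfolding config_set_eq[OF assms] using * by blast+
  show "(config_root C k i, config_root C l j) \<in> snd (dynkin_diagram L10_form (config_set C))
      \<longleftrightarrow> k = l \<and> (i, j) \<in> snd (symbol_diagram (fst (C ! k)))"
  proof (cases "k = l \<and> i = j")
    case True
    then show ?thesis using symbol_edges_irrefl[OF config_okD(1)[OF assms kl(1)]] by (simp add: dynkin_diagram_def)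
  next
    case False
    have "(config_root C k i, config_root C l j) \<in> snd (dynkin_diagram L10_form (config_set C))
        \<longleftrightarrow> L10_form (config_root C k i) (config_root C l j) = 1"
      using mem inj False by (auto simp: dynkin_diagram_def)
    also have "\<dots> \<longleftrightarrow> k = l \<and> symbol_adjacent (fst (C ! k)) i j"
      unfolding config_products[OF assms kl *(3,4)] using False by (auto simp: symbol_gram_def)
    also have "\<dots> \<longleftrightarrow> k = l \<and> (i, j) \<in> snd (symbol_diagram (fst (C ! k)))"
      using symbol_adjacent_iff[OF config_okD(1)[OF assms kl(1)] *(3)] *(4) False by blast
    finally show ?thesis .
  qed
qed simp

text \<open>The computed products of the vectors are those of a disjoint union of ADE-diagrams.\<close>

lemma config_ok_simple:
  assumes "config_ok C"
  shows "L.simple_system (config_set C)" "is_ade_diagram (dynkin_diagram L10_form (config_set C))"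
    "config_type L10_form (config_set C) = mset (map fst C)" "config_set C \<subseteq> L10"
proof -
  note dec = config_decomposition[OF assms]
  show ade: "is_ade_diagram (dynkin_diagram L10_form (config_set C))" by (rule ade_decomposition_type(1)[OF dec])
  have "config_type L10_form (config_set C) = mset (map (\<lambda>k. fst (C ! k)) [0..<length C])"
    unfolding config_type_def ade_decomposition_type(2)[OF dec] mset_map
    by (simp only: mset_upt atLeast0LessThan)
  also have "map (\<lambda>k. fst (C ! k)) [0..<length C] = map fst C" by (rule nth_equalityI) simp_all
  finally show "config_type L10_form (config_set C) = mset (map fst C)" .
  have root: "\<exists>k<length C. \<exists>i\<in>{1..symbol_rank (fst (C ! k))}. r = config_root C k i" if "r \<in> config_set C" for r
    using that unfolding config_set_eq[OF assms] by blast
  show "L.simple_system (config_set C)"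
  proof (rule L.ade_simple_system[OF _ _ _ ade])
    show "finite (config_set C)" by (simp add: config_set_def)
    show "L10_form r r = - 2" if "r \<in> config_set C" for r
    proof -
      note rs = that
      obtain k i where r: "k < length C" "i \<in> {1..symbol_rank (fst (C ! k))}" "r = config_root C k i"
        using root[OF rs] by blast
      show ?thesis using config_products[OF assms r(1,1,2,2)] r(3) by (simp add: symbol_gram_def)
    qed
    show "L10_form r s \<in> {0, 1}" if "r \<in> config_set C" "s \<in> config_set C" "r \<noteq> s" for r s
    proof -
      note rs = that
      obtain k i where r: "k < length C" "i \<in> {1..symbol_rank (fst (C ! k))}" "r = config_root C k i"
        using root[OF rs(1)] by blast
      obtain l j where s: "l < length C" "j \<in> {1..symbol_rank (fst (C ! l))}" "s = config_root C l j"
        using root[OF rs(2)] by blast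
      show ?thesis
        using config_products[OF assms r(1) s(1) r(2) s(2)] r(3) s(3) rs(3) by (auto simp: symbol_gram_def)
    qed
  qed
  show "config_set C \<subseteq> L10"
  proof
    fix r assume "r \<in> config_set C"
    then obtain v where v: "v \<in> set (concat (map snd C))" "r = lvec v" unfolding config_set_def by blast
    then obtain e where e: "e \<in> set C" "v \<in> set (snd e)" by auto
    obtain k where k: "k < length C" "C ! k = e" using e(1) unfolding in_set_conv_nth by blast
    show "r \<in> L10" unfolding v(2) by (rule vec_L10[OF config_okD(3)[OF assms k(1)]]) (simp only: k(2) e(2))
  qed
qed

lemma lvec_combination:
  assumes "length ms = length vs" "\<And>v. v \<in> set vs \<Longrightarrow> length v = 10"
  shows "lvec (combination ms vs) = (\<Sum>i<length vs. of_int (ms ! i) *\<^sub>R lvec (vs ! i)) \<and> length (combination ms vs) = 10"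
  using assms
proof (induction ms vs rule: list_induct2)
  case Nil
  show ?case by (simp add: combination_def lvec_def)
next
  case (Cons m ms v vs)
  let ?c = "combination ms vs"
  have IH: "lvec ?c = (\<Sum>i<length vs. of_int (ms ! i) *\<^sub>R lvec (vs ! i))" "length ?c = 10"
    using Cons.IH Cons.prems by auto
  have v: "length v = 10" using Cons.prems by simp
  have c: "combination (m # ms) (v # vs) = map2 (\<lambda>a b. m * a + b) v ?c" by (simp add: combination_def)
  have "lvec (map2 (\<lambda>a b. m * a + b) v ?c) = of_int m *\<^sub>R lvec v + lvec ?c"
    by (rule lvec_map2) (simp only: v IH(2))
  then show ?case
    unfolding c using v IH by (simp add: sum.lessThan_Suc_shift del: sum.lessThan_Suc)
qed

section \<open>Configurations of finite index\<close>

lemma sum_list_map2_upt: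
  assumes "length c = n"
  shows "sum_list (map2 f c [1..<Suc n]) = (\<Sum>i\<in>{1..n}. f (c ! (i - 1)) i)"
proof -
  have "sum_list (map2 f c [1..<Suc n]) = (\<Sum>i<n. f (c ! i) (Suc i))"
    by (simp add: sum_list_sum_nth assms atLeast0LessThan del: upt_Suc)
  also have "\<dots> = (\<Sum>i\<in>{1..n}. f (c ! (i - 1)) i)"
    by (rule sum.reindex_bij_witness[of _ "\<lambda>i. i - 1" Suc]) auto
  finally show ?thesis .
qed

lemma highest_okD:
  assumes "highest_ok X"
  shows "length (highest_coeffs X) = symbol_rank X"
    "i \<in> {1..symbol_rank X} \<Longrightarrow> 0 < highest_coeffs X ! (i - 1)"
    "j \<in> {1..symbol_rank X} \<Longrightarrow>
      (\<Sum>i\<in>{1..symbol_rank X}. highest_coeffs X ! (i - 1) * symbol_gram X i j) \<le> 0"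
    "(\<Sum>j\<in>{1..symbol_rank X}. highest_coeffs X ! (j - 1) *
      (\<Sum>i\<in>{1..symbol_rank X}. highest_coeffs X ! (i - 1) * symbol_gram X i j)) = - 2"
proof -
  let ?n = "symbol_rank X" and ?c = "highest_coeffs X"
  let ?p = "map (\<lambda>j. sum_list (map2 (\<lambda>m i. m * symbol_gram X i j) ?c [1..<Suc ?n])) [1..<Suc ?n]"
  show len: "length ?c = ?n" using assms unfolding highest_ok_def Let_def by (elim conjE)
  have pos: "list_all (\<lambda>m. 0 < m) ?c" and le: "list_all (\<lambda>x. x \<le> 0) ?p" and n: "sum_list (map2 (*) ?c ?p) = - 2"
    using assms unfolding highest_ok_def Let_def by - (elim conjE, assumption)+
  show "0 < ?c ! (i - 1)" if "i \<in> {1..?n}"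
    using pos len that unfolding list_all_length by auto
  have p: "?p = map (\<lambda>j. \<Sum>i\<in>{1..?n}. ?c ! (i - 1) * symbol_gram X i j) [1..<Suc ?n]"
    by (simp only: sum_list_map2_upt[OF len])
  show "(\<Sum>i\<in>{1..?n}. ?c ! (i - 1) * symbol_gram X i j) \<le> 0" if "j \<in> {1..?n}"
    using le that unfolding p list_all_iff set_map by (auto simp del: upt_Suc)
  have "map2 (*) ?c ?p = map2 (\<lambda>m j. m * (\<Sum>i\<in>{1..?n}. ?c ! (i - 1) * symbol_gram X i j)) ?c [1..<Suc ?n]"
    unfolding p by (simp add: zip_map2 case_prod_unfold comp_def del: upt_Suc)
  then show "(\<Sum>j\<in>{1..?n}. ?c ! (j - 1) * (\<Sum>i\<in>{1..?n}. ?c ! (i - 1) * symbol_gram X i j)) = - 2"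
    using n by (simp only: sum_list_map2_upt[OF len])
qed

lemma canonical_okD:
  assumes "(x, a) \<in> set canonical_subsets"
  shows "x < length index_tables" "set (table_vertices x) \<subseteq> {1..10}" "set (concat a) \<subseteq> {1..10}"
    "i \<in> set (table_vertices x) \<Longrightarrow> j \<in> set (concat a) \<Longrightarrow> L10_form (ev i) (ev j) = 0"
proof -
  have ok: "canonical_ok (x, a)" using canonical_subsets_ok assms by (simp only: list_all_iff)
  show "x < length index_tables" using ok unfolding canonical_ok_def prod.case by (rule conjunct1)
  have sub: "set (canonical_vertices (x, a)) \<subseteq> {1..10}" by (rule canonical_vertices_subset[OF assms])
  then show v: "set (table_vertices x) \<subseteq> {1..10}" and c: "set (concat a) \<subseteq> {1..10}"
    by (simp_all add: canonical_vertices_def)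
  assume i: "i \<in> set (table_vertices x)" and j: "j \<in> set (concat a)"
  have "ev_products (unit_list i) ! (j - 1) = 0"
    using ok i j unfolding canonical_ok_def prod.case list_all_iff by blast
  then show "L10_form (ev i) (ev j) = 0"
    using L10_form_vec_ev[OF length_unit_list subsetD[OF c j], of i] lvec_unit_list[OF subsetD[OF v i]] by simp
qed

lemma full_config_okD:
  assumes "(x, a) \<in> set canonical_subsets" "n < length (table_configs x)"
  shows "config_ok (table_configs x ! n @ chain_configs a)"
    "X \<in> fst ` set (table_configs x ! n @ chain_configs a) \<Longrightarrow> highest_ok X"
proof -
  have mem: "table_configs x ! n @ chain_configs a \<in> set (full_configs (x, a))"
    using assms(2) by (auto simp: full_configs_def)
  show "config_ok (table_configs x ! n @ chain_configs a)"
    using canonical_configs_ok assms(1) mem unfolding list_all_iff by blast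
  assume "X \<in> fst ` set (table_configs x ! n @ chain_configs a)"
  then obtain vs where "(X, vs) \<in> set (table_configs x ! n @ chain_configs a)" by force
  then have "X \<in> set listed_symbols"
    using canonical_symbols assms(1) mem unfolding list_all_iff by blast
  then show "highest_ok X" using listed_symbols_highest unfolding list_all_iff by blast
qed

lemma config_set_append: "config_set (C @ D) = config_set C \<union> config_set D"
  by (simp add: config_set_def image_Un)

lemma config_set_chains: "set (concat a) \<subseteq> {1..10} \<Longrightarrow> config_set (chain_configs a) = ev ` set (concat a)"
proof -
  assume a: "set (concat a) \<subseteq> {1..10}"
  have "set (concat (map snd (chain_configs a))) = unit_list ` set (concat a)" by (auto simp: chain_configs_def)
  then have "config_set (chain_configs a) = (\<lambda>i. lvec (unit_list i)) ` set (concat a)"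
    by (simp only: config_set_def image_image)
  also have "\<dots> = ev ` set (concat a)" using a by (intro image_cong refl lvec_unit_list) (rule subsetD)
  finally show ?thesis .
qed

lemma table_okD:
  assumes "x < length index_tables"
  shows "table_configs x \<noteq> []" "set (table_vertices x) \<subseteq> {1..10} \<Longrightarrow> config_set (table_configs x ! 0) = ev ` set (table_vertices x)"
    "n < length (table_configs x) \<Longrightarrow> length (concat (map snd (table_configs x ! n))) = length (table_vertices x)"
proof -
  have "table_ok x" using tables_ok assms unfolding list_all_iff by (simp del: upt_Suc)
  then have T: "table_configs x \<noteq> []"
    "\<forall>C\<in>set (table_configs x). length (concat (map snd C)) = length (table_vertices x)"
    "\<forall>v\<in>set (concat (map snd (hd (table_configs x)))). v \<in> set (map unit_list (table_vertices x))"
    "\<forall>i\<in>set (table_vertices x). unit_list i \<in> set (concat (map snd (hd (table_configs x))))"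
    unfolding table_ok_def Let_def list_all_iff by - (elim conjE, assumption)+
  show "table_configs x \<noteq> []" by (rule T(1))
  show "length (concat (map snd (table_configs x ! n))) = length (table_vertices x)" if "n < length (table_configs x)"
    using T(2) nth_mem[OF that] by (rule bspec)
  assume v: "set (table_vertices x) \<subseteq> {1..10}"
  have "set (concat (map snd (table_configs x ! 0))) = unit_list ` set (table_vertices x)"
    using T(3,4) hd_conv_nth[OF T(1)] by auto
  then have "config_set (table_configs x ! 0) = (\<lambda>i. lvec (unit_list i)) ` set (table_vertices x)"
    by (simp only: config_set_def image_image)
  also have "\<dots> = ev ` set (table_vertices x)" using v by (intro image_cong refl lvec_unit_list) (rule subsetD)
  finally show "config_set (table_configs x ! 0) = ev ` set (table_vertices x)" .
qed

text \<open>The word of a link carries the extension of one configuration of the table into another one.\<close>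

lemma link_map:
  assumes p: "(x, a) \<in> set canonical_subsets" and n: "n < length (table_configs x)"
    and k: "k < length (table_configs x ! n)" and i: "i \<in> {1..symbol_rank (fst (table_configs x ! n ! k))}"
    and m: "prime (nat (highest_coeffs (fst (table_configs x ! n ! k)) ! (i - 1)))"
  defines "C \<equiv> table_configs x ! n @ chain_configs a"
  defines "\<theta> \<equiv> \<Sum>j\<in>{1..symbol_rank (fst (C ! k))}. of_int (highest_coeffs (fst (C ! k)) ! (j - 1)) *\<^sub>R config_root C k j"
  shows "\<exists>b. n < b \<and> b < length (table_configs x) \<and> (\<exists>h\<in>W10.
    h ` (insert (- \<theta>) (config_set C - {config_root C k i})) \<subseteq> config_set (table_configs x ! b @ chain_configs a))"
proof -
  note P = canonical_okD[OF p]
  define D where "D = table_configs x ! n"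
  obtain X vs where Xv: "D ! k = (X, vs)" by (cases "D ! k")
  have kC: "k < length C" using k by (simp add: C_def)
  have Ck: "C ! k = (X, vs)" using k Xv by (simp add: C_def D_def nth_append)
  have okC: "config_ok C" unfolding C_def by (rule full_config_okD[OF p n])
  have X: "fst (C ! k) = X" "snd (C ! k) = vs" by (simp_all add: Ck)
  have DX: "fst (table_configs x ! n ! k) = X" using Xv by (simp add: D_def)
  have "X \<in> fst ` set C" using nth_mem[OF kC] Ck by force
  then have high: "highest_ok X" unfolding C_def by (rule full_config_okD(2)[OF p n])
  note H = highest_okD[OF high]
  have len: "length vs = symbol_rank X" using config_okD(2)[OF okC kC] by (simp add: X)
  have len10: "length v = 10" if "v \<in> set vs" for v using config_okD(3)[OF okC kC] that by (simp add: X)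
  have iX: "i \<in> {1..symbol_rank X}" using i by (simp add: DX)
  have mX: "prime (nat (highest_coeffs X ! (i - 1)))" using m by (simp only: DX)
  have "\<not> prime (nat 4)" "\<not> prime (nat 6)" "\<not> prime (nat 1)" by (auto simp: prime_nat_iff intro!: exI[of _ 2])
  then have "highest_coeffs X ! (i - 1) \<notin> set [1, 4, 6]" using mX by auto
  moreover have "table_complete x" using tables_complete P(1) unfolding list_all_iff by (simp del: upt_Suc)
  moreover have "(n, D) \<in> set (List.enumerate 0 (table_configs x))" using n by (simp add: in_set_enumerate_eq D_def)
  moreover have "(k, X, vs) \<in> set (List.enumerate 0 D)" using k Xv by (simp add: in_set_enumerate_eq D_def)
  moreover have "(i - 1, highest_coeffs X ! (i - 1)) \<in> set (List.enumerate 0 (highest_coeffs X))"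
    using iX H(1) by (auto simp: in_set_enumerate_eq)
  ultimately have "(n, k, i - 1) \<in> set (map (\<lambda>(a, k, i, b, w). (a, k, i)) (table_links x))"
    unfolding table_complete_def Let_def list_all_iff by fastforce
  then obtain b w where bw: "(n, k, i - 1, b, w) \<in> set (table_links x)" by auto
  have "link_ok (table_vertices x) (table_configs x) (n, k, i - 1, b, w)"
    using links_ok P(1) bw unfolding list_all_iff by (simp del: upt_Suc)
  then have b: "n < b" "b < length (table_configs x)" and w: "set w \<subseteq> set (table_vertices x)"
    and ext: "\<forall>v\<in>set (extended_config D k (i - 1)). apply_word w v \<in> set (concat (map snd (table_configs x ! b)))"
    unfolding link_ok_def prod.case list_all_iff D_def by blast+
  obtain h where h: "h \<in> L.weyl (ev ` set w)"
    "\<And>v. length v = 10 \<Longrightarrow> lvec (apply_word w v) = h (lvec v) \<and> length (apply_word w v) = 10"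
    using lvec_apply_word[OF order_trans[OF w P(2)]] by (elim bexE) simp
  have hW: "h \<in> W10" by (rule subsetD[OF weyl_ev_subset[OF order_trans[OF w P(2)]] h(1)])
  have extD: "extended_config D k (i - 1)
      = map uminus (combination (highest_coeffs X) vs) # removeAll (vs ! (i - 1)) (concat (map snd D))"
    by (simp add: extended_config_def Xv)
  have into: "h (lvec v) \<in> config_set (table_configs x ! b @ chain_configs a)"
    if "v \<in> set (extended_config D k (i - 1))" "length v = 10" for v
  proof -
    have "lvec (apply_word w v) \<in> config_set (table_configs x ! b)"
      unfolding config_set_def by (rule imageI[OF bspec[OF ext that(1)]])
    then show ?thesis using h(2)[OF that(2)] by (simp add: config_set_append)
  qed
  have comb: "lvec (combination (highest_coeffs X) vs) = (\<Sum>i<length vs. of_int (highest_coeffs X ! i) *\<^sub>R lvec (vs ! i))"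
    "length (combination (highest_coeffs X) vs) = 10"
    using lvec_combination[of "highest_coeffs X" vs] H(1) len len10 by simp_all
  have \<theta>: "\<theta> = lvec (combination (highest_coeffs X) vs)"
    unfolding \<theta>_def X config_root_def comb(1) len
    by (rule sum.reindex_bij_witness[of _ Suc "\<lambda>i. i - 1"]) auto
  have "h e \<in> config_set (table_configs x ! b @ chain_configs a)" if e: "e \<in> insert (- \<theta>) (config_set C - {config_root C k i})" for e
  proof (cases "e = - \<theta>")
    case True
    then have "e = lvec (map uminus (combination (highest_coeffs X) vs))" by (simp add: \<theta> lvec_uminus)
    moreover have "map uminus (combination (highest_coeffs X) vs) \<in> set (extended_config D k (i - 1))"
      unfolding extD list.set by (rule insertI1)
    moreover have "length (map uminus (combination (highest_coeffs X) vs)) = 10" using comb(2) by simp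
    ultimately show ?thesis by (simp only: into)
  next
    case False
    then have e': "e \<in> config_set C" "e \<noteq> config_root C k i" using e by simp_all
    then consider "e \<in> config_set D" | "e \<in> config_set (chain_configs a)"
      unfolding C_def D_def config_set_append by blast
    then show ?thesis
    proof cases
      case 1
      then obtain v where v: "v \<in> set (concat (map snd D))" "e = lvec v" unfolding config_set_def by blast
      obtain c where c: "c \<in> set D" "v \<in> set (snd c)" using v(1) by auto
      obtain l where Dl: "l < length D" "D ! l = c" using c(1) unfolding in_set_conv_nth by blast
      have l: "l < length D" "v \<in> set (snd (D ! l))" using Dl c(2) by simp_all
      have len_v: "length v = 10"
        by (rule config_okD(3)[OF okC, of l]) (use l in \<open>simp_all add: C_def D_def nth_append\<close>)
      have "v \<noteq> vs ! (i - 1)" using e'(2) v(2) by (auto simp: config_root_def X)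
      then have "v \<in> set (extended_config D k (i - 1))"
        unfolding extD list.set set_removeAll using v(1) by simp
      then show ?thesis unfolding v(2) by (rule into[OF _ len_v])
    next
      case 2
      then obtain j where j: "j \<in> set (concat a)" "e = ev j" unfolding config_set_chains[OF P(3)] by blast
      have "L10_form e r = 0" if "r \<in> ev ` set w" for r
        using that P(4)[OF subsetD[OF w] j(1)] j(2) L10_form_sym by (metis imageE)
      then have "h e = e" by (rule L.weyl_fixes_orthogonal[OF h(1)])
      then show ?thesis using 2 by (simp add: config_set_append)
    qed
  qed
  then have "h ` (insert (- \<theta>) (config_set C - {config_root C k i})) \<subseteq> config_set (table_configs x ! b @ chain_configs a)"
    by (rule image_subsetI)
  then show ?thesis using b hW by (intro exI[of _ b] conjI bexI[of _ h])
qed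

text \<open>Descend along the links until the configuration spans the lattice.\<close>

lemma finite_index_table:
  assumes "(x, a) \<in> set canonical_subsets" "n < length (table_configs x)" "L.simple_system \<Phi>"
    "\<Phi> \<subseteq> zspan (config_set (table_configs x ! n @ chain_configs a))"
    "card \<Phi> = card (config_set (table_configs x ! n @ chain_configs a))"
  shows "\<exists>b<length (table_configs x). \<exists>g\<in>W10. g ` \<Phi> = config_set (table_configs x ! b @ chain_configs a)"
  using assms(2-5)
proof (induction "length (table_configs x) - n" arbitrary: n \<Phi> rule: less_induct)
  case less
  define C where "C = table_configs x ! n @ chain_configs a"
  have ok: "config_ok C" unfolding C_def by (rule full_config_okD(1)[OF assms(1) less.prems(1)])
  note CS = config_ok_simple[OF ok]
  note D = L.simple_systemD[OF CS(1)] and F = L.simple_systemD[OF less.prems(2)]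
  have into: "\<Phi> \<subseteq> zspan (config_set C)" and card: "card \<Phi> = card (config_set C)"
    using less.prems(3,4) by (simp_all only: C_def)
  have zL: "zspan (config_set C) \<subseteq> L10" by (rule zspan_subset_L10[OF CS(4)])
  have WW: "L.weyl (L.root_set (zspan (config_set C))) \<subseteq> W10"
    by (rule weyl_subset_W10) (use zL in \<open>auto simp: L.root_set_def\<close>)
  show ?case
  proof (cases "zspan \<Phi> = zspan (config_set C)")
    case True
    obtain g where g: "g \<in> L.weyl (config_set C)" "g ` \<Phi> = config_set C"
      using L.simple_systems_conjugate[OF CS(1) less.prems(2) True] by (elim bexE)
    have "g \<in> W10" by (rule subsetD[OF WW subsetD[OF L.simple_weyl_subset[OF CS(1)] g(1)]])
    then show ?thesis using g(2) less.prems(1) unfolding C_def by (intro exI[of _ n] conjI bexI[of _ g])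
  next
    case False
    let ?V = "\<lambda>k. {1..symbol_rank (fst (C ! k))}" and ?c = "\<lambda>k i. highest_coeffs (fst (C ! k)) ! (i - 1)"
    define m where "m r = (THE z. \<exists>k<length C. \<exists>i\<in>?V k. r = config_root C k i \<and> z = ?c k i)" for r
    have m: "m (config_root C k i) = ?c k i" if "k < length C" "i \<in> ?V k" for k i
      unfolding m_def
    proof (rule the_equality)
      show "\<exists>l<length C. \<exists>j\<in>?V l. config_root C k i = config_root C l j \<and> ?c k i = ?c l j"
        using that by (intro exI[of _ k] conjI bexI[of _ i]) simp_all
      fix z assume "\<exists>l<length C. \<exists>j\<in>?V l. config_root C k i = config_root C l j \<and> z = ?c l j"
      then obtain l j where lj: "l < length C" "j \<in> ?V l" "config_root C k i = config_root C l j" "z = ?c l j"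
        by (elim exE conjE bexE)
      then show "z = ?c k i" using config_root_inj[OF ok that(1) lj(1) that(2) lj(2,3)] by simp
    qed
    have high: "highest_ok (fst (C ! k))" if "k < length C" for k
      using full_config_okD(2)[OF assms(1) less.prems(1)] nth_mem[OF that] unfolding C_def by blast
    define \<K> where "\<K> = (\<lambda>k. config_root C k ` ?V k) ` {..<length C}"
    define \<theta> where "\<theta> K = (\<Sum>e\<in>K. of_int (m e) *\<^sub>R e)" for K
    have \<theta>k: "\<theta> (config_root C k ` ?V k) = (\<Sum>i\<in>?V k. of_int (?c k i) *\<^sub>R config_root C k i)" if k: "k < length C" for k
    proof -
      have "inj_on (config_root C k) (?V k)" using config_root_inj[OF ok k k] by (auto intro: inj_onI)
      then have "\<theta> (config_root C k ` ?V k) = (\<Sum>i\<in>?V k. of_int (m (config_root C k i)) *\<^sub>R config_root C k i)"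
        unfolding \<theta>_def by (simp only: sum.reindex comp_def)
      then show ?thesis using m[OF k] by simp
    qed
    have \<theta>_prod: "L10_form (\<theta> (config_root C k ` ?V k)) (config_root C k j)
        = of_int (\<Sum>i\<in>?V k. ?c k i * symbol_gram (fst (C ! k)) i j)" if k: "k < length C" "j \<in> ?V k" for k j
      unfolding \<theta>k[OF k(1)] L.B_sum_left of_int_sum
      by (intro sum.cong refl) (simp add: config_products[OF ok k(1,1) _ k(2)])
    have "\<exists>g\<in>L.weyl (L.root_set (zspan (config_set C))). \<exists>K\<in>\<K>. \<exists>j\<in>K.
        prime (nat (m j)) \<and> g ` \<Phi> \<subseteq> zspan (insert (- \<theta> K) (config_set C - {j}))"
    proof (rule L.finite_index_step[OF CS(1)])
      show "\<Union>\<K> = config_set C" unfolding \<K>_def config_set_eq[OF ok] by simp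
      show "L10_form r s = 0" if KL: "K \<in> \<K>" "L \<in> \<K>" "K \<noteq> L" "r \<in> K" "s \<in> L" for K L r s
      proof -
        obtain k l where kl: "k < length C" "K = config_root C k ` ?V k" "l < length C" "L = config_root C l ` ?V l"
          using KL(1,2) unfolding \<K>_def by (elim imageE) simp
        obtain i j where "i \<in> ?V k" "r = config_root C k i" "j \<in> ?V l" "s = config_root C l j"
          using KL(4,5) unfolding kl(2,4) by (elim imageE)
        moreover have "k \<noteq> l" using KL(3) kl(2,4) by auto
        ultimately show ?thesis using config_products[OF ok kl(1,3)] by simp
      qed
      show "0 < m e" if "e \<in> config_set C" for e
        using that m highest_okD(2)[OF high] unfolding config_set_eq[OF ok] by auto
      show "\<theta> K = (\<Sum>e\<in>K. of_int (m e) *\<^sub>R e)" for K by (rule \<theta>_def)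
      show "L10_form (\<theta> K) e \<le> 0" if K: "K \<in> \<K>" "e \<in> K" for K e
      proof -
        obtain k where k: "k < length C" "K = config_root C k ` ?V k" using K(1) unfolding \<K>_def by (elim imageE) simp
        obtain j where j: "j \<in> ?V k" "e = config_root C k j" using K(2) unfolding k(2) by (elim imageE)
        show ?thesis unfolding k(2) j(2) \<theta>_prod[OF k(1) j(1)] of_int_le_0_iff
          by (rule highest_okD(3)[OF high[OF k(1)] j(1)])
      qed
      show "L10_form (\<theta> K) (\<theta> K) = - 2" if K: "K \<in> \<K>" for K
      proof -
        obtain k where k: "k < length C" "K = config_root C k ` ?V k" using K unfolding \<K>_def by (elim imageE) simp
        have "L10_form (\<theta> K) (\<theta> K) = (\<Sum>j\<in>?V k. of_int (?c k j) * L10_form (\<theta> K) (config_root C k j))"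
          by (subst (2) k(2), subst \<theta>k[OF k(1)]) (simp add: L.B_sum_right)
        also have "\<dots> = of_int (\<Sum>j\<in>?V k. ?c k j * (\<Sum>i\<in>?V k. ?c k i * symbol_gram (fst (C ! k)) i j))"
          unfolding of_int_sum[of _ "?V k"] of_int_mult k(2)
          by (intro sum.cong refl) (simp only: \<theta>_prod[OF k(1)] of_int_sum of_int_mult)
        finally show ?thesis unfolding highest_okD(4)[OF high[OF k(1)]] by simp
      qed
      show "finite \<Phi>" "independent \<Phi>" by (rule F)+
      show "\<Phi> \<subseteq> L.root_set (zspan (config_set C))" using into F(4) by (auto simp: L.root_set_def)
      show "card \<Phi> = card (config_set C)" by (rule card)
      show "zspan \<Phi> \<noteq> zspan (config_set C)" by (rule False)
    qed
    then obtain g K r where g: "g \<in> L.weyl (L.root_set (zspan (config_set C)))" and K: "K \<in> \<K>" "r \<in> K"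
      "prime (nat (m r))" "g ` \<Phi> \<subseteq> zspan (insert (- \<theta> K) (config_set C - {r}))" by (elim bexE conjE)
    obtain k where k: "k < length C" "K = config_root C k ` ?V k" using K(1) unfolding \<K>_def by (elim imageE) simp
    obtain i where i: "i \<in> ?V k" "r = config_root C k i" using K(2) unfolding k(2) by (elim imageE)
    have pr: "prime (nat (?c k i))" using K(3) m[OF k(1) i(1)] by (simp add: i(2))
    have kn: "k < length (table_configs x ! n)"
    proof (rule ccontr)
      assume "\<not> ?thesis"
      then have "C ! k \<in> set (chain_configs a)" using k(1) by (auto simp: C_def nth_append)
      then obtain l where "fst (C ! k) = Type_A l" by (auto simp: chain_configs_def)
      then have "?c k i = 1" using i(1) by auto
      then show False using pr by simp
    qed
    then have Cn: "C ! k = table_configs x ! n ! k" by (simp add: C_def nth_append)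
    have "\<exists>b. n < b \<and> b < length (table_configs x) \<and> (\<exists>h\<in>W10.
      h ` (insert (- \<theta> K) (config_set C - {r})) \<subseteq> config_set (table_configs x ! b @ chain_configs a))"
      using link_map[OF assms(1) less.prems(1) kn] i pr unfolding k(2) \<theta>k[OF k(1)] i(2) Cn[symmetric] C_def[symmetric] by blast
    then obtain b h where b: "n < b" "b < length (table_configs x)" and h: "h \<in> W10"
      "h ` (insert (- \<theta> K) (config_set C - {r})) \<subseteq> config_set (table_configs x ! b @ chain_configs a)"
      by (elim exE conjE bexE)
    define E where "E = table_configs x ! b @ chain_configs a"
    have okE: "config_ok E" unfolding E_def by (rule full_config_okD(1)[OF assms(1) b(2)])
    have gW: "g \<in> W10" by (rule subsetD[OF WW g])
    have hg: "h \<circ> g \<in> W10" by (rule L.weyl_comp[OF h(1) gW])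
    have "(h \<circ> g) ` \<Phi> \<subseteq> h ` zspan (insert (- \<theta> K) (config_set C - {r}))"
      unfolding image_comp[symmetric] by (rule image_mono[OF K(4)])
    also have "\<dots> = zspan (h ` (insert (- \<theta> K) (config_set C - {r})))" by (rule linear_zspan_image[OF W10_linear[OF h(1)]])
    also have "\<dots> \<subseteq> zspan (config_set E)" unfolding E_def by (rule Z.span_mono[OF h(2)])
    finally have 1: "(h \<circ> g) ` \<Phi> \<subseteq> zspan (config_set E)" .
    have 2: "L.simple_system ((h \<circ> g) ` \<Phi>)"
      by (rule L.simple_system_image[OF less.prems(2) W10_linear[OF hg] W10_isometry[OF hg]])
    have tx: "x < length index_tables" by (rule canonical_okD(1)[OF assms(1)])
    have card_eq: "card (config_set C') = length (concat (map snd C'))" if "config_ok C'" for C'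
      by (rule card_config_set[OF that]) (rule config_root_inj[OF that]; assumption)
    have "card (config_set E) = card (config_set C)"
      unfolding card_eq[OF okE] card_eq[OF ok]
      using table_okD(3)[OF tx b(2)] table_okD(3)[OF tx less.prems(1)] by (simp add: E_def C_def)
    then have 3: "card ((h \<circ> g) ` \<Phi>) = card (config_set E)"
      using card card_image[OF inj_on_subset[OF W10_inj[OF hg] subset_UNIV], of \<Phi>] by simp
    have "\<exists>b'<length (table_configs x). \<exists>g'\<in>W10. g' ` ((h \<circ> g) ` \<Phi>) = config_set (table_configs x ! b' @ chain_configs a)"
      by (rule less.hyps[of b]) (use b 1 2 3 in \<open>simp_all add: E_def\<close>)
    then obtain b' g' where b': "b' < length (table_configs x)" and g': "g' \<in> W10"
      "g' ` ((h \<circ> g) ` \<Phi>) = config_set (table_configs x ! b' @ chain_configs a)" by (elim exE conjE bexE)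
    have "(g' \<circ> (h \<circ> g)) ` \<Phi> = config_set (table_configs x ! b' @ chain_configs a)"
      unfolding image_comp[symmetric, of g'] by (rule g'(2))
    then show ?thesis using b' L.weyl_comp[OF g'(1) hg] by (intro exI[of _ b'] conjI bexI[of _ "g' \<circ> (h \<circ> g)"])
  qed
qed

section \<open>Classification of the configurations\<close>

lemma card_eq_if_span_eq:
  fixes S T :: "'v::real_vector set"
  assumes "finite S" "independent S" "finite T" "independent T" "span S = span T"
  shows "card S = card T"
proof (rule antisym)
  have 1: "S \<subseteq> span T" using span_superset[of S] by (simp only: assms(5))
  show "card S \<le> card T" by (rule conjunct2[OF independent_span_bound[OF assms(3,2) 1]])
  have 2: "T \<subseteq> span S" using span_superset[of T] by (simp only: assms(5))
  show "card T \<le> card S" by (rule conjunct2[OF independent_span_bound[OF assms(1,4) 2]])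
qed

text \<open>The primitive closure is spanned by as many vertices, and not by all ten, as their span would then
  contain isotropic vectors.\<close>

lemma config_card:
  assumes "ade_config L10_form L10 \<Phi>" shows "card \<Phi> < 10"
proof -
  obtain S where S: "S \<subseteq> {1..10}" "L.simple_system (ev ` S)" "card S = card \<Phi>"
    using config_closure[OF assms] by (elim bexE exE conjE)
  have "\<not> {1..9} \<subseteq> S" using ev_1_9_not_neg_def L.simple_systemD(3)[OF S(2)] by (intro notI) simp
  then have "S \<noteq> {1..10}" by auto
  then have "card S < card {1..10::nat}" using S(1) by (intro psubset_card_mono) auto
  then show ?thesis using S(3) by simp
qed

text \<open>The Weyl group moves the primitive closure to the span of a canonical set of simple roots, and then
  moves the configuration within this span to an entry of the table. The simple system \<open>\<Delta>\<close> is the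
  preimage of the canonical set.\<close>

lemma config_classification:
  assumes "ade_config L10_form L10 \<Phi>"
  shows "\<exists>p\<in>set canonical_subsets. \<exists>b<length (full_configs p). \<exists>g\<in>W10. \<exists>\<Delta>.
    g ` \<Phi> = config_set (full_configs p ! b)
    \<and> config_type L10_form \<Phi> = mset (map fst (full_configs p ! b))
    \<and> lattice_type L10_form (primitive_closure L10 (zspan \<Phi>)) = mset (map fst (full_configs p ! 0))
    \<and> config_set (full_configs p ! 0) = ev ` set (canonical_vertices p)
    \<and> config_ok (full_configs p ! 0)
    \<and> L.simple_system \<Delta> \<and> is_ade_diagram (dynkin_diagram L10_form \<Delta>)
    \<and> config_type L10_form \<Delta> = mset (map fst (full_configs p ! 0))
    \<and> primitive_closure L10 (zspan \<Phi>) = zspan \<Delta>"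
proof -
  note P = ade_config_L10D[OF assms]
  obtain g1 S where g1: "g1 \<in> W10" "S \<subseteq> {1..10}" "L.simple_system (ev ` S)" "g1 ` \<Phi> \<subseteq> zspan (ev ` S)"
    "card S = card \<Phi>" "g1 ` primitive_closure L10 (zspan \<Phi>) = zspan (ev ` S)"
    using config_closure[OF assms] by (elim bexE exE conjE)
  obtain p g2 where p: "p \<in> set canonical_subsets"
    and g2: "g2 \<in> W10" "g2 ` zspan (ev ` S) = zspan (ev ` set (canonical_vertices p))"
    using canonical_subset_exists[OF g1(2) L.simple_systemD(3)[OF g1(3)]] by (elim bexE)
  obtain x a where xa: "p = (x, a)" by (cases p)
  have pm: "(x, a) \<in> set canonical_subsets" using p by (simp only: xa)
  note C = canonical_okD[OF pm]
  have len: "length (full_configs p) = length (table_configs x)" by (simp add: full_configs_def xa)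
  have nth: "full_configs p ! n = table_configs x ! n @ chain_configs a" if "n < length (table_configs x)" for n
    using that by (simp add: full_configs_def xa)
  have ne: "0 < length (table_configs x)" using table_okD(1)[OF C(1)] by simp
  have set0: "config_set (full_configs p ! 0) = ev ` set (canonical_vertices p)"
    unfolding nth[OF ne] config_set_append table_okD(2)[OF C(1,2)] config_set_chains[OF C(3)]
    by (simp add: canonical_vertices_def xa image_Un)
  have ok: "config_ok (full_configs p ! n)" if "n < length (table_configs x)" for n
    unfolding nth[OF that] by (rule full_config_okD(1)[OF pm that])
  define C0 where "C0 = full_configs p ! 0"
  note CS0 = config_ok_simple[OF ok[OF ne], folded C0_def]
  define g where "g = g2 \<circ> g1"
  have gW: "g \<in> W10" unfolding g_def by (rule L.weyl_comp[OF g2(1) g1(1)])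
  have injg: "inj_on k A" if "k \<in> W10" for k and A by (rule inj_on_subset[OF W10_inj[OF that] subset_UNIV])
  have gcl: "g ` primitive_closure L10 (zspan \<Phi>) = zspan (config_set C0)"
    unfolding g_def image_comp[symmetric] g1(6) g2(2) C0_def set0 by (rule refl)
  have "g ` \<Phi> \<subseteq> g2 ` zspan (ev ` S)" unfolding g_def image_comp[symmetric] by (rule image_mono[OF g1(4)])
  then have into: "g ` \<Phi> \<subseteq> zspan (config_set C0)" unfolding g2(2) C0_def set0 .
  have simple: "L.simple_system (g ` \<Phi>)" by (rule L.simple_system_image[OF P(1) W10_linear[OF gW] W10_isometry[OF gW]])
  have s2: "L.simple_system (g2 ` ev ` S)"
    by (rule L.simple_system_image[OF g1(3) W10_linear[OF g2(1)] W10_isometry[OF g2(1)]])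
  have z2: "zspan (g2 ` ev ` S) = zspan (config_set C0)"
    unfolding linear_zspan_image[OF W10_linear[OF g2(1)], symmetric] g2(2) C0_def set0 by (rule refl)
  have "span (g2 ` ev ` S) = span (config_set C0)"
    using arg_cong[OF z2, of span] unfolding span_zspan .
  then have "card (g2 ` ev ` S) = card (config_set C0)"
    using L.simple_systemD(1,2)[OF s2] L.simple_systemD(1,2)[OF CS0(1)] by (intro card_eq_if_span_eq)
  moreover have "card (g2 ` ev ` S) = card \<Phi>"
    unfolding card_image[OF injg[OF g2(1)]] card_image[OF inj_on_subset[OF inj_vertex_vector subset_UNIV]]
    by (rule g1(5))
  ultimately have card: "card (g ` \<Phi>) = card (config_set C0)" unfolding card_image[OF injg[OF gW]] by simp
  obtain b k where b: "b < length (table_configs x)" and k: "k \<in> W10"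
    "k ` g ` \<Phi> = config_set (table_configs x ! b @ chain_configs a)"
    using finite_index_table[OF pm ne simple] into card unfolding C0_def nth[OF ne] by blast
  have kg: "k \<circ> g \<in> W10" by (rule L.weyl_comp[OF k(1) gW])
  have kgS: "(k \<circ> g) ` \<Phi> = config_set (full_configs p ! b)"
    unfolding image_comp[symmetric] nth[OF b] by (rule k(2))
  have "config_type L10_form ((k \<circ> g) ` \<Phi>) = config_type L10_form \<Phi>"
    by (rule L.config_type_image(2)[OF P(4,3) W10_isometry[OF kg] injg[OF kg]])
  then have type: "config_type L10_form \<Phi> = mset (map fst (full_configs p ! b))"
    unfolding kgS config_ok_simple(3)[OF ok[OF b]] by (rule sym)
  obtain h where h: "h \<in> W10" "h \<circ> g = id" using W10_inverse[OF gW] by (elim bexE conjE)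
  define \<Delta> where "\<Delta> = h ` config_set C0"
  have "primitive_closure L10 (zspan \<Phi>) = h ` g ` primitive_closure L10 (zspan \<Phi>)"
    unfolding image_comp h(2) by simp
  also have "\<dots> = zspan \<Delta>" unfolding gcl \<Delta>_def by (rule linear_zspan_image[OF W10_linear[OF h(1)]])
  finally have cl: "primitive_closure L10 (zspan \<Phi>) = zspan \<Delta>" .
  have sd: "L.simple_system \<Delta>"
    unfolding \<Delta>_def by (rule L.simple_system_image[OF CS0(1) W10_linear[OF h(1)] W10_isometry[OF h(1)]])
  note T = L.config_type_image[OF L.simple_systemD(1)[OF CS0(1)] CS0(2) W10_isometry[OF h(1)] injg[OF h(1)], folded \<Delta>_def]
  have t0: "config_type L10_form \<Delta> = mset (map fst C0)" unfolding T(2) by (rule CS0(3))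
  have lt: "lattice_type L10_form (primitive_closure L10 (zspan \<Phi>)) = mset (map fst C0)"
    unfolding cl L.lattice_type_simple[OF sd T(1)] by (rule t0)
  show ?thesis
    by (intro bexI[OF _ p] exI[of _ b] conjI bexI[OF _ kg] exI[of _ \<Delta>])
      (use b len kgS type lt[unfolded C0_def] set0 ok[OF ne] sd T(1) t0[unfolded C0_def] cl in \<open>simp_all only:\<close>)
qed

lemma type_code_mset:
  assumes "mset (map fst C) = mset (map fst D)"
  shows "type_code C = type_code D"
proof -
  have "type_code C = sorted_list_of_multiset (image_mset symbol_code (mset (map fst C)))" for C
  proof -
    have "map (\<lambda>(X, vs). symbol_code X) C = map symbol_code (map fst C)" by (simp add: case_prod_unfold comp_def)
    then have "type_code C = sort (map symbol_code (map fst C))" by (simp only: type_code_def)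
    also have "\<dots> = sorted_list_of_multiset (mset (map symbol_code (map fst C)))"
      by (simp only: sorted_list_of_multiset_mset)
    also have "\<dots> = sorted_list_of_multiset (image_mset symbol_code (mset (map fst C)))" by (simp only: mset_map)
    finally show ?thesis .
  qed
  then show ?thesis using assms by simp
qed

text \<open>The first entry of a table has the type of the closure and so determines the table. As the components
  of type \<open>A\<close> outside the table are common to all entries, the types of the entries differ within the
  table.\<close>

lemma full_configs_unique:
  assumes "p \<in> set canonical_subsets" "q \<in> set canonical_subsets"
    "b < length (full_configs p)" "c < length (full_configs q)"
    "mset (map fst (full_configs p ! 0)) = mset (map fst (full_configs q ! 0))"
    "mset (map fst (full_configs p ! b)) = mset (map fst (full_configs q ! c))"
  shows "full_configs p ! b = full_configs q ! c"
proof -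
  have ne: "full_configs p \<noteq> []" "full_configs q \<noteq> []" using assms(3,4) by auto
  have hd: "type_code (hd (full_configs p)) = type_code (hd (full_configs q))"
    unfolding hd_conv_nth[OF ne(1)] hd_conv_nth[OF ne(2)] by (rule type_code_mset[OF assms(5)])
  have "inj_on (\<lambda>p. type_code (hd (full_configs p))) (set canonical_subsets)"
    using canonical_types_distinct unfolding distinct_map by (rule conjunct2)
  then have pq: "p = q" by (rule inj_onD[OF _ hd assms(1,2)])
  obtain x a where xa: "p = (x, a)" by (cases p)
  have pm: "(x, a) \<in> set canonical_subsets" using assms(1) by (simp only: xa)
  have len: "length (full_configs p) = length (table_configs x)" by (simp add: full_configs_def xa)
  have bc: "b < length (table_configs x)" "c < length (table_configs x)" using assms(3,4) len pq by simp_all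
  have nth: "full_configs p ! n = table_configs x ! n @ chain_configs a" if "n < length (table_configs x)" for n
    using that by (simp add: full_configs_def xa)
  have "mset (map fst (table_configs x ! b)) = mset (map fst (table_configs x ! c))"
    using assms(6) unfolding pq[symmetric] nth[OF bc(1)] nth[OF bc(2)] by simp
  then have code: "type_code (table_configs x ! b) = type_code (table_configs x ! c)" by (rule type_code_mset)
  have "x < length index_tables" by (rule canonical_okD(1)[OF pm])
  then have "distinct (map type_code (table_configs x))"
    using table_types_distinct unfolding list_all_iff by (simp del: upt_Suc)
  then have "b = c" using code bc nth_eq_iff_index_eq[of "map type_code (table_configs x)" b c] by simp
  then show ?thesis by (simp add: pq)
qed

section \<open>Equivalence of configurations\<close>

lemma equivalent_if_same_types:
  assumes "ade_config L10_form L10 \<Phi>" "ade_config L10_form L10 \<Phi>'"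
    "config_type L10_form \<Phi> = config_type L10_form \<Phi>'"
    "lattice_type L10_form (primitive_closure L10 (zspan \<Phi>)) = lattice_type L10_form (primitive_closure L10 (zspan \<Phi>'))"
  shows "equivalent_configs L10_form L10 \<Phi> \<Phi>'"
proof -
  obtain p b g where p: "p \<in> set canonical_subsets" "b < length (full_configs p)" and g: "g \<in> W10"
    "g ` \<Phi> = config_set (full_configs p ! b)" and t: "config_type L10_form \<Phi> = mset (map fst (full_configs p ! b))"
    "lattice_type L10_form (primitive_closure L10 (zspan \<Phi>)) = mset (map fst (full_configs p ! 0))"
    using config_classification[OF assms(1)] by (elim bexE exE conjE)
  obtain q c g' where q: "q \<in> set canonical_subsets" "c < length (full_configs q)" and g': "g' \<in> W10"
    "g' ` \<Phi>' = config_set (full_configs q ! c)" and t': "config_type L10_form \<Phi>' = mset (map fst (full_configs q ! c))"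
    "lattice_type L10_form (primitive_closure L10 (zspan \<Phi>')) = mset (map fst (full_configs q ! 0))"
    using config_classification[OF assms(2)] by (elim bexE exE conjE)
  have "full_configs p ! b = full_configs q ! c"
    by (rule full_configs_unique[OF p(1) q(1) p(2) q(2)]) (simp_all only: t[symmetric] t'[symmetric] assms(3,4))
  then have eq: "g ` \<Phi> = g' ` \<Phi>'" by (simp only: g(2) g'(2))
  obtain h where h: "h \<in> W10" "h \<circ> g' = id" using W10_inverse[OF g'(1)] by (elim bexE conjE)
  have hg: "h \<circ> g \<in> W10" by (rule L.weyl_comp[OF h(1) g(1)])
  have "(h \<circ> g) ` \<Phi> = h ` g' ` \<Phi>'" unfolding image_comp[symmetric] eq by (rule refl)
  also have "\<dots> = \<Phi>'" unfolding image_comp h(2) by simp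
  finally have "bij_betw (h \<circ> g) \<Phi> \<Phi>'"
    unfolding bij_betw_def by (intro conjI inj_on_subset[OF W10_inj[OF hg] subset_UNIV])
  moreover have "h \<circ> g \<in> O_plus L10_form L10" by (rule subsetD[OF W10_subset_O_plus hg])
  ultimately show ?thesis unfolding equivalent_configs_def by (intro bexI[of _ "h \<circ> g"])
qed

text \<open>An isometry of the lattice commutes with primitive closures and maps a basis of simple roots of the
  one to a basis of simple roots of the other.\<close>

lemma same_types_if_equivalent:
  assumes "ade_config L10_form L10 \<Phi>" "equivalent_configs L10_form L10 \<Phi> \<Phi>'"
  shows "config_type L10_form \<Phi> = config_type L10_form \<Phi>'"
    "lattice_type L10_form (primitive_closure L10 (zspan \<Phi>)) = lattice_type L10_form (primitive_closure L10 (zspan \<Phi>'))"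
proof -
  note P = ade_config_L10D[OF assms(1)]
  obtain g where g: "g \<in> O_plus L10_form L10" "bij_betw g \<Phi> \<Phi>'"
    using assms(2) unfolding equivalent_configs_def by (elim bexE)
  have iso: "lattice_isometry L10_form L10 L10_form L10 g" using g(1) unfolding O_plus_def by simp
  then have lin: "linear g" and inj: "inj_on g L10" and im: "g ` L10 = L10"
    and form: "\<And>x y. x \<in> L10 \<Longrightarrow> y \<in> L10 \<Longrightarrow> L10_form (g x) (g y) = L10_form x y"
    unfolding lattice_isometry_def bij_betw_def by simp_all
  have im\<Phi>: "g ` \<Phi> = \<Phi>'" using g(2) by (simp add: bij_betw_def)
  have "config_type L10_form (g ` \<Phi>) = config_type L10_form \<Phi>"
    by (rule L.config_type_image(2)[OF P(4,3) form inj_on_subset[OF inj P(2)]]) (use P(2) in auto)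
  then show "config_type L10_form \<Phi> = config_type L10_form \<Phi>'" by (simp add: im\<Phi>)
  have cl': "primitive_closure L10 (zspan \<Phi>') = g ` primitive_closure L10 (zspan \<Phi>)"
  proof
    have q: "qspan (zspan \<Phi>') = g ` qspan \<Phi>"
      unfolding qspan_zspan im\<Phi>[symmetric] by (rule linear_qspan_image[OF lin, symmetric])
    show "g ` primitive_closure L10 (zspan \<Phi>) \<subseteq> primitive_closure L10 (zspan \<Phi>')"
      unfolding primitive_closure_def q using im by (auto simp: qspan_zspan)
    show "primitive_closure L10 (zspan \<Phi>') \<subseteq> g ` primitive_closure L10 (zspan \<Phi>)"
    proof
      fix y assume "y \<in> primitive_closure L10 (zspan \<Phi>')"
      then have y: "y \<in> g ` qspan \<Phi>" "y \<in> g ` L10" unfolding primitive_closure_def q im by simp_all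
      obtain x where x: "x \<in> qspan \<Phi>" "y = g x" using y(1) by (elim imageE)
      obtain z where z: "z \<in> L10" "y = g z" using y(2) by (elim imageE)
      obtain N :: nat where N: "0 < N" "of_nat N *\<^sub>R x \<in> zspan \<Phi>"
        using qspan_clear_denominator[OF x(1)] by (elim exE conjE)
      have Nx: "of_nat N *\<^sub>R x \<in> L10" by (rule subsetD[OF zspan_subset_L10[OF P(2)] N(2)])
      \<comment> \<open>The isometry is given on the lattice only, so compare \<open>x\<close> and \<open>z\<close> after clearing denominators.\<close>
      have "zscale (int N) z \<in> L10" by (rule Z.subspace_scale[OF L10_subspace z(1)])
      then have Nz: "of_nat N *\<^sub>R z \<in> L10" by simp
      have "g (of_nat N *\<^sub>R x) = g (of_nat N *\<^sub>R z)"
        using x(2) z(2) by (simp add: linear_scale[OF lin])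
      then have "of_nat N *\<^sub>R x = of_nat N *\<^sub>R z" by (rule inj_onD[OF inj _ Nx Nz])
      then have "x = z" using N(1) by simp
      then show "y \<in> g ` primitive_closure L10 (zspan \<Phi>)"
        unfolding primitive_closure_def qspan_zspan using x z(1) by blast
    qed
  qed
  obtain \<Delta> where \<Delta>: "L.simple_system \<Delta>" "is_ade_diagram (dynkin_diagram L10_form \<Delta>)"
    "primitive_closure L10 (zspan \<Phi>) = zspan \<Delta>"
    using config_classification[OF assms(1)] by (elim bexE exE conjE)
  note D = L.simple_systemD[OF \<Delta>(1)]
  have "zspan \<Delta> \<subseteq> L10" unfolding \<Delta>(3)[symmetric] primitive_closure_def by simp
  then have sub: "\<Delta> \<subseteq> L10" using Z.span_superset by (rule order_trans[rotated])
  have form': "L10_form (g x) (g y) = L10_form x y" if "x \<in> \<Delta>" "y \<in> \<Delta>" for x y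
    by (rule form[OF subsetD[OF sub that(1)] subsetD[OF sub that(2)]])
  note T = L.config_type_image[OF D(1) \<Delta>(2) form' inj_on_subset[OF inj sub]]
  have prod: "L10_form r s \<in> {0, 1}" if rs: "r \<in> g ` \<Delta>" "s \<in> g ` \<Delta>" "r \<noteq> s" for r s
  proof -
    obtain x y where xy: "x \<in> \<Delta>" "r = g x" "y \<in> \<Delta>" "s = g y" using rs(1,2) by (elim imageE)
    have "x \<noteq> y" using rs(3) xy by auto
    then show ?thesis unfolding xy(2,4) form'[OF xy(1,3)] by (rule D(5)[OF xy(1,3)])
  qed
  have "L.simple_system (g ` \<Delta>)"
    by (rule L.ade_simple_system[OF _ _ prod T(1)]) (use D(1,4) form' in auto)
  then have "lattice_type L10_form (zspan (g ` \<Delta>)) = config_type L10_form (g ` \<Delta>)"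
    by (rule L.lattice_type_simple[OF _ T(1)])
  then show "lattice_type L10_form (primitive_closure L10 (zspan \<Phi>)) = lattice_type L10_form (primitive_closure L10 (zspan \<Phi>'))"
    unfolding cl' \<Delta>(3) linear_zspan_image[OF lin] L.lattice_type_simple[OF \<Delta>(1,2)] by (simp only: T(2))
qed

section \<open>Realization of types\<close>

lemma type_diagram_wf:
  assumes "is_ade_type t"
  shows "finite (fst (type_diagram t))" "snd (type_diagram t) \<subseteq> fst (type_diagram t) \<times> fst (type_diagram t)"
    "sym (snd (type_diagram t))" "irrefl (snd (type_diagram t))"
proof -
  have ok: "ade_symbol_ok X" if "k < count t X" for X k
  proof -
    have "X \<in># t" using that by (simp flip: count_greater_zero_iff)
    then show ?thesis using assms by (simp add: is_ade_type_def)
  qed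
  show "finite (fst (type_diagram t))"
  proof (rule finite_subset)
    show "fst (type_diagram t) \<subseteq> Sigma (set_mset t) (\<lambda>X. {..<count t X} \<times> {1..symbol_rank X})"
      unfolding type_diagram_def by (auto simp: symbol_vertices simp flip: count_greater_zero_iff)
    show "finite (Sigma (set_mset t) (\<lambda>X. {..<count t X} \<times> {1..symbol_rank X}))" by (intro finite_SigmaI) simp_all
  qed
  show "snd (type_diagram t) \<subseteq> fst (type_diagram t) \<times> fst (type_diagram t)"
  proof
    fix e assume "e \<in> snd (type_diagram t)"
    then obtain X k i j where e: "e = ((X, k, i), (X, k, j))" "k < count t X" "(i, j) \<in> snd (symbol_diagram X)"
      unfolding type_diagram_def by auto
    have "(i, j) \<in> {1..symbol_rank X} \<times> {1..symbol_rank X}"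
      by (rule subsetD[OF symbol_edges_subset[OF ok[OF e(2)]] e(3)])
    then show "e \<in> fst (type_diagram t) \<times> fst (type_diagram t)"
      using e(1,2) by (simp add: type_diagram_def symbol_vertices)
  qed
  show "sym (snd (type_diagram t))"
    unfolding type_diagram_def sym_def by (auto intro: symbol_edges_sym)
  show "irrefl (snd (type_diagram t))"
    unfolding type_diagram_def irrefl_def using symbol_edges_irrefl[OF ok] by auto
qed

text \<open>For roots with products \<open>0\<close> and \<open>1\<close>, the Gram matrix and the Dynkin diagram determine each other.\<close>

lemma iso_of_gram:
  assumes "\<And>u v. u \<in> fst D \<Longrightarrow> v \<in> fst D \<Longrightarrow> L10_form (f u) (f v) = diagram_gram D u v"
    "inj_on f (fst D)" "irrefl (snd D)"
  shows "diagram_iso D (dynkin_diagram L10_form (f ` fst D))"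
  unfolding diagram_iso_def
proof (intro exI[of _ f] conjI ballI)
  show "bij_betw f (fst D) (fst (dynkin_diagram L10_form (f ` fst D)))"
    using assms(2) by (simp add: dynkin_diagram_def bij_betw_def)
  fix u v assume uv: "u \<in> fst D" "v \<in> fst D"
  have "(u, u) \<notin> snd D" using assms(3) by (simp add: irrefl_def)
  then show "(u, v) \<in> snd D \<longleftrightarrow> (f u, f v) \<in> snd (dynkin_diagram L10_form (f ` fst D))"
    using inj_on_eq_iff[OF assms(2) uv] uv assms(1)[OF uv] by (auto simp: dynkin_diagram_def diagram_gram_def)
qed

lemma ev_diagram: "diagram_iso (sub_diagram (e_diagram 10) S) (dynkin_diagram L10_form (ev ` S))"
proof -
  let ?D = "sub_diagram (e_diagram 10) S"
  have "L10_form (ev i) (ev j) = diagram_gram ?D i j" if "i \<in> fst ?D" "j \<in> fst ?D" for i j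
    using that by (simp add: L10_form_ev diagram_gram_def sub_diagram_def)
  moreover have "irrefl (snd ?D)"
    unfolding irrefl_def sub_diagram_def e_diagram_def chain_edges_def by simp
  ultimately have "diagram_iso ?D (dynkin_diagram L10_form (ev ` fst ?D))"
    by (intro iso_of_gram inj_on_subset[OF inj_vertex_vector subset_UNIV])
  then show ?thesis by (simp add: sub_diagram_def)
qed

lemma gram_of_iso:
  assumes "L.simple_system \<Phi>" "diagram_iso D (dynkin_diagram L10_form \<Phi>)"
  shows "\<exists>f. bij_betw f (fst D) \<Phi> \<and> (\<forall>u\<in>fst D. \<forall>v\<in>fst D. L10_form (f u) (f v) = diagram_gram D u v)"
proof -
  note D = L.simple_systemD[OF assms(1)]
  obtain f where f: "bij_betw f (fst D) \<Phi>"
    "\<forall>u\<in>fst D. \<forall>v\<in>fst D. (u, v) \<in> snd D \<longleftrightarrow> (f u, f v) \<in> snd (dynkin_diagram L10_form \<Phi>)"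
    using assms(2) unfolding diagram_iso_def L.dynkin_diagram_wf(3) by (elim exE conjE)
  have "L10_form (f u) (f v) = diagram_gram D u v" if uv: "u \<in> fst D" "v \<in> fst D" for u v
  proof -
    have mem: "f u \<in> \<Phi>" "f v \<in> \<Phi>" using bij_betwE[OF f(1)] uv by simp_all
    show ?thesis
    proof (cases "u = v")
      case True
      then show ?thesis using D(4)[OF mem(1)] by (simp add: diagram_gram_def)
    next
      case False
      then have "f u \<noteq> f v" using inj_on_eq_iff[OF bij_betw_imp_inj_on[OF f(1)] uv] by simp
      then have "L10_form (f u) (f v) \<in> {0, 1}" "(u, v) \<in> snd D \<longleftrightarrow> L10_form (f u) (f v) = 1"
        using D(5)[OF mem] f(2) uv mem by (simp_all add: dynkin_diagram_def)
      then show ?thesis using False by (auto simp: diagram_gram_def)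
    qed
  qed
  then show ?thesis using f(1) by (intro exI[of _ f]) simp
qed

lemma bilinear_eq_on_span:
  assumes "bilinear B" "bilinear B'" "linear k" "\<And>u v. u \<in> A \<Longrightarrow> v \<in> A \<Longrightarrow> B' (k u) (k v) = B u v"
    "x \<in> span A" "y \<in> span A"
  shows "B' (k x) (k y) = B x y"
proof -
  have lin: "linear (\<lambda>y. B' z (k y))" "linear (\<lambda>x. B' (k x) z)" for z
    using linear_compose[OF assms(3), of "B' z"] linear_compose[OF assms(3), of "\<lambda>x. B' x z"] assms(2)
    by (simp_all add: bilinear_def comp_def)
  then have "bilinear (\<lambda>x y. B' (k x) (k y))" by (simp add: bilinear_def)
  then show ?thesis
    by (rule bilinear_eq[OF _ assms(1) order_refl order_refl assms(5,6) assms(4)])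
qed

text \<open>A simple system with Dynkin diagram \<open>D\<close> is an isometric image of the basis of the lattice of \<open>D\<close>.
  The isometry extends to the real spans.\<close>

lemma realization:
  fixes D :: "'i diagram"
  assumes "L.simple_system \<Phi>" "diagram_iso D (dynkin_diagram L10_form \<Phi>)"
  shows "\<exists>\<kappa>. linear \<kappa> \<and> \<kappa> ` (vertex_vector ` fst D) = \<Phi> \<and> inj_on \<kappa> (span (vertex_vector ` fst D))
    \<and> (\<forall>x\<in>span (vertex_vector ` fst D). \<forall>y\<in>span (vertex_vector ` fst D). L10_form (\<kappa> x) (\<kappa> y) = diagram_form D x y)"
proof -
  obtain f where f: "bij_betw f (fst D) \<Phi>"
    "\<forall>u\<in>fst D. \<forall>v\<in>fst D. L10_form (f u) (f v) = diagram_gram D u v"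
    using gram_of_iso[OF assms] by (elim exE conjE)
  obtain \<kappa> where \<kappa>: "linear \<kappa>" "\<forall>x\<in>vertex_vector ` fst D. \<kappa> x = f (inv vertex_vector x)"
    using linear_independent_extend[OF independent_vertex_vectors, of "fst D" "\<lambda>x. f (inv vertex_vector x)"] by (elim exE conjE)
  have \<kappa>u: "\<kappa> (vertex_vector u) = f u" if "u \<in> fst D" for u
    using bspec[OF \<kappa>(2) imageI[OF that]] by (simp add: inv_f_f[OF inj_vertex_vector])
  have "\<kappa> ` (vertex_vector ` fst D) = f ` fst D" unfolding image_image using \<kappa>u by (rule image_cong[OF refl])
  then have im: "\<kappa> ` (vertex_vector ` fst D) = \<Phi>" using f(1) by (simp add: bij_betw_def)
  have "inj_on \<kappa> (vertex_vector ` fst D)"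
  proof (rule inj_onI)
    fix x y assume xy: "x \<in> vertex_vector ` fst D" "y \<in> vertex_vector ` fst D" "\<kappa> x = \<kappa> y"
    obtain u v where u: "u \<in> fst D" "x = vertex_vector u" and v: "v \<in> fst D" "y = vertex_vector v"
      using xy(1,2) by (elim imageE)
    have "f u = f v" using xy(3) unfolding u(2) v(2) \<kappa>u[OF u(1)] \<kappa>u[OF v(1)] .
    then show "x = y" using inj_onD[OF bij_betw_imp_inj_on[OF f(1)] _ u(1) v(1)] u(2) v(2) by simp
  qed
  moreover have "independent (\<kappa> ` (vertex_vector ` fst D))"
    unfolding im by (rule L.simple_systemD(2)[OF assms(1)])
  ultimately have inj: "inj_on \<kappa> (span (vertex_vector ` fst D))"
    by (intro linear_inj_on_span_independent_image[OF \<kappa>(1)])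
  have basis: "L10_form (\<kappa> x) (\<kappa> y) = diagram_form D x y" if xy: "x \<in> vertex_vector ` fst D" "y \<in> vertex_vector ` fst D" for x y
  proof -
    obtain u v where uv: "u \<in> fst D" "x = vertex_vector u" "v \<in> fst D" "y = vertex_vector v"
      using xy by (elim imageE)
    show ?thesis unfolding uv(2,4) \<kappa>u[OF uv(1)] \<kappa>u[OF uv(3)] diagram_form_vertex_vector
      by (rule bspec[OF bspec[OF f(2) uv(1)] uv(3)])
  qed
  have "L10_form (\<kappa> x) (\<kappa> y) = diagram_form D x y"
    if "x \<in> span (vertex_vector ` fst D)" "y \<in> span (vertex_vector ` fst D)" for x y
    by (rule bilinear_eq_on_span[OF bilinear_diagram_form L.bilinear_B \<kappa>(1) basis that])
  then show ?thesis using \<kappa>(1) im inj by (intro exI[of _ \<kappa>] conjI ballI)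
qed

text \<open>The overlattice is the primitive closure, transported by the inverse of the isometry that realizes
  \<open>t\<close> by \<open>\<Phi>\<close>.\<close>

lemma type_conditions_necessary:
  assumes "ade_config L10_form L10 \<Phi>"
  defines "t \<equiv> config_type L10_form \<Phi>"
    and "t' \<equiv> lattice_type L10_form (primitive_closure L10 (zspan \<Phi>))"
  shows "dim (R_lattice t) < 10"
    "\<exists>M. even_overlattice (R_form t) (R_lattice t) M \<and> lattice_isomorphic (R_form t') (R_lattice t') (R_form t) M"
    "\<exists>S\<subseteq>fst (e_diagram 10). diagram_iso (type_diagram t') (sub_diagram (e_diagram 10) S)"
proof -
  note P = ade_config_L10D[OF assms(1)]
  obtain p \<Delta> where p: "p \<in> set canonical_subsets" and tp: "t' = mset (map fst (full_configs p ! 0))"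
    and p0: "config_set (full_configs p ! 0) = ev ` set (canonical_vertices p)" "config_ok (full_configs p ! 0)"
    and \<Delta>: "L.simple_system \<Delta>" "is_ade_diagram (dynkin_diagram L10_form \<Delta>)" "config_type L10_form \<Delta> = t'"
    and cl: "primitive_closure L10 (zspan \<Phi>) = zspan \<Delta>"
    using config_classification[OF assms(1)] unfolding t'_def by (elim bexE exE conjE) simp
  have iso: "diagram_iso (type_diagram t) (dynkin_diagram L10_form \<Phi>)"
    unfolding t_def config_type_def
    by (rule diagram_iso_type_diagram(2)[OF P(3) _ L.dynkin_diagram_wf(1,2)]) (simp only: L.dynkin_diagram_wf(3) P(4))
  obtain \<kappa> where \<kappa>: "linear \<kappa>" "\<kappa> ` (vertex_vector ` fst (type_diagram t)) = \<Phi>"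
    "inj_on \<kappa> (span (vertex_vector ` fst (type_diagram t)))"
    "\<forall>x\<in>span (vertex_vector ` fst (type_diagram t)). \<forall>y\<in>span (vertex_vector ` fst (type_diagram t)).
      L10_form (\<kappa> x) (\<kappa> y) = R_form t x y"
    using realization[OF P(1) iso] by (elim exE conjE)
  have iso': "diagram_iso (type_diagram t') (dynkin_diagram L10_form \<Delta>)"
    unfolding \<Delta>(3)[symmetric] config_type_def
    by (rule diagram_iso_type_diagram(2)[OF \<Delta>(2) _ L.dynkin_diagram_wf(1,2)])
      (simp only: L.dynkin_diagram_wf(3) L.simple_systemD(1)[OF \<Delta>(1)])
  obtain \<kappa>' where \<kappa>': "linear \<kappa>'" "\<kappa>' ` (vertex_vector ` fst (type_diagram t')) = \<Delta>"
    "inj_on \<kappa>' (span (vertex_vector ` fst (type_diagram t')))"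
    "\<forall>x\<in>span (vertex_vector ` fst (type_diagram t')). \<forall>y\<in>span (vertex_vector ` fst (type_diagram t')).
      L10_form (\<kappa>' x) (\<kappa>' y) = R_form t' x y"
    using realization[OF \<Delta>(1) iso'] by (elim exE conjE)
  define A where "A = vertex_vector ` fst (type_diagram t)"
  define A' where "A' = vertex_vector ` fst (type_diagram t')"
  note \<kappa> = \<kappa>[folded A_def] and \<kappa>' = \<kappa>'[folded A'_def]
  have R: "R_lattice t = zspan A" "R_lattice t' = zspan A'" by (simp_all only: diagram_lattice_def A_def A'_def)
  have indA: "independent A" unfolding A_def by (rule independent_vertex_vectors)
  have "dim (zspan A) = card A"
    using real_vector.dim_span[of "zspan A"] real_vector.dim_span[of A] real_vector.dim_eq_card_independent[OF indA]
    by (simp only: span_zspan)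
  also have "\<dots> = card \<Phi>"
    using card_image[OF inj_on_subset[OF \<kappa>(3) span_superset]] by (simp only: \<kappa>(2))
  finally show "dim (R_lattice t) < 10" unfolding R using config_card[OF assms(1)] by simp
  obtain \<sigma> where \<sigma>: "linear \<sigma>" "\<forall>v\<in>span A. \<sigma> (\<kappa> v) = v"
    using linear_exists_left_inverse_on[OF \<kappa>(1) subspace_span \<kappa>(3)] by (elim exE conjE)
  have span\<Phi>: "span \<Phi> = \<kappa> ` span A" unfolding \<kappa>(2)[symmetric] by (rule linear_span_image[OF \<kappa>(1)])
  have \<sigma>y: "\<sigma> y \<in> span A \<and> \<kappa> (\<sigma> y) = y" if "y \<in> span \<Phi>" for y
  proof -
    obtain x where x: "x \<in> span A" "y = \<kappa> x" using \<open>y \<in> span \<Phi>\<close> unfolding span\<Phi> by (elim imageE)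
    then show ?thesis using bspec[OF \<sigma>(2) x(1)] by simp
  qed
  have form: "R_form t (\<sigma> y) (\<sigma> z) = L10_form y z" if "y \<in> span \<Phi>" "z \<in> span \<Phi>" for y z
    using bspec[OF bspec[OF \<kappa>(4) conjunct1[OF \<sigma>y[OF that(1)]]] conjunct1[OF \<sigma>y[OF that(2)]]]
      \<sigma>y[OF that(1)] \<sigma>y[OF that(2)] by simp
  have "zspan \<Delta> \<subseteq> qspan (zspan \<Phi>)" "zspan \<Delta> \<subseteq> L10"
    unfolding cl[symmetric] primitive_closure_def by simp_all
  then have \<Delta>q: "zspan \<Delta> \<subseteq> qspan \<Phi>" and \<Delta>L: "zspan \<Delta> \<subseteq> L10" by (simp_all only: qspan_zspan)
  have \<Delta>s: "zspan \<Delta> \<subseteq> span \<Phi>" using \<Delta>q qspan_subset_span by (rule order_trans)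
  have "zspan \<Phi> \<subseteq> qspan (zspan \<Phi>)" by (rule Q.span_superset)
  then have \<Phi>\<Delta>: "zspan \<Phi> \<subseteq> zspan \<Delta>"
    unfolding cl[symmetric] primitive_closure_def using zspan_subset_L10[OF P(2)] by (rule Int_greatest)
  have \<sigma>\<Phi>: "\<sigma> ` \<Phi> = A"
  proof -
    have "\<sigma> ` \<kappa> ` A = (\<lambda>v. v) ` A"
      unfolding image_image by (rule image_cong[OF refl]) (use \<sigma>(2) span_base in blast)
    then show ?thesis by (simp add: \<kappa>(2))
  qed
  define M where "M = \<sigma> ` zspan \<Delta>"
  have AM: "zspan A \<subseteq> M"
    unfolding M_def \<sigma>\<Phi>[symmetric] linear_zspan_image[OF \<sigma>(1), symmetric] by (rule image_mono[OF \<Phi>\<Delta>])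
  have int: "R_form t x y \<in> \<int>" if xy: "x \<in> M" "y \<in> M" for x y
  proof -
    obtain v w where vw: "v \<in> zspan \<Delta>" "x = \<sigma> v" "w \<in> zspan \<Delta>" "y = \<sigma> w" using xy unfolding M_def by (elim imageE)
    show ?thesis unfolding vw(2,4) form[OF subsetD[OF \<Delta>s vw(1)] subsetD[OF \<Delta>s vw(3)]]
      by (rule L10_integral[OF subsetD[OF \<Delta>L vw(1)] subsetD[OF \<Delta>L vw(3)]])
  qed
  have "even_overlattice (R_form t) (zspan A) M"
    unfolding even_overlattice_def
  proof (intro conjI)
    show "module.subspace zscale M" unfolding M_def linear_zspan_image[OF \<sigma>(1)] by (rule Z.subspace_span)
    show "zspan A \<subseteq> M" by (rule AM)
    have "M \<subseteq> \<sigma> ` qspan \<Phi>" unfolding M_def by (rule image_mono[OF \<Delta>q])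
    then have "M \<subseteq> qspan (zspan A)" unfolding linear_qspan_image[OF \<sigma>(1)] \<sigma>\<Phi> qspan_zspan .
    then show "M \<subseteq> dual_lattice (R_form t) (zspan A)"
      unfolding dual_lattice_def using int subsetD[OF AM] by auto
    show "integral_on (R_form t) M" unfolding integral_on_def using int by simp
    show "even_on (R_form t) M"
      unfolding even_on_def
    proof
      fix x assume "x \<in> M"
      then obtain v where v: "v \<in> zspan \<Delta>" "x = \<sigma> v" unfolding M_def by (elim imageE)
      show "\<exists>k::int. R_form t x x = 2 * of_int k"
        unfolding v(2) form[OF subsetD[OF \<Delta>s v(1)] subsetD[OF \<Delta>s v(1)]]
        using even_L10 subsetD[OF \<Delta>L v(1)] unfolding even_on_def by (rule bspec)
    qed
  qed
  moreover have "lattice_isometry (R_form t') (zspan A') (R_form t) M (\<sigma> \<circ> \<kappa>')"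
    unfolding lattice_isometry_def
  proof (intro conjI ballI)
    show "linear (\<sigma> \<circ> \<kappa>')" by (rule linear_compose[OF \<kappa>'(1) \<sigma>(1)])
    have im: "\<kappa>' ` zspan A' = zspan \<Delta>" unfolding linear_zspan_image[OF \<kappa>'(1)] \<kappa>'(2) by (rule refl)
    have "inj_on \<sigma> (span \<Phi>)" by (rule inj_on_inverseI[of _ \<kappa>]) (use \<sigma>y in blast)
    then have "inj_on (\<sigma> \<circ> \<kappa>') (zspan A')"
      by (intro comp_inj_on[OF inj_on_subset[OF \<kappa>'(3) zspan_subset_span]]) (simp only: im, rule inj_on_subset[OF _ \<Delta>s])
    moreover have "(\<sigma> \<circ> \<kappa>') ` zspan A' = M" unfolding image_comp[symmetric] im M_def by (rule refl)
    ultimately show "bij_betw (\<sigma> \<circ> \<kappa>') (zspan A') M" by (simp only: bij_betw_def)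
    fix x y assume xy: "x \<in> zspan A'" "y \<in> zspan A'"
    have s: "x \<in> span A'" "y \<in> span A'" by (rule subsetD[OF zspan_subset_span], rule xy)+
    have "\<kappa>' x \<in> zspan \<Delta>" "\<kappa>' y \<in> zspan \<Delta>" unfolding im[symmetric] by (rule imageI, rule xy)+
    then have "\<kappa>' x \<in> span \<Phi>" "\<kappa>' y \<in> span \<Phi>" using \<Delta>s by (simp_all only: subset_iff)
    then show "R_form t ((\<sigma> \<circ> \<kappa>') x) ((\<sigma> \<circ> \<kappa>') y) = R_form t' x y"
      unfolding comp_def using form bspec[OF bspec[OF \<kappa>'(4) s(1)] s(2)] by simp
  qed
  ultimately show "\<exists>M. even_overlattice (R_form t) (R_lattice t) M \<and> lattice_isomorphic (R_form t') (R_lattice t') (R_form t) M"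
    unfolding R lattice_isomorphic_def by (intro exI[of _ M] conjI exI[of _ "\<sigma> \<circ> \<kappa>'"])
  define S where "S = set (canonical_vertices p)"
  have S: "S \<subseteq> {1..10}" unfolding S_def by (rule canonical_vertices_subset[OF p])
  note C0 = config_ok_simple[OF p0(2), unfolded p0(1), folded S_def tp]
  have 1: "diagram_iso (type_diagram t') (dynkin_diagram L10_form (ev ` S))"
    unfolding C0(3)[symmetric] config_type_def
    by (rule diagram_iso_type_diagram(2)[OF C0(2) _ L.dynkin_diagram_wf(1,2)])
      (simp only: L.dynkin_diagram_wf(3) L.simple_systemD(1)[OF C0(1)])
  have "diagram_iso (type_diagram t') (sub_diagram (e_diagram 10) S)"
    by (rule diagram_iso_trans[OF 1 diagram_iso_sym[OF ev_diagram]])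
  then show "\<exists>S\<subseteq>fst (e_diagram 10). diagram_iso (type_diagram t') (sub_diagram (e_diagram 10) S)"
    using S by (intro exI[of _ S]) (simp add: e_diagram_def)
qed

text \<open>The basis of the lattice of \<open>t\<close> lies in \<open>M\<close>. It is pulled back to the lattice of \<open>t'\<close> by \<open>h\<close>, and this
  lattice is realized by the simple roots in \<open>S\<close>, whose span is primitive. The image of the basis has
  as many elements as \<open>S\<close>, so that its primitive closure is this span.\<close>

lemma type_conditions_sufficient:
  assumes t: "is_ade_type t" and t': "is_ade_type t'"
    and M: "even_overlattice (R_form t) (R_lattice t) M"
    and h: "lattice_isometry (R_form t') (R_lattice t') (R_form t) M h"
    and S: "S \<subseteq> {1..10}" "diagram_iso (type_diagram t') (sub_diagram (e_diagram 10) S)"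
  shows "\<exists>\<Phi>. ade_config L10_form L10 \<Phi> \<and> config_type L10_form \<Phi> = t
    \<and> lattice_type L10_form (primitive_closure L10 (zspan \<Phi>)) = t'"
proof -
  define \<Delta> where "\<Delta> = ev ` S"
  define A where "A = vertex_vector ` fst (type_diagram t)"
  define A' where "A' = vertex_vector ` fst (type_diagram t')"
  have R: "R_lattice t = zspan A" "R_lattice t' = zspan A'" by (simp_all only: diagram_lattice_def A_def A'_def)
  note W = type_diagram_wf[OF t] and W' = type_diagram_wf[OF t']
  have finA: "finite A" "finite A'" unfolding A_def A'_def by (rule finite_imageI, rule W W')+
  have ind: "independent A" "independent A'" unfolding A_def A'_def by (rule independent_vertex_vectors)+
  have iso': "diagram_iso (type_diagram t') (dynkin_diagram L10_form \<Delta>)"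
    unfolding \<Delta>_def by (rule diagram_iso_trans[OF S(2) ev_diagram])
  note ade' = diagram_iso_imp_same_type[OF type_diagram_ade[OF t'] W'(1-3) iso' L.dynkin_diagram_wf(1)]
  have prod\<Delta>: "L10_form r s \<in> {0, 1}" if rs: "r \<in> \<Delta>" "s \<in> \<Delta>" "r \<noteq> s" for r s
    using rs unfolding \<Delta>_def by (auto simp: L10_form_ev diagram_gram_def split: if_splits)
  have sd: "L.simple_system \<Delta>"
  proof (rule L.ade_simple_system[OF _ _ prod\<Delta> ade'(1)])
    show "finite \<Delta>" unfolding \<Delta>_def using S(1) by (intro finite_imageI finite_subset[OF S(1)]) simp
    show "L10_form r r = - 2" if "r \<in> \<Delta>" for r
      using that unfolding \<Delta>_def by (auto simp: L10_form_ev diagram_gram_def)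
  qed
  note D = L.simple_systemD[OF sd]
  obtain \<kappa> where \<kappa>: "linear \<kappa>" "\<kappa> ` A' = \<Delta>" "inj_on \<kappa> (span A')"
    "\<forall>x\<in>span A'. \<forall>y\<in>span A'. L10_form (\<kappa> x) (\<kappa> y) = R_form t' x y"
    using realization[OF sd iso'] unfolding A'_def by (elim exE conjE)
  have hlin: "linear h" and him: "h ` zspan A' = M"
    and hform: "\<And>x y. x \<in> zspan A' \<Longrightarrow> y \<in> zspan A' \<Longrightarrow> R_form t (h x) (h y) = R_form t' x y"
    using h unfolding lattice_isometry_def R bij_betw_def by simp_all
  have hform': "R_form t (h x) (h y) = R_form t' x y" if "x \<in> span A'" "y \<in> span A'" for x y
    by (rule bilinear_eq_on_span[OF bilinear_diagram_form bilinear_diagram_form hlin _ that])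
      (intro hform Z.span_base)
  \<comment> \<open>The form of the lattice of \<open>t'\<close> is definite, so an isometry is injective even on the real span.\<close>
  have hinj: "inj_on h (span A')"
  proof (rule inj_onI)
    fix x y assume xy: "x \<in> span A'" "y \<in> span A'" "h x = h y"
    have z: "x - y \<in> span A'" by (rule span_diff[OF xy(1,2)])
    have "h (x - y) = 0" using xy(3) by (simp add: linear_diff[OF hlin])
    then have "R_form t' (x - y) (x - y) = R_form t 0 0" using hform'[OF z z] by simp
    also have "\<dots> = 0" by (simp add: diagram_form_def)
    finally have "L10_form (\<kappa> (x - y)) (\<kappa> (x - y)) = 0" using bspec[OF bspec[OF \<kappa>(4) z] z] by simp
    moreover have "\<kappa> (x - y) \<in> span \<Delta>"
      unfolding \<kappa>(2)[symmetric] linear_span_image[OF \<kappa>(1)] by (rule imageI[OF z])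
    ultimately have "\<kappa> (x - y) = 0" using L.neg_defD[OF D(3)] by force
    then have "\<kappa> (x - y) = \<kappa> 0" by (simp add: linear_0[OF \<kappa>(1)])
    then have "x - y = 0" by (rule inj_onD[OF \<kappa>(3) _ z span_zero])
    then show "x = y" by simp
  qed
  have AM: "zspan A \<subseteq> M" and Mdual: "M \<subseteq> dual_lattice (R_form t) (zspan A)"
    using M unfolding even_overlattice_def R by simp_all
  have "M \<subseteq> qspan (zspan A)" using Mdual unfolding dual_lattice_def by blast
  then have MA: "M \<subseteq> span A" unfolding qspan_zspan using qspan_subset_span by (rule order_trans)
  have "h ` A' \<subseteq> h ` zspan A'" by (rule image_mono[OF Z.span_superset])
  then have hA: "h ` A' \<subseteq> span A" using MA unfolding him by (rule order_trans)
  have "independent (h ` A')" by (rule linear_independent_injective_image[OF hlin ind(2) hinj])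
  then have "card (h ` A') \<le> card A" using independent_span_bound[OF finA(1) _ hA] by simp
  then have cardA: "card A' \<le> card A" using card_image[OF inj_on_subset[OF hinj span_superset]] by simp
  obtain \<sigma> where \<sigma>: "linear \<sigma>" "\<forall>v\<in>span A'. \<sigma> (h v) = v"
    using linear_exists_left_inverse_on[OF hlin subspace_span hinj] by (elim exE conjE)
  have \<sigma>u: "\<sigma> u \<in> zspan A' \<and> h (\<sigma> u) = u" if "u \<in> A" for u
  proof -
    have "u \<in> h ` zspan A'" unfolding him by (rule subsetD[OF AM Z.span_base[OF that]])
    then obtain w where w: "w \<in> zspan A'" "u = h w" by (elim imageE)
    have "\<sigma> (h w) = w" by (rule bspec[OF \<sigma>(2) subsetD[OF zspan_subset_span w(1)]])
    then show ?thesis using w by simp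
  qed
  have \<sigma>s: "\<sigma> u \<in> span A'" if "u \<in> A" for u
    by (rule subsetD[OF zspan_subset_span conjunct1[OF \<sigma>u[OF that]]])
  define \<psi> where "\<psi> u = \<kappa> (\<sigma> (vertex_vector u))" for u
  have vA: "vertex_vector u \<in> A" if "u \<in> fst (type_diagram t)" for u unfolding A_def by (rule imageI[OF that])
  have gram: "L10_form (\<psi> u) (\<psi> v) = diagram_gram (type_diagram t) u v"
    if uv: "u \<in> fst (type_diagram t)" "v \<in> fst (type_diagram t)" for u v
  proof -
    note a = vA[OF uv(1)] and b = vA[OF uv(2)]
    have "L10_form (\<psi> u) (\<psi> v) = R_form t' (\<sigma> (vertex_vector u)) (\<sigma> (vertex_vector v))"
      unfolding \<psi>_def by (rule bspec[OF bspec[OF \<kappa>(4) \<sigma>s[OF a]] \<sigma>s[OF b]])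
    also have "\<dots> = R_form t (h (\<sigma> (vertex_vector u))) (h (\<sigma> (vertex_vector v)))"
      by (rule hform'[OF \<sigma>s[OF a] \<sigma>s[OF b], symmetric])
    also have "\<dots> = diagram_gram (type_diagram t) u v"
      using \<sigma>u[OF a] \<sigma>u[OF b] by (simp add: diagram_form_vertex_vector)
    finally show ?thesis .
  qed
  have inj\<psi>: "inj_on \<psi> (fst (type_diagram t))"
  proof (rule inj_onI)
    fix u v assume uv: "u \<in> fst (type_diagram t)" "v \<in> fst (type_diagram t)" "\<psi> u = \<psi> v"
    note a = vA[OF uv(1)] and b = vA[OF uv(2)]
    have "\<sigma> (vertex_vector u) = \<sigma> (vertex_vector v)"
      by (rule inj_onD[OF \<kappa>(3) _ \<sigma>s[OF a] \<sigma>s[OF b]]) (use uv(3) in \<open>simp only: \<psi>_def\<close>)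
    then have "vertex_vector u = (vertex_vector v :: _ \<Rightarrow>\<^sub>0 real)" using \<sigma>u[OF a] \<sigma>u[OF b] by metis
    then show "u = v" by (rule injD[OF inj_vertex_vector])
  qed
  define \<Phi> where "\<Phi> = \<psi> ` fst (type_diagram t)"
  have iso: "diagram_iso (type_diagram t) (dynkin_diagram L10_form \<Phi>)"
    unfolding \<Phi>_def by (rule iso_of_gram[OF gram inj\<psi> W(4)])
  note ade = diagram_iso_imp_same_type[OF type_diagram_ade[OF t] W(1-3) iso L.dynkin_diagram_wf(1)]
  have prod\<Phi>: "L10_form r s \<in> {0, 1}" if rs: "r \<in> \<Phi>" "s \<in> \<Phi>" "r \<noteq> s" for r s
  proof -
    obtain u v where uv: "u \<in> fst (type_diagram t)" "r = \<psi> u" "v \<in> fst (type_diagram t)" "s = \<psi> v"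
      using rs(1,2) unfolding \<Phi>_def by (elim imageE)
    have "u \<noteq> v" using rs(3) uv by auto
    then show ?thesis unfolding uv(2,4) gram[OF uv(1,3)] by (simp add: diagram_gram_def)
  qed
  have sP: "L.simple_system \<Phi>"
  proof (rule L.ade_simple_system[OF _ _ prod\<Phi> ade(1)])
    show "finite \<Phi>" unfolding \<Phi>_def by (rule finite_imageI[OF W(1)])
    show "L10_form r r = - 2" if "r \<in> \<Phi>" for r
    proof -
      obtain u where u: "u \<in> fst (type_diagram t)" "r = \<psi> u" using \<open>r \<in> \<Phi>\<close> unfolding \<Phi>_def by (elim imageE)
      show ?thesis unfolding u(2) gram[OF u(1,1)] by (simp add: diagram_gram_def)
    qed
  qed
  note P = L.simple_systemD[OF sP]
  have \<Phi>\<Delta>: "\<Phi> \<subseteq> zspan \<Delta>"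
  proof
    fix r assume "r \<in> \<Phi>"
    then obtain u where u: "u \<in> fst (type_diagram t)" "r = \<psi> u" unfolding \<Phi>_def by (elim imageE)
    have "r \<in> \<kappa> ` zspan A'" unfolding u(2) \<psi>_def by (rule imageI[OF conjunct1[OF \<sigma>u[OF vA[OF u(1)]]]])
    then show "r \<in> zspan \<Delta>" unfolding linear_zspan_image[OF \<kappa>(1)] \<kappa>(2) .
  qed
  have "card \<Phi> = card (fst (type_diagram t))" unfolding \<Phi>_def by (rule card_image[OF inj\<psi>])
  also have "\<dots> = card A" unfolding A_def by (rule card_image[OF inj_on_subset[OF inj_vertex_vector subset_UNIV], symmetric])
  finally have c1: "card \<Phi> = card A" .
  have c2: "card \<Delta> = card A'" unfolding \<kappa>(2)[symmetric] by (rule card_image[OF inj_on_subset[OF \<kappa>(3) span_superset]])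
  have "\<Phi> \<subseteq> span \<Delta>" using \<Phi>\<Delta> zspan_subset_span by (rule order_trans)
  then have "card \<Phi> \<le> card \<Delta>" using independent_span_bound[OF D(1) P(2)] by simp
  then have card: "card \<Phi> = card \<Delta>" using c1 c2 cardA by simp
  have "qspan \<Phi> = qspan \<Delta>" by (rule L.qspan_eq_if_card_eq[OF sd P(1) \<Phi>\<Delta> P(2) card])
  then have cl: "primitive_closure L10 (zspan \<Phi>) = zspan \<Delta>"
    unfolding primitive_closure_def qspan_zspan \<Delta>_def by (simp only: primitive_closure_ev[OF S(1)])
  have "\<Delta> \<subseteq> L10" unfolding \<Delta>_def using S(1) ev_L10 by blast
  then have "\<Phi> \<subseteq> L10" using \<Phi>\<Delta> zspan_subset_L10 by (meson order_trans)
  then have "ade_config L10_form L10 \<Phi>" by (rule L.simple_ade_config[OF sP ade(1)])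
  moreover have "config_type L10_form \<Phi> = t" unfolding config_type_def ade(2) by (rule type_diagram_type[OF t])
  moreover have "lattice_type L10_form (primitive_closure L10 (zspan \<Phi>)) = t'"
    unfolding cl L.lattice_type_simple[OF sd ade'(1)] config_type_def ade'(2) by (rule type_diagram_type[OF t'])
  ultimately show ?thesis by (intro exI[of _ \<Phi>] conjI)
qed

theorem theorem1p3:
  shows
    "(\<forall>\<Phi>. ade_config L10_form L10 \<Phi> \<longrightarrow>
        is_root_lattice L10_form (primitive_closure L10 (zspan \<Phi>)))
     \<and>
     (\<forall>\<Phi> \<Phi>'. ade_config L10_form L10 \<Phi> \<and> ade_config L10_form L10 \<Phi>' \<longrightarrow>
        (equivalent_configs L10_form L10 \<Phi> \<Phi>' \<longleftrightarrow>
           config_type L10_form \<Phi> = config_type L10_form \<Phi>'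
           \<and> lattice_type L10_form (primitive_closure L10 (zspan \<Phi>))
             = lattice_type L10_form (primitive_closure L10 (zspan \<Phi>'))))
     \<and>
     (\<forall>t t'. is_ade_type t \<and> is_ade_type t' \<longrightarrow>
        ((\<exists>\<Phi>. ade_config L10_form L10 \<Phi>
             \<and> config_type L10_form \<Phi> = t
             \<and> lattice_type L10_form (primitive_closure L10 (zspan \<Phi>)) = t')
         \<longleftrightarrow>
         dim (R_lattice t) < 10
         \<and> (\<exists>M. even_overlattice (R_form t) (R_lattice t) M
               \<and> lattice_isomorphic (R_form t') (R_lattice t') (R_form t) M)
         \<and> (\<exists>S \<subseteq> fst (e_diagram 10). diagram_iso (type_diagram t') (sub_diagram (e_diagram 10) S))))"
proof (intro conjI allI impI)
  fix \<Phi> assume \<Phi>: "ade_config L10_form L10 \<Phi>"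
  obtain \<Delta> where \<Delta>: "L.simple_system \<Delta>" "primitive_closure L10 (zspan \<Phi>) = zspan \<Delta>"
    using closure_is_root_lattice[OF \<Phi>] by (elim exE conjE)
  show "is_root_lattice L10_form (primitive_closure L10 (zspan \<Phi>))"
    unfolding \<Delta>(2) by (rule L.simple_root_lattice[OF \<Delta>(1)])
next
  fix \<Phi> \<Phi>' assume "ade_config L10_form L10 \<Phi> \<and> ade_config L10_form L10 \<Phi>'"
  then have \<Phi>: "ade_config L10_form L10 \<Phi>" "ade_config L10_form L10 \<Phi>'" by simp_all
  show "equivalent_configs L10_form L10 \<Phi> \<Phi>' \<longleftrightarrow>
           config_type L10_form \<Phi> = config_type L10_form \<Phi>'
           \<and> lattice_type L10_form (primitive_closure L10 (zspan \<Phi>))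
             = lattice_type L10_form (primitive_closure L10 (zspan \<Phi>'))"
    by (intro iffI conjI; (elim conjE)?; (rule same_types_if_equivalent[OF \<Phi>(1)] equivalent_if_same_types[OF \<Phi>]); assumption)
next
  fix t t' assume "is_ade_type t \<and> is_ade_type t'"
  then have t: "is_ade_type t" "is_ade_type t'" by simp_all
  show "(\<exists>\<Phi>. ade_config L10_form L10 \<Phi>
             \<and> config_type L10_form \<Phi> = t
             \<and> lattice_type L10_form (primitive_closure L10 (zspan \<Phi>)) = t')
         \<longleftrightarrow>
         dim (R_lattice t) < 10
         \<and> (\<exists>M. even_overlattice (R_form t) (R_lattice t) M
               \<and> lattice_isomorphic (R_form t') (R_lattice t') (R_form t) M)
         \<and> (\<exists>S \<subseteq> fst (e_diagram 10). diagram_iso (type_diagram t') (sub_diagram (e_diagram 10) S))"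
    (is "?config \<longleftrightarrow> ?conditions")
  proof
    assume ?config
    then obtain \<Phi> where \<Phi>: "ade_config L10_form L10 \<Phi>" "config_type L10_form \<Phi> = t"
      "lattice_type L10_form (primitive_closure L10 (zspan \<Phi>)) = t'" by (elim exE conjE)
    show ?conditions
      using type_conditions_necessary[OF \<Phi>(1)] unfolding \<Phi>(2,3) by (intro conjI)
  next
    assume ?conditions
    then obtain M h S where M: "even_overlattice (R_form t) (R_lattice t) M"
      and h: "lattice_isometry (R_form t') (R_lattice t') (R_form t) M h"
      and S: "S \<subseteq> fst (e_diagram 10)" "diagram_iso (type_diagram t') (sub_diagram (e_diagram 10) S)"
      unfolding lattice_isomorphic_def by (elim exE conjE)
    have "S \<subseteq> {1..10}" using S(1) by (simp add: e_diagram_def)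
    then show ?config by (rule type_conditions_sufficient[OF t M h _ S(2)])
  qed
qed

end
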